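(* For every language $L$ in the class $NP$ there exists a finite set $\mathcal{F}^<$ of finite ordered graphs such that the $\mathcal{F}^<$-free ordering problem and $L$ are polynomially equivalent.
   Context: An ordered graph ${\bf G}^<$ is a finite undirected graph ${\bf G}$ together with a fixed linear ordering $<$ of its vertices. For a fixed set $\mathcal{F}^<$ of ordered graphs, the $\mathcal{F}^<$-free ordering problem is the decision problem: given a finite graph ${\bf G}$, does there exist a linear ordering $<$ of the vertices of ${\bf G}$ such that the ordered graph ${\bf G}^<$ does not contain an ordered subgraph (not necessarily induced) isomorphic, as an ordered graph, to ${\bf F}^<$ for any ${\bf F}^<\in\mathcal{F}^<$? Two languages are polynomially equivalent if each has a polynomial-time reduction to the other. *)

theory Defs
  imports Main
begin

datatype dir = Lft | Rgt | Stay

text \<open>A machine is (Q, S, delta): states 0..<Q (0 = start, 1 = halt), tape symbols 0..<S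
  (0 = blank, 1 encodes the bit False, 2 encodes the bit True).\<close>
type_synonym tm = "nat \<times> nat \<times> (nat \<Rightarrow> nat \<Rightarrow> nat \<times> nat \<times> dir)"

definition wf_tm :: "tm \<Rightarrow> bool" where
  "wf_tm M = (case M of (Q, S, \<delta>) \<Rightarrow> 2 \<le> Q \<and> 3 \<le> S \<and>
     (\<forall>q<Q. \<forall>a<S. fst (\<delta> q a) < Q \<and> fst (snd (\<delta> q a)) < S))"

text \<open>Configuration: (state, tape left of head (nearest first), head symbol, tape right of head).\<close>
type_synonym config = "nat \<times> nat list \<times> nat \<times> nat list"

fun hdb :: "nat list \<Rightarrow> nat" where
  "hdb [] = 0" | "hdb (x # xs) = x"

fun tm_step :: "tm \<Rightarrow> config \<Rightarrow> config" where
  "tm_step (Q, S, \<delta>) (q, ls, h, rs) =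
     (if q = 1 then (q, ls, h, rs) else
      (case \<delta> q h of (q', a, d) \<Rightarrow>
        (case d of
           Stay \<Rightarrow> (q', ls, a, rs)
         | Lft \<Rightarrow> (q', tl ls, hdb ls, a # rs)
         | Rgt \<Rightarrow> (q', a # ls, hdb rs, tl rs))))"

definition sym :: "bool \<Rightarrow> nat" where
  "sym b = (if b then 2 else 1)"

definition init_config :: "bool list \<Rightarrow> config" where
  "init_config x = (0, [], hdb (map sym x), tl (map sym x))"

definition tm_output :: "config \<Rightarrow> nat list" where
  "tm_output c = (case c of (q, ls, h, rs) \<Rightarrow> takeWhile (\<lambda>a. a \<noteq> 0) (h # rs))"

definition computes_in :: "tm \<Rightarrow> (bool list \<Rightarrow> bool list) \<Rightarrow> (nat \<Rightarrow> nat) \<Rightarrow> bool" where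
  "computes_in M f T = (\<forall>x. \<exists>t \<le> T (length x).
      fst ((tm_step M ^^ t) (init_config x)) = 1 \<and>
      tm_output ((tm_step M ^^ t) (init_config x)) = map sym (f x))"

definition poly_computable :: "(bool list \<Rightarrow> bool list) \<Rightarrow> bool" where
  "poly_computable f = (\<exists>M c k. wf_tm M \<and> computes_in M f (\<lambda>n. c * n ^ k + c))"

definition in_P :: "bool list set \<Rightarrow> bool" where
  "in_P L = poly_computable (\<lambda>x. [x \<in> L])"

definition pair_enc :: "bool list \<Rightarrow> bool list \<Rightarrow> bool list" where
  "pair_enc x w = concat (map (\<lambda>b. [b, b]) x) @ [False, True] @ w"

definition in_NP :: "bool list set \<Rightarrow> bool" where
  "in_NP L = (\<exists>V c k. in_P V \<and>
      (\<forall>x. x \<in> L \<longleftrightarrow> (\<exists>w. length w \<le> c * length x ^ k + c \<and> pair_enc x w \<in> V)))"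

definition poly_reduces :: "bool list set \<Rightarrow> bool list set \<Rightarrow> bool" where
  "poly_reduces A B = (\<exists>f. poly_computable f \<and> (\<forall>x. x \<in> A \<longleftrightarrow> f x \<in> B))"

definition poly_equivalent :: "bool list set \<Rightarrow> bool list set \<Rightarrow> bool" where
  "poly_equivalent A B = (poly_reduces A B \<and> poly_reduces B A)"

text \<open>A finite ordered graph (up to isomorphism) is (m, E): vertices 0..<m in their natural
  order, E a symmetric irreflexive edge relation on 0..<m.\<close>
type_synonym ograph = "nat \<times> (nat \<Rightarrow> nat \<Rightarrow> bool)"

definition wf_ograph :: "ograph \<Rightarrow> bool" where
  "wf_ograph F = (case F of (m, E) \<Rightarrow>
     (\<forall>i j. E i j \<longrightarrow> i < m \<and> j < m) \<and> (\<forall>i j. E i j \<longrightarrow> E j i) \<and> (\<forall>i. \<not> E i i))"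

text \<open>Encoding of graphs as binary strings (total): a string x encodes the graph with
  vertex set 0..<n, n = floor(sqrt |x|), where i, j (i \<noteq> j) are adjacent iff entry (i,j) or
  (j,i) of the n x n adjacency-matrix prefix of x is True.\<close>
definition enc_nverts :: "bool list \<Rightarrow> nat" where
  "enc_nverts x = (GREATEST n. n * n \<le> length x)"

definition enc_edge :: "bool list \<Rightarrow> nat \<Rightarrow> nat \<Rightarrow> bool" where
  "enc_edge x i j = (let n = enc_nverts x in
     i < n \<and> j < n \<and> i \<noteq> j \<and> (x ! (i * n + j) \<or> x ! (j * n + i)))"

definition contains_ordered :: "nat \<Rightarrow> (nat \<Rightarrow> nat \<Rightarrow> bool) \<Rightarrow> (nat \<Rightarrow> nat) \<Rightarrow> ograph \<Rightarrow> bool" where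
  "contains_ordered n E pos F = (case F of (m, EF) \<Rightarrow>
     (\<exists>g. (\<forall>i<m. g i < n) \<and> (\<forall>i j. i < j \<and> j < m \<longrightarrow> pos (g i) < pos (g j)) \<and>
          (\<forall>i<m. \<forall>j<m. EF i j \<longrightarrow> E (g i) (g j))))"

text \<open>A linear ordering of the vertex set 0..<n is given by a bijective position map.\<close>
definition F_free_ordering_lang :: "ograph set \<Rightarrow> bool list set" where
  "F_free_ordering_lang \<F> = {x. \<exists>pos. bij_betw pos {..<enc_nverts x} {..<enc_nverts x} \<and>
      (\<forall>F\<in>\<F>. \<not> contains_ordered (enc_nverts x) (enc_edge x) pos F)}"

end

theory Submission
  imports Defs
begin

text \<open>
  A verifier for the language is run on a triangular space-time diagram whose cells are vertices of the
  graph. A clique of size \<open>q\<close> cuts a linear order into \<open>q + 1\<close> intervals, so an ordering assigns one of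
  \<open>q + 1\<close> colours to every other vertex; further vertices attached to the clique name the types of
  the cells. The forbidden ordered graphs are all small patterns that contain the clique with the naming
  vertices and show either a defect of the local structure of the diagram or a colouring that breaks the
  local rule of the machine. The free colours of the witness cells of the base row guess a witness, and
  the apex objects if the verifier rejects it. An incomplete diagram imposes nothing, since a special
  colour may be propagated from the missing cells to the apex.

  Conversely every graph has to be mapped back to an instance of the language. For this a second machine
  is run in the same diagram; it checks the format of the base row and clocks the verifier.
  The apex never objects unless this machine, which does not look at the witness, accepts. Its run can be
  simulated in polynomial time, and if it accepts in a complete diagram then the input can be read off
  the base row and is in the language iff the graph has a good ordering.
\<close>

section \<open>Turing machines on a two-sided tape\<close>

text \<open>Containment is not induced, so a forbidden pattern cannot speak of a missing edge, and
  no pattern notices that a cell of the diagram is missing. All conditions on a violation have to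
  survive the addition of edges; the colour \<open>Star\<close> is the price. Edges are undirected
  as well: cells carry the shift a + 2 b modulo 5, and since 1, 2, 3 = -2 and 4 = -1 are distinct
  modulo 5, the difference of two shifts tells both parents and both children apart. Nine kinds
  times five shifts give the 45 naming vertices. In an arbitrary graph there may be many copies of
  the clique, many apexes, or a diagram folded onto itself. Each of these is either a forbidden
  pattern, so that the graph is a plain no-instance found by exhaustive search over a constant
  number of vertices, or is shown to do no harm. At most one complete diagram remains, and it asks
  an NP question only if the second machine accepts. That machine must also run long enough for the
  verdict of the verifier to reach the apex; this is enforced by a long output, as a head moves only
  one cell per step.\<close>

definition nthd :: "nat list \<Rightarrow> nat \<Rightarrow> nat" where
  "nthd xs i = (if i < length xs then xs ! i else 0)"

lemma nthd_Nil [simp]: "nthd [] i = 0"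
  by (simp add: nthd_def)

lemma nthd_Cons_0 [simp]: "nthd (x # xs) 0 = x"
  by (simp add: nthd_def)

lemma nthd_Cons_Suc [simp]: "nthd (x # xs) (Suc i) = nthd xs i"
  by (simp add: nthd_def)

lemma hdb_nthd: "hdb xs = nthd xs 0"
  by (cases xs) auto

lemma nthd_tl: "nthd (tl xs) i = nthd xs (Suc i)"
  by (cases xs) auto

fun mv :: "dir \<Rightarrow> int" where
  "mv Stay = 0" | "mv Lft = -1" | "mv Rgt = 1"

text \<open>State, head position and tape in absolute coordinates. The given configurations are
  centred at the head, whereas a cell of the diagram stands at a fixed place.\<close>

type_synonym acfg = "nat \<times> int \<times> (int \<Rightarrow> nat)"

fun astep :: "tm \<Rightarrow> acfg \<Rightarrow> acfg" where
  "astep (Q, S, \<delta>) (q, p, tp) =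
     (if q = 1 then (q, p, tp)
      else (case \<delta> q (tp p) of (q', a, d) \<Rightarrow> (q', p + mv d, tp(p := a))))"

definition local_tape :: "nat list \<Rightarrow> nat \<Rightarrow> nat list \<Rightarrow> int \<Rightarrow> nat" where
  "local_tape ls h rs d = (if d = 0 then h else if d > 0 then nthd rs (nat (d - 1))
     else nthd ls (nat (- d - 1)))"

fun cfg_rel :: "config \<Rightarrow> acfg \<Rightarrow> bool" where
  "cfg_rel (q, ls, h, rs) (q', p, tp) = (q' = q \<and> (\<forall>z. tp z = local_tape ls h rs (z - p)))"

definition tape_of :: "nat list \<Rightarrow> int \<Rightarrow> nat" where
  "tape_of xs z = (if 0 \<le> z then nthd xs (nat z) else 0)"

text \<open>Offset d + 1 from the new head is offset d from the old one, where the freshly written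
  symbol has offset 0.\<close>

lemma local_tape_Lft:
  "local_tape (tl ls) (hdb ls) (a # rs) (d + 1) = ((local_tape ls h rs)(0 := a)) d"
proof -
  consider "d = 0" | "d > 0" | "d = -1" | "d < -1" by linarith
  then show ?thesis
  proof cases
    case 2
    then have "nat d = Suc (nat (d - 1))" by simp
    with 2 show ?thesis by (simp add: local_tape_def)
  next
    case 4
    then have "nat (- d - 1) = Suc (nat (- (d + 1) - 1))" by simp
    with 4 show ?thesis by (simp add: local_tape_def nthd_tl)
  qed (auto simp: local_tape_def hdb_nthd)
qed

lemma local_tape_Rgt:
  "local_tape (a # ls) (hdb rs) (tl rs) (d - 1) = ((local_tape ls h rs)(0 := a)) d"
proof -
  consider "d = 0" | "d > 1" | "d = 1" | "d < 0" by linarith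
  then show ?thesis
  proof cases
    case 2
    then have "nat (d - 1) = Suc (nat (d - 1 - 1))" by simp
    with 2 show ?thesis by (simp add: local_tape_def nthd_tl)
  next
    case 4
    then have "nat (- (d - 1) - 1) = Suc (nat (- d - 1))" by simp
    with 4 show ?thesis by (simp add: local_tape_def)
  qed (auto simp: local_tape_def hdb_nthd)
qed

lemma cfg_rel_step:
  assumes "cfg_rel c A"
  shows "cfg_rel (tm_step M c) (astep M A)"
proof -
  obtain Q S \<delta> where M: "M = (Q, S, \<delta>)" by (cases M) auto
  obtain q ls h rs where c: "c = (q, ls, h, rs)" by (cases c) auto
  obtain p tp where A: "A = (q, p, tp)" and tp: "\<And>z. tp z = local_tape ls h rs (z - p)"
    using assms c by (cases A) auto
  have h: "tp p = h" by (simp add: tp local_tape_def)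
  obtain q' a d where d: "\<delta> q h = (q', a, d)" by (cases "\<delta> q h") auto
  have upd: "(tp(p := a)) z = ((local_tape ls h rs)(0 := a)) (z - p)" for z
    by (simp add: tp)
  show ?thesis
  proof (cases "q = 1")
    case True
    then show ?thesis using assms by (simp add: M c A)
  next
    case False
    show ?thesis
    proof (cases d)
      case Lft
      have "(tp(p := a)) z = local_tape (tl ls) (hdb ls) (a # rs) (z - (p - 1))" for z
        using local_tape_Lft[of ls a rs "z - p" h] upd[of z] by (simp add: algebra_simps)
      with False Lft show ?thesis by (simp add: M c A h d)
    next
      case Rgt
      have "(tp(p := a)) z = local_tape (a # ls) (hdb rs) (tl rs) (z - (p + 1))" for z
        using local_tape_Rgt[of a ls rs "z - p" h] upd[of z] by (simp add: algebra_simps)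
      with False Rgt show ?thesis by (simp add: M c A h d)
    next
      case Stay
      with False show ?thesis by (auto simp: M c A h d tp local_tape_def)
    qed
  qed
qed

lemma cfg_rel_funpow:
  "cfg_rel c A \<Longrightarrow> cfg_rel ((tm_step M ^^ t) c) ((astep M ^^ t) A)"
  by (induction t) (auto intro: cfg_rel_step)

lemma cfg_rel_init: "cfg_rel (init_config x) (0, 0, tape_of (map sym x))"
proof -
  have "tape_of (map sym x) z = local_tape [] (hdb (map sym x)) (tl (map sym x)) z" for z
  proof -
    consider "z = 0" | "z > 0" | "z < 0" by linarith
    then show ?thesis
    proof cases
      case 2
      then have "nat z = Suc (nat (z - 1))" by simp
      with 2 show ?thesis by (simp add: tape_of_def local_tape_def nthd_tl)
    qed (auto simp: tape_of_def local_tape_def hdb_nthd)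
  qed
  then show ?thesis by (simp add: init_config_def)
qed

lemma takeWhile_nthd:
  assumes "\<And>i. i < length ys \<Longrightarrow> nthd xs i = ys ! i" "0 \<notin> set ys" "nthd xs (length ys) = 0"
  shows "takeWhile (\<lambda>a. a \<noteq> 0) xs = ys"
  using assms
proof (induction ys arbitrary: xs)
  case Nil
  then show ?case by (cases xs) auto
next
  case (Cons y ys)
  show ?case
  proof (cases xs)
    case Nil
    then show ?thesis using Cons.prems(1)[of 0] Cons.prems(2) by auto
  next
    case xs: (Cons z zs)
    have "takeWhile (\<lambda>a. a \<noteq> 0) zs = ys"
    proof (rule Cons.IH)
      show "nthd zs i = ys ! i" if "i < length ys" for i
        using Cons.prems(1)[of "Suc i"] that xs by simp
    qed (use Cons.prems xs in auto)
    then show ?thesis using xs Cons.prems(1)[of 0] Cons.prems(2) by auto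
  qed
qed

lemma cfg_rel_output:
  assumes "cfg_rel c (q, p, tp)" "\<And>i. i < length ys \<Longrightarrow> tp (p + int i) = ys ! i"
    "0 \<notin> set ys" "tp (p + int (length ys)) = 0"
  shows "tm_output c = ys"
proof -
  obtain ls h rs where c: "c = (q, ls, h, rs)" using assms(1) by (cases c) auto
  have *: "nthd (h # rs) i = tp (p + int i)" for i
    using assms(1) c by (cases i) (auto simp: local_tape_def)
  show ?thesis unfolding tm_output_def c prod.case
    by (rule takeWhile_nthd) (use assms * in auto)
qed

text \<open>A decider outputs one symbol, so its verdict is the symbol under the head, which a local
  rule can inspect.\<close>

lemma cfg_rel_head:
  assumes "cfg_rel c (q, p, tp)" "tm_output c = a # as"
  shows "tp p = a"
proof -
  obtain ls h rs where c: "c = (q, ls, h, rs)" using assms(1) by (cases c) auto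
  then show ?thesis using assms by (auto simp: tm_output_def local_tape_def split: if_splits)
qed

lemma cfg_rel_fst: "cfg_rel c A \<Longrightarrow> fst c = fst A"
  by (cases c; cases A) auto

lemma astep_halted: "fst A = 1 \<Longrightarrow> astep M A = A"
  by (cases M; cases A) auto

lemma astep_funpow_halted: "fst A = 1 \<Longrightarrow> (astep M ^^ t) A = A"
  by (induction t) (auto simp: astep_halted)

section \<open>Compiling register programs to Turing machines\<close>

text \<open>\<open>Wr j v a\<close> stores the constant \<open>a\<close> in array \<open>j\<close>
  at the address held by register \<open>v\<close>; \<open>Cs j v a c d\<close> branches on whether
  that entry equals \<open>a\<close>. Arrays are only written and compared with constants, so their
  entries fit into a finite alphabet.\<close>

datatype cmd = Skip | Inc nat | Dec nat | Wr nat nat nat | Seq cmd cmd (infixr ";;" 60)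
  | IfZ nat cmd cmd | Cs nat nat nat cmd cmd | Wh nat cmd

type_synonym store = "(nat \<Rightarrow> nat) \<times> (nat \<Rightarrow> nat \<Rightarrow> nat)"

text \<open>The number is the cost. Since a primitive raises a register by at most one, it also
  bounds the growth of all registers.\<close>

inductive big :: "cmd \<Rightarrow> store \<Rightarrow> nat \<Rightarrow> store \<Rightarrow> bool" where
  big_Skip: "big Skip S 1 S"
| big_Inc: "big (Inc v) (s, arr) 1 (s(v := Suc (s v)), arr)"
| big_Dec: "big (Dec v) (s, arr) 1 (s(v := s v - 1), arr)"
| big_Wr: "big (Wr j v a) (s, arr) 1 (s, arr(j := (arr j)(s v := a)))"
| big_Seq: "big c S t1 S1 \<Longrightarrow> big d S1 t2 S2 \<Longrightarrow> big (c ;; d) S (t1 + t2 + 1) S2"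
| big_IfZ: "big (if s v = 0 then c else d) (s, arr) t S \<Longrightarrow> big (IfZ v c d) (s, arr) (t + 1) S"
| big_Cs: "big (if arr j (s v) = a then c else d) (s, arr) t S \<Longrightarrow>
    big (Cs j v a c d) (s, arr) (t + 1) S"
| big_WhF: "s v = 0 \<Longrightarrow> big (Wh v c) (s, arr) 1 (s, arr)"
| big_WhT: "s v \<noteq> 0 \<Longrightarrow> big c (s, arr) t1 S1 \<Longrightarrow> big (Wh v c) S1 t2 S2 \<Longrightarrow>
    big (Wh v c) (s, arr) (t1 + t2 + 1) S2"

text \<open>In \<open>Cl f s\<close> the function lists the array entries at the address of this
  cell, and the set consists of the registers whose value exceeds that address.\<close>

datatype sy = Hm | Cl "nat \<Rightarrow> nat" "nat set"

text \<open>\<open>Start\<close> and \<open>Start2\<close> place the home mark to the left of the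
  input. \<open>Go\<close> walks to the addressed cell, \<open>Back\<close> walks home, and
  \<open>DecB\<close> is the extra step of a decrement. \<open>Fin\<close> turns array 1 into plain
  output symbols and \<open>FinB\<close> returns to its first cell.\<close>

datatype st = Start | Start2 | Halt | Fin | FinB
  | Run "cmd list" | Go "cmd list" | DecB "cmd list" | Back "cmd list"

abbreviation inp :: "nat \<Rightarrow> sy" where
  "inp a \<equiv> Cl ((\<lambda>_. 0)(0 := a)) {}"

text \<open>Registers are unary tracks and arrays are tracks of a tape whose cell -1 is marked
  \<^const>\<open>Hm\<close>; a state carries the stack of commands that remain to be executed.\<close>

fun trans :: "cmd \<Rightarrow> st \<Rightarrow> sy \<Rightarrow> st \<times> sy \<times> dir" where
  "trans c0 Start a = (Start2, a, Lft)"
| "trans c0 Start2 a = (Run [c0], Hm, Stay)"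
| "trans c0 Halt a = (Halt, a, Stay)"
| "trans c0 Fin a = (case a of Hm \<Rightarrow> (Halt, a, Stay)
     | Cl f s \<Rightarrow> if f 1 = 0 then (FinB, inp 0, Lft) else (Fin, inp (f 1), Rgt))"
| "trans c0 FinB a = (if a = Hm then (Halt, a, Rgt) else (FinB, a, Lft))"
| "trans c0 (Run l) a = (case l of [] \<Rightarrow> (Fin, a, Rgt)
     | c # k \<Rightarrow> (case c of Skip \<Rightarrow> (Run k, a, Stay)
        | Seq c d \<Rightarrow> (Run (c # d # k), a, Stay)
        | _ \<Rightarrow> (Go l, a, Rgt)))"
| "trans c0 (Go l) a = (case l of [] \<Rightarrow> (Halt, a, Stay) | c # k \<Rightarrow>
     (case a of Hm \<Rightarrow> (Halt, a, Stay) | Cl f s \<Rightarrow>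
       (case c of
          Inc v \<Rightarrow> if v \<in> s then (Go l, a, Rgt) else (Back k, Cl f (insert v s), Lft)
        | Dec v \<Rightarrow> if v \<in> s then (Go l, a, Rgt) else (DecB l, a, Lft)
        | Wr j v b \<Rightarrow> if v \<in> s then (Go l, a, Rgt) else (Back k, Cl (f(j := b)) s, Lft)
        | Cs j v b c1 c2 \<Rightarrow> if v \<in> s then (Go l, a, Rgt)
            else (Back ((if f j = b then c1 else c2) # k), a, Lft)
        | IfZ v c1 c2 \<Rightarrow> (Back ((if v \<in> s then c2 else c1) # k), a, Lft)
        | Wh v c1 \<Rightarrow> (Back (if v \<in> s then c1 # c # k else k), a, Lft)
        | _ \<Rightarrow> (Halt, a, Stay))))"
| "trans c0 (DecB l) a = (case l of [] \<Rightarrow> (Halt, a, Stay) | c # k \<Rightarrow>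
     (case c of Dec v \<Rightarrow> (case a of Hm \<Rightarrow> (Run k, a, Stay) | Cl f s \<Rightarrow> (Back k, Cl f (s - {v}), Lft))
      | _ \<Rightarrow> (Halt, a, Stay)))"
| "trans c0 (Back k) a = (if a = Hm then (Run k, a, Stay) else (Back k, a, Lft))"

fun gstep :: "cmd \<Rightarrow> st \<times> int \<times> (int \<Rightarrow> sy) \<Rightarrow> st \<times> int \<times> (int \<Rightarrow> sy)" where
  "gstep c0 (q, p, tp) = (case trans c0 q (tp p) of (q', a, d) \<Rightarrow> (q', p + mv d, tp(p := a)))"

definition TP :: "(nat \<Rightarrow> nat) \<Rightarrow> (nat \<Rightarrow> nat \<Rightarrow> nat) \<Rightarrow> int \<Rightarrow> sy" where
  "TP s arr z = (if z < -1 then inp 0 else if z = -1 then Hm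
     else Cl (\<lambda>j. arr j (nat z)) {v. nat z < s v})"

lemma TP_home [simp]: "TP s arr (-1) = Hm"
  by (simp add: TP_def)

lemma TP_int [simp]: "TP s arr (int n) = Cl (\<lambda>j. arr j n) {v. n < s v}"
  by (simp add: TP_def)

lemma TP_0 [simp]: "TP s arr 0 = Cl (\<lambda>j. arr j 0) {v. 0 < s v}"
  by (simp add: TP_def)

lemma funpow_trans: "(f ^^ a) x = y \<Longrightarrow> (f ^^ b) y = z \<Longrightarrow> (f ^^ (a + b)) x = z"
  by (metis add.commute comp_apply funpow_add)

lemma gstep_go:
  assumes "\<And>f s. v \<in> s \<Longrightarrow> trans c0 (Go l) (Cl f s) = (Go l, Cl f s, Rgt)" "n \<le> s v"
  shows "(gstep c0 ^^ n) (Go l, 0, TP s arr) = (Go l, int n, TP s arr)"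
  using assms(2)
proof (induction n)
  case (Suc n)
  then have "trans c0 (Go l) (TP s arr (int n)) = (Go l, TP s arr (int n), Rgt)"
    using assms(1) by simp
  with Suc show ?case by (simp add: fun_upd_idem)
qed simp

lemma gstep_back:
  "(gstep c0 ^^ (n + 1)) (Back k, int n - 1, TP s arr) = (Run k, -1, TP s arr)"
proof (induction n)
  case 0
  then show ?case by (simp add: fun_upd_idem)
next
  case (Suc n)
  have "gstep c0 (Back k, int (Suc n) - 1, TP s arr) = (Back k, int n - 1, TP s arr)"
    by (simp add: fun_upd_idem)
  then have "(gstep c0 ^^ 1) (Back k, int (Suc n) - 1, TP s arr) = (Back k, int n - 1, TP s arr)"
    by simp
  from funpow_trans[OF this Suc] show ?case by simp
qed

text \<open>All primitive commands run the same round trip: walk to the cell addressed by the register,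
  change it, walk home.\<close>

lemma gstep_round:
  assumes run: "trans c0 (Run l) Hm = (Go l, Hm, Rgt)"
    and go: "\<And>f s. v \<in> s \<Longrightarrow> trans c0 (Go l) (Cl f s) = (Go l, Cl f s, Rgt)"
    and act: "trans c0 (Go l) (Cl (\<lambda>j. arr j (s v)) {u. s v < s u}) = (Back k, a, Lft)"
    and tape: "(TP s arr)(int (s v) := a) = TP s' arr'"
  shows "(gstep c0 ^^ (2 * s v + 3)) (Run l, -1, TP s arr) = (Run k, -1, TP s' arr')"
proof -
  have 1: "(gstep c0 ^^ 1) (Run l, -1, TP s arr) = (Go l, 0, TP s arr)"
    by (simp add: run fun_upd_idem del: trans.simps)
  have 2: "(gstep c0 ^^ s v) (Go l, 0, TP s arr) = (Go l, int (s v), TP s arr)"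
    by (rule gstep_go[OF go]) auto
  have 3: "(gstep c0 ^^ 1) (Go l, int (s v), TP s arr) = (Back k, int (s v) - 1, TP s' arr')"
    using act tape by (simp del: trans.simps)
  have "(gstep c0 ^^ (1 + s v + 1 + (s v + 1))) (Run l, -1, TP s arr) = (Run k, -1, TP s' arr')"
    by (rule funpow_trans[OF funpow_trans[OF funpow_trans[OF 1 2] 3] gstep_back])
  then show ?thesis by (simp add: mult_2 add.commute add.left_commute numeral_3_eq_3)
qed

lemma TP_Inc: "(TP s arr)(int (s v) := Cl (\<lambda>j. arr j (s v)) (insert v {u. s v < s u})) =
  TP (s(v := Suc (s v))) arr"
proof
  fix z show "((TP s arr)(int (s v) := Cl (\<lambda>j. arr j (s v)) (insert v {u. s v < s u}))) z =
    TP (s(v := Suc (s v))) arr z"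
  proof (cases "z = int (s v)")
    case False
    then have "z \<ge> 0 \<Longrightarrow> nat z \<noteq> s v" by auto
    then show ?thesis using False by (auto simp: TP_def)
  qed auto
qed

lemma TP_Dec: "s v = Suc n \<Longrightarrow> (TP s arr)(int n := Cl (\<lambda>j. arr j n) ({u. n < s u} - {v})) =
  TP (s(v := n)) arr"
proof
  fix z assume n: "s v = Suc n"
  show "((TP s arr)(int n := Cl (\<lambda>j. arr j n) ({u. n < s u} - {v}))) z = TP (s(v := n)) arr z"
  proof (cases "z = int n")
    case False
    then have "z \<ge> 0 \<Longrightarrow> nat z \<noteq> n" by auto
    then show ?thesis using False n by (auto simp: TP_def)
  qed auto
qed

lemma TP_Wr: "(TP s arr)(int (s v) := Cl ((\<lambda>j. arr j (s v))(i := a)) {u. s v < s u}) =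
  TP s (arr(i := (arr i)(s v := a)))"
proof
  fix z show "((TP s arr)(int (s v) := Cl ((\<lambda>j. arr j (s v))(i := a)) {u. s v < s u})) z =
    TP s (arr(i := (arr i)(s v := a))) z"
  proof (cases "z = int (s v)")
    case False
    then have "z \<ge> 0 \<Longrightarrow> nat z \<noteq> s v" by auto
    then show ?thesis using False by (auto simp: TP_def fun_eq_iff)
  qed (auto simp: fun_eq_iff)
qed

lemma gstep_test:
  assumes "trans c0 (Run l) Hm = (Go l, Hm, Rgt)"
    "trans c0 (Go l) (Cl (\<lambda>j. arr j 0) {u. 0 < s u}) = (Back k, Cl (\<lambda>j. arr j 0) {u. 0 < s u}, Lft)"
  shows "(gstep c0 ^^ 3) (Run l, -1, TP s arr) = (Run k, -1, TP s arr)"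
  using assms by (simp add: eval_nat_numeral fun_upd_idem)

text \<open>Unlike the other primitives, a decrement changes the cell before the first unmarked one.
  For value 0 this is the home cell, where nothing is changed, in agreement with truncated
  subtraction.\<close>

lemma gstep_Dec:
  "(gstep c0 ^^ (2 * s v + 3)) (Run (Dec v # k), -1, TP s arr) = (Run k, -1, TP (s(v := s v - 1)) arr)"
proof -
  let ?l = "Dec v # k"
  have 1: "(gstep c0 ^^ 1) (Run ?l, -1, TP s arr) = (Go ?l, 0, TP s arr)"
    by (simp add: fun_upd_idem)
  have 2: "(gstep c0 ^^ s v) (Go ?l, 0, TP s arr) = (Go ?l, int (s v), TP s arr)"
    by (rule gstep_go[where v = v]) auto
  have 3: "(gstep c0 ^^ 1) (Go ?l, int (s v), TP s arr) = (DecB ?l, int (s v) - 1, TP s arr)"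
    by (simp add: fun_upd_idem)
  note 123 = funpow_trans[OF funpow_trans[OF 1 2] 3]
  show ?thesis
  proof (cases "s v")
    case 0
    have "(gstep c0 ^^ 1) (DecB ?l, int (s v) - 1, TP s arr) = (Run k, -1, TP s arr)"
      using 0 by (simp add: fun_upd_idem)
    from funpow_trans[OF 123 this] 0 show ?thesis by (simp add: eval_nat_numeral fun_upd_idem)
  next
    case (Suc n)
    have 4: "(gstep c0 ^^ 1) (DecB ?l, int (s v) - 1, TP s arr) = (Back k, int n - 1, TP (s(v := n)) arr)"
      using Suc TP_Dec[of s v n arr] by simp
    have e: "1 + s v + 1 + 1 + (n + 1) = 2 * s v + 3" using Suc by simp
    have "(gstep c0 ^^ (1 + s v + 1 + 1 + (n + 1))) (Run ?l, -1, TP s arr) = (Run k, -1, TP (s(v := n)) arr)"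
      by (rule funpow_trans[OF funpow_trans[OF 123 4] gstep_back])
    moreover have "s v - 1 = n" using Suc by simp
    ultimately show ?thesis by (simp only: e)
  qed
qed

text \<open>A primitive costs the length of a walk, hence the bound \<open>m\<close> on the
  registers is carried along: after cost t no register exceeds m + t. The continuation
  \<open>k\<close> is arbitrary because a body runs on top of the commands that wait on the
  stack.\<close>

lemma gstep_big:
  assumes "big c S t S'" "\<forall>v. fst S v \<le> m"
  shows "(\<forall>v. fst S' v \<le> m + t) \<and>
    (\<exists>t'. t' \<le> t * (2 * (m + t) + 3) \<and> t \<le> t' \<and>
      (\<forall>k. (gstep c0 ^^ t') (Run (c # k), -1, TP (fst S) (snd S)) =
        (Run k, -1, TP (fst S') (snd S'))))"
  using assms
proof (induction arbitrary: m)
  case (big_Skip S)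
  then show ?case
    by (auto intro!: exI[of _ 1] simp: fun_upd_idem le_SucI)
next
  case (big_Inc v s arr)
  have "(gstep c0 ^^ (2 * s v + 3)) (Run (Inc v # k), -1, TP s arr) =
    (Run k, -1, TP (s(v := Suc (s v))) arr)" for k
    by (rule gstep_round[where v = v, OF _ _ _ TP_Inc]) auto
  moreover have "2 * s v + 3 \<le> 2 * (m + 1) + 3" using big_Inc[rule_format, of v] by simp
  moreover have "\<forall>u. (s(v := Suc (s v))) u \<le> m + 1" using big_Inc by (auto simp: le_SucI)
  ultimately show ?case by (intro conjI exI[of _ "2 * s v + 3"]) (auto simp: fun_upd_def)
next
  case (big_Dec v s arr)
  have "2 * s v + 3 \<le> 2 * (m + 1) + 3" using big_Dec[rule_format, of v] by simp
  moreover have "\<forall>u. (s(v := s v - 1)) u \<le> m + 1" using big_Dec by (auto simp: le_SucI le_diff_conv)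
  ultimately show ?case
    by (intro conjI exI[of _ "2 * s v + 3"]) (auto simp: gstep_Dec[simplified] fun_upd_def)
next
  case (big_Wr j v a s arr)
  have "(gstep c0 ^^ (2 * s v + 3)) (Run (Wr j v a # k), -1, TP s arr) =
    (Run k, -1, TP s (arr(j := (arr j)(s v := a))))" for k
    by (rule gstep_round[where v = v, OF _ _ _ TP_Wr]) auto
  moreover have "2 * s v + 3 \<le> 2 * (m + 1) + 3" using big_Wr[rule_format, of v] by simp
  ultimately show ?case using big_Wr by (intro conjI exI[of _ "2 * s v + 3"]) (auto simp: le_SucI fun_upd_def)
next
  case (big_Seq c S t1 S1 d t2 S2)
  from big_Seq.IH(1)[OF big_Seq.prems] obtain t1' where b1: "\<forall>v. fst S1 v \<le> m + t1"
    and t1: "t1' \<le> t1 * (2 * (m + t1) + 3)" "t1 \<le> t1'" and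
    r1: "\<And>k. (gstep c0 ^^ t1') (Run (c # k), -1, TP (fst S) (snd S)) = (Run k, -1, TP (fst S1) (snd S1))"
    by auto
  from big_Seq.IH(2)[OF b1] obtain t2' where b2: "\<forall>v. fst S2 v \<le> m + t1 + t2"
    and t2: "t2' \<le> t2 * (2 * (m + t1 + t2) + 3)" "t2 \<le> t2'" and
    r2: "\<And>k. (gstep c0 ^^ t2') (Run (d # k), -1, TP (fst S1) (snd S1)) = (Run k, -1, TP (fst S2) (snd S2))"
    by auto
  have "(gstep c0 ^^ 1) (Run ((c ;; d) # k), -1, TP (fst S) (snd S)) =
    (Run (c # d # k), -1, TP (fst S) (snd S))" for k
    by (simp add: fun_upd_idem)
  from funpow_trans[OF funpow_trans[OF this r1] r2]
  have r: "\<And>k. (gstep c0 ^^ (1 + t1' + t2')) (Run ((c ;; d) # k), -1, TP (fst S) (snd S)) =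
    (Run k, -1, TP (fst S2) (snd S2))" .
  let ?X = "2 * (m + (t1 + t2 + 1)) + 3"
  have "t1 * (2 * (m + t1) + 3) \<le> t1 * ?X" "t2 * (2 * (m + t1 + t2) + 3) \<le> t2 * ?X"
    by (intro mult_le_mono2; simp)+
  then have "1 + t1' + t2' \<le> ?X + t1 * ?X + t2 * ?X" using t1 t2 by linarith
  then have "1 + t1' + t2' \<le> (t1 + t2 + 1) * ?X" by (simp add: algebra_simps)
  then show ?case using r b2 t1(2) t2(2)
    by (intro conjI exI[of _ "1 + t1' + t2'"]) (auto simp: add.assoc le_SucI)
next
  case (big_IfZ s v c d arr t S)
  from big_IfZ.IH[OF big_IfZ.prems] obtain t1 where b: "\<forall>v. fst S v \<le> m + t"
    and t: "t1 \<le> t * (2 * (m + t) + 3)" "t \<le> t1" and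
    r: "\<And>k. (gstep c0 ^^ t1) (Run ((if s v = 0 then c else d) # k), -1, TP s arr) = (Run k, -1, TP (fst S) (snd S))"
    by auto
  have "(gstep c0 ^^ 3) (Run (IfZ v c d # k), -1, TP s arr) =
     (Run ((if s v = 0 then c else d) # k), -1, TP s arr)" for k
    by (rule gstep_test) auto
  from funpow_trans[OF this r] have r: "\<And>k. (gstep c0 ^^ (3 + t1)) (Run (IfZ v c d # k), -1, TP s arr) =
    (Run k, -1, TP (fst S) (snd S))" .
  have "t * (2 * (m + t) + 3) \<le> t * (2 * (m + (t + 1)) + 3)" by (intro mult_le_mono2) simp
  then have "3 + t1 \<le> (t + 1) * (2 * (m + (t + 1)) + 3)" using t by (simp add: algebra_simps)
  then show ?case using r b t(2) by (intro conjI exI[of _ "3 + t1"]) (auto simp: le_SucI)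
next
  case (big_Cs arr j s v a c d t S)
  from big_Cs.IH[OF big_Cs.prems] obtain t1 where b: "\<forall>v. fst S v \<le> m + t"
    and t: "t1 \<le> t * (2 * (m + t) + 3)" "t \<le> t1" and
    r: "\<And>k. (gstep c0 ^^ t1) (Run ((if arr j (s v) = a then c else d) # k), -1, TP s arr) = (Run k, -1, TP (fst S) (snd S))"
    by auto
  have "(gstep c0 ^^ (2 * s v + 3)) (Run (Cs j v a c d # k), -1, TP s arr) =
     (Run ((if arr j (s v) = a then c else d) # k), -1, TP s arr)" for k
    by (rule gstep_round[where v = v]) (auto simp: fun_upd_idem)
  from funpow_trans[OF this r] have r: "\<And>k. (gstep c0 ^^ (2 * s v + 3 + t1)) (Run (Cs j v a c d # k), -1, TP s arr) =
    (Run k, -1, TP (fst S) (snd S))" .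
  have "t * (2 * (m + t) + 3) \<le> t * (2 * (m + (t + 1)) + 3)" by (intro mult_le_mono2) simp
  moreover have "s v \<le> m" using big_Cs.prems by simp
  ultimately have "2 * s v + 3 + t1 \<le> (t + 1) * (2 * (m + (t + 1)) + 3)" using t by (simp add: algebra_simps)
  then show ?case using r b t(2) by (intro conjI exI[of _ "2 * s v + 3 + t1"]) (auto simp: le_SucI)
next
  case (big_WhF s v c arr)
  have "(gstep c0 ^^ 3) (Run (Wh v c # k), -1, TP s arr) = (Run k, -1, TP s arr)" for k
    by (rule gstep_test) (use big_WhF in auto)
  then show ?case using big_WhF by (intro conjI exI[of _ 3]) (auto simp: le_SucI)
next
  case (big_WhT s v c arr t1 S1 t2 S2)
  from big_WhT.IH(1)[OF big_WhT.prems] obtain t1' where b1: "\<forall>v. fst S1 v \<le> m + t1"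
    and t1: "t1' \<le> t1 * (2 * (m + t1) + 3)" "t1 \<le> t1'" and
    r1: "\<And>k. (gstep c0 ^^ t1') (Run (c # k), -1, TP s arr) = (Run k, -1, TP (fst S1) (snd S1))"
    by auto
  from big_WhT.IH(2)[OF b1] obtain t2' where b2: "\<forall>v. fst S2 v \<le> m + t1 + t2"
    and t2: "t2' \<le> t2 * (2 * (m + t1 + t2) + 3)" "t2 \<le> t2'" and
    r2: "\<And>k. (gstep c0 ^^ t2') (Run (Wh v c # k), -1, TP (fst S1) (snd S1)) = (Run k, -1, TP (fst S2) (snd S2))"
    by auto
  have "(gstep c0 ^^ 3) (Run (Wh v c # k), -1, TP s arr) = (Run (c # Wh v c # k), -1, TP s arr)" for k
    by (rule gstep_test) (use big_WhT in auto)
  from funpow_trans[OF funpow_trans[OF this r1] r2]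
  have r: "\<And>k. (gstep c0 ^^ (3 + t1' + t2')) (Run (Wh v c # k), -1, TP s arr) =
    (Run k, -1, TP (fst S2) (snd S2))" .
  let ?X = "2 * (m + (t1 + t2 + 1)) + 3"
  have "t1 * (2 * (m + t1) + 3) \<le> t1 * ?X" "t2 * (2 * (m + t1 + t2) + 3) \<le> t2 * ?X"
    by (intro mult_le_mono2; simp)+
  then have "3 + t1' + t2' \<le> ?X + t1 * ?X + t2 * ?X" using t1 t2 by linarith
  then have "3 + t1' + t2' \<le> (t1 + t2 + 1) * ?X" by (simp add: algebra_simps)
  then show ?case using r b2 t1(2) t2(2)
    by (intro conjI exI[of _ "3 + t1' + t2'"]) (auto simp: add.assoc le_SucI)
qed

lemma gstep_start:
  "(gstep c0 ^^ 2) (Start, 0, \<lambda>z. inp (tape_of xs z)) =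
   (Run [c0], -1, TP (\<lambda>_. 0) (\<lambda>j i. if j = 0 then nthd xs i else 0))"
proof -
  have "(\<lambda>z. inp (tape_of xs z))(-1 := Hm) = TP (\<lambda>_. 0) (\<lambda>j i. if j = 0 then nthd xs i else 0)"
    by (auto simp: TP_def tape_of_def fun_eq_iff)
  then show ?thesis by (simp add: eval_nat_numeral fun_upd_idem)
qed

text \<open>The tape during the final sweep: \<open>n\<close> cells are already plain symbols, and
  \<open>b\<close> tells whether the blank that ends the output has been written. Cells beyond it
  may keep their content.\<close>

definition outTP :: "nat \<Rightarrow> nat \<Rightarrow> (nat \<Rightarrow> nat) \<Rightarrow> (nat \<Rightarrow> nat \<Rightarrow> nat) \<Rightarrow> int \<Rightarrow> sy" where
  "outTP n b s arr z = (if 0 \<le> z \<and> z < int n then inp (arr 1 (nat z))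
     else if b \<noteq> 0 \<and> z = int n then inp 0 else TP s arr z)"

lemma gstep_fin1:
  assumes "\<And>i. i < N \<Longrightarrow> arr 1 i \<noteq> 0" "n \<le> N"
  shows "(gstep c0 ^^ n) (Fin, 0, outTP 0 0 s arr) = (Fin, int n, outTP n 0 s arr)"
  using assms(2)
proof (induction n)
  case (Suc n)
  have "(outTP n 0 s arr)(int n := inp (arr 1 n)) = outTP (Suc n) 0 s arr"
    by (auto simp: outTP_def fun_eq_iff)
  moreover have "arr 1 n \<noteq> 0" using assms Suc by simp
  ultimately show ?case using Suc by (auto simp: outTP_def)
qed simp

lemma gstep_fin2:
  "n \<le> N \<Longrightarrow> (gstep c0 ^^ (n + 1)) (FinB, int n - 1, outTP N 1 s arr) = (Halt, 0, outTP N 1 s arr)"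
proof (induction n)
  case 0
  have "outTP N 1 s arr (-1) = Hm" by (simp add: outTP_def)
  then show ?case by (simp add: fun_upd_idem)
next
  case (Suc n)
  have "outTP N 1 s arr (int n) \<noteq> Hm" using Suc.prems by (simp add: outTP_def)
  then have "(gstep c0 ^^ 1) (FinB, int (Suc n) - 1, outTP N 1 s arr) = (FinB, int n - 1, outTP N 1 s arr)"
    by (simp add: fun_upd_idem)
  from funpow_trans[OF this Suc.IH] Suc.prems show ?case by simp
qed

lemma gstep_fin:
  assumes "\<And>i. i < N \<Longrightarrow> arr 1 i \<noteq> 0" "arr 1 N = 0"
  shows "(gstep c0 ^^ (2 * N + 3)) (Run [], -1, TP s arr) = (Halt, 0, outTP N 1 s arr)"
proof -
  have 0: "outTP 0 0 s arr = TP s arr" by (auto simp: outTP_def fun_eq_iff)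
  have 1: "(gstep c0 ^^ 1) (Run [], -1, TP s arr) = (Fin, 0, outTP 0 0 s arr)"
    unfolding 0 by (simp add: fun_upd_idem)
  have "(outTP N 0 s arr)(int N := inp 0) = outTP N 1 s arr"
    by (auto simp: outTP_def fun_eq_iff)
  then have 3: "(gstep c0 ^^ 1) (Fin, int N, outTP N 0 s arr) = (FinB, int N - 1, outTP N 1 s arr)"
    using assms(2) by (auto simp: outTP_def)
  have 2: "(gstep c0 ^^ N) (Fin, 0, outTP 0 0 s arr) = (Fin, int N, outTP N 0 s arr)"
    by (rule gstep_fin1[where N = N]) (use assms(1) in auto)
  have "(gstep c0 ^^ (1 + N + 1 + (N + 1))) (Run [], -1, TP s arr) = (Halt, 0, outTP N 1 s arr)"
    by (rule funpow_trans[OF funpow_trans[OF funpow_trans[OF 1 2] 3] gstep_fin2[OF order.refl]])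
  then show ?thesis by (simp add: mult_2 add.commute add.left_commute numeral_3_eq_3)
qed

section \<open>Finiteness of the control and of the alphabet of a compiled program\<close>

primrec conts :: "cmd \<Rightarrow> cmd list \<Rightarrow> cmd list set" where
  "conts Skip k = {Skip # k}"
| "conts (Inc v) k = {Inc v # k}"
| "conts (Dec v) k = {Dec v # k}"
| "conts (Wr j v a) k = {Wr j v a # k}"
| "conts (c ;; d) k = insert ((c ;; d) # k) (conts c (d # k) \<union> conts d k)"
| "conts (IfZ v c d) k = insert (IfZ v c d # k) (conts c k \<union> conts d k)"
| "conts (Cs j v a c d) k = insert (Cs j v a c d # k) (conts c k \<union> conts d k)"
| "conts (Wh v c) k = insert (Wh v c # k) (conts c (Wh v c # k))"

fun nxt :: "cmd list \<Rightarrow> cmd list set" where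
  "nxt ((c ;; d) # k) = {c # d # k}"
| "nxt (IfZ v c d # k) = {c # k, d # k}"
| "nxt (Cs j v a c d # k) = {c # k, d # k}"
| "nxt (Wh v c # k) = {c # Wh v c # k, k}"
| "nxt (c # k) = {k}"
| "nxt [] = {}"

text \<open>Only registers and constants that a command can put on the tape are bounded; tests leave
  the symbol as it is.\<close>

primrec bd :: "nat \<Rightarrow> cmd \<Rightarrow> bool" where
  "bd m Skip = True"
| "bd m (Inc v) = (v < m)"
| "bd m (Dec v) = (v < m)"
| "bd m (Wr j v a) = (j < m \<and> v < m \<and> a < m)"
| "bd m (c ;; d) = (bd m c \<and> bd m d)"
| "bd m (IfZ v c d) = (bd m c \<and> bd m d)"
| "bd m (Cs j v a c d) = (bd m c \<and> bd m d)"
| "bd m (Wh v c) = bd m c"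

lemma bd_mono: "bd m c \<Longrightarrow> m \<le> m' \<Longrightarrow> bd m' c"
  by (induction c) auto

lemma ex_bd: "\<exists>m. bd m c"
proof (induction c)
  case (Wr j v a)
  then show ?case by (intro exI[of _ "Suc (j + v + a)"]) auto
next
  case (Seq c d)
  then show ?case by (metis bd.simps(5) bd_mono linear)
next
  case (IfZ v c d)
  then show ?case by (metis bd.simps(6) bd_mono linear)
next
  case (Cs j v a c d)
  then show ?case by (metis bd.simps(7) bd_mono linear)
qed auto

text \<open>A loop pushes its body on top of itself and drops back to the same stack afterwards, so
  only finitely many stacks arise although runs are unbounded.\<close>

lemma finite_conts: "finite (conts c k)"
  by (induction c arbitrary: k) auto

lemma conts_self: "c # k \<in> conts c k"
  by (cases c) auto

lemma conts_nxt: "l \<in> conts c k \<Longrightarrow> nxt l \<subseteq> insert k (conts c k)"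
proof (induction c arbitrary: k)
  case (Seq c d)
  then show ?case using conts_self[of c "d # k"] conts_self[of d k] by fastforce
next
  case (IfZ v c d)
  then show ?case using conts_self[of c k] conts_self[of d k] by fastforce
next
  case (Cs j v a c d)
  then show ?case using conts_self[of c k] conts_self[of d k] by fastforce
next
  case (Wh v c)
  then show ?case using conts_self[of c "Wh v c # k"] by fastforce
qed auto

lemma conts_bd: "l \<in> conts c k \<Longrightarrow> bd m c \<Longrightarrow> list_all (bd m) k \<Longrightarrow> list_all (bd m) l"
proof (induction c arbitrary: k)
  case (Seq c d)
  from Seq.prems(1) consider "l = (c ;; d) # k" | "l \<in> conts c (d # k)" | "l \<in> conts d k"
    unfolding conts.simps by blast
  then show ?case
  proof cases
    case 2
    then show ?thesis using Seq.IH(1)[of "d # k"] Seq.prems(2,3) by simp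
  next
    case 3
    then show ?thesis using Seq.IH(2)[of k] Seq.prems(2,3) by simp
  qed (use Seq.prems(2,3) in simp)
next
  case (IfZ v c d)
  from IfZ.prems(1) consider "l = IfZ v c d # k" | "l \<in> conts c k" | "l \<in> conts d k"
    unfolding conts.simps by blast
  then show ?case
  proof cases
    case 2
    then show ?thesis using IfZ.IH(1)[of k] IfZ.prems(2,3) by simp
  next
    case 3
    then show ?thesis using IfZ.IH(2)[of k] IfZ.prems(2,3) by simp
  qed (use IfZ.prems(2,3) in simp)
next
  case (Cs j v a c d)
  from Cs.prems(1) consider "l = Cs j v a c d # k" | "l \<in> conts c k" | "l \<in> conts d k"
    unfolding conts.simps by blast
  then show ?case
  proof cases
    case 2
    then show ?thesis using Cs.IH(1)[of k] Cs.prems(2,3) by simp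
  next
    case 3
    then show ?thesis using Cs.IH(2)[of k] Cs.prems(2,3) by simp
  qed (use Cs.prems(2,3) in simp)
next
  case (Wh v c)
  from Wh.prems(1) consider "l = Wh v c # k" | "l \<in> conts c (Wh v c # k)"
    unfolding conts.simps by blast
  then show ?case
  proof cases
    case 2
    then show ?thesis using Wh.IH[of "Wh v c # k"] Wh.prems(2,3) by simp
  qed (use Wh.prems(2,3) in simp)
qed simp_all

text \<open>The functions are pinned to 0 from \<open>m\<close> on, which leaves finitely many of
  them.\<close>

definition SY :: "nat \<Rightarrow> sy set" where
  "SY m = insert Hm {Cl f s | f s. (\<forall>j. if j < m then f j < m else f j = 0) \<and> s \<subseteq> {..<m}}"

definition QS :: "cmd \<Rightarrow> st set" where
  "QS c0 = (let P = insert [] (conts c0 []) in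
     {Start, Start2, Halt, Fin, FinB} \<union> Run ` P \<union> Go ` P \<union> DecB ` P \<union> Back ` P)"

lemma finite_SY: "finite (SY m)"
proof -
  have "finite ((\<lambda>(f, s). Cl f s) `
    ({f. \<forall>j. if j < m then f j < m else f j = 0} \<times> Pow {..<m}))"
  proof (intro finite_imageI finite_cartesian_product)
    have "finite {f. \<forall>j::nat. (j \<in> {..<m} \<longrightarrow> f j \<in> {..<m}) \<and> (j \<notin> {..<m} \<longrightarrow> f j = 0)}"
      by (rule finite_set_of_finite_funs) auto
    then show "finite {f. \<forall>j. if j < m then f j < m else f j = 0}"
      by (rule rev_finite_subset) (auto split: if_splits)
  qed auto
  moreover have "SY m \<subseteq> insert Hm ((\<lambda>(f, s). Cl f s) `
    ({f. \<forall>j. if j < m then f j < m else f j = 0} \<times> Pow {..<m}))"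
    by (auto simp: SY_def)
  ultimately show ?thesis using finite_subset by blast
qed

lemma finite_QS: "finite (QS c0)"
  by (simp add: QS_def finite_conts Let_def)

lemma trans_closed:
  assumes "bd m c0" "1 < m" "q \<in> QS c0" "a \<in> SY m" "trans c0 q a = (q', b, d)"
  shows "q' \<in> QS c0" "b \<in> SY m"
proof -
  let ?P = "insert [] (conts c0 [])"
  have nx: "l \<in> ?P \<Longrightarrow> nxt l \<subseteq> ?P" for l using conts_nxt[of l c0 "[]"] by auto
  have bdd: "l \<in> ?P \<Longrightarrow> list_all (bd m) l" for l using conts_bd[of l c0 "[]" m] assms(1) by auto
  have Q: "Start \<in> QS c0" "Start2 \<in> QS c0" "Halt \<in> QS c0" "Fin \<in> QS c0" "FinB \<in> QS c0"
    "\<And>l. Run l \<in> QS c0 \<longleftrightarrow> l \<in> ?P" "\<And>l. Go l \<in> QS c0 \<longleftrightarrow> l \<in> ?P"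
    "\<And>l. DecB l \<in> QS c0 \<longleftrightarrow> l \<in> ?P" "\<And>l. Back l \<in> QS c0 \<longleftrightarrow> l \<in> ?P"
    by (auto simp: QS_def Let_def)
  have S: "Hm \<in> SY m" "\<And>f s. Cl f s \<in> SY m \<longleftrightarrow> (\<forall>j. if j < m then f j < m else f j = 0) \<and> s \<subseteq> {..<m}"
    by (auto simp: SY_def)
  have c0: "[c0] \<in> ?P" using conts_self[of c0 "[]"] by simp
  have "q' \<in> QS c0 \<and> b \<in> SY m"
  proof (cases q)
    case Fin
    then show ?thesis using assms by (auto simp: Q S split: sy.splits if_splits)
  next
    case (Run l)
    then have l: "l \<in> ?P" using assms(3) Q by simp
    then show ?thesis using nx[OF l] assms(4,5) Run
      by (auto simp: Q split: list.splits cmd.splits)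
  next
    case (Go l)
    then have l: "l \<in> ?P" using assms(3) Q by simp
    then show ?thesis using nx[OF l] bdd[OF l] assms(4,5) Go
      by (auto simp: Q S split: list.splits cmd.splits sy.splits if_splits)
  next
    case (DecB l)
    then have l: "l \<in> ?P" using assms(3) Q by simp
    then show ?thesis using nx[OF l] bdd[OF l] assms(4,5) DecB
      by (auto simp: Q S split: list.splits cmd.splits sy.splits if_splits)
  qed (use assms c0 in \<open>auto simp: Q S split: if_splits\<close>)
  then show "q' \<in> QS c0" "b \<in> SY m" by auto
qed

text \<open>The machine format fixes some codes: start is 0, halt is 1, and blank and input symbols
  keep their own numbers. All other states and symbols may be numbered at will.\<close>

lemma ex_prefix_enum:
  assumes "finite A" "set xs \<subseteq> A" "distinct xs"
  shows "\<exists>f. bij_betw f A {..<card A} \<and> (\<forall>i<length xs. f (xs ! i) = i)"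
proof -
  obtain ys where ys: "set ys = A - set xs" "distinct ys"
    using assms(1) finite_distinct_list[of "A - set xs"] by auto
  let ?zs = "xs @ ys"
  have zs: "distinct ?zs" "set ?zs = A" using ys assms by auto
  have b: "bij_betw (nth ?zs) {..<length ?zs} A"
    using bij_betw_nth[OF zs(1)] zs(2) by simp
  have len: "length ?zs = card A" using zs distinct_card by fastforce
  let ?f = "inv_into {..<length ?zs} (nth ?zs)"
  have "?f (xs ! i) = i" if "i < length xs" for i
    using inv_into_f_f[OF bij_betw_imp_inj_on[OF b], of i] that by (simp add: nth_append)
  then show ?thesis using bij_betw_inv_into[OF b] len by auto
qed

lemma nthd_less4: assumes "set xs \<subseteq> {1, 2, 3}" shows "nthd xs i < 4"
proof (cases "i < length xs")
  case True
  then have "xs ! i \<in> {1, 2, 3}" using assms nth_mem by blast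
  then show ?thesis by (auto simp: nthd_def)
qed (simp add: nthd_def)

theorem compile:
  fixes c0 :: cmd
  shows "\<exists>M. wf_tm M \<and> 4 \<le> fst (snd M) \<and> (\<forall>xs t s' arr' ys. set xs \<subseteq> {1, 2, 3} \<longrightarrow> set ys \<subseteq> {1, 2, 3} \<longrightarrow>
    big c0 (\<lambda>_. 0, \<lambda>j i. if j = 0 then nthd xs i else 0) t (s', arr') \<longrightarrow>
    (\<forall>i<length ys. arr' 1 i = ys ! i) \<longrightarrow> arr' 1 (length ys) = 0 \<longrightarrow>
    (\<exists>t' tp. t' \<le> 2 + t * (2 * t + 3) + (2 * length ys + 3) \<and>
      (astep M ^^ t') (0, 0, tape_of xs) = (1, 0, tp) \<and>
      (\<forall>i<length ys. tp (int i) = ys ! i) \<and> tp (int (length ys)) = 0))"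
proof -
  obtain m where m: "bd m c0" "4 \<le> m"
    using ex_bd[of c0] bd_mono by (metis linear)
  have St: "set [Start, Halt] \<subseteq> QS c0" by (simp add: QS_def Let_def)
  have inpS: "a < 4 \<Longrightarrow> inp a \<in> SY m" for a using m by (auto simp: SY_def)
  obtain eq where eq: "bij_betw eq (QS c0) {..<card (QS c0)}" "eq Start = 0" "eq Halt = 1"
    using ex_prefix_enum[OF finite_QS St] by (force simp: less_Suc_eq)
  have "inj_on inp {0..<4}"
    by (rule inj_onI) (metis fun_upd_same sy.inject)
  then have "distinct (map inp [0..<4])" by (simp add: distinct_map del: upt_rec_numeral)
  moreover have "set (map inp [0..<4]) \<subseteq> SY m" using inpS by auto
  ultimately have "\<exists>f. bij_betw f (SY m) {..<card (SY m)} \<and> (\<forall>i<length (map inp [0..<4]). f (map inp [0..<4] ! i) = i)"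
    by (intro ex_prefix_enum finite_SY)
  then obtain es where es: "bij_betw es (SY m) {..<card (SY m)}"
    "\<And>i. i < 4 \<Longrightarrow> es (inp i) = i"
    by (auto simp del: upt_rec_numeral)
  define dq where "dq = inv_into (QS c0) eq"
  define ds where "ds = inv_into (SY m) es"
  define \<delta> where "\<delta> = (\<lambda>q a. case trans c0 (dq q) (ds a) of (q', b, d) \<Rightarrow> (eq q', es b, d))"
  have dq: "q \<in> QS c0 \<Longrightarrow> dq (eq q) = q" for q
    using eq(1) by (simp add: dq_def bij_betw_def)
  have ds: "a \<in> SY m \<Longrightarrow> ds (es a) = a" for a
    using es(1) by (simp add: ds_def bij_betw_def)
  have dq2: "q < card (QS c0) \<Longrightarrow> dq q \<in> QS c0" for q
    using eq(1) unfolding dq_def bij_betw_def by (metis inv_into_into lessThan_iff)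
  have ds2: "a < card (SY m) \<Longrightarrow> ds a \<in> SY m" for a
    using es(1) unfolding ds_def bij_betw_def by (metis inv_into_into lessThan_iff)
  have cl: "q' \<in> QS c0" "b \<in> SY m" if "q \<in> QS c0" "a \<in> SY m" "trans c0 q a = (q', b, d)" for q a q' b d
    using trans_closed[OF m(1) _ that] m(2) by auto
  have ltq: "q \<in> QS c0 \<Longrightarrow> eq q < card (QS c0)" for q using eq(1) bij_betwE by fastforce
  have lts: "a \<in> SY m \<Longrightarrow> es a < card (SY m)" for a using es(1) bij_betwE by fastforce
  let ?M = "(card (QS c0), card (SY m), \<delta>)"
  have wf: "wf_tm ?M"
    unfolding wf_tm_def prod.case
  proof (intro conjI allI impI)
    have "eq Halt < card (QS c0)" using ltq St by simp
    then show "2 \<le> card (QS c0)" using eq(3) by simp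
    have "es (inp 3) < card (SY m)" using lts inpS by simp
    then show "3 \<le> card (SY m)" using es(2)[of 3] by simp
    fix q a assume qa: "q < card (QS c0)" "a < card (SY m)"
    obtain q' b d where tr: "trans c0 (dq q) (ds a) = (q', b, d)" by (metis prod_cases3)
    show "fst (\<delta> q a) < card (QS c0)" "fst (snd (\<delta> q a)) < card (SY m)"
      using ltq[OF cl(1)[OF dq2[OF qa(1)] ds2[OF qa(2)] tr]]
        lts[OF cl(2)[OF dq2[OF qa(1)] ds2[OF qa(2)] tr]] by (simp_all add: \<delta>_def tr)
  qed
  have sim1: "astep ?M (eq q, p, es \<circ> tp) = (eq q', p', es \<circ> tp') \<and> q' \<in> QS c0 \<and> range tp' \<subseteq> SY m"
    if h: "q \<in> QS c0" "range tp \<subseteq> SY m" "gstep c0 (q, p, tp) = (q', p', tp')" for q p tp q' p' tp'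
  proof (cases "q = Halt")
    case True
    then show ?thesis using that by (auto simp: eq(3) fun_upd_idem)
  next
    case False
    then have "eq q \<noteq> eq Halt"
      using inj_onD[OF bij_betw_imp_inj_on[OF eq(1)], of q Halt] that(1) St by auto
    then have "eq q \<noteq> 1" by (simp add: eq(3))
    moreover have a: "tp p \<in> SY m" using that(2) by auto
    moreover obtain b d where tr: "trans c0 q (tp p) = (q', b, d)"
      and pd: "p' = p + mv d" "tp' = tp(p := b)"
      using h(3) by (auto split: prod.splits)
    moreover note cl[OF that(1) a tr]
    ultimately show ?thesis using that(1,2)
      by (auto simp: \<delta>_def dq ds fun_upd_comp split: if_splits)
  qed
  have sim: "(astep ?M ^^ t) (eq q, p, es \<circ> tp) = (eq q', p', es \<circ> tp') \<and> q' \<in> QS c0 \<and> range tp' \<subseteq> SY m"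
    if "q \<in> QS c0" "range tp \<subseteq> SY m" "(gstep c0 ^^ t) (q, p, tp) = (q', p', tp')" for q p tp q' p' tp' t
    using that(3)
  proof (induction t arbitrary: q' p' tp')
    case 0
    then show ?case using that by auto
  next
    case (Suc t)
    obtain q1 p1 tp1 where 1: "(gstep c0 ^^ t) (q, p, tp) = (q1, p1, tp1)"
      by (metis prod_cases3)
    with Suc.prems have 2: "gstep c0 (q1, p1, tp1) = (q', p', tp')" by simp
    have IH: "(astep ?M ^^ t) (eq q, p, es \<circ> tp) = (eq q1, p1, es \<circ> tp1)" "q1 \<in> QS c0" "range tp1 \<subseteq> SY m"
      using Suc.IH[OF 1] by blast+
    have "(astep ?M ^^ Suc t) (eq q, p, es \<circ> tp) = astep ?M ((astep ?M ^^ t) (eq q, p, es \<circ> tp))"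
      by (rule trans[OF fun_cong[OF funpow.simps(2)] comp_apply])
    then show ?case unfolding IH(1) using sim1[OF IH(2,3) 2] by metis
  qed
  show ?thesis
  proof (intro exI[of _ ?M] conjI wf allI impI)
    show "4 \<le> fst (snd ?M)" using lts[OF inpS[of 3]] es(2)[of 3] by simp
    fix xs ys :: "nat list" and t s' arr'
    assume xs: "set xs \<subseteq> {1, 2, 3}" and ys: "set ys \<subseteq> {1, 2, 3}"
      and b: "big c0 (\<lambda>_. 0, \<lambda>j i. if j = 0 then nthd xs i else 0) t (s', arr')"
      and out: "\<forall>i<length ys. arr' 1 i = ys ! i" "arr' 1 (length ys) = 0"
    have xs4: "nthd xs i < 4" for i
      using nthd_less4[OF xs] .
    have ys4: "ys ! i < 4" "ys ! i \<noteq> 0" if "i < length ys" for i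
      using ys nth_mem[OF that] by auto
    from gstep_big[OF b, of 0 c0] obtain t1 where t1: "t1 \<le> t * (2 * t + 3)"
      "\<And>k. (gstep c0 ^^ t1) (Run (c0 # k), -1, TP (\<lambda>_. 0) (\<lambda>j i. if j = 0 then nthd xs i else 0)) =
        (Run k, -1, TP s' arr')"
      by auto
    have fin: "(gstep c0 ^^ (2 * length ys + 3)) (Run [], -1, TP s' arr') = (Halt, 0, outTP (length ys) 1 s' arr')"
      by (rule gstep_fin) (use out ys4 in auto)
    note g = funpow_trans[OF funpow_trans[OF gstep_start t1(2)] fin]
    have r: "range (\<lambda>z. inp (tape_of xs z)) \<subseteq> SY m"
      using inpS xs4 by (auto simp: tape_of_def)
    have e: "es \<circ> (\<lambda>z. inp (tape_of xs z)) = tape_of xs"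
      using es(2) xs4 by (auto simp: tape_of_def fun_eq_iff)
    have "(astep ?M ^^ (2 + t1 + (2 * length ys + 3))) (0, 0, tape_of xs) =
      (1, 0, es \<circ> outTP (length ys) 1 s' arr')"
      using sim[OF _ r g] St by (simp only: eq e list.set insert_subset)
    then show "\<exists>t' tp. t' \<le> 2 + t * (2 * t + 3) + (2 * length ys + 3) \<and>
      (astep ?M ^^ t') (0, 0, tape_of xs) = (1, 0, tp) \<and>
      (\<forall>i<length ys. tp (int i) = ys ! i) \<and> tp (int (length ys)) = 0"
    proof (intro exI[of _ "2 + t1 + (2 * length ys + 3)"] exI[of _ "es \<circ> outTP (length ys) 1 s' arr'"] conjI)
      show "\<forall>i<length ys. (es \<circ> outTP (length ys) 1 s' arr') (int i) = ys ! i"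
        using out(1) ys4(1) es(2) by (simp add: outTP_def)
      show "(es \<circ> outTP (length ys) 1 s' arr') (int (length ys)) = 0"
        using es(2)[of 0] by (simp add: outTP_def)
    qed (use t1(1) in auto)
  qed
qed

section \<open>Polynomial-time functions\<close>

declare One_nat_def [simp del]

text \<open>Monotonicity is included so that a bound may be evaluated at any upper estimate of its
  argument.\<close>

definition polyb :: "(nat \<Rightarrow> nat) \<Rightarrow> bool" where
  "polyb p = (mono p \<and> (\<exists>C e. \<forall>N. p N \<le> C * (N + 1) ^ e))"

lemma polyb_mono: "polyb p \<Longrightarrow> a \<le> b \<Longrightarrow> p a \<le> p b"
  by (simp add: polyb_def monoD)

lemma polyb_const [intro!, simp]: "polyb (\<lambda>_. k)"
proof -
  have "\<forall>N. k \<le> k * (N + 1) ^ 0" by simp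
  then show ?thesis unfolding polyb_def mono_def by blast
qed

lemma polyb_id [intro!, simp]: "polyb (\<lambda>N. N)"
proof -
  have "\<forall>N::nat. N \<le> 1 * (N + 1) ^ 1" by simp
  then show ?thesis unfolding polyb_def mono_def by blast
qed

lemma polyb_add [intro!]: assumes "polyb p" "polyb q" shows "polyb (\<lambda>N. p N + q N)"
proof -
  obtain C1 e1 C2 e2 where C: "\<And>N. p N \<le> C1 * (N + 1) ^ e1" "\<And>N. q N \<le> C2 * (N + 1) ^ e2"
    using assms unfolding polyb_def by blast
  have e: "C1 * (N + 1) ^ e1 \<le> C1 * (N + 1) ^ (e1 + e2)"
    "C2 * (N + 1) ^ e2 \<le> C2 * (N + 1) ^ (e1 + e2)" for N :: nat
    by (intro mult_le_mono2 power_increasing; simp)+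
  have "\<forall>N. p N + q N \<le> (C1 + C2) * (N + 1) ^ (e1 + e2)"
  proof
    fix N show "p N + q N \<le> (C1 + C2) * (N + 1) ^ (e1 + e2)"
      unfolding distrib_right using C[of N] e[of N] by linarith
  qed
  moreover have "mono (\<lambda>N. p N + q N)" using assms by (simp add: polyb_def mono_def add_mono)
  ultimately show ?thesis unfolding polyb_def by blast
qed

lemma polyb_mult [intro!]: assumes "polyb p" "polyb q" shows "polyb (\<lambda>N. p N * q N)"
proof -
  obtain C1 e1 C2 e2 where "\<forall>N. p N \<le> C1 * (N + 1) ^ e1" "\<forall>N. q N \<le> C2 * (N + 1) ^ e2"
    using assms unfolding polyb_def by blast
  then have "\<forall>N. p N * q N \<le> (C1 * (N + 1) ^ e1) * (C2 * (N + 1) ^ e2)"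
    by (meson mult_le_mono)
  then have "\<forall>N. p N * q N \<le> (C1 * C2) * (N + 1) ^ (e1 + e2)"
    by (simp add: power_add algebra_simps)
  moreover have "mono (\<lambda>N. p N * q N)" using assms by (simp add: polyb_def mono_def mult_le_mono)
  ultimately show ?thesis unfolding polyb_def by blast
qed

lemma polyb_comp: assumes "polyb p" "polyb q" shows "polyb (\<lambda>N. p (q N))"
proof -
  obtain C1 e1 C2 e2 where 1: "\<forall>N. p N \<le> C1 * (N + 1) ^ e1" and 2: "\<forall>N. q N \<le> C2 * (N + 1) ^ e2"
    using assms unfolding polyb_def by blast
  have "p (q N) \<le> (C1 * (C2 + 1) ^ e1) * (N + 1) ^ (e2 * e1)" for N
  proof -
    have "q N + 1 \<le> C2 * (N + 1) ^ e2 + (N + 1) ^ e2" using 2 by (intro add_mono) auto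
    also have "\<dots> = (C2 + 1) * (N + 1) ^ e2" by (simp only: distrib_right mult_1)
    finally have "(q N + 1) ^ e1 \<le> ((C2 + 1) * (N + 1) ^ e2) ^ e1"
      by (intro power_mono) auto
    then have "(q N + 1) ^ e1 \<le> (C2 + 1) ^ e1 * (N + 1) ^ (e2 * e1)"
      by (simp only: power_mult_distrib power_mult)
    then have "C1 * (q N + 1) ^ e1 \<le> C1 * ((C2 + 1) ^ e1 * (N + 1) ^ (e2 * e1))"
      by (rule mult_le_mono2)
    then show ?thesis using 1[rule_format, of "q N"] unfolding mult.assoc by linarith
  qed
  moreover have "mono (\<lambda>N. p (q N))" using assms by (simp add: polyb_def mono_def)
  ultimately show ?thesis unfolding polyb_def by blast
qed

lemma polyb_Suc [intro!]: "polyb p \<Longrightarrow> polyb (\<lambda>N. Suc (p N))"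
  using polyb_add[of p "\<lambda>_. 1"] by (simp add: One_nat_def)

lemma polyb_power [intro!]: "polyb p \<Longrightarrow> polyb (\<lambda>N. p N ^ k)"
  by (induction k) auto

section \<open>Cost-annotated program logic\<close>

definition keep :: "nat \<Rightarrow> (nat \<Rightarrow> nat \<Rightarrow> nat) \<Rightarrow> (nat \<Rightarrow> nat \<Rightarrow> nat) \<Rightarrow> bool" where
  "keep l arr arr' = (\<forall>j. j \<notin> {2..<2+l} \<longrightarrow> arr' j = arr j)"

lemma keep_refl [simp]: "keep l arr arr"
  by (simp add: keep_def)

lemma keep_trans: "keep l a b \<Longrightarrow> keep l b c \<Longrightarrow> keep l a c"
  by (simp add: keep_def)

definition ina :: "nat list \<Rightarrow> (nat \<Rightarrow> nat \<Rightarrow> nat) \<Rightarrow> bool" where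
  "ina x arr = (arr 0 = nthd x)"

lemma keep_ina: "keep l a b \<Longrightarrow> ina x a \<Longrightarrow> ina x b"
  by (simp add: keep_def ina_def)

text \<open>The final registers are exact, but of the arrays only those outside the scratch block of
  length \<open>l\<close> are known. Programs composed by these rules therefore never rely on
  earlier scratch contents.\<close>

definition R :: "nat \<Rightarrow> cmd \<Rightarrow> (nat \<Rightarrow> nat) \<Rightarrow> (nat \<Rightarrow> nat \<Rightarrow> nat) \<Rightarrow> nat \<Rightarrow> (nat \<Rightarrow> nat) \<Rightarrow> bool" where
  "R l c s arr B s' = (\<exists>t arr'. big c (s, arr) t (s', arr') \<and> t \<le> B \<and> keep l arr arr')"

lemma R_big: "big c (s, arr) t (s', arr) \<Longrightarrow> t \<le> B \<Longrightarrow> R l c s arr B s'"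
  unfolding R_def by (meson keep_refl)

lemma R_Seq: "R l c s arr B1 s1 \<Longrightarrow> (\<And>arr1. keep l arr arr1 \<Longrightarrow> R l d s1 arr1 B2 s2) \<Longrightarrow>
  R l (c ;; d) s arr (B1 + B2 + 1) s2"
  unfolding R_def
  by (elim exE conjE) (meson add_le_mono big_Seq keep_trans le_refl)

lemma R_le: "R l c s arr B s' \<Longrightarrow> B \<le> B' \<Longrightarrow> R l c s arr B' s'"
  unfolding R_def by (meson le_trans)

lemma R_conv: "R l c s arr B s1 \<Longrightarrow> s1 = s2 \<Longrightarrow> B \<le> B' \<Longrightarrow> R l c s arr B' s2"
  by (auto intro: R_le)

lemma R_WhT: "s v \<noteq> 0 \<Longrightarrow> R l c s arr B1 s1 \<Longrightarrow>
  (\<And>arr1. keep l arr arr1 \<Longrightarrow> R l (Wh v c) s1 arr1 B2 s2) \<Longrightarrow> R l (Wh v c) s arr (B1 + B2 + 1) s2"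
  unfolding R_def
  by (elim exE conjE) (meson add_le_mono big_WhT keep_trans le_refl)

lemma R_WhF: "s v = 0 \<Longrightarrow> R l (Wh v c) s arr 1 s"
  by (rule R_big[OF big_WhF]) auto

lemma R_Inc: "R l (Inc v) s arr 1 (s(v := Suc (s v)))"
  by (rule R_big[OF big_Inc]) auto

lemma R_Dec: "R l (Dec v) s arr 1 (s(v := s v - 1))"
  by (rule R_big[OF big_Dec]) auto

lemma R_Skip: "R l Skip s arr 1 s"
  by (rule R_big[OF big_Skip]) auto

lemma R_IfZ: "R l (if s v = 0 then c else d) s arr B s' \<Longrightarrow> R l (IfZ v c d) s arr (B + 1) s'"
  unfolding R_def by (metis add_le_cancel_right big_IfZ)

lemma R_Cs: "R l (if arr j (s v) = a then c else d) s arr B s' \<Longrightarrow> R l (Cs j v a c d) s arr (B + 1) s'"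
  unfolding R_def by (metis add_le_cancel_right big_Cs)

definition clr :: "nat \<Rightarrow> cmd" where "clr v = Wh v (Dec v)"
definition mov :: "nat \<Rightarrow> nat \<Rightarrow> cmd" where "mov v w = Wh v (Dec v ;; Inc w)"
definition mov2 :: "nat \<Rightarrow> nat \<Rightarrow> nat \<Rightarrow> cmd" where "mov2 v w u = Wh v (Dec v ;; Inc w ;; Inc u)"
text \<open>A register is read only by emptying it, so its value passes through the scratch register
  \<open>u\<close>, from which \<open>v\<close> is restored.\<close>

definition cpy :: "nat \<Rightarrow> nat \<Rightarrow> nat \<Rightarrow> cmd" where "cpy v w u = mov2 v w u ;; mov u v"

lemma R_clr: "R l (clr v) s arr (2 * s v + 1) (s(v := 0))"
proof (induction "s v" arbitrary: s arr)
  case 0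
  then show ?case unfolding clr_def using R_WhF[of s v l "Dec v" arr] by (simp add: fun_upd_idem)
next
  case (Suc n)
  let ?s = "s(v := s v - 1)"
  have "R l (Wh v (Dec v)) ?s arr1 (2 * ?s v + 1) (?s(v := 0))" for arr1
    using Suc(1)[of ?s arr1] Suc(2) by (simp add: clr_def)
  then have "R l (Wh v (Dec v)) s arr (1 + (2 * ?s v + 1) + 1) (?s(v := 0))"
    by (intro R_WhT[OF _ R_Dec]) (use Suc(2) in auto)
  then show ?case unfolding clr_def by (rule R_conv) (use Suc(2) in auto)
qed

lemma R_mov: "v \<noteq> w \<Longrightarrow> R l (mov v w) s arr (4 * s v + 1) (s(v := 0, w := s w + s v))"
proof (induction "s v" arbitrary: s arr)
  case 0
  then show ?case unfolding mov_def
    using R_WhF[of s v l _ arr] by (simp add: fun_upd_idem)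
next
  case (Suc n)
  let ?s = "s(v := s v - 1, w := Suc (s w))"
  have "R l (Dec v ;; Inc w) s arr (1 + 1 + 1) ((s(v := s v - 1))(w := Suc ((s(v := s v - 1)) w)))"
    by (rule R_Seq[OF R_Dec R_Inc])
  then have b: "R l (Dec v ;; Inc w) s arr 3 ?s" by (rule R_conv) (use Suc in auto)
  have "R l (Wh v (Dec v ;; Inc w)) ?s arr1 (4 * ?s v + 1) (?s(v := 0, w := ?s w + ?s v))" for arr1
    using Suc(1)[of ?s arr1] Suc(2,3) by (simp add: mov_def)
  from R_WhT[OF _ b this] Suc(2,3)
  have "R l (mov v w) s arr (3 + (4 * ?s v + 1) + 1) (?s(v := 0, w := ?s w + ?s v))"
    by (simp add: mov_def)
  moreover have "?s(v := 0, w := ?s w + ?s v) = s(v := 0, w := s w + s v)"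
    using Suc(2,3) by (auto simp: fun_eq_iff)
  moreover have "3 + (4 * ?s v + 1) + 1 \<le> 4 * s v + 1" using Suc(2,3) by simp
  ultimately show ?case by (rule R_conv)
qed

lemma R_mov2: "v \<noteq> w \<Longrightarrow> v \<noteq> u \<Longrightarrow> w \<noteq> u \<Longrightarrow>
  R l (mov2 v w u) s arr (6 * s v + 1) (s(v := 0, w := s w + s v, u := s u + s v))"
proof (induction "s v" arbitrary: s arr)
  case 0
  then show ?case unfolding mov2_def
    using R_WhF[of s v l _ arr] by (simp add: fun_upd_idem)
next
  case (Suc n)
  let ?s = "s(v := s v - 1, w := Suc (s w), u := Suc (s u))"
  let ?s1 = "s(v := s v - 1)"
  let ?s2 = "?s1(w := Suc (?s1 w))"
  have "R l (Dec v ;; Inc w ;; Inc u) s arr (1 + (1 + 1 + 1) + 1) (?s2(u := Suc (?s2 u)))"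
    by (rule R_Seq[OF R_Dec R_Seq[OF R_Inc R_Inc]])
  then have b: "R l (Dec v ;; Inc w ;; Inc u) s arr 5 ?s" by (rule R_conv) (use Suc in auto)
  have "R l (Wh v (Dec v ;; Inc w ;; Inc u)) ?s arr1 (6 * ?s v + 1)
    (?s(v := 0, w := ?s w + ?s v, u := ?s u + ?s v))" for arr1
    using Suc(1)[of ?s arr1] Suc(2-) by (simp add: mov2_def)
  from R_WhT[OF _ b this] Suc(2-)
  have "R l (mov2 v w u) s arr (5 + (6 * ?s v + 1) + 1) (?s(v := 0, w := ?s w + ?s v, u := ?s u + ?s v))"
    by (simp add: mov2_def)
  moreover have "?s(v := 0, w := ?s w + ?s v, u := ?s u + ?s v) = s(v := 0, w := s w + s v, u := s u + s v)"
    using Suc(2-) by (auto simp: fun_eq_iff)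
  moreover have "5 + (6 * ?s v + 1) + 1 \<le> 6 * s v + 1" using Suc(2-) by simp
  ultimately show ?case by (rule R_conv)
qed

lemma R_cpy:
  assumes "v \<noteq> w" "v \<noteq> u" "w \<noteq> u" "s u = 0"
  shows "R l (cpy v w u) s arr (10 * s v + 3) (s(w := s w + s v))"
proof -
  let ?s = "s(v := 0, w := s w + s v, u := s u + s v)"
  have "R l (cpy v w u) s arr ((6 * s v + 1) + (4 * ?s u + 1) + 1) (?s(u := 0, v := ?s v + ?s u))"
    unfolding cpy_def by (rule R_Seq[OF R_mov2 R_mov]) (use assms in auto)
  moreover have "?s(u := 0, v := ?s v + ?s u) = s(w := s w + s v)"
    using assms by (auto simp: fun_eq_iff)
  moreover have "(6 * s v + 1) + (4 * ?s u + 1) + 1 \<le> 10 * s v + 3" using assms by simp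
  ultimately show ?thesis by (rule R_conv)
qed

text \<open>A function of the input \<open>x\<close> and of the registers \<open>env\<close> is in \<open>PT l m\<close> if a program appends
  its value to the \<open>m\<close> registers in polynomial time, using only the arrays 2, ..., l + 1 as
  scratch memory.\<close>

definition PT :: "nat \<Rightarrow> nat \<Rightarrow> (nat list \<Rightarrow> nat list \<Rightarrow> nat) \<Rightarrow> bool" where
  "PT l m F = (\<exists>c p. polyb p \<and> (\<forall>x env arr. set x \<subseteq> {1, 2, 3} \<longrightarrow> length env = m \<longrightarrow> ina x arr \<longrightarrow>
     R l c (nthd env) arr (p (length x + sum_list env)) ((nthd env)(m := F x env))))"

lemma nthd_snoc: "nthd (xs @ [a]) = (nthd xs)(length xs := a)"
  by (auto simp: nthd_def nth_append fun_eq_iff)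

lemma nthd_snoc2: "nthd (xs @ [a, b]) = (nthd xs)(length xs := a, Suc (length xs) := b)"
  using nthd_snoc[of xs a] nthd_snoc[of "xs @ [a]" b] by simp

lemma nthd_beyond [simp]: "length xs \<le> i \<Longrightarrow> nthd xs i = 0"
  by (simp add: nthd_def)

lemma nthd_less: "i < length xs \<Longrightarrow> nthd xs i = xs ! i"
  by (simp add: nthd_def)

lemma nthd_le_sum: "nthd xs i \<le> sum_list xs"
  by (simp add: nthd_def member_le_sum_list)

lemma big_growth: "big c (s, arr) t (s', arr') \<Longrightarrow> \<forall>v. s v \<le> m \<Longrightarrow> s' v \<le> m + t"
  using gstep_big[of c "(s, arr)" t "(s', arr')" m] by auto

text \<open>The value is bounded as well, since one unit of cost adds at most one to a register: it
  is at most the sum of the given registers plus the running time.\<close>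

lemma PTE:
  assumes "PT l m F"
  obtains c p where "polyb p"
    "\<And>x env arr. set x \<subseteq> {1, 2, 3} \<Longrightarrow> length env = m \<Longrightarrow> ina x arr \<Longrightarrow>
      R l c (nthd env) arr (p (length x + sum_list env)) ((nthd env)(m := F x env))"
    "\<And>x env. set x \<subseteq> {1, 2, 3} \<Longrightarrow> length env = m \<Longrightarrow> F x env \<le> p (length x + sum_list env)"
proof -
  obtain c p where p: "polyb p" and
    r: "\<And>x env arr. set x \<subseteq> {1, 2, 3} \<Longrightarrow> length env = m \<Longrightarrow> ina x arr \<Longrightarrow>
      R l c (nthd env) arr (p (length x + sum_list env)) ((nthd env)(m := F x env))"
    using assms unfolding PT_def by blast
  let ?p = "\<lambda>N. N + p N"
  have "F x env \<le> ?p (length x + sum_list env)" if x: "set x \<subseteq> {1, 2, 3}" "length env = m" for x env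
  proof -
    have "R l c (nthd env) (\<lambda>_. nthd x) (p (length x + sum_list env)) ((nthd env)(m := F x env))"
      by (rule r[OF x]) (simp add: ina_def)
    then obtain t arr' where t: "big c (nthd env, \<lambda>_. nthd x) t ((nthd env)(m := F x env), arr')"
      "t \<le> p (length x + sum_list env)"
      unfolding R_def by blast
    show ?thesis using big_growth[OF t(1), of "sum_list env" m] t(2) nthd_le_sum by auto
  qed
  moreover have "R l c (nthd env) arr (?p (length x + sum_list env)) ((nthd env)(m := F x env))"
    if "set x \<subseteq> {1, 2, 3}" "length env = m" "ina x arr" for x env arr
    using r[OF that] by (rule R_le) simp
  ultimately show ?thesis using p by (intro that[of ?p c]) auto
qed

lemma PTI:
  assumes "polyb p" "\<And>x env arr. set x \<subseteq> {1, 2, 3} \<Longrightarrow> length env = m \<Longrightarrow> ina x arr \<Longrightarrow>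
    R l c (nthd env) arr (p (length x + sum_list env)) ((nthd env)(m := F x env))"
  shows "PT l m F"
  unfolding PT_def using assms by blast

lemma PT_cong:
  assumes "\<And>x env. set x \<subseteq> {1, 2, 3} \<Longrightarrow> length env = m \<Longrightarrow> F x env = G x env"
  shows "PT l m F \<longleftrightarrow> PT l m G"
  unfolding PT_def using assms by (metis (no_types, lifting))

primrec ren :: "(nat \<Rightarrow> nat) \<Rightarrow> cmd \<Rightarrow> cmd" where
  "ren \<rho> Skip = Skip"
| "ren \<rho> (Inc v) = Inc (\<rho> v)"
| "ren \<rho> (Dec v) = Dec (\<rho> v)"
| "ren \<rho> (Wr j v a) = Wr j (\<rho> v) a"
| "ren \<rho> (c ;; d) = ren \<rho> c ;; ren \<rho> d"
| "ren \<rho> (IfZ v c d) = IfZ (\<rho> v) (ren \<rho> c) (ren \<rho> d)"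
| "ren \<rho> (Cs j v a c d) = Cs j (\<rho> v) a (ren \<rho> c) (ren \<rho> d)"
| "ren \<rho> (Wh v c) = Wh (\<rho> v) (ren \<rho> c)"

definition mrg :: "(nat \<Rightarrow> nat) \<Rightarrow> (nat \<Rightarrow> nat) \<Rightarrow> (nat \<Rightarrow> nat) \<Rightarrow> nat \<Rightarrow> nat" where
  "mrg \<rho> \<sigma> s u = (if u \<in> range \<rho> then s (inv \<rho> u) else \<sigma> u)"

lemma mrg_app: "inj \<rho> \<Longrightarrow> mrg \<rho> \<sigma> s (\<rho> v) = s v"
  by (simp add: mrg_def)

lemma mrg_upd: "inj \<rho> \<Longrightarrow> mrg \<rho> \<sigma> (s(v := a)) = (mrg \<rho> \<sigma> s)(\<rho> v := a)"
  by (auto simp: mrg_def fun_eq_iff)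

text \<open>A frame rule: a program renamed by an injection acts on the image of the injection and
  leaves all other registers, here given by \<open>\<sigma>\<close>, untouched.\<close>

lemma big_ren:
  "big c S t S' \<Longrightarrow> inj \<rho> \<Longrightarrow> big (ren \<rho> c) (mrg \<rho> \<sigma> (fst S), snd S) t (mrg \<rho> \<sigma> (fst S'), snd S')"
proof (induction rule: big.induct)
  case (big_Wr j v a s arr)
  then show ?case using big.big_Wr[of j "\<rho> v" a "mrg \<rho> \<sigma> s" arr] by (simp add: mrg_app del: fun_upd_apply)
next
  case (big_Inc v s arr)
  then show ?case using big.big_Inc[of "\<rho> v" "mrg \<rho> \<sigma> s" arr] by (simp add: mrg_app mrg_upd del: fun_upd_apply)
next
  case (big_Dec v s arr)
  then show ?case using big.big_Dec[of "\<rho> v" "mrg \<rho> \<sigma> s" arr] by (simp add: mrg_app mrg_upd del: fun_upd_apply)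
next
  case (big_IfZ s v c d arr t S)
  then show ?case using big.big_IfZ[of "mrg \<rho> \<sigma> s" "\<rho> v" "ren \<rho> c" "ren \<rho> d" arr t]
    by (simp add: mrg_app split: if_splits)
next
  case (big_Cs arr j s v a c d t S)
  then show ?case using big.big_Cs[of arr j "mrg \<rho> \<sigma> s" "\<rho> v" a "ren \<rho> c" "ren \<rho> d" t]
    by (simp add: mrg_app split: if_splits)
next
  case (big_WhF s v c arr)
  then show ?case by (simp add: big.big_WhF mrg_app)
next
  case (big_WhT s v c arr t1 S1 t2 S2)
  then show ?case by (auto intro!: big.big_WhT simp: mrg_app)
qed (auto intro: big.intros)

text \<open>Renaming shifts the registers from \<open>m1\<close> on by \<open>i\<close>, so a
  program can run while further values lie between its arguments. The bound does not depend on the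
  values in between, which are never visited.\<close>

lemma PT_insert:
  assumes "PT l (m1 + m2) F"
  obtains c p where "polyb p"
    "\<And>x env1 ins env2 arr. set x \<subseteq> {1, 2, 3} \<Longrightarrow> length env1 = m1 \<Longrightarrow> length ins = i \<Longrightarrow>
      length env2 = m2 \<Longrightarrow> ina x arr \<Longrightarrow>
      R l c (nthd (env1 @ ins @ env2)) arr (p (length x + sum_list env1 + sum_list env2))
        ((nthd (env1 @ ins @ env2))(m1 + i + m2 := F x (env1 @ env2)))"
proof -
  obtain c p where p: "polyb p" and
    r: "\<And>x env arr. set x \<subseteq> {1, 2, 3} \<Longrightarrow> length env = m1 + m2 \<Longrightarrow> ina x arr \<Longrightarrow>
      R l c (nthd env) arr (p (length x + sum_list env)) ((nthd env)(m1 + m2 := F x env))"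
    using PTE[OF assms] by metis
  define \<rho> where "\<rho> = (\<lambda>v. if v < m1 then v else v + i)"
  have inj: "inj \<rho>" by (auto simp: \<rho>_def inj_def)
  have "R l (ren \<rho> c) (nthd (env1 @ ins @ env2)) arr (p (length x + sum_list env1 + sum_list env2))
        ((nthd (env1 @ ins @ env2))(m1 + i + m2 := F x (env1 @ env2)))"
    if h: "set x \<subseteq> {1, 2, 3}" "length env1 = m1" "length ins = i" "length env2 = m2" "ina x arr"
    for x env1 ins env2 arr
  proof -
    let ?e = "nthd (env1 @ ins @ env2)"
    obtain t arr' where b: "big c (nthd (env1 @ env2), arr) t ((nthd (env1 @ env2))(m1 + m2 := F x (env1 @ env2)), arr')"
      and t: "t \<le> p (length x + sum_list (env1 @ env2))" "keep l arr arr'"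
      using r[of x "env1 @ env2" arr] h unfolding R_def by auto
    have m: "mrg \<rho> ?e (nthd (env1 @ env2)) = ?e"
    proof
      fix u show "mrg \<rho> ?e (nthd (env1 @ env2)) u = ?e u"
      proof (cases "u \<in> range \<rho>")
        case True
        then obtain v where v: "u = \<rho> v" by auto
        show ?thesis unfolding v mrg_app[OF inj] using h
          by (auto simp: \<rho>_def nthd_def nth_append)
      qed (simp add: mrg_def)
    qed
    have "\<rho> (m1 + m2) = m1 + i + m2" by (simp add: \<rho>_def)
    then show ?thesis using big_ren[OF b inj, of ?e] t unfolding R_def
      by (auto simp: mrg_upd[OF inj] m add.assoc)
  qed
  then show ?thesis using that[OF p] by blast
qed

text \<open>The values are appended one by one; for each of them the values computed before are the
  inserted block of \<open>PT_insert\<close>.\<close>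

lemma PT_args:
  assumes "\<forall>F\<in>set Fs. PT l m F"
  shows "\<exists>c p. polyb p \<and> (\<forall>x env arr. set x \<subseteq> {1, 2, 3} \<longrightarrow> length env = m \<longrightarrow> ina x arr \<longrightarrow>
    R l c (nthd env) arr (p (length x + sum_list env)) (nthd (env @ map (\<lambda>F. F x env) Fs)) \<and>
    sum_list (map (\<lambda>F. F x env) Fs) \<le> p (length x + sum_list env))"
  using assms
proof (induction Fs rule: rev_induct)
  case Nil
  then show ?case by (intro exI[of _ Skip] exI[of _ "\<lambda>_. 1"]) (simp add: R_Skip)
next
  case (snoc F Fs)
  then have "\<forall>F\<in>set Fs. PT l m F" by simp
  from snoc.IH[OF this] obtain c1 p1 where p1: "polyb p1" and
    r: "\<forall>x env arr. set x \<subseteq> {1, 2, 3} \<longrightarrow> length env = m \<longrightarrow> ina x arr \<longrightarrow>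
    R l c1 (nthd env) arr (p1 (length x + sum_list env)) (nthd (env @ map (\<lambda>F. F x env) Fs)) \<and>
    sum_list (map (\<lambda>F. F x env) Fs) \<le> p1 (length x + sum_list env)"
    by blast
  note r1 = r[rule_format]
  have F: "PT l (m + 0) F" "PT l m F" using snoc by auto
  obtain c2 p2 where p2: "polyb p2" and r2: "\<And>x env1 ins env2 arr. set x \<subseteq> {1, 2, 3} \<Longrightarrow> length env1 = m \<Longrightarrow>
      length ins = length Fs \<Longrightarrow> length env2 = 0 \<Longrightarrow> ina x arr \<Longrightarrow>
      R l c2 (nthd (env1 @ ins @ env2)) arr (p2 (length x + sum_list env1 + sum_list env2))
        ((nthd (env1 @ ins @ env2))(m + length Fs + 0 := F x (env1 @ env2)))"
    using PT_insert[OF F(1), of "length Fs"] by metis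
  obtain p3 where p3: "polyb p3" and r3: "\<And>x env. set x \<subseteq> {1, 2, 3} \<Longrightarrow> length env = m \<Longrightarrow> F x env \<le> p3 (length x + sum_list env)"
    using PTE[OF F(2)] by metis
  let ?p = "\<lambda>N. p1 N + p2 N + 1 + p3 N"
  have "R l (c1 ;; c2) (nthd env) arr (?p (length x + sum_list env)) (nthd (env @ map (\<lambda>F. F x env) (Fs @ [F]))) \<and>
    sum_list (map (\<lambda>F. F x env) (Fs @ [F])) \<le> ?p (length x + sum_list env)"
    if h: "set x \<subseteq> {1, 2, 3}" "length env = m" "ina x arr" for x env arr
  proof
    let ?N = "length x + sum_list env" and ?a = "map (\<lambda>F. F x env) Fs"
    have "R l c2 (nthd (env @ ?a)) arr1 (p2 ?N) (nthd (env @ map (\<lambda>F. F x env) (Fs @ [F])))" if "keep l arr arr1" for arr1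
    proof -
      have "R l c2 (nthd (env @ ?a @ [])) arr1 (p2 (length x + sum_list env + sum_list []))
        ((nthd (env @ ?a @ []))(m + length Fs + 0 := F x (env @ [])))"
        by (rule r2) (use h keep_ina[OF that h(3)] in auto)
      moreover have "nthd (env @ map (\<lambda>F. F x env) (Fs @ [F])) = (nthd (env @ ?a))(m + length Fs := F x env)"
        using nthd_snoc[of "env @ ?a"] h by simp
      ultimately show ?thesis by simp
    qed
    from R_Seq[OF conjunct1[OF r1[OF h]] this]
    show "R l (c1 ;; c2) (nthd env) arr (?p ?N) (nthd (env @ map (\<lambda>F. F x env) (Fs @ [F])))"
      by (rule R_le) simp_all
    show "sum_list (map (\<lambda>F. F x env) (Fs @ [F])) \<le> ?p ?N"
      using r1[OF h] r3[OF h(1,2)] by simp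
  qed
  then show ?case using p1 p2 p3 by (intro exI[of _ "c1 ;; c2"] exI[of _ ?p]) auto
qed

primrec clrs :: "nat \<Rightarrow> nat \<Rightarrow> cmd" where
  "clrs m 0 = Skip"
| "clrs m (Suc k) = clr (m + k) ;; clrs m k"

lemma R_clrs:
  "\<forall>v. s v \<le> B \<Longrightarrow> R l (clrs m k) s arr (k * (2 * B + 2) + 1) (\<lambda>v. if m \<le> v \<and> v < m + k then 0 else s v)"
proof (induction k arbitrary: s arr)
  case 0
  have "(\<lambda>v. if m \<le> v \<and> v < m + 0 then 0 else s v) = s" by (auto simp: fun_eq_iff)
  then show ?case using R_Skip[of l s arr] by simp
next
  case (Suc k)
  let ?s = "s(m + k := 0)"
  have "R l (clrs m (Suc k)) s arr (2 * s (m + k) + 1 + (k * (2 * B + 2) + 1) + 1)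
    (\<lambda>v. if m \<le> v \<and> v < m + k then 0 else ?s v)"
    unfolding clrs.simps by (rule R_Seq[OF R_clr Suc.IH]) (use Suc.prems in auto)
  moreover have "(\<lambda>v. if m \<le> v \<and> v < m + k then 0 else ?s v) = (\<lambda>v. if m \<le> v \<and> v < m + Suc k then 0 else s v)"
    by (auto simp: fun_eq_iff)
  moreover have "2 * s (m + k) + 1 + (k * (2 * B + 2) + 1) + 1 \<le> Suc k * (2 * B + 2) + 1"
    using Suc.prems by simp
  ultimately show ?case by (rule R_conv)
qed

text \<open>The arguments are computed behind the registers \<open>env\<close>, then
  \<open>G\<close> runs on them with \<open>env\<close> as a block inserted in front. Afterwards the
  arguments are cleared and the result moves down to register \<open>m\<close>.\<close>

lemma PT_comp:
  assumes "PT l n G" "\<forall>F\<in>set Fs. PT l m F" "length Fs = n"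
  shows "PT l m (\<lambda>x env. G x (map (\<lambda>F. F x env) Fs))"
proof -
  obtain c1 p1 where p1: "polyb p1" and r: "\<forall>x env arr. set x \<subseteq> {1, 2, 3} \<longrightarrow> length env = m \<longrightarrow> ina x arr \<longrightarrow>
    R l c1 (nthd env) arr (p1 (length x + sum_list env)) (nthd (env @ map (\<lambda>F. F x env) Fs)) \<and>
    sum_list (map (\<lambda>F. F x env) Fs) \<le> p1 (length x + sum_list env)"
    using PT_args[OF assms(2)] by blast
  note r1 = r[rule_format]
  have G: "PT l (0 + n) G" using assms by simp
  obtain c2 p2 where p2: "polyb p2" and r2: "\<And>x env1 ins env2 arr. set x \<subseteq> {1, 2, 3} \<Longrightarrow> length env1 = 0 \<Longrightarrow>
      length ins = m \<Longrightarrow> length env2 = n \<Longrightarrow> ina x arr \<Longrightarrow>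
      R l c2 (nthd (env1 @ ins @ env2)) arr (p2 (length x + sum_list env1 + sum_list env2))
        ((nthd (env1 @ ins @ env2))(0 + m + n := G x (env1 @ env2)))"
    using PT_insert[OF G, of m] by metis
  obtain p3 where p3: "polyb p3" and r3: "\<And>x env. set x \<subseteq> {1, 2, 3} \<Longrightarrow> length env = n \<Longrightarrow> G x env \<le> p3 (length x + sum_list env)"
    using PTE[OF assms(1)] by metis
  \<comment> \<open>Without arguments the result already is in register \<open>m\<close>, and moving
    a nonzero register to itself would not terminate.\<close>
  define cc where "cc = (if n = 0 then Skip else clrs m n ;; mov (m + n) m)"
  define q where "q = (\<lambda>N. p3 (N + p1 N))"
  define p where "p = (\<lambda>N. (p1 N + (p2 (N + p1 N) + (n * (2 * (N + p1 N + q N) + 2) + 1 + (4 * q N + 1) + 1) + 1)) + 1)"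
  have q: "polyb q" unfolding q_def by (intro polyb_comp[OF p3] polyb_add polyb_id p1)
  show ?thesis
  proof (rule PTI[of p])
    have "polyb (\<lambda>N. p2 (N + p1 N))" by (intro polyb_comp[OF p2] polyb_add polyb_id p1)
    then show "polyb p" unfolding p_def using p1 q by (intro polyb_add polyb_mult polyb_const polyb_id)
    fix x env :: "nat list" and arr :: "nat \<Rightarrow> nat \<Rightarrow> nat"
    assume h: "set x \<subseteq> {1, 2, 3}" "length env = m" "ina x arr"
    let ?N = "length x + sum_list env" and ?a = "map (\<lambda>F. F x env) Fs"
    let ?g = "G x ?a"
    have la: "length ?a = n" using assms by simp
    have sa: "sum_list ?a \<le> p1 ?N" using r1[OF h] ..
    have "?g \<le> p3 (length x + sum_list ?a)" using r3[OF h(1) la] .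
    also have "\<dots> \<le> q ?N" unfolding q_def by (rule polyb_mono[OF p3]) (use sa in simp)
    finally have g: "?g \<le> q ?N" .
    let ?s = "(nthd (env @ ?a))(m + n := ?g)"
    have R2: "R l c2 (nthd (env @ ?a)) arr1 (p2 (?N + p1 ?N)) ?s" if "keep l arr arr1" for arr1
    proof -
      have "R l c2 (nthd ([] @ env @ ?a)) arr1 (p2 (length x + sum_list [] + sum_list ?a))
        ((nthd ([] @ env @ ?a))(0 + m + n := G x ([] @ ?a)))"
        by (rule r2) (use h keep_ina[OF that h(3)] la in auto)
      then have "R l c2 (nthd (env @ ?a)) arr1 (p2 (length x + sum_list ?a)) ?s" by simp
      moreover have "p2 (length x + sum_list ?a) \<le> p2 (?N + p1 ?N)"
        by (rule polyb_mono[OF p2]) (use sa in simp)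
      ultimately show ?thesis by (rule R_le)
    qed
    have R3: "R l cc ?s arr1 (n * (2 * (?N + p1 ?N + q ?N) + 2) + 1 + (4 * q ?N + 1) + 1) ((nthd env)(m := ?g))" for arr1
    proof (cases "n = 0")
      case True
      then have "?a = []" using la by simp
      then have "R l cc ?s arr1 1 ?s" using R_Skip[of l ?s arr1] True unfolding cc_def by simp
      then show ?thesis by (rule R_conv) (use True la in auto)
    next
      case False
      let ?s2 = "\<lambda>v. if m \<le> v \<and> v < m + n then 0 else ?s v"
      have "nthd (env @ ?a) v \<le> ?N + p1 ?N" for v
        using nthd_le_sum[of "env @ ?a" v] sa by simp
      then have "\<forall>v. ?s v \<le> ?N + p1 ?N + q ?N" using g by (simp add: trans_le_add1 trans_le_add2)
      note A = R_clrs[OF this, of l m n arr1]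
      have B: "R l (mov (m + n) m) ?s2 arr2 (4 * ?s2 (m + n) + 1) (?s2(m + n := 0, m := ?s2 m + ?s2 (m + n)))" for arr2
        by (rule R_mov) (use False in simp)
      have e: "?s2(m + n := 0, m := ?s2 m + ?s2 (m + n)) = (nthd env)(m := ?g)"
      proof
        fix v
        show "(?s2(m + n := 0, m := ?s2 m + ?s2 (m + n))) v = ((nthd env)(m := ?g)) v"
          using False h(2) la by (auto simp: nthd_def nth_append)
      qed
      have "R l (clrs m n ;; mov (m + n) m) ?s arr1
        (n * (2 * (?N + p1 ?N + q ?N) + 2) + 1 + (4 * ?s2 (m + n) + 1) + 1) ((nthd env)(m := ?g))"
        using R_Seq[OF A B] unfolding e .
      then have "R l cc ?s arr1 (n * (2 * (?N + p1 ?N + q ?N) + 2) + 1 + (4 * ?s2 (m + n) + 1) + 1) ((nthd env)(m := ?g))"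
        using False unfolding cc_def by (simp only: if_False)
      then show ?thesis by (rule R_le) (use g in simp)
    qed
    show "R l (c1 ;; c2 ;; cc) (nthd env) arr (p ?N) ((nthd env)(m := ?g))"
      unfolding p_def by (rule R_Seq[OF conjunct1[OF r1[OF h]] R_Seq[OF R2 R3]])
  qed
qed

section \<open>Closure properties of polynomial-time functions\<close>

lemma PT_op1:
  assumes "PT l 1 (\<lambda>x env. h x (env ! 0))" "PT l m A"
  shows "PT l m (\<lambda>x env. h x (A x env))"
  using PT_comp[OF assms(1), of "[A]" m] assms(2) by simp

lemma PT_op2:
  assumes "PT l 2 (\<lambda>x env. h x (env ! 0) (env ! 1))" "PT l m A" "PT l m B"
  shows "PT l m (\<lambda>x env. h x (A x env) (B x env))"
  using PT_comp[OF assms(1), of "[A, B]" m] assms(2,3) by simp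

lemma PT_op0: "PT l 0 (\<lambda>x env. h x) \<Longrightarrow> PT l m (\<lambda>x env. h x)"
  using PT_comp[of l 0 "\<lambda>x env. h x" "[]" m] by simp

lemma PT_zero: "PT l m (\<lambda>x env. 0)"
  by (rule PTI[of "\<lambda>_. 1" _ _ Skip]) (auto simp: fun_upd_idem R_Skip)

lemma PT_Suc: assumes "PT l m F" shows "PT l m (\<lambda>x env. Suc (F x env))"
proof -
  obtain c p where p: "polyb p" and
    r: "\<And>x env arr. set x \<subseteq> {1, 2, 3} \<Longrightarrow> length env = m \<Longrightarrow> ina x arr \<Longrightarrow>
      R l c (nthd env) arr (p (length x + sum_list env)) ((nthd env)(m := F x env))"
    using PTE[OF assms] by metis
  show ?thesis
  proof (rule PTI[of "\<lambda>N. p N + 1 + 1" _ _ "c ;; Inc m"])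
    fix x env :: "nat list" and arr :: "nat \<Rightarrow> nat \<Rightarrow> nat"
    assume h: "set x \<subseteq> {1, 2, 3}" "length env = m" "ina x arr"
    show "R l (c ;; Inc m) (nthd env) arr (p (length x + sum_list env) + 1 + 1) ((nthd env)(m := Suc (F x env)))"
      by (rule R_conv[OF R_Seq[OF r[OF h] R_Inc]]) auto
  qed (use p in auto)
qed

lemma PT_pred: assumes "PT l m F" shows "PT l m (\<lambda>x env. F x env - 1)"
proof -
  obtain c p where p: "polyb p" and
    r: "\<And>x env arr. set x \<subseteq> {1, 2, 3} \<Longrightarrow> length env = m \<Longrightarrow> ina x arr \<Longrightarrow>
      R l c (nthd env) arr (p (length x + sum_list env)) ((nthd env)(m := F x env))"
    using PTE[OF assms] by metis
  show ?thesis
  proof (rule PTI[of "\<lambda>N. p N + 1 + 1" _ _ "c ;; Dec m"])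
    fix x env :: "nat list" and arr :: "nat \<Rightarrow> nat \<Rightarrow> nat"
    assume h: "set x \<subseteq> {1, 2, 3}" "length env = m" "ina x arr"
    show "R l (c ;; Dec m) (nthd env) arr (p (length x + sum_list env) + 1 + 1) ((nthd env)(m := F x env - 1))"
      by (rule R_conv[OF R_Seq[OF r[OF h] R_Dec]]) auto
  qed (use p in auto)
qed

lemma PT_const: "PT l m (\<lambda>x env. k)"
  by (induction k) (auto intro: PT_zero PT_Suc)

lemma PT_var: assumes "j < m" shows "PT l m (\<lambda>x env. env ! j)"
proof (rule PTI[of "\<lambda>N. 10 * N + 3" _ _ "cpy j m (Suc m)"])
  fix x env :: "nat list" and arr :: "nat \<Rightarrow> nat \<Rightarrow> nat"
  assume h: "length env = m"
  have "R l (cpy j m (Suc m)) (nthd env) arr (10 * nthd env j + 3) ((nthd env)(m := nthd env m + nthd env j))"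
    by (rule R_cpy) (use assms h in auto)
  then show "R l (cpy j m (Suc m)) (nthd env) arr (10 * (length x + sum_list env) + 3) ((nthd env)(m := env ! j))"
    by (rule R_conv) (use h assms nthd_le_sum[of env j] in \<open>auto simp: nthd_less\<close>)
qed auto

lemma PT_if:
  assumes "PT l m B" "PT l m F" "PT l m G"
  shows "PT l m (\<lambda>x env. if B x env = 0 then G x env else F x env)"
proof -
  obtain c1 p1 where p1: "polyb p1" and
    r1: "\<And>x env arr. set x \<subseteq> {1, 2, 3} \<Longrightarrow> length env = m \<Longrightarrow> ina x arr \<Longrightarrow>
      R l c1 (nthd env) arr (p1 (length x + sum_list env)) ((nthd env)(m := B x env))"
    "\<And>x env. set x \<subseteq> {1, 2, 3} \<Longrightarrow> length env = m \<Longrightarrow> B x env \<le> p1 (length x + sum_list env)"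
    using PTE[OF assms(1)] by metis
  obtain c2 p2 where p2: "polyb p2" and
    r2: "\<And>x env arr. set x \<subseteq> {1, 2, 3} \<Longrightarrow> length env = m \<Longrightarrow> ina x arr \<Longrightarrow>
      R l c2 (nthd env) arr (p2 (length x + sum_list env)) ((nthd env)(m := F x env))"
    using PTE[OF assms(2)] by metis
  obtain c3 p3 where p3: "polyb p3" and
    r3: "\<And>x env arr. set x \<subseteq> {1, 2, 3} \<Longrightarrow> length env = m \<Longrightarrow> ina x arr \<Longrightarrow>
      R l c3 (nthd env) arr (p3 (length x + sum_list env)) ((nthd env)(m := G x env))"
    using PTE[OF assms(3)] by metis
  let ?c = "c1 ;; IfZ m c3 (clr m ;; c2)"
  let ?p = "\<lambda>N. p1 N + ((2 * p1 N + 1 + p2 N + 1 + p3 N) + 1) + 1"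
  show ?thesis
  proof (rule PTI[of ?p _ _ ?c])
    fix x env :: "nat list" and arr :: "nat \<Rightarrow> nat \<Rightarrow> nat"
    assume h: "set x \<subseteq> {1, 2, 3}" "length env = m" "ina x arr"
    let ?N = "length x + sum_list env"
    have "R l (IfZ m c3 (clr m ;; c2)) ((nthd env)(m := B x env)) arr1
       ((2 * p1 ?N + 1 + p2 ?N + 1 + p3 ?N) + 1) ((nthd env)(m := if B x env = 0 then G x env else F x env))"
      if k: "keep l arr arr1" for arr1
    proof (rule R_IfZ, cases "B x env = 0")
      case True
      have "R l c3 (nthd env) arr1 (2 * p1 ?N + 1 + p2 ?N + 1 + p3 ?N) ((nthd env)(m := G x env))"
        using r3[OF h(1,2) keep_ina[OF k h(3)]] by (rule R_le) simp
      moreover have "(nthd env)(m := B x env) = nthd env" using True h by auto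
      ultimately show "R l (if ((nthd env)(m := B x env)) m = 0 then c3 else clr m ;; c2) ((nthd env)(m := B x env)) arr1
       (2 * p1 ?N + 1 + p2 ?N + 1 + p3 ?N) ((nthd env)(m := if B x env = 0 then G x env else F x env))"
        using True h by (simp del: fun_upd_apply)
    next
      case False
      have "R l c2 (((nthd env)(m := B x env))(m := 0)) arr2 (p2 ?N) ((nthd env)(m := F x env))" if "keep l arr1 arr2" for arr2
        using r2[OF h(1,2) keep_ina[OF that keep_ina[OF k h(3)]]] h by (simp add: fun_upd_idem)
      from R_Seq[OF R_clr this] have "R l (clr m ;; c2) ((nthd env)(m := B x env)) arr1 (2 * B x env + 1 + p2 ?N + 1) ((nthd env)(m := F x env))"
        by simp
      then have "R l (clr m ;; c2) ((nthd env)(m := B x env)) arr1 (2 * p1 ?N + 1 + p2 ?N + 1 + p3 ?N) ((nthd env)(m := F x env))"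
        by (rule R_le) (use r1(2)[OF h(1,2)] in simp)
      then show "R l (if ((nthd env)(m := B x env)) m = 0 then c3 else clr m ;; c2) ((nthd env)(m := B x env)) arr1
       (2 * p1 ?N + 1 + p2 ?N + 1 + p3 ?N) ((nthd env)(m := if B x env = 0 then G x env else F x env))"
        using False by simp
    qed
    from R_Seq[OF r1(1)[OF h] this]
    show "R l ?c (nthd env) arr (?p ?N) ((nthd env)(m := if B x env = 0 then G x env else F x env))" .
  qed (use p1 p2 p3 in auto)
qed

text \<open>The loop register counts down and serves as the index, so the list is processed from its
  end, as \<open>foldr\<close> does. All intermediate accumulators need a polynomial bound, because
  a step takes time depending on their size.\<close>

lemma PT_foldr_poly:
  assumes "PT l m N" "PT l m A" "PT l (m + 2) (\<lambda>x env. S x (take m env) (env ! m) (env ! Suc m))" "polyb p"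
    and bound: "\<And>x env i. set x \<subseteq> {1, 2, 3} \<Longrightarrow> length env = m \<Longrightarrow> i \<le> N x env \<Longrightarrow>
      foldr (S x env) [i..<N x env] (A x env) \<le> p (length x + sum_list env)"
  shows "PT l m (\<lambda>x env. foldr (S x env) [0..<N x env] (A x env))"
proof -
  obtain c1 p1 where p1: "polyb p1" and
    r1: "\<And>x env arr. set x \<subseteq> {1, 2, 3} \<Longrightarrow> length env = m \<Longrightarrow> ina x arr \<Longrightarrow>
      R l c1 (nthd env) arr (p1 (length x + sum_list env)) ((nthd env)(m := N x env))"
    "\<And>x env. set x \<subseteq> {1, 2, 3} \<Longrightarrow> length env = m \<Longrightarrow> N x env \<le> p1 (length x + sum_list env)"
    using PTE[OF assms(1)] by metis
  have A: "PT l (m + 0) A" using assms by simp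
  obtain c2 p2 where p2: "polyb p2" and r2: "\<And>x env1 ins env2 arr. set x \<subseteq> {1, 2, 3} \<Longrightarrow> length env1 = m \<Longrightarrow>
      length ins = 1 \<Longrightarrow> length env2 = 0 \<Longrightarrow> ina x arr \<Longrightarrow>
      R l c2 (nthd (env1 @ ins @ env2)) arr (p2 (length x + sum_list env1 + sum_list env2))
        ((nthd (env1 @ ins @ env2))(m + 1 + 0 := A x (env1 @ env2)))"
    using PT_insert[OF A, of 1] by metis
  obtain c3 p3 where p3: "polyb p3" and
    r3: "\<And>x env arr. set x \<subseteq> {1, 2, 3} \<Longrightarrow> length env = m + 2 \<Longrightarrow> ina x arr \<Longrightarrow>
      R l c3 (nthd env) arr (p3 (length x + sum_list env)) ((nthd env)(m + 2 := S x (take m env) (env ! m) (env ! Suc m)))"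
    using PTE[OF assms(3)] by metis
  define p4 where "p4 = p"
  have p4: "polyb p4" using assms(4) by (simp add: p4_def)
  let ?body = "Dec m ;; c3 ;; clr (m + 1) ;; mov (m + 2) (m + 1)"
  let ?c = "c1 ;; c2 ;; Wh m ?body ;; mov (m + 1) m"
  define B where "B = (\<lambda>M. 1 + (p3 (M + p1 M + p4 M) + ((2 * p4 M + 1) + (4 * p4 M + 1) + 1) + 1) + 1)"
  define P where "P = (\<lambda>M. p1 M + (p2 M + ((p1 M * (B M + 1) + 1) + (4 * p4 M + 1) + 1) + 1) + 1)"
  have B: "polyb B" unfolding B_def
    by (intro polyb_comp[OF p3] polyb_add polyb_mult polyb_const polyb_id p1 p4)
  show ?thesis
  proof (rule PTI[of P _ _ ?c])
    show "polyb P" unfolding P_def using p1 p2 p4 B by (intro polyb_add polyb_mult polyb_const)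
    fix x env :: "nat list" and arr :: "nat \<Rightarrow> nat \<Rightarrow> nat"
    assume h: "set x \<subseteq> {1, 2, 3}" "length env = m" "ina x arr"
    let ?M = "length x + sum_list env"
    \<comment> \<open>The accumulator once all indices from i on have been processed.\<close>
    define f where "f = (\<lambda>i. foldr (S x env) [i..<N x env] (A x env))"
    have f4: "f i \<le> p4 ?M" if "i \<le> N x env" for i
      using bound[OF h(1,2) that] unfolding f_def p4_def by linarith
    have N1: "N x env \<le> p1 ?M" using r1(2)[OF h(1,2)] .
    let ?s = "\<lambda>i a. (nthd env)(m := i, Suc m := a)"
    have s: "?s i a = nthd (env @ [i, a])" for i a using h(2) by (simp add: nthd_snoc2)
    have body: "R l ?body (?s (Suc i) (f (Suc i))) arr1 (B ?M) (?s i (f i))"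
      if i: "Suc i \<le> N x env" and k: "ina x arr1" for i arr1
    proof -
      let ?s1 = "?s i (f (Suc i))"
      have fi: "f i = S x env i (f (Suc i))"
        using i by (simp add: f_def upt_conv_Cons)
      have 1: "R l (Dec m) (?s (Suc i) (f (Suc i))) arr1 1 ?s1"
      proof -
        have "(?s (Suc i) (f (Suc i)))(m := (?s (Suc i) (f (Suc i))) m - 1) = ?s1"
          by (auto simp: fun_eq_iff)
        then show ?thesis using R_Dec[of l m "?s (Suc i) (f (Suc i))" arr1] by metis
      qed
      let ?s2 = "?s1(m + 2 := f i)"
      have 2: "R l c3 ?s1 arr2 (p3 (?M + p1 ?M + p4 ?M)) ?s2" if "keep l arr1 arr2" for arr2
      proof -
        have "R l c3 (nthd (env @ [i, f (Suc i)])) arr2 (p3 (length x + sum_list (env @ [i, f (Suc i)])))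
          ((nthd (env @ [i, f (Suc i)]))(m + 2 := f i))"
          using r3[of x "env @ [i, f (Suc i)]" arr2] h keep_ina[OF that k] by (simp add: fi nth_append)
        moreover have "p3 (length x + sum_list (env @ [i, f (Suc i)])) \<le> p3 (?M + p1 ?M + p4 ?M)"
          by (rule polyb_mono[OF p3]) (use i N1 f4[OF i] in simp)
        ultimately show ?thesis unfolding s by (rule R_le)
      qed
      let ?s3 = "?s2(m + 1 := 0)"
      have 3: "R l (clr (m + 1)) ?s2 arr2 (2 * p4 ?M + 1) ?s3" for arr2
        by (rule R_le[OF R_clr]) (use f4[OF i] in simp)
      have 4: "R l (mov (m + 2) (m + 1)) ?s3 arr2 (4 * p4 ?M + 1) (?s i (f i))" for arr2
      proof -
        have "R l (mov (m + 2) (m + 1)) ?s3 arr2 (4 * ?s3 (m + 2) + 1) (?s3(m + 2 := 0, m + 1 := ?s3 (m + 1) + ?s3 (m + 2)))"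
          by (rule R_mov) simp
        moreover have "?s3(m + 2 := 0, m + 1 := ?s3 (m + 1) + ?s3 (m + 2)) = ?s i (f i)"
          using h(2) by (auto simp: fun_eq_iff)
        moreover have "4 * ?s3 (m + 2) + 1 \<le> 4 * p4 ?M + 1" using f4[of i] i by simp
        ultimately show ?thesis by (rule R_conv)
      qed
      show ?thesis unfolding B_def by (rule R_Seq[OF 1 R_Seq[OF 2 R_Seq[OF 3 4]]])
    qed
    have loop: "R l (Wh m ?body) (?s i (f i)) arr1 (i * (B ?M + 1) + 1) (?s 0 (f 0))"
      if "i \<le> N x env" "ina x arr1" for i arr1
      using that
    proof (induction i arbitrary: arr1)
      case 0
      have "R l (Wh m ?body) (?s 0 (f 0)) arr1 1 (?s 0 (f 0))" by (rule R_WhF) simp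
      then show ?case by (simp only: mult_0 add_0)
    next
      case (Suc i)
      have "R l (Wh m ?body) (?s (Suc i) (f (Suc i))) arr1 (B ?M + (i * (B ?M + 1) + 1) + 1) (?s 0 (f 0))"
      proof (rule R_WhT[OF _ body])
        fix arr2 assume "keep l arr1 arr2"
        then show "R l (Wh m ?body) (?s i (f i)) arr2 (i * (B ?M + 1) + 1) (?s 0 (f 0))"
          using keep_ina Suc.prems by (intro Suc.IH) auto
      qed (use Suc.prems in auto)
      then show ?case by (rule R_le) simp
    qed
    have i2: "R l c2 ((nthd env)(m := N x env)) arr1 (p2 ?M) (?s (N x env) (f (N x env)))" if "keep l arr arr1" for arr1
    proof -
      have "R l c2 (nthd (env @ [N x env] @ [])) arr1 (p2 (length x + sum_list env + sum_list []))
        ((nthd (env @ [N x env] @ []))(m + 1 + 0 := A x (env @ [])))"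
        by (rule r2) (use h keep_ina[OF that h(3)] in auto)
      then show ?thesis using h(2) by (simp add: nthd_snoc f_def One_nat_def)
    qed
    have i3: "R l (Wh m ?body) (?s (N x env) (f (N x env))) arr1 (p1 ?M * (B ?M + 1) + 1) (?s 0 (f 0))"
      if "ina x arr1" for arr1
      using loop[OF order.refl that] by (rule R_le) (use N1 in simp)
    have i4: "R l (mov (m + 1) m) (?s 0 (f 0)) arr1 (4 * p4 ?M + 1) ((nthd env)(m := f 0))" for arr1
    proof -
      have "R l (mov (m + 1) m) (?s 0 (f 0)) arr1 (4 * (?s 0 (f 0)) (m + 1) + 1)
        ((?s 0 (f 0))(m + 1 := 0, m := (?s 0 (f 0)) m + (?s 0 (f 0)) (m + 1)))"
        by (rule R_mov) simp
      moreover have "(?s 0 (f 0))(m + 1 := 0, m := (?s 0 (f 0)) m + (?s 0 (f 0)) (m + 1)) = (nthd env)(m := f 0)"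
        using h(2) by (auto simp: fun_eq_iff)
      moreover have "4 * (?s 0 (f 0)) (m + 1) + 1 \<le> 4 * p4 ?M + 1" using f4[of 0] by simp
      ultimately show ?thesis by (rule R_conv)
    qed
    have "R l ?c (nthd env) arr (P ?M) ((nthd env)(m := f 0))"
      unfolding P_def
    proof (rule R_Seq[OF r1(1)[OF h] R_Seq[OF i2 R_Seq[OF i3 i4]]])
      fix arr1 arr2 assume "keep l arr arr1" "keep l arr1 arr2"
      then show "ina x arr2" using keep_ina h(3) by blast
    qed
    then show "R l ?c (nthd env) arr (P ?M) ((nthd env)(m := foldr (S x env) [0..<N x env] (A x env)))"
      by (simp add: f_def)
  qed
qed

lemma PT_foldr:
  assumes "PT l m N" "PT l m A" "PT l (m + 2) (\<lambda>x env. S x (take m env) (env ! m) (env ! Suc m))" "PT l m H"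
    and "\<And>x env i. set x \<subseteq> {1, 2, 3} \<Longrightarrow> length env = m \<Longrightarrow> i \<le> N x env \<Longrightarrow>
      foldr (S x env) [i..<N x env] (A x env) \<le> H x env"
  shows "PT l m (\<lambda>x env. foldr (S x env) [0..<N x env] (A x env))"
proof -
  obtain p where "polyb p"
    "\<And>x env. set x \<subseteq> {1, 2, 3} \<Longrightarrow> length env = m \<Longrightarrow> H x env \<le> p (length x + sum_list env)"
    using PTE[OF assms(4)] by metis
  then show ?thesis by (intro PT_foldr_poly[OF assms(1-3), of p]) (auto intro: le_trans[OF assms(5)])
qed

text \<open>Input symbols are nonzero, so the first 0 in array 0 marks the end. Register m + 1 is a
  flag that keeps the loop running until it is found.\<close>

lemma PT_len: "PT l m (\<lambda>x env. length x)"
proof (rule PTI[of "\<lambda>N. 4 * N + 10" _ _ "Inc (Suc m) ;; Wh (Suc m) (Cs 0 m 0 (Dec (Suc m)) (Inc m))"])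
  fix x env :: "nat list" and arr :: "nat \<Rightarrow> nat \<Rightarrow> nat"
  assume h: "set x \<subseteq> {1, 2, 3}" "length env = m" "ina x arr"
  let ?c = "Wh (Suc m) (Cs 0 m 0 (Dec (Suc m)) (Inc m))"
  let ?s = "\<lambda>i a. (nthd env)(m := i, Suc m := a)"
  have loop: "R l ?c (?s i 1) arr1 (3 * (length x - i) + 4) ((nthd env)(m := length x))"
    if "i \<le> length x" "ina x arr1" for i arr1
    using that
  proof (induction "length x - i" arbitrary: i arr1)
    case 0
    have e: "(?s i 1)(Suc m := (?s i 1) (Suc m) - 1) = (nthd env)(m := length x)"
      using 0 h by (auto simp: fun_eq_iff)
    have b: "R l (Cs 0 m 0 (Dec (Suc m)) (Inc m)) (?s i 1) arr1 (1 + 1) ((nthd env)(m := length x))"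
      by (rule R_Cs) (use 0 R_Dec[of l "Suc m" "?s i 1" arr1] e in \<open>auto simp: ina_def\<close>)
    have w: "R l ?c ((nthd env)(m := length x)) arr2 1 ((nthd env)(m := length x))" for arr2
      by (rule R_WhF) (use h in auto)
    have "R l ?c (?s i 1) arr1 (1 + 1 + 1 + 1) ((nthd env)(m := length x))"
      by (rule R_WhT[OF _ b w]) auto
    then show ?case by (rule R_le) simp
  next
    case (Suc n)
    have "x ! i \<in> {1, 2, 3}" using h(1) nth_mem[of i x] Suc by fastforce
    then have "x ! i \<noteq> 0" by auto
    then have nz: "arr1 0 i \<noteq> 0" using Suc by (simp add: nthd_def ina_def)
    have e: "(?s i 1)(m := Suc ((?s i 1) m)) = ?s (Suc i) 1" by (auto simp: fun_eq_iff)
    have b: "R l (Cs 0 m 0 (Dec (Suc m)) (Inc m)) (?s i 1) arr1 (1 + 1) (?s (Suc i) 1)"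
      by (rule R_Cs) (use nz R_Inc[of l m "?s i 1" arr1] e in auto)
    have "R l ?c (?s i 1) arr1 (1 + 1 + (3 * (length x - Suc i) + 4) + 1) ((nthd env)(m := length x))"
    proof (rule R_WhT[OF _ b])
      fix arr2 assume "keep l arr1 arr2"
      then show "R l ?c (?s (Suc i) 1) arr2 (3 * (length x - Suc i) + 4) ((nthd env)(m := length x))"
        using Suc keep_ina by (intro Suc(1)) auto
    qed auto
    then show ?case by (rule R_le) (use Suc in linarith)
  qed
  have "?s 0 1 = (nthd env)(Suc m := Suc (nthd env (Suc m)))" using h(2) by (auto simp: fun_eq_iff)
  then have i: "R l (Inc (Suc m)) (nthd env) arr 1 (?s 0 1)" using R_Inc by metis
  have "R l (Inc (Suc m) ;; ?c) (nthd env) arr (1 + (3 * (length x - 0) + 4) + 1) ((nthd env)(m := length x))"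
  proof (rule R_Seq[OF i])
    fix arr1 assume "keep l arr arr1"
    then show "R l ?c (?s 0 1) arr1 (3 * (length x - 0) + 4) ((nthd env)(m := length x))"
      using keep_ina h(3) by (intro loop) auto
  qed
  then show "R l (Inc (Suc m) ;; ?c) (nthd env) arr (4 * (length x + sum_list env) + 10) ((nthd env)(m := length x))"
    by (rule R_le) simp
qed auto

primrec incs :: "nat \<Rightarrow> nat \<Rightarrow> cmd" where
  "incs v 0 = Skip"
| "incs v (Suc k) = Inc v ;; incs v k"

lemma R_incs: "R l (incs v k) s arr (2 * k + 1) (s(v := s v + k))"
proof (induction k arbitrary: s arr)
  case 0
  then show ?case using R_Skip by simp
next
  case (Suc k)
  show ?case unfolding incs.simps by (rule R_conv[OF R_Seq[OF R_Inc Suc.IH]]) auto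
qed

text \<open>An array entry can only be compared with constants, so all \<open>k\<close> candidates
  are tried and the matching one is built up in unary.\<close>

primrec load :: "nat \<Rightarrow> nat \<Rightarrow> nat \<Rightarrow> cmd" where
  "load j v 0 = Skip"
| "load j v (Suc k) = Cs j v k (clr v ;; incs v k) (load j v k)"

lemma R_load:
  assumes "arr j (s v) < k"
  shows "R l (load j v k) s arr (2 * s v + 5 * k + 5) (s(v := arr j (s v)))"
  using assms
proof (induction k)
  case (Suc k)
  show ?case
  proof (cases "arr j (s v) = k")
    case True
    have "R l (clr v ;; incs v k) s arr (2 * s v + 1 + (2 * k + 1) + 1) ((s(v := 0))(v := (s(v := 0)) v + k))"
      by (rule R_Seq[OF R_clr R_incs])
    then have "R l (load j v (Suc k)) s arr ((2 * s v + 1 + (2 * k + 1) + 1) + 1) (s(v := k))"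
      unfolding load.simps by (intro R_Cs) (use True in simp)
    then show ?thesis by (rule R_conv) (use True in auto)
  next
    case False
    then have "R l (load j v (Suc k)) s arr ((2 * s v + 5 * k + 5) + 1) (s(v := arr j (s v)))"
      unfolding load.simps by (intro R_Cs) (use Suc.IH Suc.prems False in \<open>simp del: fun_upd_apply\<close>)
    then show ?thesis by (rule R_le) simp
  qed
qed simp

lemma PT_symbol:
  assumes "PT l m F"
  shows "PT l m (\<lambda>x env. nthd x (F x env))"
proof -
  obtain c p where p: "polyb p" and
    r: "\<And>x env arr. set x \<subseteq> {1, 2, 3} \<Longrightarrow> length env = m \<Longrightarrow> ina x arr \<Longrightarrow>
      R l c (nthd env) arr (p (length x + sum_list env)) ((nthd env)(m := F x env))"
    "\<And>x env. set x \<subseteq> {1, 2, 3} \<Longrightarrow> length env = m \<Longrightarrow> F x env \<le> p (length x + sum_list env)"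
    using PTE[OF assms] by metis
  show ?thesis
  proof (rule PTI[of "\<lambda>N. p N + (2 * p N + 5 * 4 + 5) + 1" _ _ "c ;; load 0 m 4"])
    fix x env :: "nat list" and arr :: "nat \<Rightarrow> nat \<Rightarrow> nat"
    assume h: "set x \<subseteq> {1, 2, 3}" "length env = m" "ina x arr"
    let ?N = "length x + sum_list env" and ?s = "(nthd env)(m := F x env)"
    have x4: "nthd x i < 4" for i
      using nthd_less4[OF h(1)] .
    have "R l (load 0 m 4) ?s arr1 (2 * p ?N + 5 * 4 + 5) ((nthd env)(m := nthd x (F x env)))"
      if "keep l arr arr1" for arr1
    proof -
      have a: "arr1 0 = nthd x" using keep_ina[OF that h(3)] by (simp add: ina_def)
      show ?thesis by (rule R_conv[OF R_load]) (use a x4 r(2)[OF h(1,2)] in auto)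
    qed
    from R_Seq[OF r(1)[OF h] this]
    show "R l (c ;; load 0 m 4) (nthd env) arr (p ?N + (2 * p ?N + 5 * 4 + 5) + 1) ((nthd env)(m := nthd x (F x env)))" .
  qed (use p in auto)
qed

lemma PT_take:
  assumes "k \<le> m" "PT l k F"
  shows "PT l m (\<lambda>x env. F x (take k env))"
proof -
  let ?Fs = "map (\<lambda>j x env. env ! j) [0..<k] :: (nat list \<Rightarrow> nat list \<Rightarrow> nat) list"
  have "PT l m (\<lambda>x env. F x (map (\<lambda>G. G x env) ?Fs))"
    by (rule PT_comp[OF assms(2)]) (use assms(1) in \<open>auto intro: PT_var\<close>)
  moreover have "F x (map (\<lambda>G. G x env) ?Fs) = F x (take k env)" if "length env = m" for x env
    using that assms(1) by (intro arg_cong[of _ _ "F x"] nth_equalityI) auto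
  ultimately show ?thesis by (subst PT_cong[where G = "\<lambda>x env. F x (map (\<lambda>G. G x env) ?Fs)"]) auto
qed

lemma length_2E: "length (env :: nat list) = 2 \<Longrightarrow> (\<And>a b. env = [a, b] \<Longrightarrow> P) \<Longrightarrow> P"
  by (auto simp: numeral_2_eq_2 length_Suc_conv)

lemma foldr_Suc: "foldr (\<lambda>i a. Suc a) xs a = a + length xs"
  by (induction xs) auto

lemma foldr_plus: "foldr (\<lambda>i a. a + b) xs 0 = length xs * (b::nat)"
  by (induction xs) auto

lemma foldr_pred: "foldr (\<lambda>i a. a - 1) xs a = a - length xs"
  by (induction xs) auto

lemma PT_add:
  assumes "PT l m A" "PT l m B"
  shows "PT l m (\<lambda>x env. A x env + B x env)"
proof (rule PT_op2[OF _ assms])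
  have "PT l 2 (\<lambda>x env. foldr (\<lambda>i a. Suc a) [0..<env ! 1] (env ! 0))"
  proof (rule PT_foldr_poly[where p = "\<lambda>N. N"])
    show "PT l (2 + 2) (\<lambda>x env. Suc (env ! Suc 2))" by (intro PT_Suc PT_var) simp
    fix x env :: "nat list" and i assume "length env = 2"
    then show "foldr (\<lambda>i a. Suc a) [i..<env ! 1] (env ! 0) \<le> length x + sum_list env"
      by (elim length_2E) (simp add: foldr_Suc)
  qed (auto intro: PT_var)
  then show "PT l 2 (\<lambda>x env. env ! 0 + env ! 1)" by (simp add: foldr_Suc)
qed

lemma PT_mult:
  assumes "PT l m A" "PT l m B"
  shows "PT l m (\<lambda>x env. A x env * B x env)"
proof (rule PT_op2[OF _ assms])
  have "PT l 2 (\<lambda>x env. foldr (\<lambda>i a. a + env ! 1) [0..<env ! 0] 0)"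
  proof (rule PT_foldr_poly[where p = "\<lambda>N. N * N"])
    show "PT l (2 + 2) (\<lambda>x env. env ! Suc 2 + take 2 env ! 1)"
      by (intro PT_add PT_var) (auto simp: PT_var)
    fix x env :: "nat list" and i assume "length env = 2"
    then obtain a b where e: "env = [a, b]" by (elim length_2E)
    have "(a - i) * b \<le> (length x + (a + b)) * (length x + (a + b))" by (intro mult_le_mono) auto
    then show "foldr (\<lambda>i a. a + env ! 1) [i..<env ! 0] 0 \<le> (length x + sum_list env) * (length x + sum_list env)"
      by (simp add: e foldr_plus)
  qed (auto intro: PT_var PT_const)
  then show "PT l 2 (\<lambda>x env. env ! 0 * env ! 1)" by (simp add: foldr_plus)
qed

lemma PT_diff:
  assumes "PT l m A" "PT l m B"
  shows "PT l m (\<lambda>x env. A x env - B x env)"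
proof (rule PT_op2[OF _ assms])
  have "PT l 2 (\<lambda>x env. foldr (\<lambda>i a. a - 1) [0..<env ! 1] (env ! 0))"
  proof (rule PT_foldr_poly[where p = "\<lambda>N. N"])
    show "PT l (2 + 2) (\<lambda>x env. env ! Suc 2 - 1)" by (intro PT_pred PT_var) simp
    fix x env :: "nat list" and i assume "length env = 2"
    then show "foldr (\<lambda>i a. a - 1) [i..<env ! 1] (env ! 0) \<le> length x + sum_list env"
      by (elim length_2E) (simp add: foldr_pred)
  qed (auto intro: PT_var)
  then show "PT l 2 (\<lambda>x env. env ! 0 - env ! 1)" by (simp add: foldr_pred)
qed

lemma PT_power: "PT l m A \<Longrightarrow> PT l m (\<lambda>x env. A x env ^ k)"
  by (induction k) (auto intro: PT_const PT_mult)

section \<open>Polynomial-time predicates, bounded search, iteration and arithmetic\<close>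

definition PTb :: "nat \<Rightarrow> nat \<Rightarrow> (nat list \<Rightarrow> nat list \<Rightarrow> bool) \<Rightarrow> bool" where
  "PTb l m B = PT l m (\<lambda>x env. of_bool (B x env))"

lemma PT_of_bool: "PTb l m B \<Longrightarrow> PT l m (\<lambda>x env. of_bool (B x env))"
  by (simp add: PTb_def)

lemma PTb_cong:
  assumes "\<And>x env. set x \<subseteq> {1, 2, 3} \<Longrightarrow> length env = m \<Longrightarrow> B x env = C x env"
  shows "PTb l m B \<longleftrightarrow> PTb l m C"
  unfolding PTb_def by (rule PT_cong) (use assms in auto)

lemma PT_If:
  assumes "PTb l m B" "PT l m F" "PT l m G"
  shows "PT l m (\<lambda>x env. if B x env then F x env else G x env)"
proof -
  have "(if of_bool (B x env) = (0::nat) then G x env else F x env) =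
    (if B x env then F x env else G x env)" for x env by simp
  then show ?thesis using PT_if[OF PT_of_bool[OF assms(1)] assms(2,3)] by simp
qed

lemma PTb_const: "PTb l m (\<lambda>x env. b)"
  unfolding PTb_def by (rule PT_const)

lemma PTb_If:
  assumes "PTb l m B" "PTb l m F" "PTb l m G"
  shows "PTb l m (\<lambda>x env. if B x env then F x env else G x env)"
  using PT_If[OF assms(1) PT_of_bool[OF assms(2)] PT_of_bool[OF assms(3)]]
  unfolding PTb_def by (simp add: if_distrib[of of_bool] cong: if_cong)

lemma PTb_eqI: "PTb l m B \<Longrightarrow> (\<And>x env. B x env = C x env) \<Longrightarrow> PTb l m C"
  by (subst PTb_cong[where C = B]) auto

lemma PTb_not: "PTb l m B \<Longrightarrow> PTb l m (\<lambda>x env. \<not> B x env)"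
  by (rule PTb_eqI[OF PTb_If[OF _ PTb_const[of _ _ False] PTb_const[of _ _ True]]]) auto

lemma PTb_conj: "PTb l m B \<Longrightarrow> PTb l m C \<Longrightarrow> PTb l m (\<lambda>x env. B x env \<and> C x env)"
  by (rule PTb_eqI[OF PTb_If[of l m B C "\<lambda>x env. False"]]) (auto intro: PTb_const)

lemma PTb_disj: "PTb l m B \<Longrightarrow> PTb l m C \<Longrightarrow> PTb l m (\<lambda>x env. B x env \<or> C x env)"
  by (rule PTb_eqI[OF PTb_If[of l m B "\<lambda>x env. True" C]]) (auto intro: PTb_const)

lemma PTb_imp: "PTb l m B \<Longrightarrow> PTb l m C \<Longrightarrow> PTb l m (\<lambda>x env. B x env \<longrightarrow> C x env)"
  by (rule PTb_eqI[OF PTb_If[of l m B C "\<lambda>x env. True"]]) (auto intro: PTb_const)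

lemma PTb_less: assumes "PT l m A" "PT l m B" shows "PTb l m (\<lambda>x env. A x env < B x env)"
proof -
  have "(if B x env - A x env = 0 then 0 else 1) = (of_bool (A x env < B x env) :: nat)" for x env by simp
  then show ?thesis using PT_if[OF PT_diff[OF assms(2,1)] PT_const[of _ _ 1] PT_const[of _ _ 0]]
    unfolding PTb_def by simp
qed

lemma PTb_le: "PT l m A \<Longrightarrow> PT l m B \<Longrightarrow> PTb l m (\<lambda>x env. A x env \<le> B x env)"
  by (rule PTb_eqI[OF PTb_not[OF PTb_less[of l m B A]]]) auto

lemma PTb_eq: "PT l m A \<Longrightarrow> PT l m B \<Longrightarrow> PTb l m (\<lambda>x env. A x env = B x env)"
  by (rule PTb_eqI[OF PTb_conj[OF PTb_le[of l m A B] PTb_le[of l m B A]]]) auto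

text \<open>The least index with the property, and \<open>n\<close> if there is none. Being out of
  range, this default serves as a failure value throughout.\<close>

definition bleast :: "nat \<Rightarrow> (nat \<Rightarrow> bool) \<Rightarrow> nat" where
  "bleast n B = foldr (\<lambda>i a. if B i then i else a) [0..<n] n"

lemma foldr_least:
  "k \<le> n \<Longrightarrow> foldr (\<lambda>i a. if B i then i else a) [k..<n] n = (LEAST i. i = n \<or> k \<le> i \<and> B i)"
proof (induction "n - k" arbitrary: k)
  case 0
  then show ?case by (auto intro!: Least_equality[symmetric])
next
  case (Suc d)
  then have k: "[k..<n] = k # [Suc k..<n]" by (simp add: upt_conv_Cons)
  show ?case
  proof (cases "B k")
    case True
    then show ?thesis unfolding k using Suc by (auto intro!: Least_equality[symmetric])
  next
    case False
    have "(i = n \<or> k \<le> i \<and> B i) = (i = n \<or> Suc k \<le> i \<and> B i)" for i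
      using False by (metis Suc_leD not_less_eq_eq order_antisym)
    then show ?thesis unfolding k using Suc False by simp
  qed
qed

lemma bleast_Least: "bleast n B = (LEAST i. i = n \<or> B i)"
  unfolding bleast_def by (simp add: foldr_least)

lemma bleast_le: "bleast n B \<le> n"
  unfolding bleast_Least by (rule Least_le) simp

lemma bleast_less: "bleast n B < n \<Longrightarrow> B (bleast n B)"
  unfolding bleast_Least using LeastI[of "\<lambda>i. i = n \<or> B i" n] by auto

lemma bleast_least: "i < bleast n B \<Longrightarrow> \<not> B i"
  unfolding bleast_Least using not_less_Least by blast

lemma bleast_less_iff: "bleast n B < n \<longleftrightarrow> (\<exists>i<n. B i)"
proof
  assume "\<exists>i<n. B i"
  then obtain i where "i < n" "B i" by blast
  moreover then have "\<not> i < bleast n B" using bleast_least by blast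
  ultimately show "bleast n B < n" by simp
qed (use bleast_less in blast)

lemma bleast_unique: "i < n \<Longrightarrow> B i \<Longrightarrow> (\<And>j. j < n \<Longrightarrow> B j \<Longrightarrow> j = i) \<Longrightarrow> bleast n B = i"
proof -
  assume h: "i < n" "B i" and u: "\<And>j. j < n \<Longrightarrow> B j \<Longrightarrow> j = i"
  then have l: "bleast n B < n" using bleast_less_iff by blast
  show ?thesis by (rule u[OF l bleast_less[OF l]])
qed

lemma PT_bleast:
  assumes "PT l m N" "PTb l (Suc m) (\<lambda>x env. B x (take m env) (env ! m))"
  shows "PT l m (\<lambda>x env. bleast (N x env) (B x env))"
  unfolding bleast_def
proof (rule PT_foldr[OF assms(1) assms(1) _ assms(1)])
  have "PTb l (m + 2) (\<lambda>x env. B x (take m (take (Suc m) env)) (take (Suc m) env ! m))"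
    using PT_take[OF _ assms(2)[unfolded PTb_def], of "m + 2"] unfolding PTb_def by simp
  then have "PTb l (m + 2) (\<lambda>x env. B x (take m env) (env ! m))" by simp
  then show "PT l (m + 2) (\<lambda>x env. if B x (take m env) (env ! m) then env ! m else env ! Suc m)"
    by (intro PT_If PT_var) auto
  fix x env i assume "i \<le> N x env"
  then show "foldr (\<lambda>i a. if B x env i then i else a) [i..<N x env] (N x env) \<le> N x env"
    by (simp add: foldr_least Least_le)
qed

lemma PTb_ex:
  assumes "PT l m N" "PTb l (Suc m) (\<lambda>x env. B x (take m env) (env ! m))"
  shows "PTb l m (\<lambda>x env. \<exists>i<N x env. B x env i)"
  by (rule PTb_eqI[OF PTb_less[OF PT_bleast[OF assms] assms(1)]]) (simp add: bleast_less_iff)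

lemma PTb_all:
  assumes "PT l m N" "PTb l (Suc m) (\<lambda>x env. B x (take m env) (env ! m))"
  shows "PTb l m (\<lambda>x env. \<forall>i<N x env. B x env i)"
  by (rule PTb_eqI[OF PTb_not[OF PTb_ex[OF assms(1) PTb_not[OF assms(2)]]]]) auto

lemma foldr_funpow: "foldr (\<lambda>i a. f a) xs a = (f ^^ length xs) a"
  by (induction xs) auto

lemma PT_funpow:
  assumes "PT l m N" "PT l m A" "PT l (Suc m) (\<lambda>x env. S x (take m env) (env ! m))" "PT l m H"
    and bound: "\<And>x env i. set x \<subseteq> {1, 2, 3} \<Longrightarrow> length env = m \<Longrightarrow> i \<le> N x env \<Longrightarrow> (S x env ^^ i) (A x env) \<le> H x env"
  shows "PT l m (\<lambda>x env. (S x env ^^ N x env) (A x env))"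
proof -
  have "PT l m (\<lambda>x env. foldr (\<lambda>i a. S x env a) [0..<N x env] (A x env))"
  proof (rule PT_foldr[OF assms(1,2) _ assms(4)])
    have "PT l (m + 2) (\<lambda>x env. S x (take m (map (\<lambda>F. F x env) (map (\<lambda>j x env. env ! j) [0..<m] @ [\<lambda>x env. env ! Suc m])))
      (map (\<lambda>F. F x env) (map (\<lambda>j x env. env ! j) [0..<m] @ [\<lambda>x env. env ! Suc m]) ! m))"
      by (rule PT_comp[OF assms(3)]) (auto intro: PT_var)
    moreover have "take m (map (\<lambda>F. F x env) (map (\<lambda>j x env. env ! j) [0..<m] @ [\<lambda>x env. env ! Suc m])) = take m env"
      "map (\<lambda>F. F x env) (map (\<lambda>j x env. env ! j) [0..<m] @ [\<lambda>x env. env ! Suc m]) ! m = env ! Suc m"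
      if "length env = m + 2" for x env :: "nat list"
      using that by (auto intro!: nth_equalityI simp: nth_append)
    ultimately show "PT l (m + 2) (\<lambda>x env. S x (take m env) (env ! Suc m))"
      by (subst (asm) PT_cong[where G = "\<lambda>x env. S x (take m env) (env ! Suc m)"]) auto
  qed (auto simp: foldr_funpow bound)
  then show ?thesis by (simp add: foldr_funpow)
qed

lemma foldr_sum: "foldr (\<lambda>i a. a + f i) [k..<n] 0 = (\<Sum>i=k..<n. f i :: nat)"
proof (induction "n - k" arbitrary: k)
  case (Suc d)
  then have "[k..<n] = k # [Suc k..<n]" by (simp add: upt_conv_Cons)
  then show ?case using Suc by (simp add: sum.atLeast_Suc_lessThan)
qed simp

lemma PT_sum:
  assumes "PT l m N" "PT l (Suc m) (\<lambda>x env. F x (take m env) (env ! m))"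
  shows "PT l m (\<lambda>x env. \<Sum>i<N x env. F x env i)"
proof -
  obtain p1 where p1: "polyb p1" and
    r1: "\<And>x env. set x \<subseteq> {1, 2, 3} \<Longrightarrow> length env = m \<Longrightarrow> N x env \<le> p1 (length x + sum_list env)"
    using PTE[OF assms(1)] by metis
  obtain p2 where p2: "polyb p2" and
    r2: "\<And>x env. set x \<subseteq> {1, 2, 3} \<Longrightarrow> length env = Suc m \<Longrightarrow> F x (take m env) (env ! m) \<le> p2 (length x + sum_list env)"
    using PTE[OF assms(2)] by metis
  have "PT l m (\<lambda>x env. foldr (\<lambda>i a. a + F x env i) [0..<N x env] 0)"
  proof (rule PT_foldr_poly[OF assms(1) PT_const, where p = "\<lambda>M. p1 M * p2 (M + p1 M)"])
    have "PT l (m + 2) (\<lambda>x env. F x (take m (take (Suc m) env)) (take (Suc m) env ! m))"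
      using PT_take[OF _ assms(2), of "m + 2"] by simp
    then have "PT l (m + 2) (\<lambda>x env. F x (take m env) (env ! m))" by simp
    then show "PT l (m + 2) (\<lambda>x env. env ! Suc m + F x (take m env) (env ! m))"
      by (intro PT_add PT_var) auto
    show "polyb (\<lambda>M. p1 M * p2 (M + p1 M))"
      by (intro polyb_comp[OF p2] polyb_mult polyb_add polyb_id p1)
    fix x env :: "nat list" and k assume h: "set x \<subseteq> {1, 2, 3}" "length env = m"
    let ?M = "length x + sum_list env"
    have "F x env i \<le> p2 (?M + p1 ?M)" if "i < N x env" for i
    proof -
      have "F x env i \<le> p2 (length x + sum_list (env @ [i]))" using r2[of x "env @ [i]"] h by (simp add: nth_append)
      also have "\<dots> \<le> p2 (?M + p1 ?M)"
        by (rule polyb_mono[OF p2]) (use that r1[OF h] in simp)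
      finally show ?thesis .
    qed
    then have "(\<Sum>i=k..<N x env. F x env i) \<le> (\<Sum>i=k..<N x env. p2 (?M + p1 ?M))"
      by (intro sum_mono) auto
    also have "\<dots> \<le> p1 ?M * p2 (?M + p1 ?M)"
      using r1[OF h] by (auto intro!: mult_le_mono1)
    finally show "foldr (\<lambda>i a. a + F x env i) [k..<N x env] 0 \<le> p1 ?M * p2 (?M + p1 ?M)"
      by (simp add: foldr_sum)
  qed
  then show ?thesis by (simp add: foldr_sum atLeast0LessThan)
qed

lemma PT_div:
  assumes "PT l m A" "PT l m B"
  shows "PT l m (\<lambda>x env. A x env div B x env)"
proof (rule PT_op2[OF _ assms])
  have e: "a div b = (if b = 0 then 0 else bleast (Suc a) (\<lambda>q. a < Suc q * b))" for a b :: nat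
  proof (cases "b = 0")
    case False
    have "bleast (Suc a) (\<lambda>q. a < Suc q * b) = a div b"
      unfolding bleast_Least
    proof (rule Least_equality)
      show "a div b = Suc a \<or> a < Suc (a div b) * b"
        using False by (metis dividend_less_div_times gr0I mult.commute mult_Suc)
      show "a div b \<le> q" if "q = Suc a \<or> a < Suc q * b" for q
        using that False
        by (metis Suc_leI div_le_dividend le_SucI less_Suc_eq_le less_mult_imp_div_less)
    qed
    then show ?thesis using False by simp
  qed simp
  show "PT l 2 (\<lambda>x env. env ! 0 div env ! 1)"
    unfolding e
    by (intro PT_If PTb_eq PT_bleast PT_Suc PT_var PT_const PTb_less PT_mult) (auto intro: PT_var)
qed

lemma PT_mod:
  assumes "PT l m A" "PT l m B"
  shows "PT l m (\<lambda>x env. A x env mod B x env)"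
  unfolding modulo_nat_def by (intro PT_diff PT_mult PT_div assms)

lemma PT_list:
  assumes "PT l m A"
  shows "PT l m (\<lambda>x env. nthd ks (A x env))"
proof (rule PT_op1[OF _ assms], induction ks)
  case Nil
  then show ?case by (simp add: PT_const)
next
  case (Cons k ks)
  have e: "nthd (k # ks) a = (if a = 0 then k else nthd ks (a - 1))" for a by (cases a) auto
  have "PT l 1 (\<lambda>x env. env ! 0 - 1)" by (intro PT_pred PT_var) simp
  from PT_op1[OF Cons this] show ?case unfolding e
    by (intro PT_If PTb_eq PT_var PT_const) auto
qed

lemmas PT_intros = PT_const PT_add PT_mult PT_diff PT_Suc PT_power PT_div PT_mod PT_If PT_len PT_symbol
  PT_of_bool PTb_const PTb_not PTb_conj PTb_disj PTb_imp PTb_less PTb_le PTb_eq PTb_If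

section \<open>Programs that write arrays, and machines with a given output\<close>

definition RA :: "cmd \<Rightarrow> (nat \<Rightarrow> nat) \<Rightarrow> (nat \<Rightarrow> nat \<Rightarrow> nat) \<Rightarrow> nat \<Rightarrow> (nat \<Rightarrow> nat) \<Rightarrow> (nat \<Rightarrow> nat \<Rightarrow> nat) \<Rightarrow> bool" where
  "RA c s arr B s' arr' = (\<exists>t. big c (s, arr) t (s', arr') \<and> t \<le> B)"

lemma RA_R: "R l c s arr B s' \<Longrightarrow> \<exists>arr'. RA c s arr B s' arr' \<and> keep l arr arr'"
  unfolding R_def RA_def by blast

lemma RA_R0: "R 0 c s arr B s' \<Longrightarrow> RA c s arr B s' arr"
  unfolding R_def RA_def keep_def by (metis ext atLeastLessThan_empty_iff2 empty_iff add_0_right less_irrefl)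

lemma R_RA: "RA c s arr B s' arr' \<Longrightarrow> keep l arr arr' \<Longrightarrow> R l c s arr B s'"
  unfolding R_def RA_def by blast

lemma RA_Seq: "RA c s arr B1 s1 arr1 \<Longrightarrow> RA d s1 arr1 B2 s2 arr2 \<Longrightarrow> RA (c ;; d) s arr (B1 + B2 + 1) s2 arr2"
  unfolding RA_def by (meson add_le_mono big_Seq le_refl)

lemma RA_le: "RA c s arr B s' arr' \<Longrightarrow> B \<le> B' \<Longrightarrow> RA c s arr B' s' arr'"
  unfolding RA_def by (meson le_trans)

lemma RA_WhT: "s v \<noteq> 0 \<Longrightarrow> RA c s arr B1 s1 arr1 \<Longrightarrow> RA (Wh v c) s1 arr1 B2 s2 arr2 \<Longrightarrow>
  RA (Wh v c) s arr (B1 + B2 + 1) s2 arr2"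
  unfolding RA_def by (meson add_le_mono big_WhT le_refl)

lemma RA_IfZ: "RA (if s v = 0 then c else d) s arr B s' arr' \<Longrightarrow> RA (IfZ v c d) s arr (B + 1) s' arr'"
  unfolding RA_def by (metis add_le_cancel_right big_IfZ)

lemma RA_Cs: "RA (if arr j (s v) = a then c else d) s arr B s' arr' \<Longrightarrow> RA (Cs j v a c d) s arr (B + 1) s' arr'"
  unfolding RA_def by (metis add_le_cancel_right big_Cs)

lemma RA_Wr: "RA (Wr j v a) s arr 1 s (arr(j := (arr j)(s v := a)))"
  unfolding RA_def by (meson big_Wr le_refl)

lemmas RA_Inc = RA_R0[OF R_Inc]
lemmas RA_Dec = RA_R0[OF R_Dec]
lemmas RA_clr = RA_R0[OF R_clr]
lemmas RA_cpy = RA_R0[OF R_cpy]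
lemmas RA_load = RA_R0[OF R_load]

text \<open>The invariant is indexed by the number of rounds still to come. The registers at that
  point are given by a function of this number, so the invariant is left to speak of the
  arrays.\<close>

lemma RA_loop:
  assumes body: "\<And>i arr. i < n \<Longrightarrow> Inv (Suc i) arr \<Longrightarrow> \<exists>arr'. Inv i arr' \<and> RA c (S (Suc i)) arr B (S i) arr'"
    and S: "\<And>i. S i v = i"
  shows "i \<le> n \<Longrightarrow> Inv i arr \<Longrightarrow> \<exists>arr'. Inv 0 arr' \<and> RA (Wh v c) (S i) arr (i * (B + 1) + 1) (S 0) arr'"
proof (induction i arbitrary: arr)
  case 0
  then show ?case using big_WhF[of "S 0" v c arr] S[of 0] unfolding RA_def by auto
next
  case (Suc i)
  then obtain arr1 where 1: "Inv i arr1" "RA c (S (Suc i)) arr B (S i) arr1"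
    using body[of i arr] by auto
  then obtain arr2 where 2: "Inv 0 arr2" "RA (Wh v c) (S i) arr1 (i * (B + 1) + 1) (S 0) arr2"
    using Suc by auto
  have "RA (Wh v c) (S (Suc i)) arr (B + (i * (B + 1) + 1) + 1) (S 0) arr2"
    by (rule RA_WhT[OF _ 1(2) 2(2)]) (simp add: S)
  then have "RA (Wh v c) (S (Suc i)) arr (Suc i * (B + 1) + 1) (S 0) arr2" by (rule RA_le) simp
  then show ?case using 2(1) by blast
qed

text \<open>An output is described by its length \<open>N\<close> and by a predicate
  \<open>B\<close> for its positions, so each position is computed from the input alone. The loop
  counts down and writes the last symbol first.\<close>

theorem PT_output:
  assumes "PT l 0 N" "PTb l 1 B"
  shows "\<exists>M p. wf_tm M \<and> 4 \<le> fst (snd M) \<and> polyb p \<and> (\<forall>xs. set xs \<subseteq> {1, 2, 3} \<longrightarrow>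
    (\<exists>t tp. t \<le> p (length xs) \<and> (astep M ^^ t) (0, 0, tape_of xs) = (1, 0, tp) \<and>
      (\<forall>i<N xs []. tp (int i) = sym (B xs [i])) \<and> tp (int (N xs [])) = 0))"
proof -
  obtain c1 p1 where p1: "polyb p1" and
    r1: "\<And>x env arr. set x \<subseteq> {1, 2, 3} \<Longrightarrow> length env = 0 \<Longrightarrow> ina x arr \<Longrightarrow>
      R l c1 (nthd env) arr (p1 (length x + sum_list env)) ((nthd env)(0 := N x env))"
    "\<And>x env. set x \<subseteq> {1, 2, 3} \<Longrightarrow> length env = 0 \<Longrightarrow> N x env \<le> p1 (length x + sum_list env)"
    using PTE[OF assms(1)] by metis
  obtain c2 p2 where p2: "polyb p2" and
    r2: "\<And>x env arr. set x \<subseteq> {1, 2, 3} \<Longrightarrow> length env = 1 \<Longrightarrow> ina x arr \<Longrightarrow>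
      R l c2 (nthd env) arr (p2 (length x + sum_list env)) ((nthd env)(1 := of_bool (B x env)))"
    using PTE[OF assms(2)[unfolded PTb_def]] by metis
  let ?w = "IfZ 1 (Wr 1 0 1) (Wr 1 0 2 ;; clr 1)"
  let ?body = "Dec 0 ;; c2 ;; ?w"
  let ?c = "c1 ;; Wh 0 ?body"
  define Bd where "Bd = (\<lambda>n. 1 + (p2 (n + p1 n) + 6 + 1) + 1)"
  define T where "T = (\<lambda>n. p1 n + (p1 n * (Bd n + 1) + 1) + 1)"
  have Bd: "polyb Bd" unfolding Bd_def by (intro polyb_comp[OF p2] polyb_add polyb_const polyb_id p1)
  have T: "polyb T" unfolding T_def using p1 Bd by (intro polyb_add polyb_mult polyb_const)
  have run: "\<exists>t arr'. t \<le> T (length x) \<and> big ?c (\<lambda>_. 0, \<lambda>j i. if j = 0 then nthd x i else 0) t (\<lambda>_. 0, arr') \<and>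
     (\<forall>j. arr' 1 j = (if j < N x [] then sym (B x [j]) else 0))"
    if x: "set x \<subseteq> {1, 2, 3}" for x
  proof -
    let ?n = "length x" and ?N = "N x []"
    let ?arr = "\<lambda>j i. if j = (0::nat) then nthd x i else 0"
    define S where "S = (\<lambda>i. (\<lambda>_::nat. 0::nat)(0 := i))"
    define Inv where "Inv = (\<lambda>i (arr :: nat \<Rightarrow> nat \<Rightarrow> nat). arr 0 = nthd x \<and> (\<forall>j. arr 1 j = (if i \<le> j \<and> j < ?N then sym (B x [j]) else 0)))"
    have N1: "?N \<le> p1 ?n" using r1(2)[OF x, of "[]"] by simp
    have nt: "nthd [] = (\<lambda>_. 0)" "nthd [i] = S i" for i
      by (auto simp: fun_eq_iff S_def nthd_def)
    obtain arr1 where a1: "RA c1 (\<lambda>_. 0) ?arr (p1 ?n) (S ?N) arr1" "keep l ?arr arr1"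
      using RA_R[OF r1(1)[OF x, of "[]" ?arr]] nt by (auto simp: S_def ina_def)
    have I1: "Inv ?N arr1" using a1(2) by (auto simp: Inv_def keep_def fun_eq_iff)
    have body: "\<exists>arr'. Inv i arr' \<and> RA ?body (S (Suc i)) arr (Bd ?n) (S i) arr'"
      if i: "i < ?N" and I: "Inv (Suc i) arr" for i arr
    proof -
      have d: "RA (Dec 0) (S (Suc i)) arr 1 (S i) arr"
        using RA_Dec[of 0 "S (Suc i)" arr] by (simp add: S_def)
      have a0: "ina x arr" using I by (simp add: Inv_def ina_def)
      obtain arr2 where a2: "RA c2 (S i) arr (p2 (?n + i)) ((S i)(1 := of_bool (B x [i]))) arr2" "keep l arr arr2"
        using RA_R[OF r2[OF x, of "[i]" arr]] a0 nt by auto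
      let ?arr3 = "arr2(1 := (arr2 1)(i := sym (B x [i])))"
      have w: "RA ?w ((S i)(1 := of_bool (B x [i]))) arr2 6 (S i) ?arr3"
      proof (cases "B x [i]")
        case True
        let ?s = "(S i)(1 := 1)"
        have "RA (Wr 1 0 2 ;; clr 1) ?s arr2 (1 + (2 * ?s 1 + 1) + 1) (?s(1 := 0)) (arr2(1 := (arr2 1)(?s 0 := 2)))"
          by (rule RA_Seq[OF RA_Wr RA_clr])
        then have "RA ?w ?s arr2 (1 + (2 * ?s 1 + 1) + 1 + 1) (?s(1 := 0)) (arr2(1 := (arr2 1)(?s 0 := 2)))"
          by (intro RA_IfZ) simp
        moreover have "?s(1 := 0) = S i" by (auto simp: S_def fun_eq_iff)
        ultimately have "RA ?w ?s arr2 (1 + (2 * ?s 1 + 1) + 1 + 1) (S i) ?arr3"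
          using True by (simp add: S_def sym_def)
        then show ?thesis using True by (simp add: eval_nat_numeral One_nat_def)
      next
        case False
        let ?s = "(S i)(1 := 0)"
        have "RA (Wr 1 0 1) ?s arr2 1 ?s (arr2(1 := (arr2 1)(?s 0 := 1)))" by (rule RA_Wr)
        then have "RA ?w ?s arr2 (1 + 1) ?s (arr2(1 := (arr2 1)(?s 0 := 1)))"
          by (intro RA_IfZ) (simp only: fun_upd_same refl if_True)
        moreover have "?s = S i" by (auto simp: S_def fun_eq_iff)
        ultimately have "RA ?w (S i) arr2 (1 + 1) (S i) ?arr3"
          using False by (simp add: S_def sym_def)
        then have "RA ?w (S i) arr2 6 (S i) ?arr3" by (rule RA_le) simp
        then show ?thesis using False \<open>?s = S i\<close> by simp
      qed
      have "p2 (?n + i) \<le> p2 (?n + p1 ?n)" by (rule polyb_mono[OF p2]) (use i N1 in simp)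
      then have "RA ?body (S (Suc i)) arr (Bd ?n) (S i) ?arr3"
        unfolding Bd_def by (intro RA_Seq[OF d RA_Seq[OF RA_le[OF a2(1)] w]])
      moreover have "Inv i ?arr3"
        using I a2(2) i by (auto simp: Inv_def keep_def)
      ultimately show ?thesis by blast
    qed
    obtain arr' where I': "Inv 0 arr'" and r': "RA (Wh 0 ?body) (S ?N) arr1 (?N * (Bd ?n + 1) + 1) (S 0) arr'"
      using RA_loop[of ?N Inv ?body S "Bd ?n" 0 ?N arr1, OF body _ order.refl I1] by (auto simp: S_def)
    have "?N * (Bd ?n + 1) + 1 \<le> p1 ?n * (Bd ?n + 1) + 1" using N1 by simp
    then have "RA ?c (\<lambda>_. 0) ?arr (T ?n) (S 0) arr'"
      unfolding T_def by (intro RA_Seq[OF a1(1) RA_le[OF r']])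
    moreover have "S 0 = (\<lambda>_. 0)" by (auto simp: S_def)
    ultimately obtain t where "t \<le> T ?n" "big ?c (\<lambda>_. 0, ?arr) t (\<lambda>_. 0, arr')"
      unfolding RA_def by auto
    moreover have "\<forall>j. arr' 1 j = (if j < ?N then sym (B x [j]) else 0)"
      using I' unfolding Inv_def by auto
    ultimately show ?thesis by blast
  qed
  obtain M where wf: "wf_tm M" "4 \<le> fst (snd M)" and M0: "\<forall>xs t s' arr' ys. set xs \<subseteq> {1, 2, 3} \<longrightarrow> set ys \<subseteq> {1, 2, 3} \<longrightarrow>
    big ?c (\<lambda>_. 0, \<lambda>j i. if j = 0 then nthd xs i else 0) t (s', arr') \<longrightarrow>
    (\<forall>i<length ys. arr' 1 i = ys ! i) \<longrightarrow> arr' 1 (length ys) = 0 \<longrightarrow>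
    (\<exists>t' tp. t' \<le> 2 + t * (2 * t + 3) + (2 * length ys + 3) \<and>
      (astep M ^^ t') (0, 0, tape_of xs) = (1, 0, tp) \<and>
      (\<forall>i<length ys. tp (int i) = ys ! i) \<and> tp (int (length ys)) = 0)"
    using compile[of ?c] by blast
  define p where "p = (\<lambda>n. 2 + T n * (2 * T n + 3) + (2 * p1 n + 3))"
  have "polyb p" unfolding p_def using T p1 by (intro polyb_add polyb_mult polyb_const)
  moreover have "\<exists>t tp. t \<le> p (length xs) \<and> (astep M ^^ t) (0, 0, tape_of xs) = (1, 0, tp) \<and>
      (\<forall>i<N xs []. tp (int i) = sym (B xs [i])) \<and> tp (int (N xs [])) = 0"
    if x: "set xs \<subseteq> {1, 2, 3}" for xs
  proof -
    obtain t arr' where t: "t \<le> T (length xs)"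
      and b: "big ?c (\<lambda>_. 0, \<lambda>j i. if j = 0 then nthd xs i else 0) t (\<lambda>_. 0, arr')"
      and a: "\<forall>j. arr' 1 j = (if j < N xs [] then sym (B xs [j]) else 0)"
      using run[OF x] by blast
    let ?ys = "map (\<lambda>i. sym (B xs [i])) [0..<N xs []]"
    have "set ?ys \<subseteq> {1, 2, 3}" by (auto simp: sym_def)
    with M0[rule_format, OF x this b] a obtain t' tp where t': "t' \<le> 2 + t * (2 * t + 3) + (2 * N xs [] + 3)"
      "(astep M ^^ t') (0, 0, tape_of xs) = (1, 0, tp)"
      "\<forall>i<N xs []. tp (int i) = sym (B xs [i])" "tp (int (N xs [])) = 0"
      by auto
    have "t * (2 * t + 3) \<le> T (length xs) * (2 * T (length xs) + 3)"
      using t by (intro mult_le_mono) auto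
    then have "t' \<le> p (length xs)" unfolding p_def using t'(1) r1(2)[OF x, of "[]"] by simp
    then show ?thesis using t' by blast
  qed
  ultimately show ?thesis using wf by blast
qed

corollary PT_poly_computable:
  assumes "PT l 0 N" "PTb l 1 B"
  shows "poly_computable (\<lambda>x. map (\<lambda>i. B (map sym x) [i]) [0..<N (map sym x) []])"
proof -
  obtain M p where M: "wf_tm M" "polyb p" and r: "\<And>xs. set xs \<subseteq> {1, 2, 3} \<Longrightarrow>
    (\<exists>t tp. t \<le> p (length xs) \<and> (astep M ^^ t) (0, 0, tape_of xs) = (1, 0, tp) \<and>
      (\<forall>i<N xs []. tp (int i) = sym (B xs [i])) \<and> tp (int (N xs [])) = 0)"
    using PT_output[OF assms] by metis
  obtain C e where pb: "\<And>n. p n \<le> C * (n + 1) ^ e" using M(2) unfolding polyb_def by blast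
  \<comment> \<open>The required form of the bound is reached by (n + 1) ^ e \<le> (2 * n) ^ e for
    positive n; the additive constant covers n = 0.\<close>
  have pb2: "p n \<le> (C * 2 ^ e) * n ^ e + C * 2 ^ e" for n
  proof (cases "n = 0")
    case True
    have "p 0 \<le> C" using pb[of 0] by simp
    also have "C \<le> C * 2 ^ e" by simp
    finally have "p 0 \<le> C * 2 ^ e" .
    then show ?thesis using True by (simp add: trans_le_add2)
  next
    case False
    then have "(n + 1) ^ e \<le> (2 * n) ^ e" by (intro power_mono) auto
    then have "C * (n + 1) ^ e \<le> C * (2 * n) ^ e" by (rule mult_le_mono2)
    also have "\<dots> = (C * 2 ^ e) * n ^ e" by (simp only: power_mult_distrib mult.assoc)
    finally show ?thesis using pb[of n] by linarith
  qed
  have "computes_in M (\<lambda>x. map (\<lambda>i. B (map sym x) [i]) [0..<N (map sym x) []]) (\<lambda>n. (C * 2 ^ e) * n ^ e + C * 2 ^ e)"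
    unfolding computes_in_def
  proof
    fix x
    let ?xs = "map sym x"
    have "set ?xs \<subseteq> {1, 2, 3}" by (auto simp: sym_def)
    from r[OF this] obtain t tp where t: "t \<le> p (length x)" "(astep M ^^ t) (0, 0, tape_of ?xs) = (1, 0, tp)"
      "\<forall>i<N ?xs []. tp (int i) = sym (B ?xs [i])" "tp (int (N ?xs [])) = 0"
      by auto
    have rel: "cfg_rel ((tm_step M ^^ t) (init_config x)) (1, 0, tp)"
      using cfg_rel_funpow[OF cfg_rel_init, where M = M and t = t and x1 = x] t(2) by simp
    have "tm_output ((tm_step M ^^ t) (init_config x)) = map sym (map (\<lambda>i. B ?xs [i]) [0..<N ?xs []])"
      by (rule cfg_rel_output[OF rel]) (use t in \<open>auto simp: sym_def\<close>)
    moreover have "fst ((tm_step M ^^ t) (init_config x)) = 1" using cfg_rel_fst[OF rel] by simp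
    moreover have "t \<le> (C * 2 ^ e) * length x ^ e + C * 2 ^ e" using t(1) pb2 le_trans by blast
    ultimately show "\<exists>t\<le>(C * 2 ^ e) * length x ^ e + C * 2 ^ e. fst ((tm_step M ^^ t) (init_config x)) = 1 \<and>
      tm_output ((tm_step M ^^ t) (init_config x)) = map sym (map (\<lambda>i. B ?xs [i]) [0..<N ?xs []])"
      by blast
  qed
  then show ?thesis unfolding poly_computable_def using M(1) by blast
qed

section \<open>Polynomial-time evaluation of triangles\<close>

text \<open>The value on top of the triangle with base a, ..., a + d. The recursion branches, but
  computed row by row it takes a quadratic number of steps.\<close>

primrec tri :: "('a \<Rightarrow> 'a \<Rightarrow> 'a) \<Rightarrow> (nat \<Rightarrow> 'a) \<Rightarrow> nat \<Rightarrow> nat \<Rightarrow> 'a" where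
  "tri f \<nu> 0 a = \<nu> a"
| "tri f \<nu> (Suc d) a = f (tri f \<nu> d a) (tri f \<nu> d (Suc a))"

fun stor :: "nat \<Rightarrow> nat \<Rightarrow> nat \<Rightarrow> nat \<Rightarrow> nat \<Rightarrow> cmd" where
  "stor j v w a 0 = Skip"
| "stor j v w a (Suc k) = IfZ w (Wr j v a) (Dec w ;; stor j v w (Suc a) k)"

text \<open>The combining function is arbitrary on numbers below a constant, so its table is
  compiled into nested case distinctions. \<open>sw1\<close> reads the left entry;
  \<open>sw2\<close> reads the right one and overwrites the left one with the result.\<close>

primrec sw2 :: "nat \<Rightarrow> (nat \<Rightarrow> nat) \<Rightarrow> nat \<Rightarrow> cmd" where
  "sw2 p g 0 = Skip"
| "sw2 p g (Suc k) = Cs 2 p k (Dec p ;; Wr 2 p (g k) ;; Inc p) (sw2 p g k)"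

primrec sw1 :: "nat \<Rightarrow> (nat \<Rightarrow> nat \<Rightarrow> nat) \<Rightarrow> nat \<Rightarrow> nat \<Rightarrow> cmd" where
  "sw1 p f K 0 = Skip"
| "sw1 p f K (Suc k) = Cs 2 p k (Inc p ;; sw2 p (f k) K) (sw1 p f K k)"

lemma RA_conv: "RA c s arr B s1 a1 \<Longrightarrow> s1 = s2 \<Longrightarrow> a1 = a2 \<Longrightarrow> B \<le> B' \<Longrightarrow> RA c s arr B' s2 a2"
  by (auto intro: RA_le)

lemma RA_stor:
  "s w < k \<Longrightarrow> v \<noteq> w \<Longrightarrow> RA (stor j v w a k) s arr (3 * k + 2) (s(w := 0)) (arr(j := (arr j)(s v := a + s w)))"
proof (induction k arbitrary: a s)
  case (Suc k)
  show ?case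
  proof (cases "s w")
    case 0
    have "RA (stor j v w a (Suc k)) s arr (1 + 1) s (arr(j := (arr j)(s v := a)))"
      unfolding stor.simps by (rule RA_IfZ) (simp only: 0 refl if_True RA_Wr)
    then show ?thesis by (rule RA_conv) (use 0 in \<open>auto simp: fun_eq_iff\<close>)
  next
    case n: (Suc n)
    let ?s = "s(w := s w - 1)"
    have "RA (stor j v w (Suc a) k) ?s arr (3 * k + 2) (?s(w := 0)) (arr(j := (arr j)(?s v := Suc a + ?s w)))"
      using Suc.prems n by (intro Suc.IH) auto
    note RA_Seq[OF RA_Dec this]
    then have "RA (stor j v w a (Suc k)) s arr (1 + (3 * k + 2) + 1 + 1) (?s(w := 0)) (arr(j := (arr j)(?s v := Suc a + ?s w)))"
      unfolding stor.simps by (intro RA_IfZ) (simp only: n if_False nat.simps)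
    then show ?thesis by (rule RA_conv) (use n Suc.prems in \<open>auto simp: fun_eq_iff\<close>)
  qed
qed simp

lemma RA_sw2:
  "arr 2 (s p) < k \<Longrightarrow> s p = Suc a \<Longrightarrow>
   RA (sw2 p g k) s arr (k + 6) s (arr(2 := (arr 2)(a := g (arr 2 (s p)))))"
proof (induction k)
  case (Suc k)
  show ?case
  proof (cases "arr 2 (s p) = k")
    case True
    let ?s = "s(p := s p - 1)"
    have "RA (Dec p ;; Wr 2 p (g k) ;; Inc p) s arr (1 + (1 + 1 + 1) + 1) (?s(p := Suc (?s p))) (arr(2 := (arr 2)(?s p := g k)))"
      by (rule RA_Seq[OF RA_Dec RA_Seq[OF RA_Wr RA_Inc]])
    then have "RA (sw2 p g (Suc k)) s arr (1 + (1 + 1 + 1) + 1 + 1) (?s(p := Suc (?s p))) (arr(2 := (arr 2)(?s p := g k)))"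
      unfolding sw2.simps by (intro RA_Cs) (simp only: True refl if_True)
    then show ?thesis by (rule RA_conv) (use True Suc.prems in \<open>auto simp: fun_eq_iff\<close>)
  next
    case False
    then have "RA (sw2 p g k) s arr (k + 6) s (arr(2 := (arr 2)(a := g (arr 2 (s p)))))"
      using Suc.prems by (intro Suc.IH) auto
    then have "RA (sw2 p g (Suc k)) s arr (k + 6 + 1) s (arr(2 := (arr 2)(a := g (arr 2 (s p)))))"
      unfolding sw2.simps by (intro RA_Cs) (simp only: False if_False)
    then show ?thesis by (rule RA_conv) (auto simp: fun_eq_iff)
  qed
qed simp

lemma RA_sw1:
  "arr 2 a < k \<Longrightarrow> arr 2 (Suc a) < K \<Longrightarrow> s p = a \<Longrightarrow>
   RA (sw1 p f K k) s arr (k + K + 9) (s(p := Suc a)) (arr(2 := (arr 2)(a := f (arr 2 a) (arr 2 (Suc a)))))"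
proof (induction k)
  case (Suc k)
  show ?case
  proof (cases "arr 2 (s p) = k")
    case True
    let ?s = "s(p := Suc (s p))"
    have "RA (sw2 p (f k) K) ?s arr (K + 6) ?s (arr(2 := (arr 2)(a := f k (arr 2 (?s p)))))"
      by (rule RA_sw2) (use Suc.prems in auto)
    note RA_Seq[OF RA_Inc this]
    then have "RA (sw1 p f K (Suc k)) s arr (1 + (K + 6) + 1 + 1) ?s (arr(2 := (arr 2)(a := f k (arr 2 (?s p)))))"
      unfolding sw1.simps by (intro RA_Cs) (simp only: True refl if_True)
    then show ?thesis by (rule RA_conv) (use True Suc.prems in \<open>auto simp: fun_eq_iff\<close>)
  next
    case False
    then have "RA (sw1 p f K k) s arr (k + K + 9) (s(p := Suc a)) (arr(2 := (arr 2)(a := f (arr 2 a) (arr 2 (Suc a)))))"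
      using Suc.prems by (intro Suc.IH) auto
    then have "RA (sw1 p f K (Suc k)) s arr (k + K + 9 + 1) (s(p := Suc a)) (arr(2 := (arr 2)(a := f (arr 2 a) (arr 2 (Suc a)))))"
      unfolding sw1.simps by (intro RA_Cs) (simp only: False if_False)
    then show ?thesis by (rule RA_conv) (auto simp: fun_eq_iff)
  qed
qed simp

lemma keep1_upd: "keep 1 arr0 arr \<Longrightarrow> keep 1 arr0 (arr(2 := b))"
  by (auto simp: keep_def)

text \<open>One array suffices: entry j of the next row depends on entries j and j + 1 only, so a
  sweep from left to right may overwrite entry j as soon as it has been used.\<close>

lemma PT_tri:
  assumes "PT 0 m T" "PT 0 (Suc m) (\<lambda>x env. I x (take m env) (env ! m))"
    and IK: "\<And>x env j. set x \<subseteq> {1, 2, 3} \<Longrightarrow> length env = m \<Longrightarrow> I x env j < K"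
    and fK: "\<And>a b. a < K \<Longrightarrow> b < K \<Longrightarrow> f a b < K"
  shows "PT 1 m (\<lambda>x env. tri f (I x env) (T x env) 0)"
proof -
  obtain cT p1 where p1: "polyb p1" and
    r1: "\<And>x env arr. set x \<subseteq> {1, 2, 3} \<Longrightarrow> length env = m \<Longrightarrow> ina x arr \<Longrightarrow>
      R 0 cT (nthd env) arr (p1 (length x + sum_list env)) ((nthd env)(m := T x env))"
    "\<And>x env. set x \<subseteq> {1, 2, 3} \<Longrightarrow> length env = m \<Longrightarrow> T x env \<le> p1 (length x + sum_list env)"
    using PTE[OF assms(1)] by metis
  have I': "PT 0 (m + 1) (\<lambda>x env. I x (take m env) (env ! m))" using assms(2) by (simp add: One_nat_def)
  obtain cI p2 where p2: "polyb p2" and r2: "\<And>x env1 ins env2 arr. set x \<subseteq> {1, 2, 3} \<Longrightarrow> length env1 = m \<Longrightarrow>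
      length ins = 1 \<Longrightarrow> length env2 = 1 \<Longrightarrow> ina x arr \<Longrightarrow>
      R 0 cI (nthd (env1 @ ins @ env2)) arr (p2 (length x + sum_list env1 + sum_list env2))
        ((nthd (env1 @ ins @ env2))(m + 1 + 1 := I x (take m (env1 @ env2)) ((env1 @ env2) ! m)))"
    using PT_insert[OF I', of 1] by metis
  let ?cs = "cpy m (m + 1) (m + 2)"
  let ?b1 = "Dec (m + 1) ;; cI ;; stor 2 (m + 1) (m + 2) 0 K"
  let ?b3 = "Dec (m + 3) ;; sw1 (m + 2) f K K"
  let ?b2 = "Dec (m + 1) ;; cpy m (m + 3) (m + 4) ;; Wh (m + 3) ?b3 ;; clr (m + 2)"
  let ?P1 = "?cs ;; Inc (m + 1) ;; Wh (m + 1) ?b1"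
  let ?P2 = "?cs ;; Wh (m + 1) ?b2"
  let ?P3 = "clr m ;; load 2 m K"
  let ?c = "cT ;; ?P1 ;; ?P2 ;; ?P3"
  define B1 where "B1 = (\<lambda>M. 1 + (p2 (M + p1 M + 1) + (3 * K + 2) + 1) + 1)"
  define B3 where "B3 = 1 + (K + K + 9) + (1::nat)"
  define B2 where "B2 = (\<lambda>M. 1 + ((10 * p1 M + 3) + ((p1 M * (B3 + 1) + 1) + (2 * p1 M + 1) + 1) + 1) + 1)"
  define Q1 where "Q1 = (\<lambda>M. (10 * p1 M + 3) + (1 + ((p1 M + 1) * (B1 M + 1) + 1) + 1) + 1)"
  define Q2 where "Q2 = (\<lambda>M. (10 * p1 M + 3) + (p1 M * (B2 M + 1) + 1) + 1)"
  define Q3 where "Q3 = (\<lambda>M. (2 * p1 M + 1) + (5 * K + 5) + 1)"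
  define Q where "Q = (\<lambda>M. p1 M + (Q1 M + (Q2 M + Q3 M + 1) + 1) + 1)"
  have "polyb B1" unfolding B1_def by (intro polyb_comp[OF p2] polyb_add polyb_id polyb_const p1)
  moreover have "polyb B2" unfolding B2_def by (intro polyb_add polyb_mult polyb_const p1)
  ultimately have Q: "polyb Q" unfolding Q_def Q1_def Q2_def Q3_def
    by (intro polyb_add polyb_mult polyb_const p1)
  show ?thesis
  proof (rule PTI[of Q _ _ ?c])
    show "polyb Q" by (rule Q)
    fix x env :: "nat list" and arr :: "nat \<Rightarrow> nat \<Rightarrow> nat"
    assume h: "set x \<subseteq> {1, 2, 3}" "length env = m" "ina x arr"
    let ?M = "length x + sum_list env"
    define N where "N = T x env"
    define t where "t = p1 ?M"
    define \<nu> where "\<nu> = I x env"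
    have Nt: "N \<le> t" using r1(2)[OF h(1,2)] by (simp add: N_def t_def)
    define \<sigma> where "\<sigma> = (\<lambda>c p r. (nthd env)(m := N, m + 1 := c, m + 2 := p, m + 3 := r))"
    have e0: "nthd env v = 0" if "m \<le> v" for v using that h(2) by simp
    have s0: "(nthd env)(m := N) = \<sigma> 0 0 0" using e0 by (auto simp: \<sigma>_def fun_eq_iff)
    have a0: "RA cT (nthd env) arr t (\<sigma> 0 0 0) arr"
      using RA_R0[OF r1(1)[OF h]] s0 by (simp add: N_def t_def)
    have cs: "RA ?cs (\<sigma> 0 0 0) a (10 * t + 3) (\<sigma> N 0 0) a" for a
    proof -
      have "RA ?cs (\<sigma> 0 0 0) a (10 * (\<sigma> 0 0 0) m + 3) ((\<sigma> 0 0 0)(m + 1 := (\<sigma> 0 0 0) (m + 1) + (\<sigma> 0 0 0) m)) a"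
        by (rule RA_cpy) (auto simp: \<sigma>_def)
      then show ?thesis by (rule RA_conv) (use Nt in \<open>auto simp: \<sigma>_def fun_eq_iff\<close>)
    qed
    have inc: "RA (Inc (m + 1)) (\<sigma> N 0 0) a 1 (\<sigma> (Suc N) 0 0) a" for a
      by (rule RA_conv[OF RA_Inc]) (auto simp: \<sigma>_def fun_eq_iff)
    have dec: "RA (Dec (m + 1)) (\<sigma> (Suc i) 0 0) a 1 (\<sigma> i 0 0) a" for a i
      by (rule RA_conv[OF RA_Dec]) (auto simp: \<sigma>_def fun_eq_iff)
    define Inv1 where "Inv1 = (\<lambda>i a. keep 1 arr a \<and> (\<forall>j. i \<le> j \<and> j \<le> N \<longrightarrow> a 2 j = \<nu> j))"
    have body1: "\<exists>a'. Inv1 i a' \<and> RA ?b1 (\<sigma> (Suc i) 0 0) a (B1 ?M) (\<sigma> i 0 0) a'"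
      if i: "i < Suc N" and I: "Inv1 (Suc i) a" for i a
    proof -
      have st: "nthd (env @ [N] @ [i]) = \<sigma> i 0 0"
        using h(2) e0 by (auto simp: \<sigma>_def fun_eq_iff nthd_snoc2 One_nat_def)
      have "R 0 cI (nthd (env @ [N] @ [i])) a (p2 (length x + sum_list env + sum_list [i]))
        ((nthd (env @ [N] @ [i]))(m + 1 + 1 := I x (take m (env @ [i])) ((env @ [i]) ! m)))"
        by (rule r2) (use h I keep_ina[of 1 arr a] in \<open>auto simp: Inv1_def\<close>)
      then have "RA cI (\<sigma> i 0 0) a (p2 (?M + i)) ((\<sigma> i 0 0)(m + 1 + 1 := \<nu> i)) a"
        unfolding st using h(2) by (intro RA_R0) (simp add: \<nu>_def nth_append)
      then have ci: "RA cI (\<sigma> i 0 0) a (p2 (?M + p1 ?M + 1)) (\<sigma> i (\<nu> i) 0) a"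
      proof (rule RA_conv)
        show "p2 (?M + i) \<le> p2 (?M + p1 ?M + 1)"
          by (rule polyb_mono[OF p2]) (use i Nt in \<open>simp add: t_def\<close>)
      qed (auto simp: \<sigma>_def fun_eq_iff)
      let ?a = "a(2 := (a 2)(i := \<nu> i))"
      have "RA (stor 2 (m + 1) (m + 2) 0 K) (\<sigma> i (\<nu> i) 0) a (3 * K + 2) ((\<sigma> i (\<nu> i) 0)(m + 2 := 0))
        (a(2 := (a 2)((\<sigma> i (\<nu> i) 0) (m + 1) := 0 + (\<sigma> i (\<nu> i) 0) (m + 2))))"
        by (rule RA_stor) (use IK[OF h(1,2)] in \<open>auto simp: \<sigma>_def \<nu>_def\<close>)
      then have "RA (stor 2 (m + 1) (m + 2) 0 K) (\<sigma> i (\<nu> i) 0) a (3 * K + 2) (\<sigma> i 0 0) ?a"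
        by (rule RA_conv) (auto simp: \<sigma>_def fun_eq_iff)
      from RA_Seq[OF dec RA_Seq[OF ci this]] have "RA ?b1 (\<sigma> (Suc i) 0 0) a (B1 ?M) (\<sigma> i 0 0) ?a"
        unfolding B1_def .
      moreover have "Inv1 i ?a" using I by (auto simp: Inv1_def keep1_upd)
      ultimately show ?thesis by blast
    qed
    have "Inv1 (Suc N) arr" by (simp add: Inv1_def)
    with RA_loop[of "Suc N" Inv1 ?b1 "\<lambda>i. \<sigma> i 0 0" "B1 ?M" "m + 1" "Suc N" arr, OF body1]
    obtain a1 where a1: "Inv1 0 a1" "RA (Wh (m + 1) ?b1) (\<sigma> (Suc N) 0 0) arr (Suc N * (B1 ?M + 1) + 1) (\<sigma> 0 0 0) a1"
      by (auto simp: \<sigma>_def)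
    have "Suc N * (B1 ?M + 1) + 1 \<le> (p1 ?M + 1) * (B1 ?M + 1) + 1"
      using Nt unfolding t_def by (intro add_mono mult_le_mono) auto
    then have P1: "RA ?P1 (\<sigma> 0 0 0) arr (Q1 ?M) (\<sigma> 0 0 0) a1"
      unfolding Q1_def using cs inc a1(2) unfolding t_def by (intro RA_Seq) (auto intro: RA_le)
    \<comment> \<open>Every round sweeps the same N pairs. Entries outside the shrinking row become
      meaningless, but they stay below \<open>K\<close>, so the table lookup remains
      defined.\<close>
    define Inv2 where "Inv2 = (\<lambda>i a. keep 1 arr a \<and> (\<forall>j\<le>N. a 2 j < K) \<and> (\<forall>j. j + (N - i) \<le> N \<longrightarrow> a 2 j = tri f \<nu> (N - i) j))"
    have body2: "\<exists>a'. Inv2 i a' \<and> RA ?b2 (\<sigma> (Suc i) 0 0) a (B2 ?M) (\<sigma> i 0 0) a'"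
      if i: "i < N" and I: "Inv2 (Suc i) a" for i a
    proof -
      \<comment> \<open>With r pairs left, the entries below N - r are new and the others still
        old.\<close>
      define Inv3 where "Inv3 = (\<lambda>r a'. keep 1 arr a' \<and> a' 2 = (\<lambda>j. if j < N - r then f (a 2 j) (a 2 (Suc j)) else a 2 j))"
      have aK: "a 2 j < K" if "j \<le> N" for j using I that by (simp add: Inv2_def)
      have body3: "\<exists>a''. Inv3 r a'' \<and> RA ?b3 (\<sigma> i (N - Suc r) (Suc r)) a' B3 (\<sigma> i (N - r) r) a''"
        if r: "r < N" and I3: "Inv3 (Suc r) a'" for r a'
      proof -
        let ?j = "N - Suc r"
        have sj: "Suc ?j = N - r" using r by simp
        have aj: "a' 2 ?j = a 2 ?j" "a' 2 (Suc ?j) = a 2 (Suc ?j)" using I3 by (simp_all add: Inv3_def)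
        have d: "RA (Dec (m + 3)) (\<sigma> i ?j (Suc r)) a' 1 (\<sigma> i ?j r) a'"
          by (rule RA_conv[OF RA_Dec]) (auto simp: \<sigma>_def fun_eq_iff)
        let ?a = "a'(2 := (a' 2)(?j := f (a' 2 ?j) (a' 2 (Suc ?j))))"
        have "RA (sw1 (m + 2) f K K) (\<sigma> i ?j r) a' (K + K + 9) ((\<sigma> i ?j r)(m + 2 := Suc ?j)) ?a"
          by (rule RA_sw1) (use aK[of ?j] aK[of "Suc ?j"] aj r in \<open>auto simp: \<sigma>_def\<close>)
        then have "RA (sw1 (m + 2) f K K) (\<sigma> i ?j r) a' (K + K + 9) (\<sigma> i (N - r) r) ?a"
          by (rule RA_conv) (use sj in \<open>auto simp: \<sigma>_def fun_eq_iff\<close>)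
        from RA_Seq[OF d this] have "RA ?b3 (\<sigma> i ?j (Suc r)) a' B3 (\<sigma> i (N - r) r) ?a"
          unfolding B3_def .
        moreover have "Inv3 r ?a"
        proof -
          have "j < N - r \<longleftrightarrow> j < ?j \<or> j = ?j" for j using r by auto
          then show ?thesis using I3 aj by (auto simp: Inv3_def keep1_upd fun_eq_iff)
        qed
        ultimately show ?thesis by blast
      qed
      have "Inv3 N a" using I by (simp add: Inv3_def Inv2_def)
      with RA_loop[of N Inv3 ?b3 "\<lambda>r. \<sigma> i (N - r) r" B3 "m + 3" N a, OF body3]
      obtain a' where a': "Inv3 0 a'" "RA (Wh (m + 3) ?b3) (\<sigma> i 0 N) a (N * (B3 + 1) + 1) (\<sigma> i N 0) a'"
        by (auto simp: \<sigma>_def)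
      have lp: "RA (Wh (m + 3) ?b3) (\<sigma> i 0 N) a (p1 ?M * (B3 + 1) + 1) (\<sigma> i N 0) a'"
        using a'(2) by (rule RA_le) (use Nt in \<open>simp add: t_def\<close>)
      have "RA (cpy m (m + 3) (m + 4)) (\<sigma> i 0 0) a (10 * (\<sigma> i 0 0) m + 3)
        ((\<sigma> i 0 0)(m + 3 := (\<sigma> i 0 0) (m + 3) + (\<sigma> i 0 0) m)) a"
        by (rule RA_cpy) (use e0 in \<open>auto simp: \<sigma>_def\<close>)
      then have cp: "RA (cpy m (m + 3) (m + 4)) (\<sigma> i 0 0) a (10 * p1 ?M + 3) (\<sigma> i 0 N) a"
        by (rule RA_conv) (use Nt in \<open>auto simp: \<sigma>_def fun_eq_iff t_def\<close>)
      have cl: "RA (clr (m + 2)) (\<sigma> i N 0) a' (2 * p1 ?M + 1) (\<sigma> i 0 0) a'"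
        by (rule RA_conv[OF RA_clr]) (use Nt in \<open>auto simp: \<sigma>_def fun_eq_iff t_def\<close>)
      from RA_Seq[OF dec RA_Seq[OF cp RA_Seq[OF lp cl]]]
      have "RA ?b2 (\<sigma> (Suc i) 0 0) a (B2 ?M) (\<sigma> i 0 0) a'" unfolding B2_def .
      moreover have "Inv2 i a'"
        unfolding Inv2_def
      proof (intro conjI allI impI)
        show "keep 1 arr a'" using a'(1) by (simp add: Inv3_def)
        show "a' 2 j < K" if "j \<le> N" for j using a'(1) aK that fK by (auto simp: Inv3_def)
        fix j assume j: "j + (N - i) \<le> N"
        have ni: "N - i = Suc (N - Suc i)" using i by simp
        have "j < N" using j i by simp
        then have "a' 2 j = f (a 2 j) (a 2 (Suc j))" using a'(1) by (simp add: Inv3_def)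
        moreover have "a 2 j = tri f \<nu> (N - Suc i) j" "a 2 (Suc j) = tri f \<nu> (N - Suc i) (Suc j)"
          using I j ni by (auto simp: Inv2_def)
        ultimately show "a' 2 j = tri f \<nu> (N - i) j" unfolding ni by simp
      qed
      ultimately show ?thesis by blast
    qed
    have "Inv2 N a1" using a1(1) IK[OF h(1,2)] by (auto simp: Inv1_def Inv2_def \<nu>_def)
    with RA_loop[of N Inv2 ?b2 "\<lambda>i. \<sigma> i 0 0" "B2 ?M" "m + 1" N a1, OF body2]
    obtain a2 where a2: "Inv2 0 a2" "RA (Wh (m + 1) ?b2) (\<sigma> N 0 0) a1 (N * (B2 ?M + 1) + 1) (\<sigma> 0 0 0) a2"
      by (auto simp: \<sigma>_def)
    have "N * (B2 ?M + 1) + 1 \<le> p1 ?M * (B2 ?M + 1) + 1"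
      using Nt unfolding t_def by (intro add_mono mult_le_mono) auto
    then have P2: "RA ?P2 (\<sigma> 0 0 0) a1 (Q2 ?M) (\<sigma> 0 0 0) a2"
      unfolding Q2_def using cs a2(2) unfolding t_def by (intro RA_Seq) (auto intro: RA_le)
    have res: "a2 2 0 = tri f \<nu> N 0" "a2 2 0 < K" using a2(1) by (auto simp: Inv2_def)
    have "RA (clr m) (\<sigma> 0 0 0) a2 (2 * p1 ?M + 1) (nthd env) a2"
      by (rule RA_conv[OF RA_clr]) (use Nt e0 in \<open>auto simp: \<sigma>_def fun_eq_iff t_def\<close>)
    moreover have "RA (load 2 m K) (nthd env) a2 (5 * K + 5) ((nthd env)(m := tri f \<nu> N 0)) a2"
      by (rule RA_conv[OF RA_load]) (use res e0 in auto)
    ultimately have P3: "RA ?P3 (\<sigma> 0 0 0) a2 (Q3 ?M) ((nthd env)(m := tri f \<nu> N 0)) a2"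
      unfolding Q3_def by (rule RA_Seq)
    have "RA ?c (nthd env) arr (Q ?M) ((nthd env)(m := tri f \<nu> N 0)) a2"
      unfolding Q_def by (rule RA_Seq[OF a0[unfolded t_def] RA_Seq[OF P1 RA_Seq[OF P2 P3]]])
    then show "R 1 ?c (nthd env) arr (Q ?M) ((nthd env)(m := tri f (I x env) (T x env) 0))"
      using a2(1) unfolding Inv2_def \<nu>_def N_def by (blast intro: R_RA)
  qed
qed

section \<open>Space-time diagrams\<close>

type_synonym tc = "nat \<times> nat \<times> nat"

text \<open>A cell of the space-time diagram of a machine is (symbol, head, flag): the head entry is 0 or the
  successor of the state; after halting the flag 1 (accept) or 2 (reject) spreads from the head.\<close>

fun rule :: "tm \<Rightarrow> tc \<Rightarrow> tc \<Rightarrow> tc \<Rightarrow> tc" where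
  "rule (Q, S, \<delta>) (s1, h1, f1) (s2, h2, f2) (s3, h3, f3) =
    ((if h2 = 0 \<or> h2 = 2 then s2 else fst (snd (\<delta> (h2 - 1) s2))),
     (if h2 = 2 then 2
      else if h2 \<noteq> 0 \<and> snd (snd (\<delta> (h2 - 1) s2)) = Stay then Suc (fst (\<delta> (h2 - 1) s2))
      else if h1 \<noteq> 0 \<and> h1 \<noteq> 2 \<and> snd (snd (\<delta> (h1 - 1) s1)) = Rgt then Suc (fst (\<delta> (h1 - 1) s1))
      else if h3 \<noteq> 0 \<and> h3 \<noteq> 2 \<and> snd (snd (\<delta> (h3 - 1) s3)) = Lft then Suc (fst (\<delta> (h3 - 1) s3))
      else 0),
     (if f1 \<noteq> 0 then f1 else if f2 \<noteq> 0 then f2 else if f3 \<noteq> 0 then f3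
      else if h2 = 2 then (if s2 = 2 then 1 else 2) else 0))"

primrec tcell :: "tm \<Rightarrow> (int \<Rightarrow> nat) \<Rightarrow> nat \<Rightarrow> int \<Rightarrow> tc" where
  "tcell M \<tau> 0 z = (\<tau> z, (if z = 0 then 1 else 0), 0)"
| "tcell M \<tau> (Suc t) z = rule M (tcell M \<tau> t (z - 1)) (tcell M \<tau> t z) (tcell M \<tau> t (z + 1))"

definition acell :: "acfg \<Rightarrow> int \<Rightarrow> nat \<times> nat" where
  "acell A z = (case A of (q, p, tp) \<Rightarrow> (tp z, if z = p then Suc q else 0))"

lemma rule_astep:
  assumes "rule M (fst (acell A (z - 1)), snd (acell A (z - 1)), f1) (fst (acell A z), snd (acell A z), f2)
    (fst (acell A (z + 1)), snd (acell A (z + 1)), f3) = (s, h, f)"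
  shows "(s, h) = acell (astep M A) z"
proof -
  obtain Q S \<delta> where M: "M = (Q, S, \<delta>)" by (cases M) auto
  obtain q p tp where A: "A = (q, p, tp)" by (cases A) auto
  obtain q' a d where d: "\<delta> q (tp p) = (q', a, d)" by (cases "\<delta> q (tp p)") auto
  consider "z = p" | "z = p + 1" | "z = p - 1" | "z \<noteq> p" "z \<noteq> p + 1" "z \<noteq> p - 1" by blast
  then show ?thesis
    using assms by cases (cases "q = 1"; cases d; auto simp: M A acell_def d One_nat_def)+
qed

lemma tcell_acell_pair:
  "fst (tcell M \<tau> t z) = fst (acell ((astep M ^^ t) (0, 0, \<tau>)) z) \<and>
   fst (snd (tcell M \<tau> t z)) = snd (acell ((astep M ^^ t) (0, 0, \<tau>)) z)"
proof (induction t arbitrary: z)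
  case 0
  show ?case by (auto simp: acell_def One_nat_def)
next
  case (Suc t)
  let ?A = "(astep M ^^ t) (0, 0, \<tau>)"
  have c: "tcell M \<tau> t y = (fst (acell ?A y), snd (acell ?A y), snd (snd (tcell M \<tau> t y)))" for y
    using Suc[of y] by (metis prod.collapse)
  obtain s h f where r: "tcell M \<tau> (Suc t) z = (s, h, f)" by (metis prod_cases3)
  have "(s, h) = acell (astep M ?A) z"
    by (rule rule_astep[of M ?A z "snd (snd (tcell M \<tau> t (z - 1)))" "snd (snd (tcell M \<tau> t z))"
          "snd (snd (tcell M \<tau> t (z + 1)))" s h f])
      (use r c in \<open>metis tcell.simps(2)\<close>)
  then show ?case
    unfolding r by (metis comp_apply fst_conv funpow.simps(2) snd_conv)
qed

lemmas tcell_acell = conjunct1[OF tcell_acell_pair] conjunct2[OF tcell_acell_pair]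

lemma rule_flag: "snd (snd (rule M a b c)) = (if snd (snd a) \<noteq> 0 then snd (snd a)
   else if snd (snd b) \<noteq> 0 then snd (snd b) else if snd (snd c) \<noteq> 0 then snd (snd c)
   else if fst (snd b) = 2 then (if fst b = 2 then 1 else 2) else 0)"
  by (cases M; cases a; cases b; cases c) auto

text \<open>The halted head raises the flag one step after the first halting time
  \<open>\<theta>\<close>, and the flag spreads by one cell per step in both directions. So it fills
  a cone with its tip at time \<open>\<theta>\<close> + 1 above the final head position.\<close>

lemma tcell_flag:
  assumes halt: "(astep M ^^ \<theta>) (0, 0, \<tau>) = (1, p, tp)"
    and first: "\<And>t. t < \<theta> \<Longrightarrow> fst ((astep M ^^ t) (0, 0, \<tau>)) \<noteq> 1"
  shows "snd (snd (tcell M \<tau> t z)) = (if int \<theta> + 1 + \<bar>z - p\<bar> \<le> int t then (if tp p = 2 then 1 else 2) else 0)"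
proof (induction t arbitrary: z)
  case (Suc t)
  let ?A = "(astep M ^^ t) (0, 0, \<tau>)"
  have after: "?A = (1, p, tp)" if "\<theta> \<le> t"
  proof -
    have "(astep M ^^ (\<theta> + (t - \<theta>))) (0, 0, \<tau>) = (1, p, tp)"
      by (rule funpow_trans[OF halt]) (rule astep_funpow_halted, simp)
    then show ?thesis using that by simp
  qed
  have hd: "fst (snd (tcell M \<tau> t z)) = 2 \<longleftrightarrow> \<theta> \<le> t \<and> z = p"
  proof (cases "\<theta> \<le> t")
    case True
    then show ?thesis using after[OF True] by (auto simp: tcell_acell acell_def One_nat_def)
  next
    case False
    then have "fst ?A \<noteq> 1" using first by simp
    then show ?thesis using False by (auto simp: tcell_acell acell_def One_nat_def split: prod.splits)
  qed
  have sy: "\<theta> \<le> t \<Longrightarrow> z = p \<Longrightarrow> fst (tcell M \<tau> t z) = tp p"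
    using after by (simp add: tcell_acell acell_def)
  show ?case
    unfolding tcell.simps rule_flag hd Suc using sy by auto
qed simp

text \<open>The head moves at most one cell per step. Read backwards this is a lower bound on the
  running time of a machine that changes a remote cell.\<close>

lemma astep_reach:
  assumes "(astep M ^^ t) (q, 0, \<tau>) = (q', p, tp)"
  shows "\<bar>p\<bar> \<le> int t" "\<And>z. int t \<le> z \<Longrightarrow> tp z = \<tau> z"
proof -
  have "\<bar>p\<bar> \<le> int t \<and> (\<forall>z. int t \<le> z \<longrightarrow> tp z = \<tau> z)" using assms
  proof (induction t arbitrary: q' p tp)
    case (Suc t)
    obtain q1 p1 tp1 where 1: "(astep M ^^ t) (q, 0, \<tau>) = (q1, p1, tp1)" by (metis prod_cases3)
    obtain Q S \<delta> where M: "M = (Q, S, \<delta>)" by (cases M) auto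
    obtain q2 a d where d: "\<delta> q1 (tp1 p1) = (q2, a, d)" by (cases "\<delta> q1 (tp1 p1)") auto
    have "\<bar>mv d\<bar> \<le> 1" by (cases d) auto
    then show ?case using Suc.IH[OF 1] Suc.prems 1 d by (auto simp: M split: if_splits)
  qed auto
  then show "\<bar>p\<bar> \<le> int t" "\<And>z. int t \<le> z \<Longrightarrow> tp z = \<tau> z" by auto
qed

lemma astep_first_halt:
  assumes "(astep M ^^ t) A = (1, p, tp)"
  obtains \<theta> where "\<theta> \<le> t" "(astep M ^^ \<theta>) A = (1, p, tp)" "\<And>t'. t' < \<theta> \<Longrightarrow> fst ((astep M ^^ t') A) \<noteq> 1"
proof -
  define \<theta> where "\<theta> = (LEAST t. fst ((astep M ^^ t) A) = 1)"
  have a: "fst ((astep M ^^ \<theta>) A) = 1" unfolding \<theta>_def by (rule LeastI[of _ t]) (simp add: assms)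
  have b: "\<theta> \<le> t" unfolding \<theta>_def by (rule Least_le) (simp add: assms)
  have "(astep M ^^ (\<theta> + (t - \<theta>))) A = (astep M ^^ \<theta>) A"
    by (rule funpow_trans[OF refl]) (rule astep_funpow_halted[OF a])
  then have "(astep M ^^ \<theta>) A = (1, p, tp)" using assms b by simp
  moreover have "fst ((astep M ^^ t') A) \<noteq> 1" if "t' < \<theta>" for t'
    using not_less_Least[OF that[unfolded \<theta>_def]] .
  ultimately show ?thesis using that b by blast
qed

text \<open>A vertex of the diagram has two parents, while a machine step needs three neighbouring
  cells. Hence rows alternate: a \<open>Cel\<close> holds a cell of either machine, a
  \<open>Par\<close> holds two neighbouring cells of either machine, and two rows make one step.
  \<open>Off\<close> switches a vertex off, \<open>Star\<close> reports an incomplete past, and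
  \<open>Dead\<close> is an ill-formed combination.\<close>

datatype val = Off | Star | Dead | Ini nat nat | Cel tc tc | Par tc tc tc tc

text \<open>Kinds of base cells: 2 blank on the left, 3/4 first input bit, 5/6 further input bits,
  7 witness slot (whose symbol is the choice \<open>c\<close>), 8 blank on the right.\<close>

definition icell :: "nat \<Rightarrow> nat \<Rightarrow> tc" where
  "icell k c = ((if k = 3 \<or> k = 5 then 1 else if k = 4 \<or> k = 6 then 2 else if k = 7 then c else 0),
     (if k = 3 \<or> k = 4 then 1 else 0), 0)"

text \<open>The verifier reads the chosen symbols, the second machine reads 3 in each slot and so
  cannot depend on the choice. Chosen witnesses may be padded by blanks on the right only; a blank
  slot before a filled one gives \<open>Dead\<close>, as the verifier would otherwise run on a word
  with a gap.\<close>

fun comb :: "tm \<Rightarrow> tm \<Rightarrow> val \<Rightarrow> val \<Rightarrow> val" where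
  "comb MA MC (Ini k c) (Ini k' c') = (if k = 7 \<and> k' = 7 \<and> c = 0 \<and> c' \<noteq> 0 then Dead
     else Par (icell k c) (icell k 3) (icell k' c') (icell k' 3))"
| "comb MA MC (Cel a b) (Cel c d) = Par a b c d"
| "comb MA MC (Par a b c d) (Par c' d' e f) = Cel (rule MA a c e) (rule MC b d f)"
| "comb MA MC _ _ = Dead"

text \<open>An apex of the form \<open>Cel\<close> objects exactly if the second machine has
  accepted and the verifier has rejected. A diagram of odd height ends in a \<open>Par\<close>,
  which is good.\<close>

fun good :: "val \<Rightarrow> bool" where
  "good Off = False"
| "good Star = False"
| "good Dead = False"
| "good (Cel a b) = (\<not> (snd (snd b) = 1 \<and> snd (snd a) = 2))"
| "good _ = True"

fun cflag :: "val \<Rightarrow> nat" where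
  "cflag (Cel a b) = snd (snd b)"
| "cflag _ = 0"

text \<open>The index is the left end of the interval a, ..., a + 2 t on which the cell depends, so
  the cell itself is at position a + t.\<close>

primrec grow :: "tm \<Rightarrow> (nat \<Rightarrow> tc) \<Rightarrow> nat \<Rightarrow> nat \<Rightarrow> tc" where
  "grow M r 0 a = r a"
| "grow M r (Suc t) a = rule M (grow M r t a) (grow M r t (Suc a)) (grow M r t (Suc (Suc a)))"

lemma tri_cong: "(\<And>j. a \<le> j \<Longrightarrow> j \<le> a + d \<Longrightarrow> \<nu> j = \<nu>' j) \<Longrightarrow> tri f \<nu> d a = tri f \<nu>' d a"
  by (induction d arbitrary: a) auto

lemma comb_Dead [simp]: "comb MA MC Dead v = Dead" "comb MA MC v Dead = Dead"
  by (cases v; simp)+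

text \<open>The gap shows one row above the base, and \<open>comb\<close> hands \<open>Dead\<close>
  on to every triangle that covers both slots.\<close>

lemma tri_Dead:
  assumes "\<nu> j = Ini 7 0" "\<nu> (Suc j) = Ini 7 c" "c \<noteq> 0"
  shows "a \<le> j \<Longrightarrow> j < a + d \<Longrightarrow> tri (comb MA MC) \<nu> d a = Dead"
proof (induction d arbitrary: a)
  case (Suc d)
  show ?case
  proof (cases "d = 0")
    case True
    then show ?thesis using Suc.prems assms by (cases "a = j") auto
  next
    case False
    show ?thesis
    proof (cases "j < a + d")
      case True
      then show ?thesis using Suc by simp
    next
      case F: False
      then have "tri (comb MA MC) \<nu> d (Suc a) = Dead" using Suc False by (intro Suc.IH) auto
      then show ?thesis by simp
    qed
  qed
qed simp

lemma tri_grow: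
  assumes "\<And>j. \<not> (k j = 7 \<and> k (Suc j) = 7 \<and> c j = 0 \<and> c (Suc j) \<noteq> 0)"
  shows "tri (comb MA MC) (\<lambda>j. Ini (k j) (c j)) (Suc (2 * t)) a =
      Par (grow MA (\<lambda>j. icell (k j) (c j)) t a) (grow MC (\<lambda>j. icell (k j) 3) t a)
        (grow MA (\<lambda>j. icell (k j) (c j)) t (Suc a)) (grow MC (\<lambda>j. icell (k j) 3) t (Suc a))"
    "tri (comb MA MC) (\<lambda>j. Ini (k j) (c j)) (2 * Suc t) a =
      Cel (grow MA (\<lambda>j. icell (k j) (c j)) (Suc t) a) (grow MC (\<lambda>j. icell (k j) 3) (Suc t) a)"
proof -
  have step: "tri (comb MA MC) (\<lambda>j. Ini (k j) (c j)) (2 * Suc t) a =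
      Cel (grow MA (\<lambda>j. icell (k j) (c j)) (Suc t) a) (grow MC (\<lambda>j. icell (k j) 3) (Suc t) a)"
    if "\<And>a. tri (comb MA MC) (\<lambda>j. Ini (k j) (c j)) (Suc (2 * t)) a =
      Par (grow MA (\<lambda>j. icell (k j) (c j)) t a) (grow MC (\<lambda>j. icell (k j) 3) t a)
        (grow MA (\<lambda>j. icell (k j) (c j)) t (Suc a)) (grow MC (\<lambda>j. icell (k j) 3) t (Suc a))" for t a
    using that[of a] that[of "Suc a"] by simp
  show 1: "tri (comb MA MC) (\<lambda>j. Ini (k j) (c j)) (Suc (2 * t)) a =
      Par (grow MA (\<lambda>j. icell (k j) (c j)) t a) (grow MC (\<lambda>j. icell (k j) 3) t a)
        (grow MA (\<lambda>j. icell (k j) (c j)) t (Suc a)) (grow MC (\<lambda>j. icell (k j) 3) t (Suc a))" for a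
  proof (induction t arbitrary: a)
    case 0
    then show ?case using assms by auto
  next
    case (Suc t)
    have "tri (comb MA MC) (\<lambda>j. Ini (k j) (c j)) (Suc (2 * Suc t)) a =
      comb MA MC (tri (comb MA MC) (\<lambda>j. Ini (k j) (c j)) (2 * Suc t) a)
        (tri (comb MA MC) (\<lambda>j. Ini (k j) (c j)) (2 * Suc t) (Suc a))"
      by (simp only: tri.simps)
    also have "\<dots> = Par (grow MA (\<lambda>j. icell (k j) (c j)) (Suc t) a) (grow MC (\<lambda>j. icell (k j) 3) (Suc t) a)
        (grow MA (\<lambda>j. icell (k j) (c j)) (Suc t) (Suc a)) (grow MC (\<lambda>j. icell (k j) 3) (Suc t) (Suc a))"
      unfolding step[OF Suc] by (simp only: comb.simps)
    finally show ?case .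
  qed
  show "tri (comb MA MC) (\<lambda>j. Ini (k j) (c j)) (2 * Suc t) a =
      Cel (grow MA (\<lambda>j. icell (k j) (c j)) (Suc t) a) (grow MC (\<lambda>j. icell (k j) 3) (Suc t) a)"
    by (rule step[OF 1])
qed

lemma grow_tcell:
  assumes "\<And>a. r a = tcell M \<tau> 0 (int a - i)"
  shows "grow M r t a = tcell M \<tau> t (int a + int t - i)"
proof (induction t arbitrary: a)
  case (Suc t)
  have "int a + int (Suc t) - i - 1 = int a + int t - i" "int (Suc a) + int t - i = int a + int (Suc t) - i"
    "int (Suc (Suc a)) + int t - i = int a + int (Suc t) - i + 1" by auto
  then show ?case by (simp only: grow.simps tcell.simps Suc)
qed (simp only: grow.simps assms of_nat_0 add_0_right)

text \<open>Heads arise from heads only, and flags from halted heads. So a base row without a start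
  cell never raises a flag.\<close>

lemma grow_headless:
  assumes "\<And>a. fst (snd (r a)) = 0 \<and> snd (snd (r a)) = 0"
  shows "fst (snd (grow M r t a)) = 0 \<and> snd (snd (grow M r t a)) = 0"
proof (induction t arbitrary: a)
  case (Suc t)
  have "fst (snd (rule M a b c)) = 0 \<and> snd (snd (rule M a b c)) = 0"
    if "fst (snd a) = 0 \<and> snd (snd a) = 0" "fst (snd b) = 0 \<and> snd (snd b) = 0" "fst (snd c) = 0 \<and> snd (snd c) = 0"
    for a b c using that by (cases M; cases a; cases b; cases c) auto
  then show ?case using Suc by simp
qed (simp add: assms)

section \<open>Format of base rows\<close>

definition cls :: "nat \<Rightarrow> nat" where
  "cls k = (if k = 2 then 0 else if k = 3 \<or> k = 4 then 1 else if k = 5 \<or> k = 6 then 2 else if k = 7 then 3 else 4)"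

text \<open>Along a row the classes rise from left blanks over the start cell, input and slots to
  right blanks. The start cell is not repeated, and left blanks lead to nothing but it. This speaks
  of neighbours only, so a pattern of constant size can test it.\<close>

definition adj :: "nat \<Rightarrow> nat \<Rightarrow> bool" where
  "adj l r = (cls l \<le> cls r \<and> \<not> (cls l = 1 \<and> cls r = 1) \<and> (cls l = 0 \<longrightarrow> cls r \<le> 1))"

definition rowok :: "(nat \<Rightarrow> nat) \<Rightarrow> nat \<Rightarrow> bool" where
  "rowok \<kappa> T = ((\<forall>j\<le>T. 2 \<le> \<kappa> j \<and> \<kappa> j \<le> 8) \<and> (\<forall>j<T. adj (\<kappa> j) (\<kappa> (Suc j))))"

definition choice :: "(nat \<Rightarrow> nat) \<Rightarrow> (nat \<Rightarrow> nat) \<Rightarrow> nat \<Rightarrow> bool" where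
  "choice \<kappa> c T = (\<forall>j\<le>T. c j < 3 \<and> (\<kappa> j \<noteq> 7 \<longrightarrow> c j = 0))"

definition solvable :: "tm \<Rightarrow> tm \<Rightarrow> (nat \<Rightarrow> nat) \<Rightarrow> nat \<Rightarrow> bool" where
  "solvable MA MC \<kappa> T = (\<exists>c. choice \<kappa> c T \<and> good (tri (comb MA MC) (\<lambda>j. Ini (\<kappa> j) (c j)) T 0))"

text \<open>The number of slots is exactly the witness bound, so every admissible witness fits after
  padding and none that is too long does.\<close>

definition goodv :: "(nat \<Rightarrow> nat) \<Rightarrow> nat list \<Rightarrow> bool" where
  "goodv pW v = (\<exists>x. v = map sym (pair_enc x []) @ replicate (pW (length x)) 3)"

lemma parity_cases: obtains "T = 0" | t where "T = Suc (2 * t)" | t where "T = 2 * Suc t"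
proof (cases "even T")
  case True
  then obtain s where "T = 2 * s" by (elim evenE)
  then show ?thesis using that(1) that(3) by (cases s) auto
next
  case False
  then show ?thesis using that(2) by (elim oddE) auto
qed

text \<open>Blanks in all slots leave no gap, so \<open>Dead\<close> does not occur, and without the
  flag of the second machine the apex does not object.\<close>

lemma good_no_flag:
  assumes "0 < T" "cflag (tri (comb MA MC) (\<lambda>j. Ini (\<kappa> j) 0) T 0) \<noteq> 1"
  shows "good (tri (comb MA MC) (\<lambda>j. Ini (\<kappa> j) 0) T 0)"
proof (cases T rule: parity_cases)
  case (2 t)
  then show ?thesis using tri_grow(1)[of \<kappa> "\<lambda>_. 0" MA MC t 0] by simp
next
  case (3 t)
  then show ?thesis using tri_grow(2)[of \<kappa> "\<lambda>_. 0" MA MC t 0] assms(2)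
    by (simp del: tri.simps mult_Suc_right grow.simps)
qed (use assms in simp)

lemma solvable_no_flag:
  assumes "0 < T" "cflag (tri (comb MA MC) (\<lambda>j. Ini (\<kappa> j) 0) T 0) \<noteq> 1"
  shows "solvable MA MC \<kappa> T"
  unfolding solvable_def choice_def using good_no_flag[OF assms] by (intro exI[of _ "\<lambda>_. 0"]) simp

lemma mono_threshold:
  fixes g :: "nat \<Rightarrow> nat"
  assumes "mono g" "b < g N"
  shows "\<exists>d. \<forall>l. g l \<le> b \<longleftrightarrow> l < d"
proof (intro exI allI)
  let ?d = "LEAST l. b < g l"
  have d: "b < g ?d" by (rule LeastI) (rule assms(2))
  fix l show "g l \<le> b \<longleftrightarrow> l < ?d"
  proof
    assume "g l \<le> b"
    then show "l < ?d" using d assms(1) by (metis leD leI le_trans monoD)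
  next
    assume "l < ?d"
    then show "g l \<le> b" using not_less_Least by (metis leI)
  qed
qed

lemma length_pair_enc: "length (pair_enc x w) = 2 * length x + 2 + length w"
  by (induction x) (auto simp: pair_enc_def)

lemma pair_enc_append: "pair_enc x w = pair_enc x [] @ w"
  by (simp add: pair_enc_def)

lemma pair_enc_Cons: "pair_enc (b # x) w = b # b # pair_enc x w"
  by (simp add: pair_enc_def)

lemma nth_pair_enc: "l < length x \<Longrightarrow> pair_enc x w ! (2 * l) = x ! l \<and> pair_enc x w ! Suc (2 * l) = x ! l"
proof (induction x arbitrary: l)
  case (Cons b x)
  then show ?case by (cases l) (auto simp: pair_enc_Cons)
qed simp

lemma row_format:
  assumes "rowok \<kappa> T" "i \<le> T" "\<kappa> i = 3 \<or> \<kappa> i = 4"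
  shows "\<And>j j'. j \<le> j' \<Longrightarrow> j' \<le> T \<Longrightarrow> cls (\<kappa> j) \<le> cls (\<kappa> j')"
    "\<And>j. j < i \<Longrightarrow> \<kappa> j = 2" "\<And>j. i < j \<Longrightarrow> j \<le> T \<Longrightarrow> 5 \<le> \<kappa> j"
proof -
  have ad: "\<And>j. j < T \<Longrightarrow> adj (\<kappa> j) (\<kappa> (Suc j))" and k: "\<And>j. j \<le> T \<Longrightarrow> 2 \<le> \<kappa> j \<and> \<kappa> j \<le> 8"
    using assms(1) by (auto simp: rowok_def)
  show mono: "cls (\<kappa> j) \<le> cls (\<kappa> j')" if "j \<le> j'" "j' \<le> T" for j j'
    using that
  proof (induction j')
    case (Suc j')
    show ?case
    proof (cases "j = Suc j'")
      case False
      then have "cls (\<kappa> j) \<le> cls (\<kappa> j')" using Suc by simp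
      also have "\<dots> \<le> cls (\<kappa> (Suc j'))" using ad[of j'] Suc by (simp add: adj_def)
      finally show ?thesis .
    qed simp
  qed simp
  have ci: "cls (\<kappa> i) = 1" using assms(3) by (auto simp: cls_def)
  show "\<kappa> j = 2" if ji: "j < i" for j
  proof -
    obtain i' where i': "i = Suc i'" using ji by (cases i) auto
    have "cls (\<kappa> i') \<le> 1" using mono[of i' i] assms(2) ci i' by simp
    moreover have "cls (\<kappa> i') \<noteq> 1" using ad[of i'] assms(2) ci i' by (simp add: adj_def)
    moreover have "cls (\<kappa> j) \<le> cls (\<kappa> i')" using mono[of j i'] ji i' assms(2) by simp
    ultimately have "cls (\<kappa> j) = 0" by simp
    then show ?thesis by (simp add: cls_def split: if_splits)
  qed
  show "5 \<le> \<kappa> j" if "i < j" "j \<le> T" for j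
  proof -
    have "cls (\<kappa> (Suc i)) \<ge> 1" "cls (\<kappa> (Suc i)) \<noteq> 1"
      using ad[of i] that ci by (auto simp: adj_def)
    moreover have "cls (\<kappa> (Suc i)) \<le> cls (\<kappa> j)" using mono[of "Suc i" j] that by simp
    ultimately have "2 \<le> cls (\<kappa> j)" by simp
    then show ?thesis using k[OF that(2)] by (simp add: cls_def split: if_splits)
  qed
qed

text \<open>The last condition on \<open>MC\<close> makes it a clock: the cell in question lies
  beyond the input and is blank at first, so filling it takes more than 2 * \<open>tA\<close>
  (length v) steps. By then the verdict of the verifier \<open>MA\<close> has spread far
  enough.\<close>

locale verifier =
  fixes MA MC :: tm and V L :: "bool list set" and tA pW TC :: "nat \<Rightarrow> nat"
  assumes tA_mono: "mono tA"
    and MA: "\<And>y. \<exists>t p tp. t \<le> tA (length y) \<and> (astep MA ^^ t) (0, 0, tape_of (map sym y)) = (1, p, tp) \<and>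
      tp p = (if y \<in> V then 2 else 1)"
    and MC: "\<And>v. set v \<subseteq> {1, 2, 3} \<Longrightarrow> \<exists>t tp. t \<le> TC (length v) \<and> (astep MC ^^ t) (0, 0, tape_of v) = (1, 0, tp) \<and>
      tp 0 = (if goodv pW v then 2 else 1) \<and> tp (int (2 * tA (length v) + length v)) \<noteq> 0"
    and L: "\<And>x. x \<in> L \<longleftrightarrow> (\<exists>w. length w \<le> pW (length x) \<and> pair_enc x w \<in> V)"
begin

lemma MC_halt:
  assumes "set v \<subseteq> {1, 2, 3}"
  obtains \<theta> where "\<theta> \<le> TC (length v)" "2 * tA (length v) \<le> \<theta>"
    "\<And>t z. snd (snd (tcell MC (tape_of v) t z)) =
      (if int \<theta> + 1 + \<bar>z\<bar> \<le> int t then (if goodv pW v then 1 else 2) else 0)"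
proof -
  obtain t tp where t: "t \<le> TC (length v)" "(astep MC ^^ t) (0, 0, tape_of v) = (1, 0, tp)"
    "tp 0 = (if goodv pW v then 2 else 1)" "tp (int (2 * tA (length v) + length v)) \<noteq> 0"
    using MC[OF assms] by blast
  obtain \<theta> where \<theta>: "\<theta> \<le> t" "(astep MC ^^ \<theta>) (0, 0, tape_of v) = (1, 0, tp)"
    "\<And>t'. t' < \<theta> \<Longrightarrow> fst ((astep MC ^^ t') (0, 0, tape_of v)) \<noteq> 1"
    using astep_first_halt[OF t(2)] by blast
  \<comment> \<open>Halting earlier would leave the remote cell out of reach and therefore
    blank.\<close>
  have "2 * tA (length v) \<le> \<theta>"
  proof (rule ccontr)
    assume "\<not> 2 * tA (length v) \<le> \<theta>"
    then have "tp (int (2 * tA (length v) + length v)) = tape_of v (int (2 * tA (length v) + length v))"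
      by (intro astep_reach(2)[OF \<theta>(2)]) simp
    then show False using t(4) by (simp add: tape_of_def nat_add_distrib)
  qed
  moreover have "snd (snd (tcell MC (tape_of v) t z)) =
      (if int \<theta> + 1 + \<bar>z\<bar> \<le> int t then (if goodv pW v then 1 else 2) else 0)" for t z
    using tcell_flag[OF \<theta>(2,3), of t z] t(3) by simp
  ultimately show ?thesis using that[of \<theta>] t(1) \<theta>(1) by auto
qed

text \<open>The factor 2: the verifier halts within \<open>tA\<close> n steps, at a distance of at
  most \<open>tA\<close> n from its start, and its flag may need as many further steps to come
  back.\<close>

lemma MA_flag:
  assumes "int \<theta> + 1 + \<bar>z\<bar> \<le> int t" "2 * tA n \<le> \<theta>" "length y \<le> n"
  shows "snd (snd (tcell MA (tape_of (map sym y)) t z)) = (if y \<in> V then 1 else 2)"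
proof -
  obtain t0 p tp where t0: "t0 \<le> tA (length y)" "(astep MA ^^ t0) (0, 0, tape_of (map sym y)) = (1, p, tp)"
    "tp p = (if y \<in> V then 2 else 1)"
    using MA[of y] by blast
  obtain \<theta>' where \<theta>': "\<theta>' \<le> t0" "(astep MA ^^ \<theta>') (0, 0, tape_of (map sym y)) = (1, p, tp)"
    "\<And>t'. t' < \<theta>' \<Longrightarrow> fst ((astep MA ^^ t') (0, 0, tape_of (map sym y))) \<noteq> 1"
    using astep_first_halt[OF t0(2)] by blast
  have "\<bar>p\<bar> \<le> int \<theta>'" by (rule astep_reach(1)[OF \<theta>'(2)])
  moreover have "tA (length y) \<le> tA n" using monoD[OF tA_mono assms(3)] .
  ultimately have "int \<theta>' + 1 + \<bar>z - p\<bar> \<le> int t" using assms(1,2) \<theta>'(1) t0(1) by linarith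
  then show ?thesis using tcell_flag[OF \<theta>'(2,3), of t z] t0(3) by simp
qed

text \<open>The flag of the second machine certifies the whole base row: it needs a start cell, its
  input must be a doubled word with separator and the right number of slots, and enough time has
  passed for the verifier. What remains open is only whether some filling of the slots is accepted.
  The input is read off without solving anything.\<close>

theorem row_main:
  assumes row: "rowok \<kappa> T" and flag: "cflag (tri (comb MA MC) (\<lambda>j. Ini (\<kappa> j) 0) T 0) = 1"
  shows "\<exists>i x. i \<le> T \<and> (\<kappa> i = 3 \<or> \<kappa> i = 4) \<and>
    (\<forall>j\<le>T. (3 \<le> \<kappa> j \<and> \<kappa> j \<le> 6) \<longleftrightarrow> i \<le> j \<and> j < i + (2 * length x + 2)) \<and>
    i + (2 * length x + 2) \<le> Suc T \<and>
    (\<forall>l<length x. x ! l \<longleftrightarrow> \<kappa> (i + 2 * l) = 4 \<or> \<kappa> (i + 2 * l) = 6) \<and>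
    (solvable MA MC \<kappa> T \<longleftrightarrow> x \<in> L)"
proof -
  \<comment> \<open>The base is prolonged by right blanks to an unbounded tape; the apex depends on
    positions up to T only.\<close>
  define \<kappa>' where "\<kappa>' = (\<lambda>j. if j \<le> T then \<kappa> j else 8)"
  have ext: "tri (comb MA MC) (\<lambda>j. Ini (\<kappa> j) (c j)) T 0 = tri (comb MA MC) (\<lambda>j. Ini (\<kappa>' j) (c' j)) T 0"
    if "\<And>j. j \<le> T \<Longrightarrow> c j = c' j" for c c' by (rule tri_cong) (auto simp: \<kappa>'_def that)
  \<comment> \<open>Only a \<open>Cel\<close> carries a flag, and these occupy the rows of positive
    even height.\<close>
  obtain t where T: "T = 2 * Suc t"
  proof (cases T rule: parity_cases)
    case 1
    then show ?thesis using flag by simp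
  next
    case (2 t)
    then show ?thesis using flag tri_grow(1)[of \<kappa> "\<lambda>_. 0" MA MC t 0] by (simp del: tri.simps)
  qed
  define r where "r = (\<lambda>j. icell (\<kappa>' j) 3)"
  have fl: "snd (snd (grow MC r (Suc t) 0)) = 1"
    using flag ext[of "\<lambda>_. 0" "\<lambda>_. 0"] tri_grow(2)[of \<kappa>' "\<lambda>_. 0" MA MC t 0]
    unfolding T r_def by (simp del: tri.simps mult_Suc_right grow.simps)
  have "\<exists>i. i \<le> T \<and> (\<kappa> i = 3 \<or> \<kappa> i = 4)"
  proof (rule ccontr)
    assume "\<not> ?thesis"
    then have "fst (snd (r a)) = 0 \<and> snd (snd (r a)) = 0" for a
      by (auto simp: r_def icell_def \<kappa>'_def)
    then show False using grow_headless[of r MC "Suc t" 0] fl by simp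
  qed
  then obtain i where i: "i \<le> T" "\<kappa> i = 3 \<or> \<kappa> i = 4" by blast
  note fmt = row_format[OF row i]
  have k28: "2 \<le> \<kappa> j \<and> \<kappa> j \<le> 8" if "j \<le> T" for j using row that by (simp add: rowok_def)
  have ki: "\<kappa>' i = 3 \<or> \<kappa>' i = 4" using i by (simp add: \<kappa>'_def)
  have klt: "\<kappa>' j = 2" if "j < i" for j using fmt(2)[OF that] that i(1) by (simp add: \<kappa>'_def)
  have kgt: "5 \<le> \<kappa>' j \<and> \<kappa>' j \<le> 8" if "i < j" for j
    using fmt(3)[OF that] k28[of j] by (simp add: \<kappa>'_def)
  have mono: "mono (\<lambda>l. cls (\<kappa>' (i + l)))"
  proof (rule monoI)
    fix a b :: nat assume ab: "a \<le> b"
    show "cls (\<kappa>' (i + a)) \<le> cls (\<kappa>' (i + b))"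
    proof (cases "i + b \<le> T")
      case True
      then show ?thesis using fmt(1)[of "i + a" "i + b"] ab by (simp add: \<kappa>'_def)
    next
      case False
      then have "cls (\<kappa>' (i + b)) = 4" by (simp add: \<kappa>'_def cls_def)
      then show ?thesis by (simp add: cls_def)
    qed
  qed
  have big: "cls (\<kappa>' (i + Suc T)) = 4" by (simp add: \<kappa>'_def cls_def)
  \<comment> \<open>Relative to the start cell, input occupies the offsets below d, slots those from
    d to m - 1, and blanks the rest.\<close>
  obtain d where d: "\<And>l. cls (\<kappa>' (i + l)) \<le> 2 \<longleftrightarrow> l < d"
    using mono_threshold[OF mono, of 2 "Suc T"] big by auto
  obtain m where m: "\<And>l. cls (\<kappa>' (i + l)) \<le> 3 \<longleftrightarrow> l < m"
    using mono_threshold[OF mono, of 3 "Suc T"] big by auto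
  have dm: "d \<le> m"
  proof (rule ccontr)
    assume "\<not> d \<le> m"
    then show False using d[of m] m[of m] by simp
  qed
  have kd: "3 \<le> \<kappa>' (i + l) \<and> \<kappa>' (i + l) \<le> 6" if "l < d" for l
    using d[of l] that ki kgt[of "i + l"] by (cases "l = 0") (auto simp: cls_def split: if_splits)
  have kw: "\<kappa>' (i + l) = 7" if "d \<le> l" "l < m" for l
    using d[of l] m[of l] that by (auto simp: cls_def split: if_splits)
  have ke: "\<kappa>' (i + l) = 8" if "m \<le> l" for l
    using m[of l] that kgt[of "i + l"] ki by (cases "l = 0") (auto simp: cls_def split: if_splits)
  have d0: "0 < d" using d[of 0] ki by (auto simp: cls_def)
  have kd5: "\<kappa>' (i + l) = 5 \<or> \<kappa>' (i + l) = 6" if "l < d" "0 < l" for l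
    using kd[OF that(1)] kgt[of "i + l"] that(2) by auto
  \<comment> \<open>The word that the second machine reads, with 3 in each slot.\<close>
  define v where "v = map (\<lambda>l. fst (icell (\<kappa>' (i + l)) 3)) [0..<m]"
  have lv: "length v = m" by (simp add: v_def)
  have nv: "nthd v l = fst (icell (\<kappa>' (i + l)) 3)" for l
    using ke[of l] by (cases "l < m") (auto simp: v_def nthd_def icell_def)
  have set_v: "set v \<subseteq> {1, 2, 3}"
  proof
    fix s assume "s \<in> set v"
    then obtain l where l: "l < m" "s = fst (icell (\<kappa>' (i + l)) 3)" by (auto simp: v_def)
    show "s \<in> {1, 2, 3}"
    proof (cases "l < d")
      case True
      then have "\<kappa>' (i + l) = 3 \<or> \<kappa>' (i + l) = 4 \<or> \<kappa>' (i + l) = 5 \<or> \<kappa>' (i + l) = 6"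
        using kd[OF True] by linarith
      then show ?thesis using l by (auto simp: icell_def)
    qed (use kw[of l] l in \<open>auto simp: icell_def\<close>)
  qed
  text \<open>Both machines start on the base row with the head on cell \<open>i\<close>.\<close>
  have start: "icell (\<kappa>' a) (c a) = tcell M (tape_of y) 0 (int a - int i)"
    if y: "\<And>l. nthd y l = fst (icell (\<kappa>' (i + l)) (c (i + l)))" for a c y M
  proof -
    consider "a < i" | "a = i" | "i < a" by linarith
    then show ?thesis
    proof cases
      case 1
      then show ?thesis using klt[OF 1] by (simp add: icell_def tape_of_def)
    next
      case 2
      then show ?thesis using ki y[of 0] by (auto simp: icell_def tape_of_def)
    next
      case 3
      then have "nat (int a - int i) = a - i" by simp
      then have "tape_of y (int a - int i) = fst (icell (\<kappa>' a) (c a))"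
        using 3 y[of "a - i"] by (simp add: tape_of_def)
      then show ?thesis using 3 kgt[OF 3] by (auto simp: icell_def)
    qed
  qed
  have gC: "grow MC r (Suc t) 0 = tcell MC (tape_of v) (Suc t) (int 0 + int (Suc t) - int i)"
    by (rule grow_tcell) (unfold r_def, rule start[of v "\<lambda>_. 3", OF nv])
  define z where "z = int (Suc t) - int i"
  obtain \<theta> where \<theta>: "2 * tA m \<le> \<theta>" and \<theta>f: "\<And>t z. snd (snd (tcell MC (tape_of v) t z)) =
      (if int \<theta> + 1 + \<bar>z\<bar> \<le> int t then (if goodv pW v then 1 else 2) else 0)"
    using MC_halt[OF set_v] lv by metis
  have time: "int \<theta> + 1 + \<bar>z\<bar> \<le> int (Suc t)" and gv: "goodv pW v"
    using fl \<theta>f[of "Suc t" z] unfolding gC z_def by (auto split: if_splits)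
  then obtain x where x: "v = map sym (pair_enc x []) @ replicate (pW (length x)) 3"
    by (auto simp: goodv_def)
  let ?P = "map sym (pair_enc x [])"
  have lP: "length ?P = 2 * length x + 2" by (simp add: length_pair_enc)
  have mP: "m = 2 * length x + 2 + pW (length x)" using lv x lP by simp
  have P3: "?P ! l \<noteq> 3" if "l < length ?P" for l using that by (simp add: sym_def)
  \<comment> \<open>Input cells read as 1 or 2 and slots as 3, so the boundary between them is
    visible in v and must be the end of the encoded pair.\<close>
  have "l < d \<longleftrightarrow> l < 2 * length x + 2" for l
  proof
    assume l: "l < d"
    show "l < 2 * length x + 2"
    proof (rule ccontr)
      assume n: "\<not> ?thesis"
      then have "nthd v l = 3" using l dm mP lP by (auto simp: nthd_def x nth_append)
      then show False using nv[of l] kd[OF l] by (auto simp: icell_def split: if_splits)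
    qed
  next
    assume l: "l < 2 * length x + 2"
    show "l < d"
    proof (rule ccontr)
      assume "\<not> l < d"
      then have "\<kappa>' (i + l) = 7" using kw l mP by simp
      then have "nthd v l = 3" using nv[of l] by (simp add: icell_def)
      then show False using P3[of l] l lP mP lv by (simp add: nthd_def x nth_append)
    qed
  qed
  then have dP: "d = 2 * length x + 2" by (metis less_irrefl linorder_neqE_nat)
  have nP: "fst (icell (\<kappa>' (i + l)) c) = ?P ! l" if "l < d" for l c
  proof -
    have "\<kappa>' (i + l) \<noteq> 7" using kd[OF that] by auto
    then have "fst (icell (\<kappa>' (i + l)) c) = nthd v l" using nv[of l] by (simp add: icell_def)
    also have "\<dots> = ?P ! l" using that dP lP lv mP by (simp add: nthd_def x nth_append)
    finally show ?thesis .
  qed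
  have dT: "i + d \<le> Suc T"
  proof -
    have "\<kappa>' (i + (d - 1)) \<noteq> 8" using kd[of "d - 1"] d0 by auto
    then show ?thesis using d0 by (auto simp: \<kappa>'_def split: if_splits)
  qed
  text \<open>A choice without a gap is a witness, and the flag of the verifier reports its acceptance.\<close>
  have runA: "snd (snd (grow MA (\<lambda>j. icell (\<kappa>' j) (c j)) (Suc t) 0)) = (if pair_enc x w \<in> V then 1 else 2)"
    if w: "length w \<le> m - d" "\<And>l. l < m - d \<Longrightarrow> c (i + d + l) = (if l < length w then sym (w ! l) else 0)" for c w
  proof -
    let ?y = "map sym (pair_enc x w)"
    have "nthd ?y l = fst (icell (\<kappa>' (i + l)) (c (i + l)))" for l
    proof -
      consider "l < d" | "d \<le> l" "l < m" | "m \<le> l" by linarith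
      then show ?thesis
      proof cases
        case 1
        then show ?thesis using nP[OF 1] dP lP
          by (simp add: nthd_def pair_enc_append[of x w] nth_append)
      next
        case 2
        then obtain l' where l': "l = d + l'" "l' < m - d" using le_Suc_ex by (metis add_diff_cancel_left' diff_less_mono)
        have "nthd ?y l = (if l' < length w then sym (w ! l') else 0)"
          using l' dP lP by (auto simp: nthd_def pair_enc_append[of x w] nth_append)
        then show ?thesis using w(2)[OF l'(2)] kw[OF 2] l' by (simp add: icell_def add.assoc)
      next
        case 3
        then have "2 * length x + 2 + length w \<le> l" using w(1) dP dm by linarith
        then show ?thesis using ke[OF 3] by (simp add: nthd_def length_pair_enc icell_def)
      qed
    qed
    note st = start[OF this]
    have "grow MA (\<lambda>j. icell (\<kappa>' j) (c j)) (Suc t) 0 = tcell MA (tape_of ?y) (Suc t) (int 0 + int (Suc t) - int i)"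
      by (rule grow_tcell) (rule st)
    moreover have "snd (snd (tcell MA (tape_of ?y) (Suc t) z)) = (if pair_enc x w \<in> V then 1 else 2)"
      by (rule MA_flag[OF time \<theta>]) (use w(1) dP dm in \<open>simp add: length_pair_enc\<close>)
    ultimately show ?thesis unfolding z_def by simp
  qed
  have pWm: "pW (length x) = m - d" using mP dP by simp
  have "solvable MA MC \<kappa> T \<longleftrightarrow> x \<in> L"
  proof
    assume "solvable MA MC \<kappa> T"
    then obtain c where c: "choice \<kappa> c T" "good (tri (comb MA MC) (\<lambda>j. Ini (\<kappa> j) (c j)) T 0)"
      unfolding solvable_def by blast
    define c' where "c' = (\<lambda>j. if j \<le> T then c j else 0)"
    have g: "good (tri (comb MA MC) (\<lambda>j. Ini (\<kappa>' j) (c' j)) T 0)"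
      using c(2) ext[of c c'] by (simp add: c'_def)
    have nb: "\<not> (\<kappa>' j = 7 \<and> \<kappa>' (Suc j) = 7 \<and> c' j = 0 \<and> c' (Suc j) \<noteq> 0)" for j
    proof
      assume b: "\<kappa>' j = 7 \<and> \<kappa>' (Suc j) = 7 \<and> c' j = 0 \<and> c' (Suc j) \<noteq> 0"
      then have "j < T" by (auto simp: \<kappa>'_def split: if_splits)
      then have "tri (comb MA MC) (\<lambda>j. Ini (\<kappa>' j) (c' j)) T 0 = Dead"
        using b by (intro tri_Dead[of _ j "c' (Suc j)"]) auto
      then show False using g by simp
    qed
    \<comment> \<open>The first blank slot ends the witness. Since a blank before a filled slot
      would have killed the apex, all later slots are blank too.\<close>
    define e where "e = (LEAST l. c' (i + d + l) = 0 \<or> m - d \<le> l)"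
    have e1: "c' (i + d + e) = 0 \<or> m - d \<le> e" unfolding e_def by (rule LeastI[of _ "m - d"]) simp
    have e2: "c' (i + d + l) \<noteq> 0 \<and> l < m - d" if "l < e" for l
      using not_less_Least[OF that[unfolded e_def]] by simp
    have em: "e \<le> m - d" unfolding e_def by (rule Least_le) simp
    have e3: "c' (i + d + l) = 0" if "e \<le> l" "l < m - d" for l
      using that
    proof (induction l)
      case 0
      then show ?case using e1 by simp
    next
      case (Suc l)
      show ?case
      proof (cases "e = Suc l")
        case True
        then show ?thesis using e1 Suc.prems by simp
      next
        case False
        then have "c' (i + d + l) = 0" using Suc by simp
        moreover have "\<kappa>' (i + d + l) = 7" "\<kappa>' (i + d + Suc l) = 7"
          using kw[of "d + l"] kw[of "d + Suc l"] Suc.prems by (simp_all add: add.assoc)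
        ultimately show ?thesis using nb[of "i + d + l"] by auto
      qed
    qed
    define w where "w = map (\<lambda>l. c' (i + d + l) = 2) [0..<e]"
    have c3: "c' j < 3" for j using c(1) by (simp add: choice_def c'_def)
    have "c' (i + d + l) = (if l < length w then sym (w ! l) else 0)" if "l < m - d" for l
    proof (cases "l < e")
      case True
      then have "c' (i + d + l) = 1 \<or> c' (i + d + l) = 2" using e2[OF True] c3[of "i + d + l"] by linarith
      then show ?thesis using True by (auto simp: w_def sym_def)
    qed (use e3[of l] that in \<open>simp add: w_def\<close>)
    then have "snd (snd (grow MA (\<lambda>j. icell (\<kappa>' j) (c' j)) (Suc t) 0)) = (if pair_enc x w \<in> V then 1 else 2)"
      by (intro runA) (simp_all add: w_def em)
    moreover have "tri (comb MA MC) (\<lambda>j. Ini (\<kappa>' j) (c' j)) T 0 =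
        Cel (grow MA (\<lambda>j. icell (\<kappa>' j) (c' j)) (Suc t) 0) (grow MC r (Suc t) 0)"
      unfolding T r_def by (rule tri_grow(2)) (rule nb)
    ultimately have "pair_enc x w \<in> V" using g fl by (simp del: grow.simps split: if_splits)
    then show "x \<in> L" unfolding L using em pWm by (auto simp: w_def intro!: exI[of _ w])
  next
    assume "x \<in> L"
    then obtain w where w: "length w \<le> m - d" "pair_enc x w \<in> V" unfolding L pWm by blast
    define c where "c = (\<lambda>j. if i + d \<le> j \<and> j < i + d + length w then sym (w ! (j - (i + d))) else 0)"
    have c7: "\<kappa>' j = 7" if "c j \<noteq> 0" for j
    proof -
      have "i + d \<le> j" "j < i + m" using that w(1) dm by (auto simp: c_def split: if_splits)
      then show ?thesis using kw[of "j - i"] by simp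
    qed
    have "choice \<kappa> c T"
      using c7 unfolding choice_def \<kappa>'_def by (fastforce simp: c_def sym_def)
    moreover have nb: "\<not> (\<kappa>' j = 7 \<and> \<kappa>' (Suc j) = 7 \<and> c j = 0 \<and> c (Suc j) \<noteq> 0)" for j
    proof
      assume b: "\<kappa>' j = 7 \<and> \<kappa>' (Suc j) = 7 \<and> c j = 0 \<and> c (Suc j) \<noteq> 0"
      then have "j < i + d" "i + d \<le> Suc j" by (auto simp: c_def sym_def split: if_splits)
      then have "j = i + (d - 1)" using d0 by simp
      then show False using b kd[of "d - 1"] d0 by simp
    qed
    have "snd (snd (grow MA (\<lambda>j. icell (\<kappa>' j) (c j)) (Suc t) 0)) = (if pair_enc x w \<in> V then 1 else 2)"
      by (rule runA) (use w(1) in \<open>auto simp: c_def\<close>)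
    moreover have "tri (comb MA MC) (\<lambda>j. Ini (\<kappa> j) (c j)) T 0 =
        Cel (grow MA (\<lambda>j. icell (\<kappa>' j) (c j)) (Suc t) 0) (grow MC r (Suc t) 0)"
      unfolding ext[OF refl] unfolding T r_def by (rule tri_grow(2)) (rule nb)
    ultimately show "solvable MA MC \<kappa> T"
      unfolding solvable_def using w(2) by (intro exI[of _ c]) (simp del: grow.simps tri.simps)
  qed
  moreover have "(3 \<le> \<kappa> j \<and> \<kappa> j \<le> 6) \<longleftrightarrow> i \<le> j \<and> j < i + d" if "j \<le> T" for j
  proof (cases "i \<le> j")
    case True
    then obtain l where l: "j = i + l" using le_Suc_ex by blast
    have "\<kappa>' j = \<kappa> j" using that by (simp add: \<kappa>'_def)
    then show ?thesis using kd[of l] kw[of l] ke[of l] l by (cases "l < d"; cases "l < m") auto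
  qed (use klt[of j] that in \<open>auto simp: \<kappa>'_def\<close>)
  moreover have "x ! l \<longleftrightarrow> \<kappa> (i + 2 * l) = 4 \<or> \<kappa> (i + 2 * l) = 6" if "l < length x" for l
  proof -
    have l: "2 * l < d" using that dP by simp
    have "\<kappa>' (i + 2 * l) = \<kappa> (i + 2 * l)" using dT l by (simp add: \<kappa>'_def)
    moreover have "fst (icell (\<kappa>' (i + 2 * l)) 0) = sym (x ! l)"
      using nP[OF l, of 0] nth_pair_enc[OF that, of "[]"] l dP by (simp add: length_pair_enc)
    ultimately show ?thesis using kd[OF l] by (auto simp: icell_def sym_def split: if_splits)
  qed
  ultimately show ?thesis using i dP dT by (intro exI[of _ i] exI[of _ x]) simp
qed

end

section \<open>Forbidden patterns\<close>

text \<open>The label vertex q + l is joined to the clique vertices 0, ..., l. This staircase makes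
  the naming rigid: clique vertices may be permuted, but labels cannot be exchanged.\<close>

definition Rg :: "nat \<Rightarrow> nat \<Rightarrow> nat \<Rightarrow> bool" where
  "Rg q i j = (i < q \<and> j < q \<and> i \<noteq> j \<or> i < q \<and> q \<le> j \<and> j < q + 45 \<and> i \<le> j - q \<or>
     j < q \<and> q \<le> i \<and> i < q + 45 \<and> j \<le> i - q)"

text \<open>Copies of the reference graph: a clique of size \<open>q\<close> and 45 vertices naming the labels. A further
  vertex has kind \<open>k\<close> and shift \<open>s\<close> if it is adjacent to the label vertex \<open>5 * k + s\<close>. Distinctness is a
  parameter \<open>N\<close> so that all conditions are positive in the edge relation and in \<open>N\<close>.\<close>

definition emb :: "nat \<Rightarrow> (nat \<Rightarrow> nat \<Rightarrow> bool) \<Rightarrow> (nat \<Rightarrow> nat \<Rightarrow> bool) \<Rightarrow> (nat \<Rightarrow> nat) \<Rightarrow> bool" where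
  "emb q E N \<rho> = (\<forall>i<q+45. \<forall>j<q+45. (Rg q i j \<longrightarrow> E (\<rho> i) (\<rho> j)) \<and> (i \<noteq> j \<longrightarrow> N (\<rho> i) (\<rho> j)))"

definition cl :: "nat \<Rightarrow> (nat \<Rightarrow> nat \<Rightarrow> bool) \<Rightarrow> (nat \<Rightarrow> nat \<Rightarrow> bool) \<Rightarrow> (nat \<Rightarrow> nat) \<Rightarrow> nat \<Rightarrow> nat \<Rightarrow> nat \<Rightarrow> bool" where
  "cl q E N \<rho> v k s = (k < 9 \<and> s < 5 \<and> (\<forall>i<q+45. N v (\<rho> i)) \<and> E v (\<rho> (q + (5 * k + s))))"

text \<open>An undirected edge has no first and second end; the shifts decide which end is the
  parent and which parent it is. First parents add 1 and second parents add 2 modulo 5, while the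
  reversed edges add 4 and 3.\<close>

definition par :: "nat \<Rightarrow> (nat \<Rightarrow> nat \<Rightarrow> bool) \<Rightarrow> (nat \<Rightarrow> nat \<Rightarrow> bool) \<Rightarrow> (nat \<Rightarrow> nat) \<Rightarrow> nat \<Rightarrow> nat \<Rightarrow> nat \<Rightarrow> bool" where
  "par q E N \<rho> e u a = (E u a \<and> (\<exists>k<9. \<exists>s<5. \<exists>k'<9. cl q E N \<rho> u k s \<and> cl q E N \<rho> a k' ((s + e) mod 5)))"

text \<open>Base cells stand beside base cells and inner cells beside inner cells. With commuting
  parents this makes all descents to the base equally long.\<close>

definition okp :: "nat \<Rightarrow> nat \<Rightarrow> bool" where
  "okp l r = (if 2 \<le> l \<and> 2 \<le> r then adj l r else l < 2 \<and> r < 2)"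

text \<open>Another copy of the reference that differs in a label or contains a new clique vertex.
  Where this is forbidden, references agree up to a permutation of the clique, and such a
  permutation changes neither cells nor colours.\<close>

definition diff_emb :: "nat \<Rightarrow> (nat \<Rightarrow> nat \<Rightarrow> bool) \<Rightarrow> (nat \<Rightarrow> nat \<Rightarrow> bool) \<Rightarrow> (nat \<Rightarrow> nat) \<Rightarrow> (nat \<Rightarrow> nat) \<Rightarrow> bool" where
  "diff_emb q E N \<rho> \<rho>' = (emb q E N \<rho>' \<and> ((\<exists>i<45. N (\<rho> (q + i)) (\<rho>' (q + i))) \<or> (\<exists>i<q. \<forall>j<q. N (\<rho>' i) (\<rho> j))))"

text \<open>The defects in order: two labels on one vertex, two apexes, two first parents, two
  second parents, a base cell with a parent, a square that does not close, parents that violate the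
  row format, and a base cell that is the first parent of two cells. The last one keeps the witness
  slots of a folded diagram apart.\<close>

definition svc :: "nat \<Rightarrow> (nat \<Rightarrow> nat \<Rightarrow> bool) \<Rightarrow> (nat \<Rightarrow> nat \<Rightarrow> bool) \<Rightarrow> (nat \<Rightarrow> nat) \<Rightarrow>
    nat \<Rightarrow> nat \<Rightarrow> nat \<Rightarrow> nat \<Rightarrow> nat \<Rightarrow> bool" where
  "svc q E N \<rho> u a b c d =
    ((\<exists>k<9. \<exists>s<5. \<exists>k'<9. \<exists>s'<5. cl q E N \<rho> u k s \<and> cl q E N \<rho> u k' s' \<and> (k \<noteq> k' \<or> s \<noteq> s')) \<or>
     (\<exists>s<5. \<exists>s'<5. N u a \<and> cl q E N \<rho> u 1 s \<and> cl q E N \<rho> a 1 s') \<or>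
     par q E N \<rho> 1 u a \<and> par q E N \<rho> 1 u b \<and> N a b \<or>
     par q E N \<rho> 2 u a \<and> par q E N \<rho> 2 u b \<and> N a b \<or>
     (\<exists>k<9. \<exists>s<5. (par q E N \<rho> 1 u a \<or> par q E N \<rho> 2 u a) \<and> cl q E N \<rho> u k s \<and> 2 \<le> k) \<or>
     par q E N \<rho> 1 u a \<and> par q E N \<rho> 2 u b \<and> par q E N \<rho> 2 a c \<and> par q E N \<rho> 1 b d \<and> N c d \<or>
     (\<exists>ka<9. \<exists>sa<5. \<exists>kb<9. \<exists>sb<5. par q E N \<rho> 1 u a \<and> par q E N \<rho> 2 u b \<and> cl q E N \<rho> a ka sa \<and> cl q E N \<rho> b kb sb \<and> \<not> okp kb ka) \<or>
     (\<exists>k<9. \<exists>s<5. par q E N \<rho> 1 a u \<and> par q E N \<rho> 1 b u \<and> N a b \<and> cl q E N \<rho> u k s \<and> 2 \<le> k))"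

definition allowed :: "nat \<Rightarrow> val \<Rightarrow> bool" where
  "allowed k v = (v = Off \<or> (\<exists>c<3. v = Ini k c \<and> (k \<noteq> 7 \<longrightarrow> c = 0)))"

definition real :: "val \<Rightarrow> bool" where
  "real v = (v \<noteq> Off \<and> v \<noteq> Star)"

text \<open>Base cells are never \<open>Star\<close>, so \<open>Star\<close> cannot climb to the
  apex of a complete diagram. That apex must then be real, which forces real values on everything
  below it; away from it all cells may be \<open>Off\<close>.\<close>

definition okc :: "tm \<Rightarrow> tm \<Rightarrow> val \<Rightarrow> val \<Rightarrow> val \<Rightarrow> bool" where
  "okc MA MC u l r = (u = Off \<or> u = Star \<and> (l = Star \<or> r = Star) \<or>
     real u \<and> real l \<and> real r \<and> u = comb MA MC l r)"

text \<open>The colour Star propagates upwards from cells whose past is incomplete.\<close>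

definition cvc :: "tm \<Rightarrow> tm \<Rightarrow> nat \<Rightarrow> (nat \<Rightarrow> nat \<Rightarrow> bool) \<Rightarrow> (nat \<Rightarrow> nat \<Rightarrow> bool) \<Rightarrow> (nat \<Rightarrow> nat) \<Rightarrow> (nat \<Rightarrow> val) \<Rightarrow>
    nat \<Rightarrow> nat \<Rightarrow> nat \<Rightarrow> bool" where
  "cvc MA MC q E N \<rho> col u a b =
    ((\<exists>s. cl q E N \<rho> u 1 s \<and> \<not> (good (col u) \<or> col u = Star)) \<or>
     (\<exists>k s. cl q E N \<rho> u k s \<and> 2 \<le> k \<and> \<not> allowed k (col u)) \<or>
     par q E N \<rho> 1 u a \<and> par q E N \<rho> 2 u b \<and> \<not> okc MA MC (col u) (col b) (col a))"

definition colour :: "nat \<Rightarrow> (nat \<Rightarrow> nat \<Rightarrow> bool) \<Rightarrow> (nat \<Rightarrow> nat) \<Rightarrow> nat \<Rightarrow> nat" where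
  "colour q lt \<rho> v = card {i. i < q \<and> lt (\<rho> i) v}"

text \<open>Distinctness is expressed by the order, so a violation speaks of edges and order only,
  which are what an ordered subgraph transports.\<close>

definition viol :: "tm \<Rightarrow> tm \<Rightarrow> (nat \<Rightarrow> val) \<Rightarrow> nat \<Rightarrow> (nat \<Rightarrow> nat \<Rightarrow> bool) \<Rightarrow> (nat \<Rightarrow> nat \<Rightarrow> bool) \<Rightarrow>
    (nat \<Rightarrow> nat) \<Rightarrow> (nat \<Rightarrow> nat) \<Rightarrow> nat \<Rightarrow> nat \<Rightarrow> nat \<Rightarrow> nat \<Rightarrow> nat \<Rightarrow> bool" where
  "viol MA MC dec q E lt \<rho> \<rho>' u a b c d = (let N = (\<lambda>x y. lt x y \<or> lt y x) in
     emb q E N \<rho> \<and> (diff_emb q E N \<rho> \<rho>' \<or> svc q E N \<rho> u a b c d \<or>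
       cvc MA MC q E N \<rho> (\<lambda>v. dec (colour q lt \<rho> v)) u a b))"

definition pat :: "tm \<Rightarrow> tm \<Rightarrow> (nat \<Rightarrow> val) \<Rightarrow> nat \<Rightarrow> (nat \<Rightarrow> nat \<Rightarrow> bool) \<Rightarrow> (nat \<Rightarrow> nat \<Rightarrow> bool) \<Rightarrow> (nat \<Rightarrow> nat) \<Rightarrow> bool" where
  "pat MA MC dec q E lt h = (let r = q + 45 in
     viol MA MC dec q E lt h (\<lambda>i. h (r + i)) (h (2 * r)) (h (2 * r + 1)) (h (2 * r + 2)) (h (2 * r + 3)) (h (2 * r + 4)))"

text \<open>Instead of a list of patterns, all graphs that show a violation are taken. Two copies of
  the reference and five more vertices always suffice for one, so the size can be bounded.\<close>

definition Fset :: "tm \<Rightarrow> tm \<Rightarrow> (nat \<Rightarrow> val) \<Rightarrow> nat \<Rightarrow> ograph set" where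
  "Fset MA MC dec q = {(m, E). m \<le> 2 * (q + 45) + 5 \<and> wf_ograph (m, E) \<and>
     (\<exists>h. (\<forall>i. h i < m) \<and> pat MA MC dec q E (<) h)}"

section \<open>Patterns under maps of vertices and addition of edges\<close>

lemma emb_map: "emb q E N (\<lambda>i. g (h i)) = emb q (\<lambda>a b. E (g a) (g b)) (\<lambda>a b. N (g a) (g b)) h"
  by (simp add: emb_def)

lemma cl_map: "cl q E N (\<lambda>i. g (h i)) (g v) = cl q (\<lambda>a b. E (g a) (g b)) (\<lambda>a b. N (g a) (g b)) h v"
  by (simp add: cl_def fun_eq_iff)

lemma par_map: "par q E N (\<lambda>i. g (h i)) e (g u) (g a) = par q (\<lambda>a b. E (g a) (g b)) (\<lambda>a b. N (g a) (g b)) h e u a"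
  by (simp add: par_def cl_map)

lemma viol_map: "viol MA MC dec q E lt (\<lambda>i. g (\<rho> i)) (\<lambda>i. g (\<rho>' i)) (g u) (g a) (g b) (g c) (g d) =
  viol MA MC dec q (\<lambda>a b. E (g a) (g b)) (\<lambda>a b. lt (g a) (g b)) \<rho> \<rho>' u a b c d"
  by (simp add: viol_def Let_def emb_map diff_emb_def svc_def cvc_def cl_map par_map colour_def)

lemma pat_map: "pat MA MC dec q E lt (\<lambda>i. g (h i)) = pat MA MC dec q (\<lambda>a b. E (g a) (g b)) (\<lambda>a b. lt (g a) (g b)) h"
  unfolding pat_def Let_def using viol_map[of MA MC dec q E lt g] by simp

lemma cl_mono: "\<forall>a b. E a b \<longrightarrow> E' a b \<Longrightarrow> cl q E N \<rho> v k s \<Longrightarrow> cl q E' N \<rho> v k s"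
  by (simp add: cl_def)

lemma par_mono: "\<forall>a b. E a b \<longrightarrow> E' a b \<Longrightarrow> par q E N \<rho> e u a \<Longrightarrow> par q E' N \<rho> e u a"
  unfolding par_def by (meson cl_mono)

lemma emb_mono: "\<forall>a b. E a b \<longrightarrow> E' a b \<Longrightarrow> emb q E N \<rho> \<Longrightarrow> emb q E' N \<rho>"
  by (simp add: emb_def)

lemma svc_mono:
  assumes "\<forall>a b. E a b \<longrightarrow> E' a b" "svc q E N \<rho> u a b c d"
  shows "svc q E' N \<rho> u a b c d"
  using assms(2) unfolding svc_def
  by (elim disj_forward ex_forward conj_forward)
    (assumption | erule cl_mono[OF assms(1)] | erule par_mono[OF assms(1)])+

lemma cvc_mono:
  assumes "\<forall>a b. E a b \<longrightarrow> E' a b" "cvc MA MC q E N \<rho> col u a b"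
  shows "cvc MA MC q E' N \<rho> col u a b"
  using assms(2) unfolding cvc_def
  by (elim disj_forward ex_forward conj_forward)
    (assumption | erule cl_mono[OF assms(1)] | erule par_mono[OF assms(1)])+

lemma viol_mono:
  assumes "\<forall>a b. E a b \<longrightarrow> E' a b" "viol MA MC dec q E lt \<rho> \<rho>' u a b c d"
  shows "viol MA MC dec q E' lt \<rho> \<rho>' u a b c d"
  using assms(2) unfolding viol_def Let_def diff_emb_def
  by (elim disj_forward ex_forward conj_forward)
    (assumption | erule emb_mono[OF assms(1)] | erule svc_mono[OF assms(1)] | erule cvc_mono[OF assms(1)])+

text \<open>Edges occur only positively. This is what makes patterns fit for containment that is not
  induced: the host may have more edges than the pattern.\<close>

lemma pat_mono: "\<forall>a b. E a b \<longrightarrow> E' a b \<Longrightarrow> pat MA MC dec q E lt h \<Longrightarrow> pat MA MC dec q E' lt h"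
  unfolding pat_def Let_def by (rule viol_mono)

lemma finite_Fset: "finite (Fset MA MC dec q)"
proof -
  let ?K = "2 * (q + 45) + 5"
  let ?f = "\<lambda>(m, X). (m :: nat, \<lambda>i j. (i, j) \<in> X)"
  have "Fset MA MC dec q \<subseteq> ?f ` ({..?K} \<times> Pow ({..<?K} \<times> {..<?K}))"
  proof
    fix F assume "F \<in> Fset MA MC dec q"
    then obtain m E where F: "F = (m, E)" "m \<le> ?K" "wf_ograph (m, E)" by (auto simp: Fset_def)
    let ?X = "{(i, j). E i j}"
    have "?X \<subseteq> {..<?K} \<times> {..<?K}" using F(2,3) by (fastforce simp: wf_ograph_def)
    moreover have "F = ?f (m, ?X)" using F by simp
    ultimately show "F \<in> ?f ` ({..?K} \<times> Pow ({..<?K} \<times> {..<?K}))" using F(2) by blast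
  qed
  then show ?thesis by (rule finite_subset) auto
qed

lemma ex_enum_by_pos:
  assumes "finite S" "inj_on pos S"
  shows "\<exists>g. bij_betw g {..<card S} S \<and> (\<forall>i j. i < j \<and> j < card S \<longrightarrow> pos (g i) < (pos (g j) :: nat))"
proof -
  let ?xs = "sorted_list_of_set (pos ` S)"
  have fin: "finite (pos ` S)" using assms(1) by simp
  have l: "length ?xs = card S" using assms by (simp add: card_image)
  let ?g = "\<lambda>i. inv_into S pos (?xs ! i)"
  have m: "i < card S \<Longrightarrow> ?xs ! i \<in> pos ` S" for i
    using nth_mem[of i ?xs] l set_sorted_list_of_set[OF fin] by metis
  have pg: "i < card S \<Longrightarrow> pos (?g i) = ?xs ! i" for i using f_inv_into_f[OF m] .
  have lt: "i < j \<Longrightarrow> j < card S \<Longrightarrow> pos (?g i) < pos (?g j)" for i j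
    using pg strict_sorted_list_of_set[of "pos ` S"] l by (simp add: sorted_wrt_iff_nth_less)
  have inj: "inj_on ?g {..<card S}"
  proof (rule inj_onI)
    fix i j assume "i \<in> {..<card S}" "j \<in> {..<card S}" "?g i = ?g j"
    then show "i = j" using lt[of i j] lt[of j i] by (metis lessThan_iff less_irrefl linorder_neqE_nat)
  qed
  have "?g ` {..<card S} \<subseteq> S" using inv_into_into[OF m] by auto
  then have "?g ` {..<card S} = S"
    using assms(1) card_image[OF inj] by (intro card_subset_eq) auto
  then show ?thesis using inj lt unfolding bij_betw_def by blast
qed

text \<open>The vertices touched by a violation in the host induce a graph that is itself a member
  of the set. Conversely, a contained member carries its violation over to the host by
  \<open>pat_mono\<close>.\<close>

theorem Fset_contains:
  assumes E: "\<And>i j. E i j \<Longrightarrow> E j i" "\<And>i. \<not> E i i" and pos: "inj pos"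
  shows "(\<exists>F\<in>Fset MA MC dec q. contains_ordered n E pos F) \<longleftrightarrow>
    (\<exists>h. (\<forall>i. h i < n) \<and> card (range h) \<le> 2 * (q + 45) + 5 \<and> pat MA MC dec q E (\<lambda>a b. pos a < pos b) h)"
proof
  assume "\<exists>F\<in>Fset MA MC dec q. contains_ordered n E pos F"
  then obtain F where F: "F \<in> Fset MA MC dec q" "contains_ordered n E pos F" by blast
  obtain m E' where F': "F = (m, E')" by (cases F)
  have m: "m \<le> 2 * (q + 45) + 5" and "\<exists>h. (\<forall>i. h i < m) \<and> pat MA MC dec q E' (<) h"
    using F(1) unfolding F' Fset_def by blast+
  then obtain h where h: "\<And>i. h i < m" "pat MA MC dec q E' (<) h" by blast
  obtain g where g0: "\<forall>i<m. g i < n" "\<forall>i j. i < j \<and> j < m \<longrightarrow> pos (g i) < pos (g j)"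
      "\<forall>i<m. \<forall>j<m. E' i j \<longrightarrow> E (g i) (g j)"
    using F(2) unfolding F' contains_ordered_def prod.case by blast
  have g: "\<And>i. i < m \<Longrightarrow> g i < n" "\<And>i j. i < j \<Longrightarrow> j < m \<Longrightarrow> pos (g i) < pos (g j)"
      "\<And>i j. i < m \<Longrightarrow> j < m \<Longrightarrow> E' i j \<Longrightarrow> E (g i) (g j)"
    using g0 by auto
  have "range (\<lambda>i. g (h i)) \<subseteq> g ` {..<m}" using h(1) by auto
  then have "card (range (\<lambda>i. g (h i))) \<le> card (g ` {..<m})" by (intro card_mono) auto
  also have "\<dots> \<le> m" using card_image_le[of "{..<m}" g] by simp
  finally have c: "card (range (\<lambda>i. g (h i))) \<le> 2 * (q + 45) + 5" using m by simp
  have lt: "pos (g (h i)) < pos (g (h j)) \<longleftrightarrow> h i < h j" for i j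
    using g(2)[of "h i" "h j"] g(2)[of "h j" "h i"] h(1)[of i] h(1)[of j]
    by (metis less_irrefl less_not_sym linorder_neqE_nat)
  have "pat MA MC dec q (\<lambda>a b. E' (h a) (h b)) (\<lambda>a b. h a < h b) (\<lambda>i. i)"
    using h(2) pat_map[of MA MC dec q E' "(<)" h "\<lambda>i. i"] by simp
  then have "pat MA MC dec q (\<lambda>a b. E (g (h a)) (g (h b))) (\<lambda>a b. h a < h b) (\<lambda>i. i)"
    by (rule pat_mono[rotated]) (use g(3) h(1) in auto)
  then have "pat MA MC dec q E (\<lambda>a b. pos a < pos b) (\<lambda>i. g (h i))"
    using pat_map[of MA MC dec q E "\<lambda>a b. pos a < pos b" "\<lambda>i. g (h i)" "\<lambda>i. i"] lt by simp
  then show "\<exists>h. (\<forall>i. h i < n) \<and> card (range h) \<le> 2 * (q + 45) + 5 \<and> pat MA MC dec q E (\<lambda>a b. pos a < pos b) h"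
    using c g(1) h(1) by (intro exI[of _ "\<lambda>i. g (h i)"]) auto
next
  assume "\<exists>h. (\<forall>i. h i < n) \<and> card (range h) \<le> 2 * (q + 45) + 5 \<and> pat MA MC dec q E (\<lambda>a b. pos a < pos b) h"
  then obtain h where h: "\<And>i. h i < n" "card (range h) \<le> 2 * (q + 45) + 5" "pat MA MC dec q E (\<lambda>a b. pos a < pos b) h"
    by blast
  let ?S = "range h" and ?m = "card (range h)"
  have "?S \<subseteq> {..<n}" using h(1) by blast
  then have fin: "finite ?S" by (rule finite_subset) simp
  obtain g where g: "bij_betw g {..<?m} ?S" "\<And>i j. i < j \<Longrightarrow> j < ?m \<Longrightarrow> pos (g i) < pos (g j)"
    using ex_enum_by_pos[OF fin inj_on_subset[OF pos subset_UNIV]] by auto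
  define h' where "h' = (\<lambda>i. inv_into {..<?m} g (h i))"
  have gh: "g (h' i) = h i" for i unfolding h'_def
    using g(1) by (intro f_inv_into_f) (auto simp: bij_betw_def)
  have h': "h' i < ?m" for i unfolding h'_def
    using g(1) inv_into_into[of "h i" g "{..<?m}"] by (auto simp: bij_betw_def)
  have lt: "pos (h i) < pos (h j) \<longleftrightarrow> h' i < h' j" for i j
    using g(2)[of "h' i" "h' j"] g(2)[of "h' j" "h' i"] h'[of i] h'[of j] gh
    by (metis less_irrefl less_not_sym linorder_neqE_nat)
  let ?E = "\<lambda>i j. i < ?m \<and> j < ?m \<and> E (g i) (g j)"
  have "pat MA MC dec q (\<lambda>a b. E (h a) (h b)) (\<lambda>a b. pos (h a) < pos (h b)) (\<lambda>i. i)"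
    using h(3) pat_map[of MA MC dec q E "\<lambda>a b. pos a < pos b" h "\<lambda>i. i"] by simp
  then have "pat MA MC dec q (\<lambda>a b. ?E (h' a) (h' b)) (\<lambda>a b. h' a < h' b) (\<lambda>i. i)"
    using lt h' gh by simp
  then have p: "pat MA MC dec q ?E (<) h'"
    using pat_map[of MA MC dec q ?E "(<)" h' "\<lambda>i. i"] by simp
  have "wf_ograph (?m, ?E)" using E by (auto simp: wf_ograph_def)
  then have "(?m, ?E) \<in> Fset MA MC dec q" unfolding Fset_def using h(2) h' p by blast
  moreover have "contains_ordered n E pos (?m, ?E)"
    unfolding contains_ordered_def prod.case
  proof (intro exI[of _ g] conjI allI impI)
    fix i assume "i < ?m"
    then have "g i \<in> ?S" using g(1) by (auto simp: bij_betw_def)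
    then show "g i < n" using h(1) by auto
  qed (use g(2) in auto)
  ultimately show "\<exists>F\<in>Fset MA MC dec q. contains_ordered n E pos F" by blast
qed

lemma emb_cong: "(\<And>i. i < q + 45 \<Longrightarrow> \<rho> i = \<sigma> i) \<Longrightarrow> emb q E N \<rho> = emb q E N \<sigma>"
  by (simp add: emb_def)

lemma cl_cong: "(\<And>i. i < q + 45 \<Longrightarrow> \<rho> i = \<sigma> i) \<Longrightarrow> cl q E N \<rho> = cl q E N \<sigma>"
  by (auto simp: cl_def fun_eq_iff)

lemma par_cong: "(\<And>i. i < q + 45 \<Longrightarrow> \<rho> i = \<sigma> i) \<Longrightarrow> par q E N \<rho> = par q E N \<sigma>"
  by (simp add: par_def fun_eq_iff cl_cong[of q \<rho> \<sigma>])

lemma viol_cong: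
  assumes "\<And>i. i < q + 45 \<Longrightarrow> \<rho> i = \<sigma> i" "\<And>i. i < q + 45 \<Longrightarrow> \<rho>' i = \<sigma>' i"
  shows "viol MA MC dec q E lt \<rho> \<rho>' = viol MA MC dec q E lt \<sigma> \<sigma>'"
proof -
  have "diff_emb q E N \<rho> \<rho>' = diff_emb q E N \<sigma> \<sigma>'" for N
    using assms by (simp add: diff_emb_def emb_cong[OF assms(2)] cong: conj_cong)
  moreover have "colour q lt \<rho> = colour q lt \<sigma>"
    unfolding colour_def using assms(1) by (intro ext arg_cong[of _ _ card]) auto
  ultimately show ?thesis
    by (simp add: viol_def Let_def fun_eq_iff svc_def cvc_def emb_cong[OF assms(1)]
        cl_cong[OF assms(1)] par_cong[OF assms(1)])
qed

lemma pat_viol: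
  "(\<exists>h. (\<forall>i. h i < n) \<and> card (range h) \<le> 2 * (q + 45) + 5 \<and> pat MA MC dec q E lt h) \<longleftrightarrow>
   (\<exists>\<rho> \<rho>' u a b c d. (\<forall>i<q+45. \<rho> i < n \<and> \<rho>' i < n) \<and> u < n \<and> a < n \<and> b < n \<and> c < n \<and> d < n \<and>
     viol MA MC dec q E lt \<rho> \<rho>' u a b c d)" (is "?A = ?B")
proof
  assume ?A
  then obtain h where h: "\<And>i. h i < n" "pat MA MC dec q E lt h" by blast
  show ?B
  proof (intro exI conjI)
    show "viol MA MC dec q E lt h (\<lambda>i. h (q + 45 + i)) (h (2 * (q + 45))) (h (2 * (q + 45) + 1))
      (h (2 * (q + 45) + 2)) (h (2 * (q + 45) + 3)) (h (2 * (q + 45) + 4))"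
      using h(2) unfolding pat_def Let_def .
  qed (use h(1) in auto)
next
  assume ?B
  then obtain \<rho> \<rho>' u a b c d where
    \<rho>: "\<forall>i<q + 45. \<rho> i < n \<and> \<rho>' i < n" and v: "u < n" "a < n" "b < n" "c < n" "d < n"
    and V: "viol MA MC dec q E lt \<rho> \<rho>' u a b c d" by (elim exE conjE)
  let ?r = "q + 45"
  define h where "h = (\<lambda>i. if i < ?r then \<rho> i else if i < 2 * ?r then \<rho>' (i - ?r) else if i = 2 * ?r then u
    else if i = 2 * ?r + 1 then a else if i = 2 * ?r + 2 then b else if i = 2 * ?r + 3 then c else d)"
  have hn: "h i < n" for i unfolding h_def using \<rho> v by auto
  have "h i \<in> h ` {..<2 * ?r + 5}" for i
  proof (cases "i < 2 * ?r + 5")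
    case False
    then have "h i = h (2 * ?r + 4)" by (simp add: h_def)
    then show ?thesis by (intro image_eqI[of _ _ "2 * ?r + 4"]) auto
  qed auto
  then have "range h \<subseteq> h ` {..<2 * ?r + 5}" by blast
  then have "card (range h) \<le> card (h ` {..<2 * ?r + 5})" by (intro card_mono) auto
  also have "\<dots> \<le> 2 * ?r + 5" using card_image_le[of "{..<2 * ?r + 5}" h] by simp
  finally have ch: "card (range h) \<le> 2 * (q + 45) + 5" by simp
  have "viol MA MC dec q E lt h (\<lambda>i. h (?r + i)) = viol MA MC dec q E lt \<rho> \<rho>'"
    by (rule viol_cong) (auto simp: h_def)
  then have "pat MA MC dec q E lt h" unfolding pat_def Let_def using V by (simp add: h_def)
  then show ?A using hn ch by blast
qed

lemma enc_edge_sym: "enc_edge x i j \<Longrightarrow> enc_edge x j i"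
  by (auto simp: enc_edge_def Let_def)

theorem F_free_iff:
  "x \<in> F_free_ordering_lang (Fset MA MC dec q) \<longleftrightarrow>
   (\<exists>pos. inj pos \<and> bij_betw pos {..<enc_nverts x} {..<enc_nverts x} \<and>
     (\<forall>\<rho> \<rho>' u a b c d. (\<forall>i<q+45. \<rho> i < enc_nverts x \<and> \<rho>' i < enc_nverts x) \<longrightarrow> u < enc_nverts x \<longrightarrow> a < enc_nverts x \<longrightarrow>
       b < enc_nverts x \<longrightarrow> c < enc_nverts x \<longrightarrow> d < enc_nverts x \<longrightarrow>
       \<not> viol MA MC dec q (enc_edge x) (\<lambda>a b. pos a < pos b) \<rho> \<rho>' u a b c d))" (is "?L = ?R")
proof -
  let ?n = "enc_nverts x" and ?E = "enc_edge x"
  let ?F = "Fset MA MC dec q"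
  have key: "(\<forall>F\<in>?F. \<not> contains_ordered ?n ?E pos F) \<longleftrightarrow>
    (\<forall>\<rho> \<rho>' u a b c d. (\<forall>i<q+45. \<rho> i < ?n \<and> \<rho>' i < ?n) \<longrightarrow> u < ?n \<longrightarrow> a < ?n \<longrightarrow>
       b < ?n \<longrightarrow> c < ?n \<longrightarrow> d < ?n \<longrightarrow> \<not> viol MA MC dec q ?E (\<lambda>a b. pos a < pos b) \<rho> \<rho>' u a b c d)" if "inj pos" for pos
  proof -
    have "(\<exists>F\<in>?F. contains_ordered ?n ?E pos F) \<longleftrightarrow>
       (\<exists>\<rho> \<rho>' u a b c d. (\<forall>i<q+45. \<rho> i < ?n \<and> \<rho>' i < ?n) \<and> u < ?n \<and> a < ?n \<and> b < ?n \<and> c < ?n \<and> d < ?n \<and>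
     viol MA MC dec q ?E (\<lambda>a b. pos a < pos b) \<rho> \<rho>' u a b c d)"
      unfolding pat_viol[symmetric]
      by (rule Fset_contains[OF enc_edge_sym _ that]) (auto simp: enc_edge_def Let_def)
    then show ?thesis by blast
  qed
  show ?thesis
  proof
    assume ?L
    then obtain pos where p: "bij_betw pos {..<?n} {..<?n}" "\<forall>F\<in>?F. \<not> contains_ordered ?n ?E pos F"
      unfolding F_free_ordering_lang_def by blast
    \<comment> \<open>Outside of the graph the positions are continued by the identity, so that the
      map is injective everywhere and order comparability is plain distinctness.\<close>
    define pos' where "pos' = (\<lambda>v. if v < ?n then pos v else v)"
    have pn: "pos v < ?n" if "v < ?n" for v using p(1) that by (auto simp: bij_betw_def)
    have "inj pos'"
    proof (rule injI)
      fix u v assume e: "pos' u = pos' v"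
      consider "u < ?n" "v < ?n" | "u < ?n" "\<not> v < ?n" | "\<not> u < ?n" "v < ?n" | "\<not> u < ?n" "\<not> v < ?n" by blast
      then show "u = v"
      proof cases
        case 1
        then show ?thesis using p(1) e by (auto simp: pos'_def bij_betw_def inj_on_def)
      qed (use e pn[of u] pn[of v] in \<open>auto simp: pos'_def\<close>)
    qed
    moreover have "bij_betw pos' {..<?n} {..<?n}"
      using p(1) by (subst bij_betw_cong[of _ _ pos]) (auto simp: pos'_def)
    moreover have "contains_ordered ?n ?E pos' F = contains_ordered ?n ?E pos F" for F
      unfolding contains_ordered_def pos'_def
      by (cases F) (auto intro!: ex_cong1 simp: less_trans)
    ultimately show ?R using p(2) key[of pos'] by blast
  next
    assume ?R
    then obtain pos where "inj pos" "bij_betw pos {..<?n} {..<?n}" "\<forall>F\<in>?F. \<not> contains_ordered ?n ?E pos F"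
      using key by blast
    then show ?L unfolding F_free_ordering_lang_def by blast
  qed
qed

section \<open>Graphs without static defects\<close>

abbreviation cel :: "nat \<Rightarrow> (nat \<Rightarrow> nat \<Rightarrow> bool) \<Rightarrow> (nat \<Rightarrow> nat) \<Rightarrow> nat \<Rightarrow> nat \<Rightarrow> nat \<Rightarrow> bool" where
  "cel q E \<rho> \<equiv> cl q E (\<noteq>) \<rho>"

abbreviation Pa :: "nat \<Rightarrow> (nat \<Rightarrow> nat \<Rightarrow> bool) \<Rightarrow> (nat \<Rightarrow> nat) \<Rightarrow> nat \<Rightarrow> nat \<Rightarrow> nat \<Rightarrow> bool" where
  "Pa q E \<rho> \<equiv> par q E (\<noteq>) \<rho>"

text \<open>Only a binary tree of parents is asked for; that it closes up to a triangle follows from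
  the commuting squares.\<close>

primrec hgt :: "nat \<Rightarrow> (nat \<Rightarrow> nat \<Rightarrow> bool) \<Rightarrow> (nat \<Rightarrow> nat) \<Rightarrow> nat \<Rightarrow> nat \<Rightarrow> bool" where
  "hgt q E \<rho> 0 u = (\<exists>k s. cel q E \<rho> u k s \<and> 2 \<le> k)"
| "hgt q E \<rho> (Suc T) u = (\<exists>a b. Pa q E \<rho> 1 u a \<and> Pa q E \<rho> 2 u b \<and> hgt q E \<rho> T a \<and> hgt q E \<rho> T b)"

text \<open>Bounded search instead of choice, so that the same functions can be evaluated by the
  reduction. The value is \<open>n\<close> where there is no such parent.\<close>

definition prt :: "nat \<Rightarrow> nat \<Rightarrow> (nat \<Rightarrow> nat \<Rightarrow> bool) \<Rightarrow> (nat \<Rightarrow> nat) \<Rightarrow> nat \<Rightarrow> nat \<Rightarrow> nat" where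
  "prt n q E \<rho> e u = bleast n (Pa q E \<rho> e u)"

definition kd :: "nat \<Rightarrow> (nat \<Rightarrow> nat \<Rightarrow> bool) \<Rightarrow> (nat \<Rightarrow> nat) \<Rightarrow> nat \<Rightarrow> nat" where
  "kd q E \<rho> v = bleast 9 (\<lambda>k. \<exists>s<5. cel q E \<rho> v k s)"

definition pt :: "nat \<Rightarrow> nat \<Rightarrow> (nat \<Rightarrow> nat \<Rightarrow> bool) \<Rightarrow> (nat \<Rightarrow> nat) \<Rightarrow> nat \<Rightarrow> nat \<Rightarrow> nat \<Rightarrow> nat" where
  "pt n q E \<rho> \<kappa> a b = (prt n q E \<rho> 2 ^^ b) ((prt n q E \<rho> 1 ^^ a) \<kappa>)"

definition rowk :: "nat \<Rightarrow> nat \<Rightarrow> (nat \<Rightarrow> nat \<Rightarrow> bool) \<Rightarrow> (nat \<Rightarrow> nat) \<Rightarrow> nat \<Rightarrow> nat \<Rightarrow> nat \<Rightarrow> nat" where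
  "rowk n q E \<rho> \<kappa> T j = kd q E \<rho> (pt n q E \<rho> \<kappa> j (T - j))"

definition tcs :: "tm \<Rightarrow> tc set" where
  "tcs M = {..<fst (snd M)} \<times> {..fst M} \<times> {..2}"

definition vals :: "tm \<Rightarrow> tm \<Rightarrow> val set" where
  "vals MA MC = {Off, Star, Dead} \<union> (\<lambda>(k, c). Ini k c) ` ({..<9} \<times> {..<3}) \<union>
     (\<lambda>(a, b). Cel a b) ` (tcs MA \<times> tcs MC) \<union>
     (\<lambda>(a, b, c, d). Par a b c d) ` (tcs MA \<times> tcs MC \<times> tcs MA \<times> tcs MC)"

lemma finite_vals: "finite (vals MA MC)"
  by (simp add: vals_def tcs_def)

lemma vals_simps:
  "Off \<in> vals MA MC" "Star \<in> vals MA MC" "Dead \<in> vals MA MC"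
  "Ini k c \<in> vals MA MC \<longleftrightarrow> k < 9 \<and> c < 3"
  "Cel a b \<in> vals MA MC \<longleftrightarrow> a \<in> tcs MA \<and> b \<in> tcs MC"
  "Par a b a' b' \<in> vals MA MC \<longleftrightarrow> a \<in> tcs MA \<and> b \<in> tcs MC \<and> a' \<in> tcs MA \<and> b' \<in> tcs MC"
proof -
  have 1: "Cel a b \<in> (\<lambda>(a, b). Cel a b) ` (tcs MA \<times> tcs MC) \<longleftrightarrow> a \<in> tcs MA \<and> b \<in> tcs MC"
    by (auto intro!: image_eqI[of _ _ "(a, b)"])
  have 2: "Par a b a' b' \<in> (\<lambda>(a, b, c, d). Par a b c d) ` (tcs MA \<times> tcs MC \<times> tcs MA \<times> tcs MC) \<longleftrightarrow>
      a \<in> tcs MA \<and> b \<in> tcs MC \<and> a' \<in> tcs MA \<and> b' \<in> tcs MC"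
    by (auto intro!: image_eqI[of _ _ "(a, b, a', b')"])
  show "Off \<in> vals MA MC" "Star \<in> vals MA MC" "Dead \<in> vals MA MC"
    "Ini k c \<in> vals MA MC \<longleftrightarrow> k < 9 \<and> c < 3"
    by (auto simp: vals_def)
  show "Cel a b \<in> vals MA MC \<longleftrightarrow> a \<in> tcs MA \<and> b \<in> tcs MC" unfolding vals_def Un_iff 1 by auto
  show "Par a b a' b' \<in> vals MA MC \<longleftrightarrow> a \<in> tcs MA \<and> b \<in> tcs MC \<and> a' \<in> tcs MA \<and> b' \<in> tcs MC"
    unfolding vals_def Un_iff 2 by auto
qed

lemma rule_tcs:
  assumes "wf_tm M" "a \<in> tcs M" "b \<in> tcs M" "c \<in> tcs M"
  shows "rule M a b c \<in> tcs M"
proof -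
  obtain Q S \<delta> where M: "M = (Q, S, \<delta>)" by (cases M) auto
  obtain s1 h1 f1 s2 h2 f2 s3 h3 f3 where abc: "a = (s1, h1, f1)" "b = (s2, h2, f2)" "c = (s3, h3, f3)"
    by (metis prod_cases3)
  have d: "fst (\<delta> (h - 1) s) < Q \<and> fst (snd (\<delta> (h - 1) s)) < S" if "h \<noteq> 0" "h \<le> Q" "s < S" for h s
    using assms(1) that by (auto simp: M wf_tm_def)
  have Q: "2 \<le> Q" using assms(1) by (simp add: M wf_tm_def)
  have b: "s1 < S" "h1 \<le> Q" "f1 \<le> 2" "s2 < S" "h2 \<le> Q" "f2 \<le> 2" "s3 < S" "h3 \<le> Q" "f3 \<le> 2"
    using assms(2-4) by (auto simp: M abc tcs_def)
  show ?thesis using b Q d[of h1 s1] d[of h2 s2] d[of h3 s3]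
    by (auto simp: M abc tcs_def Suc_le_eq)
qed

lemma cl_bd: "cl q E N \<rho> v k s \<Longrightarrow> k < 9" "cl q E N \<rho> v k s \<Longrightarrow> s < 5"
  by (auto simp: cl_def)

lemma svcI_label: "cl q E N \<rho> u k s \<Longrightarrow> cl q E N \<rho> u k' s' \<Longrightarrow> k \<noteq> k' \<or> s \<noteq> s' \<Longrightarrow> svc q E N \<rho> u a b c d"
  unfolding svc_def by (rule disjI1, (blast dest: cl_bd))

lemma svcI_corner: "N u a \<Longrightarrow> cl q E N \<rho> u 1 s \<Longrightarrow> cl q E N \<rho> a 1 s' \<Longrightarrow> svc q E N \<rho> u a b c d"
  unfolding svc_def by (rule disjI2, rule disjI1, (blast dest: cl_bd))

lemma svcI_par1: "par q E N \<rho> 1 u a \<Longrightarrow> par q E N \<rho> 1 u b \<Longrightarrow> N a b \<Longrightarrow> svc q E N \<rho> u a b c d"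
  unfolding svc_def by (rule disjI2, rule disjI2, rule disjI1, (blast dest: cl_bd))

lemma svcI_par2: "par q E N \<rho> 2 u a \<Longrightarrow> par q E N \<rho> 2 u b \<Longrightarrow> N a b \<Longrightarrow> svc q E N \<rho> u a b c d"
  unfolding svc_def by (rule disjI2, rule disjI2, rule disjI2, rule disjI1, (blast dest: cl_bd))

lemma svcI_base: "par q E N \<rho> 1 u a \<or> par q E N \<rho> 2 u a \<Longrightarrow> cl q E N \<rho> u k s \<Longrightarrow> 2 \<le> k \<Longrightarrow> svc q E N \<rho> u a b c d"
  unfolding svc_def by (rule disjI2, rule disjI2, rule disjI2, rule disjI2, rule disjI1, (blast dest: cl_bd))

lemma svcI_commute: "par q E N \<rho> 1 u a \<Longrightarrow> par q E N \<rho> 2 u b \<Longrightarrow> par q E N \<rho> 2 a c \<Longrightarrow> par q E N \<rho> 1 b d \<Longrightarrow> N c d \<Longrightarrow> svc q E N \<rho> u a b c d"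
  unfolding svc_def by (rule disjI2, rule disjI2, rule disjI2, rule disjI2, rule disjI2, rule disjI1, (blast dest: cl_bd))

lemma svcI_okp: "par q E N \<rho> 1 u a \<Longrightarrow> par q E N \<rho> 2 u b \<Longrightarrow> cl q E N \<rho> a ka sa \<Longrightarrow> cl q E N \<rho> b kb sb \<Longrightarrow> \<not> okp kb ka \<Longrightarrow> svc q E N \<rho> u a b c d"
  unfolding svc_def by (rule disjI2, rule disjI2, rule disjI2, rule disjI2, rule disjI2, rule disjI2, rule disjI1, (blast dest: cl_bd))

lemma svcI_child: "par q E N \<rho> 1 a u \<Longrightarrow> par q E N \<rho> 1 b u \<Longrightarrow> N a b \<Longrightarrow> cl q E N \<rho> u k s \<Longrightarrow> 2 \<le> k \<Longrightarrow> svc q E N \<rho> u a b c d"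
  unfolding svc_def by (rule disjI2, rule disjI2, rule disjI2, rule disjI2, rule disjI2, rule disjI2, rule disjI2, (blast dest: cl_bd))

locale gref = verifier +
  fixes n q :: nat and E :: "nat \<Rightarrow> nat \<Rightarrow> bool" and \<rho> :: "nat \<Rightarrow> nat"
  assumes wf: "wf_tm MA" "wf_tm MC" "4 \<le> fst (snd MC)"
    and E_n: "\<And>i j. E i j \<Longrightarrow> i < n \<and> j < n"
    and nosv: "\<And>u a b c d. u < n \<Longrightarrow> a < n \<Longrightarrow> b < n \<Longrightarrow> c < n \<Longrightarrow> d < n \<Longrightarrow> \<not> svc q E (\<noteq>) \<rho> u a b c d"
begin

abbreviation "C \<equiv> cel q E \<rho>"
abbreviation "P \<equiv> Pa q E \<rho>"
abbreviation "H \<equiv> hgt q E \<rho>"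
abbreviation "p \<equiv> prt n q E \<rho>"
abbreviation "pp \<equiv> pt n q E \<rho>"
abbreviation "K \<equiv> kd q E \<rho>"

lemma C_bd: "C v k s \<Longrightarrow> k < 9 \<and> s < 5 \<and> v < n"
  using E_n by (auto simp: cl_def)

lemma P_n: "P e u a \<Longrightarrow> u < n \<and> a < n"
  using E_n by (auto simp: par_def)

lemma P_cells: "P e u a \<Longrightarrow> \<exists>k s k' s'. C u k s \<and> C a k' s'"
  unfolding par_def by blast

lemma C_unique: assumes "C v k s" "C v k' s'" shows "k = k' \<and> s = s'"
proof (rule ccontr)
  assume "\<not> ?thesis"
  then have "svc q E (\<noteq>) \<rho> v v v v v" using assms by (intro svcI_label[of q E _ \<rho> v k s k' s']) auto
  then show False using nosv C_bd[OF assms(1)] by blast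
qed

lemma corner_unique: assumes "C u 1 s" "C a 1 s'" shows "u = a"
proof (rule ccontr)
  assume "\<not> ?thesis"
  then have "svc q E (\<noteq>) \<rho> u a u u u" using assms by (intro svcI_corner) auto
  then show False using nosv C_bd[OF assms(1)] C_bd[OF assms(2)] by blast
qed

lemma P1_unique: assumes "P 1 u a" "P 1 u b" shows "a = b"
proof (rule ccontr)
  assume "\<not> ?thesis"
  then have "svc q E (\<noteq>) \<rho> u a b u u" using assms by (intro svcI_par1) auto
  then show False using nosv P_n[OF assms(1)] P_n[OF assms(2)] by blast
qed

lemma P2_unique: assumes "P 2 u a" "P 2 u b" shows "a = b"
proof (rule ccontr)
  assume "\<not> ?thesis"
  then have "svc q E (\<noteq>) \<rho> u a b u u" using assms by (intro svcI_par2) auto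
  then show False using nosv P_n[OF assms(1)] P_n[OF assms(2)] by blast
qed

lemma P_kind: assumes "P 1 u a \<or> P 2 u a" "C u k s" shows "k < 2"
proof (rule ccontr)
  assume "\<not> ?thesis"
  then have "svc q E (\<noteq>) \<rho> u a u u u" using assms by (intro svcI_base) auto
  then show False using nosv P_n assms(1) by blast
qed

lemma P_commute: assumes "P 1 u a" "P 2 u b" "P 2 a c" "P 1 b d" shows "c = d"
proof (rule ccontr)
  assume "\<not> ?thesis"
  then have "svc q E (\<noteq>) \<rho> u a b c d" using assms by (intro svcI_commute) auto
  then show False using nosv P_n[OF assms(1)] P_n[OF assms(2)] P_n[OF assms(3)] P_n[OF assms(4)] by blast
qed

lemma P_okp: assumes "P 1 u a" "P 2 u b" "C a ka sa" "C b kb sb" shows "okp kb ka"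
proof (rule ccontr)
  assume "\<not> ?thesis"
  then have "svc q E (\<noteq>) \<rho> u a b u u" using assms by (intro svcI_okp) auto
  then show False using nosv P_n[OF assms(1)] P_n[OF assms(2)] by blast
qed

lemma P1_child_unique: assumes "P 1 a u" "P 1 b u" "C u k s" "2 \<le> k" shows "a = b"
proof (rule ccontr)
  assume "\<not> ?thesis"
  then have "svc q E (\<noteq>) \<rho> u a b u u" using assms by (intro svcI_child) auto
  then show False using nosv P_n[OF assms(1)] P_n[OF assms(2)] by blast
qed

lemma p1_eq: "P 1 u a \<Longrightarrow> p 1 u = a"
  unfolding prt_def using P_n P1_unique by (intro bleast_unique) blast+

lemma p2_eq: "P 2 u a \<Longrightarrow> p 2 u = a"
  unfolding prt_def using P_n P2_unique by (intro bleast_unique) blast+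

lemma K_eq: "C v k s \<Longrightarrow> K v = k"
  unfolding kd_def using C_bd C_unique by (intro bleast_unique) blast+

text \<open>Base cells have no parents and first parents are unique, so the descent along them has
  only one possible length.\<close>

lemma H_unique: "H T u \<Longrightarrow> H T' u \<Longrightarrow> T = T'"
proof (induction T arbitrary: u T')
  case 0
  then obtain k s where k: "C u k s" "2 \<le> k" by auto
  show ?case
  proof (cases T')
    case (Suc T'')
    then obtain a where "P 1 u a" using 0 by auto
    then have "k < 2" using P_kind k(1) by blast
    then show ?thesis using k by simp
  qed simp
next
  case (Suc T)
  then obtain a b where ab: "P 1 u a" "H T a" by auto
  show ?case
  proof (cases T')
    case 0
    then obtain k s where k: "C u k s" "2 \<le> k" using Suc.prems by auto
    then have "k < 2" using P_kind ab by blast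
    then show ?thesis using k by simp
  next
    case (Suc T'')
    then obtain a' where a': "P 1 u a'" "H T'' a'" using Suc.prems by auto
    then have "a' = a" using P1_unique ab by blast
    then show ?thesis using Suc.IH[OF ab(2)] a' Suc by simp
  qed
qed

text \<open>By the row format both parents are base cells or none is. In the second case they share
  a grandparent by the commuting square, and its unique height determines theirs. So a cell with two
  complete parents is complete, which is what the placement of \<open>Star\<close> relies
  on.\<close>

lemma H_par_eq:
  assumes "P 1 u a" "P 2 u b" "H Ta a" "H Tb b"
  shows "Ta = Tb"
proof -
  obtain ka sa where ka: "C a ka sa" using P_cells[OF assms(1)] by blast
  obtain kb sb where kb: "C b kb sb" using P_cells[OF assms(2)] by blast
  note k = ka kb
  have ok: "okp kb ka" by (rule P_okp[OF assms(1,2) k])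
  have base: "H 0 v \<longleftrightarrow> 2 \<le> k" if "C v k s" for v k s
  proof
    assume "H 0 v"
    then obtain k' s' where "C v k' s'" "2 \<le> k'" by auto
    then show "2 \<le> k" using C_unique[OF that, of k' s'] by simp
  qed (use that in auto)
  have step: "k < 2" if h: "C v k s" "H (Suc T) v" for v k s T
  proof -
    obtain w where "P 1 v w" using h by auto
    then show ?thesis by (rule P_kind[OF disjI1 h(1)])
  qed
  show ?thesis
  proof (cases Ta)
    case 0
    then have "2 \<le> ka" using assms(3) base[OF k(1)] by simp
    then have "2 \<le> kb" using ok by (simp add: okp_def split: if_splits)
    then show ?thesis using H_unique[OF assms(4), of 0] base[OF k(2)] 0 by auto
  next
    case (Suc Ta')
    then have "ka < 2" using step[OF k(1), of Ta'] assms(3) by simp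
    then have kb: "kb < 2" using ok by (simp add: okp_def split: if_splits)
    then obtain Tb' where Tb: "Tb = Suc Tb'" using assms(4) base[OF k(2)] by (cases Tb) auto
    obtain c where c: "P 2 a c" "H Ta' c" using assms(3) Suc by auto
    obtain d where d: "P 1 b d" "H Tb' d" using assms(4) Tb by auto
    have "c = d" by (rule P_commute[OF assms(1,2) c(1) d(1)])
    then show ?thesis using H_unique[OF c(2), of Tb'] d Suc Tb by simp
  qed
qed

lemma H_Suc: assumes "H (Suc T) u"
  shows "P 1 u (p 1 u)" "P 2 u (p 2 u)" "H T (p 1 u)" "H T (p 2 u)"
  using assms p1_eq p2_eq by (metis hgt.simps(2))+

lemma H_pt1: "H T \<kappa> \<Longrightarrow> a \<le> T \<Longrightarrow> H (T - a) ((p 1 ^^ a) \<kappa>)"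
proof (induction a)
  case (Suc a)
  then have "H (Suc (T - Suc a)) ((p 1 ^^ a) \<kappa>)" using Suc_diff_Suc[of a T] by simp
  from H_Suc(3)[OF this] show ?case by simp
qed simp

lemma H_pt: "H T \<kappa> \<Longrightarrow> a + b \<le> T \<Longrightarrow> H (T - a - b) (pp \<kappa> a b)"
proof (induction b)
  case 0
  then show ?case using H_pt1[of T \<kappa> a] by (simp add: pt_def)
next
  case (Suc b)
  then have "H (Suc (T - a - Suc b)) (pp \<kappa> a b)" using Suc_diff_Suc[of b "T - a"] by simp
  from H_Suc(4)[OF this] show ?case by (simp add: pt_def)
qed

lemma p2_pt: "p 2 (pp \<kappa> a b) = pp \<kappa> a (Suc b)"
  by (simp add: pt_def)

text \<open>The address takes first-parent steps before second-parent steps; commuting squares move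
  another first-parent step past the latter.\<close>

lemma p1_pt: "H T \<kappa> \<Longrightarrow> a + b < T \<Longrightarrow> p 1 (pp \<kappa> a b) = pp \<kappa> (Suc a) b"
proof (induction b)
  case 0
  then show ?case by (simp add: pt_def)
next
  case (Suc b)
  let ?u = "pp \<kappa> a b"
  define m where "m = T - a - b - 2"
  have m: "T - a - b = Suc (Suc m)" using Suc.prems by (simp add: m_def)
  have "H (T - a - b) ?u" by (rule H_pt) (use Suc.prems in auto)
  then have h: "H (Suc (Suc m)) ?u" unfolding m .
  note h1 = H_Suc[OF h]
  have "p 2 (p 1 ?u) = p 1 (p 2 ?u)"
    using P_commute[OF h1(1,2) H_Suc(2)[OF h1(3)] H_Suc(1)[OF h1(4)]] .
  then show ?case using Suc by (simp add: p2_pt)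
qed

lemma H_parents:
  assumes "H T \<kappa>" "a + b < T"
  shows "P 1 (pp \<kappa> a b) (pp \<kappa> (Suc a) b)" "P 2 (pp \<kappa> a b) (pp \<kappa> a (Suc b))"
proof -
  obtain m where m: "T - a - b = Suc m" using assms(2) by (cases "T - a - b") auto
  have "H (T - a - b) (pp \<kappa> a b)" by (rule H_pt) (use assms in auto)
  then have h: "H (Suc m) (pp \<kappa> a b)" unfolding m .
  show "P 1 (pp \<kappa> a b) (pp \<kappa> (Suc a) b)" "P 2 (pp \<kappa> a b) (pp \<kappa> a (Suc b))"
    using H_Suc(1,2)[OF h] p1_pt[OF assms] p2_pt by metis+
qed

lemma H_base:
  assumes "H T \<kappa>" "j \<le> T"
  shows "\<exists>s. C (pp \<kappa> j (T - j)) (rowk n q E \<rho> \<kappa> T j) s" "2 \<le> rowk n q E \<rho> \<kappa> T j" "rowk n q E \<rho> \<kappa> T j \<le> 8"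
proof -
  have "H 0 (pp \<kappa> j (T - j))" using H_pt[OF assms(1), of j "T - j"] assms(2) by simp
  then obtain k s where k: "C (pp \<kappa> j (T - j)) k s" "2 \<le> k" by auto
  then have "rowk n q E \<rho> \<kappa> T j = k" by (simp add: rowk_def K_eq)
  then show "\<exists>s. C (pp \<kappa> j (T - j)) (rowk n q E \<rho> \<kappa> T j) s" "2 \<le> rowk n q E \<rho> \<kappa> T j" "rowk n q E \<rho> \<kappa> T j \<le> 8"
    using k C_bd[OF k(1)] by auto
qed

lemma H_rowok: assumes "H T \<kappa>" shows "rowok (rowk n q E \<rho> \<kappa> T) T"
  unfolding rowok_def
proof (intro conjI allI impI)
  fix j assume j: "j < T"
  have s: "Suc (T - Suc j) = T - j" using j by simp
  have pr: "P 1 (pp \<kappa> j (T - Suc j)) (pp \<kappa> (Suc j) (T - Suc j))" "P 2 (pp \<kappa> j (T - Suc j)) (pp \<kappa> j (T - j))"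
    using H_parents[OF assms, of j "T - Suc j"] j s by auto
  obtain s1 where s1: "C (pp \<kappa> j (T - j)) (rowk n q E \<rho> \<kappa> T j) s1" using H_base(1)[OF assms, of j] j by auto
  obtain s2 where s2: "C (pp \<kappa> (Suc j) (T - Suc j)) (rowk n q E \<rho> \<kappa> T (Suc j)) s2"
    using H_base(1)[OF assms, of "Suc j"] j by auto
  have "okp (rowk n q E \<rho> \<kappa> T j) (rowk n q E \<rho> \<kappa> T (Suc j))" by (rule P_okp[OF pr s2 s1])
  then show "adj (rowk n q E \<rho> \<kappa> T j) (rowk n q E \<rho> \<kappa> T (Suc j))"
    using H_base(2)[OF assms, of j] H_base(2)[OF assms, of "Suc j"] j by (simp add: okp_def)
qed (use H_base(2,3)[OF assms] in auto)

section \<open>Valid colourings of a graph without static defects\<close>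

definition valid :: "(nat \<Rightarrow> val) \<Rightarrow> bool" where
  "valid c = (\<forall>u<n. \<forall>a<n. \<forall>b<n. \<not> cvc MA MC q E (\<noteq>) \<rho> c u a b)"

lemma valid_iff:
  "valid c \<longleftrightarrow> (\<forall>u s. C u 1 s \<longrightarrow> good (c u) \<or> c u = Star) \<and> (\<forall>u k s. C u k s \<longrightarrow> 2 \<le> k \<longrightarrow> allowed k (c u)) \<and>
    (\<forall>u a b. P 1 u a \<longrightarrow> P 2 u b \<longrightarrow> okc MA MC (c u) (c b) (c a))" (is "_ = ?R")
proof
  assume v: "valid c"
  have v': "\<not> cvc MA MC q E (\<noteq>) \<rho> c u a b" if "u < n" "a < n" "b < n" for u a b
    using v that unfolding valid_def by blast
  show ?R
  proof (intro conjI allI impI)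
    show "good (c u) \<or> c u = Star" if "C u 1 s" for u s
      using v'[of u u u] C_bd[OF that] that unfolding cvc_def by blast
    show "allowed k (c u)" if "C u k s" "2 \<le> k" for u k s
      using v'[of u u u] C_bd[OF that(1)] that unfolding cvc_def by blast
    show "okc MA MC (c u) (c b) (c a)" if "P 1 u a" "P 2 u b" for u a b
      using v'[of u a b] P_n[OF that(1)] P_n[OF that(2)] that unfolding cvc_def by blast
  qed
next
  assume ?R
  then show "valid c" unfolding valid_def cvc_def by blast
qed

lemma valid_imp_solvable:
  assumes v: "valid c" and k: "C \<kappa> 1 s" and h: "H T \<kappa>"
  shows "solvable MA MC (rowk n q E \<rho> \<kappa> T) T"
proof -
  let ?r = "rowk n q E \<rho> \<kappa> T"
  note vv = v[unfolded valid_iff]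
  have c1: "\<And>u s. C u 1 s \<Longrightarrow> good (c u) \<or> c u = Star" and c3: "\<And>u k s. C u k s \<Longrightarrow> 2 \<le> k \<Longrightarrow> allowed k (c u)"
    and c2: "\<And>u a b. P 1 u a \<Longrightarrow> P 2 u b \<Longrightarrow> okc MA MC (c u) (c b) (c a)"
    using vv by blast+
  \<comment> \<open>Base cells are never \<open>Star\<close>, and above them \<open>Star\<close>
    needs a \<open>Star\<close> parent.\<close>
  have nostar: "c u \<noteq> Star" if "H t u" for t u
    using that
  proof (induction t arbitrary: u)
    case 0
    then obtain k s where "C u k s" "2 \<le> k" by auto
    then show ?case using c3[of u k s] by (auto simp: allowed_def)
  next
    case (Suc t)
    then obtain a b where ab: "P 1 u a" "P 2 u b" "H t a" "H t b" by auto
    then show ?case using c2[OF ab(1,2)] Suc.IH[OF ab(3)] Suc.IH[OF ab(4)] by (auto simp: okc_def real_def)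
  qed
  have g: "good (c \<kappa>)" using c1[OF k] nostar[OF h] by blast
  have step: "real (c (pp \<kappa> (Suc a) b)) \<and> real (c (pp \<kappa> a (Suc b))) \<and>
      c (pp \<kappa> a b) = comb MA MC (c (pp \<kappa> a (Suc b))) (c (pp \<kappa> (Suc a) b))"
    if "real (c (pp \<kappa> a b))" "a + b < T" for a b
    using c2[OF H_parents[OF h that(2)]] that(1) by (auto simp: okc_def real_def)
  \<comment> \<open>The apex is good, hence real, and a real cell forces real parents; this reaches
    the base.\<close>
  have "real (c (pp \<kappa> a b))" if "a + b = m" "m \<le> T" for a b m
    using that
  proof (induction m arbitrary: a b)
    case 0
    then show ?case using g by (auto simp: pt_def real_def)
  next
    case (Suc m)
    show ?case
    proof (cases a)
      case (Suc a')
      then show ?thesis using step[of a' b] Suc.IH[of a' b] Suc.prems by simp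
    next
      case 0
      then obtain b' where "b = Suc b'" using Suc.prems by (cases b) auto
      then show ?thesis using step[of a b'] Suc.IH[of a b'] Suc.prems by simp
    qed
  qed
  then have re: "real (c (pp \<kappa> a b))" if "a + b \<le> T" for a b using that by blast
  define \<nu> where "\<nu> = (\<lambda>j. c (pp \<kappa> j (T - j)))"
  have tri: "c (pp \<kappa> a b) = tri (comb MA MC) \<nu> d a" if "a + b + d = T" for a b d
    using that
  proof (induction d arbitrary: a b)
    case 0
    then have "b = T - a" by simp
    then show ?case by (simp add: \<nu>_def)
  next
    case (Suc d)
    then show ?case using step[OF re, of a b] Suc.IH[of "Suc a" b] Suc.IH[of a "Suc b"] by simp
  qed
  have "\<exists>ch<3. \<nu> j = Ini (?r j) ch \<and> (?r j \<noteq> 7 \<longrightarrow> ch = 0)" if j: "j \<le> T" for j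
  proof -
    obtain s where "C (pp \<kappa> j (T - j)) (?r j) s" using H_base(1)[OF h j] by blast
    then have "allowed (?r j) (\<nu> j)" using c3 H_base(2)[OF h j] by (simp add: \<nu>_def)
    moreover have "\<nu> j \<noteq> Off" using re[of j "T - j"] j by (simp add: \<nu>_def real_def)
    ultimately show ?thesis by (simp add: allowed_def)
  qed
  then obtain ch where ch: "\<And>j. j \<le> T \<Longrightarrow> ch j < 3 \<and> \<nu> j = Ini (?r j) (ch j) \<and> (?r j \<noteq> 7 \<longrightarrow> ch j = 0)"
    by metis
  have "tri (comb MA MC) (\<lambda>j. Ini (?r j) (ch j)) T 0 = tri (comb MA MC) \<nu> T 0"
    by (rule tri_cong) (simp add: ch)
  also have "\<dots> = c \<kappa>" using tri[of 0 0 T] by (simp add: pt_def)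
  finally have "good (tri (comb MA MC) (\<lambda>j. Ini (?r j) (ch j)) T 0)" using g by simp
  then show ?thesis unfolding solvable_def choice_def using ch by blast
qed

lemma comb_vals: assumes "u \<in> vals MA MC" "v \<in> vals MA MC" shows "comb MA MC u v \<in> vals MA MC"
proof -
  have S: "3 \<le> fst (snd MA)" "2 \<le> fst MA" "2 \<le> fst MC" using wf by (auto simp: wf_tm_def split: prod.splits)
  have i: "icell k c \<in> tcs MA" "icell k 3 \<in> tcs MC" if "c < 3" for k c
    using that S wf(3) by (auto simp: icell_def tcs_def)
  show ?thesis
  proof (cases u; cases v)
    fix a b c d a' b' c' d' assume uv: "u = Par a b c d" "v = Par a' b' c' d'"
    have "a \<in> tcs MA" "c \<in> tcs MA" "c' \<in> tcs MA" "b \<in> tcs MC" "d \<in> tcs MC" "d' \<in> tcs MC"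
      using assms uv by (simp_all add: vals_simps)
    then show ?thesis using uv rule_tcs[OF wf(1)] rule_tcs[OF wf(2)] by (simp add: vals_simps)
  next
    fix k c k' c' assume uv: "u = Ini k c" "v = Ini k' c'"
    have "c < 3" "c' < 3" using assms uv by (simp_all add: vals_simps)
    then show ?thesis using uv i by (simp add: vals_simps)
  qed (use assms in \<open>simp_all add: vals_simps\<close>)
qed

lemma tri_vals: "(\<And>j. \<nu> j \<in> vals MA MC) \<Longrightarrow> tri (comb MA MC) \<nu> d a \<in> vals MA MC"
  by (induction d arbitrary: a) (auto intro: comb_vals)

lemma comb_real: "real (comb MA MC u v)"
  by (cases u; cases v) (auto simp: real_def)

lemma tri_real: "(\<And>j. real (\<nu> j)) \<Longrightarrow> real (tri (comb MA MC) \<nu> d a)"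
  by (cases d) (auto intro: comb_real)

lemma corner_pos: assumes "C \<kappa> 1 s" "H T \<kappa>" shows "0 < T"
proof (rule ccontr)
  assume "\<not> 0 < T"
  then obtain k s' where k: "C \<kappa> k s'" "2 \<le> k" using assms(2) by auto
  then show False using C_unique[OF assms(1) k(1)] by simp
qed

lemma pp_par:
  assumes h: "H T \<kappa>" and e: "pp \<kappa> a b = pp \<kappa> a' b'" and ab: "a + b < T" "a' + b' < T"
  shows "pp \<kappa> (Suc a) b = pp \<kappa> (Suc a') b'" "pp \<kappa> a (Suc b) = pp \<kappa> a' (Suc b')"
  using p1_pt[OF h ab(1)] p1_pt[OF h ab(2)] p2_pt[of \<kappa> a b] p2_pt[of \<kappa> a' b'] e by auto

lemma pp_depth:
  assumes "H T \<kappa>" "pp \<kappa> a b = pp \<kappa> a' b'" "a + b \<le> T" "a' + b' \<le> T"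
  shows "T - a - b = T - a' - b'"
  using H_pt[OF assms(1,3)] H_pt[OF assms(1,4)] assms(2) H_unique by simp

text \<open>Going left along the base row, two equal witness slots would lead to the start cell and a cell
  to its right being equal.\<close>

lemma slots_distinct:
  assumes h: "H T \<kappa>" and i: "i \<le> T" "rowk n q E \<rho> \<kappa> T i = 3 \<or> rowk n q E \<rho> \<kappa> T i = 4"
  shows "i \<le> j \<Longrightarrow> j < j' \<Longrightarrow> j' \<le> T \<Longrightarrow> pp \<kappa> j (T - j) \<noteq> pp \<kappa> j' (T - j')"
proof (induction "j - i" arbitrary: j j')
  case 0
  let ?r = "rowk n q E \<rho> \<kappa> T"
  have "?r j' \<ge> 5" using row_format(3)[OF H_rowok[OF h] i] 0 by simp
  then have "?r j \<noteq> ?r j'" using 0 i by auto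
  then show ?case by (auto simp: rowk_def)
next
  case (Suc m)
  obtain l where l: "j = Suc l" using Suc by (cases j) auto
  obtain l' where l': "j' = Suc l'" using Suc by (cases j') auto
  show ?case
  proof
    assume e: "pp \<kappa> j (T - j) = pp \<kappa> j' (T - j')"
    have x: "P 1 (pp \<kappa> l (T - j)) (pp \<kappa> j (T - j))" "P 1 (pp \<kappa> l' (T - j')) (pp \<kappa> j' (T - j'))"
      using H_parents(1)[OF h, of l "T - j"] H_parents(1)[OF h, of l' "T - j'"] l l' Suc.prems by auto
    obtain s where s: "C (pp \<kappa> j (T - j)) (rowk n q E \<rho> \<kappa> T j) s" "2 \<le> rowk n q E \<rho> \<kappa> T j"
      using H_base[OF h, of j] Suc.prems by auto
    have "pp \<kappa> l (T - j) = pp \<kappa> l' (T - j')" by (rule P1_child_unique[OF x(1) x(2)[folded e] s])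
    then have "pp \<kappa> l (Suc (T - j)) = pp \<kappa> l' (Suc (T - j'))" using p2_pt by metis
    moreover have "Suc (T - j) = T - l" "Suc (T - j') = T - l'" using l l' Suc.prems by auto
    ultimately have "pp \<kappa> l (T - l) = pp \<kappa> l' (T - l')" by simp
    moreover have "pp \<kappa> l (T - l) \<noteq> pp \<kappa> l' (T - l')"
      by (rule Suc.hyps(1)) (use Suc l l' in auto)
    ultimately show False by simp
  qed
qed

text \<open>A folded diagram may use one vertex at several base positions, and then these share one
  colour. If the second machine accepts, there is a start cell and distinct slots are distinct
  vertices; otherwise the choice of blanks everywhere is already good.\<close>

lemma consistent_choice:
  assumes k: "C \<kappa> 1 s" and h: "H T \<kappa>" and sol: "solvable MA MC (rowk n q E \<rho> \<kappa> T) T"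
  shows "\<exists>c. choice (rowk n q E \<rho> \<kappa> T) c T \<and> good (tri (comb MA MC) (\<lambda>j. Ini (rowk n q E \<rho> \<kappa> T j) (c j)) T 0) \<and>
    (\<forall>j\<le>T. \<forall>j'\<le>T. pp \<kappa> j (T - j) = pp \<kappa> j' (T - j') \<longrightarrow> c j = c j')"
proof -
  let ?r = "rowk n q E \<rho> \<kappa> T"
  show ?thesis
  proof (cases "cflag (tri (comb MA MC) (\<lambda>j. Ini (?r j) 0) T 0) = 1")
    case True
    obtain i where i: "i \<le> T" "?r i = 3 \<or> ?r i = 4"
      using row_main[OF H_rowok[OF h] True] by blast
    obtain c where c: "choice ?r c T" "good (tri (comb MA MC) (\<lambda>j. Ini (?r j) (c j)) T 0)"
      using sol unfolding solvable_def by blast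
    have "c j = c j'" if j: "j \<le> T" "j' \<le> T" "pp \<kappa> j (T - j) = pp \<kappa> j' (T - j')" for j j'
    proof (cases "?r j = 7")
      case F: False
      moreover have "?r j' = ?r j" using j(3) by (simp add: rowk_def)
      ultimately show ?thesis using c(1) j by (simp add: choice_def)
    next
      case 7: True
      moreover have "?r j' = 7" using 7 j(3) by (simp add: rowk_def)
      ultimately have "i \<le> j" "i \<le> j'"
        using row_format(2)[OF H_rowok[OF h] i] by (metis eval_nat_numeral(3) not_le numeral_eq_iff semiring_norm(88))+
      then have "j = j'"
        using slots_distinct[OF h i, of j j'] slots_distinct[OF h i, of j' j] j by (metis linorder_neqE_nat)
      then show ?thesis by simp
    qed
    then show ?thesis using c by blast
  next
    case False
    have "good (tri (comb MA MC) (\<lambda>j. Ini (?r j) 0) T 0)"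
      by (rule good_no_flag[OF corner_pos[OF k h] False])
    then show ?thesis by (intro exI[of _ "\<lambda>_. 0"]) (simp add: choice_def)
  qed
qed

text \<open>There is at most one apex, hence at most one diagram that makes demands. If it is
  incomplete, \<open>Star\<close> climbs to it; if it is complete, its cells get the values computed
  from a solution and all other vertices are \<open>Off\<close>.\<close>

theorem colour_iff:
  "(\<exists>c. valid c \<and> (\<forall>v. c v \<in> vals MA MC)) \<longleftrightarrow>
   (\<forall>\<kappa> s T. C \<kappa> 1 s \<longrightarrow> H T \<kappa> \<longrightarrow> solvable MA MC (rowk n q E \<rho> \<kappa> T) T)" (is "?L = ?R")
proof
  assume ?L
  then show ?R using valid_imp_solvable by blast
next
  assume R: ?R
  show ?L
  proof (cases "\<exists>\<kappa> s T. C \<kappa> 1 s \<and> H T \<kappa>")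
    case False
    \<comment> \<open>A cell with a missing parent is under no propagation condition and may be
      \<open>Star\<close>. Above it \<open>Star\<close> persists, because by \<open>H_par_eq\<close>
      an incomplete cell with both parents has an incomplete one among them.\<close>
    define c where "c = (\<lambda>u. if (\<exists>k s. C u k s) \<and> \<not> (\<exists>T. H T u) then Star else Off)"
    have "valid c"
      unfolding valid_iff
    proof (intro conjI allI impI)
      show "good (c u) \<or> c u = Star" if "C u 1 s" for u s
        using that False by (auto simp: c_def)
      show "allowed k (c u)" if "C u k s" "2 \<le> k" for u k s
      proof -
        have "H 0 u" using that by auto
        then have "c u = Off" by (auto simp: c_def simp del: hgt.simps)
        then show ?thesis by (simp add: allowed_def)
      qed
      fix u a b assume ab: "P 1 u a" "P 2 u b"
      show "okc MA MC (c u) (c b) (c a)"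
      proof (cases "c u = Star")
        case True
        then have n: "\<not> (\<exists>T. H T u)" by (auto simp: c_def split: if_splits)
        have "c a = Star \<or> c b = Star"
        proof (rule ccontr)
          assume "\<not> ?thesis"
          then have "\<exists>T. H T a" "\<exists>T. H T b"
            using P_cells[OF ab(1)] P_cells[OF ab(2)] unfolding c_def by (auto split: if_splits)
          then obtain Ta Tb where T: "H Ta a" "H Tb b" by blast
          then have "Ta = Tb" using H_par_eq[OF ab] by blast
          then have "H (Suc Ta) u" using T ab by auto
          then show False using n by blast
        qed
        then show ?thesis using True by (auto simp: okc_def)
      next
        case False
        then have "c u = Off" by (auto simp: c_def split: if_splits)
        then show ?thesis by (simp add: okc_def)
      qed
    qed
    moreover have "\<forall>v. c v \<in> vals MA MC" by (simp add: c_def vals_simps)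
    ultimately show ?thesis by blast
  next
    case True
    then obtain \<kappa> s T where k: "C \<kappa> 1 s" and h: "H T \<kappa>" by blast
    let ?r = "rowk n q E \<rho> \<kappa> T"
    obtain ch where ch: "choice ?r ch T" "good (tri (comb MA MC) (\<lambda>j. Ini (?r j) (ch j)) T 0)"
      "\<And>j j'. j \<le> T \<Longrightarrow> j' \<le> T \<Longrightarrow> pp \<kappa> j (T - j) = pp \<kappa> j' (T - j') \<Longrightarrow> ch j = ch j'"
      using consistent_choice[OF k h] R k h by blast
    define \<nu> where "\<nu> = (\<lambda>j. if j \<le> T then Ini (?r j) (ch j) else Dead)"
    have \<nu>v: "\<nu> j \<in> vals MA MC" for j
    proof (cases "j \<le> T")
      case True
      have "?r j < 9" "ch j < 3" using H_base(3)[OF h True] ch(1) True by (simp_all add: choice_def)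
      then show ?thesis using True by (simp add: \<nu>_def vals_simps)
    qed (simp add: \<nu>_def vals_simps)
    have \<nu>r: "real (\<nu> j)" for j by (simp add: \<nu>_def real_def)
    have gd: "good (tri (comb MA MC) \<nu> T 0)"
    proof -
      have "tri (comb MA MC) \<nu> T 0 = tri (comb MA MC) (\<lambda>j. Ini (?r j) (ch j)) T 0"
        by (rule tri_cong) (simp add: \<nu>_def)
      then show ?thesis using ch(2) by simp
    qed
    \<comment> \<open>One vertex may have several addresses in the triangle; the value computed
      there depends on the vertex alone.\<close>
    have wd: "tri (comb MA MC) \<nu> d a = tri (comb MA MC) \<nu> d a'"
      if "a + b + d = T" "a' + b' + d = T" "pp \<kappa> a b = pp \<kappa> a' b'" for a b a' b' d
      using that
    proof (induction d arbitrary: a b a' b')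
      case 0
      then have b: "b = T - a" "b' = T - a'" "a \<le> T" "a' \<le> T" by auto
      then have "ch a = ch a'" "?r a = ?r a'" using ch(3)[of a a'] 0 by (auto simp: rowk_def)
      then show ?case using b by (simp add: \<nu>_def)
    next
      case (Suc d)
      have l: "a + b < T" "a' + b' < T" using Suc.prems by auto
      note pr = pp_par[OF h Suc.prems(3) l]
      have "tri (comb MA MC) \<nu> d a = tri (comb MA MC) \<nu> d a'"
        by (rule Suc.IH[of a "Suc b" a' "Suc b'"]) (use Suc.prems pr in auto)
      moreover have "tri (comb MA MC) \<nu> d (Suc a) = tri (comb MA MC) \<nu> d (Suc a')"
        by (rule Suc.IH[of "Suc a" b "Suc a'" b']) (use Suc.prems pr in auto)
      ultimately show ?case by simp
    qed
    define ab where "ab = (\<lambda>u. SOME x. fst x + snd x \<le> T \<and> u = pp \<kappa> (fst x) (snd x))"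
    define c where "c = (\<lambda>u. if \<exists>a b. a + b \<le> T \<and> u = pp \<kappa> a b
      then tri (comb MA MC) \<nu> (T - fst (ab u) - snd (ab u)) (fst (ab u)) else Off)"
    have coff: "c u = Off" if "\<not> (\<exists>a b. a + b \<le> T \<and> u = pp \<kappa> a b)" for u
      using that unfolding c_def by (simp only: if_False)
    have cpp: "c (pp \<kappa> a b) = tri (comb MA MC) \<nu> (T - a - b) a" if l: "a + b \<le> T" for a b
    proof -
      let ?u = "pp \<kappa> a b"
      have "\<exists>x. fst x + snd x \<le> T \<and> ?u = pp \<kappa> (fst x) (snd x)" using l by (intro exI[of _ "(a, b)"]) simp
      from someI_ex[OF this] have x: "fst (ab ?u) + snd (ab ?u) \<le> T" "?u = pp \<kappa> (fst (ab ?u)) (snd (ab ?u))"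
        unfolding ab_def by auto
      have d: "T - a - b = T - fst (ab ?u) - snd (ab ?u)" by (rule pp_depth[OF h x(2) l x(1)])
      have "tri (comb MA MC) \<nu> (T - a - b) a = tri (comb MA MC) \<nu> (T - a - b) (fst (ab ?u))"
        by (rule wd[of a b _ _ "snd (ab ?u)"]) (use l x d in auto)
      then show ?thesis unfolding c_def using l d by auto
    qed
    have "valid c"
      unfolding valid_iff
    proof (intro conjI allI impI)
      show "good (c u) \<or> c u = Star" if "C u 1 s'" for u s'
      proof -
        have "u = pp \<kappa> 0 0" using corner_unique[OF that k] by (simp add: pt_def)
        then show ?thesis using cpp[of 0 0] gd by simp
      qed
      show "allowed k' (c u)" if u: "C u k' s'" "2 \<le> k'" for u k' s'
      proof (cases "\<exists>a b. a + b \<le> T \<and> u = pp \<kappa> a b")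
        case True
        then obtain a b where x: "a + b \<le> T" "u = pp \<kappa> a b" by blast
        have "H 0 u" using u by auto
        moreover have "H (T - a - b) u" using H_pt[OF h x(1)] x(2) by simp
        ultimately have d: "T - a - b = 0" using H_unique by blast
        then have b: "b = T - a" "a \<le> T" using x(1) by auto
        then have "?r a = k'" using K_eq[OF u(1)] x(2) by (simp add: rowk_def)
        moreover have "c u = Ini (?r a) (ch a)" using cpp[OF x(1)] d x(2) b by (simp add: \<nu>_def)
        ultimately show ?thesis using ch(1) b by (auto simp: allowed_def choice_def)
      qed (simp add: coff allowed_def)
      fix u x y assume xy: "P 1 u x" "P 2 u y"
      show "okc MA MC (c u) (c y) (c x)"
      proof (cases "\<exists>a b. a + b \<le> T \<and> u = pp \<kappa> a b")
        case True
        then obtain a b where u: "a + b \<le> T" "u = pp \<kappa> a b" by blast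
        have l: "a + b < T"
        proof (rule ccontr)
          assume "\<not> a + b < T"
          then have "H 0 u" using H_pt[OF h u(1)] u by simp
          then obtain k' s' where k': "C u k' s'" "2 \<le> k'" by auto
          then show False using P_kind[OF disjI1[OF xy(1)] k'(1)] by simp
        qed
        have x: "x = pp \<kappa> (Suc a) b" using P1_unique[OF xy(1)] H_parents(1)[OF h l] u by simp
        have y: "y = pp \<kappa> a (Suc b)" using P2_unique[OF xy(2)] H_parents(2)[OF h l] u by simp
        have d: "T - a - b = Suc (T - a - Suc b)" "T - Suc a - b = T - a - Suc b" using l by auto
        have "c u = comb MA MC (c y) (c x)"
          unfolding x y u(2) using cpp[of a b] cpp[of "Suc a" b] cpp[of a "Suc b"] l d by simp
        moreover have "real (c u)" "real (c x)" "real (c y)"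
          unfolding x y u(2) using cpp[of a b] cpp[of "Suc a" b] cpp[of a "Suc b"] l tri_real[OF \<nu>r] by auto
        ultimately show ?thesis by (simp add: okc_def)
      qed (simp add: coff okc_def)
    qed
    moreover have "c v \<in> vals MA MC" for v
      unfolding c_def using tri_vals[OF \<nu>v] by (simp add: vals_simps)
    ultimately show ?thesis by blast
  qed
qed

end

section \<open>Orderings and colourings\<close>

lemma rank_bij:
  fixes K :: "nat \<Rightarrow> nat"
  assumes "inj_on K {..<n}"
  defines "pos \<equiv> \<lambda>v. card {u. u < n \<and> K u < K v}"
  shows "bij_betw pos {..<n} {..<n}" "\<And>u v. u < n \<Longrightarrow> v < n \<Longrightarrow> pos u < pos v \<longleftrightarrow> K u < K v"
proof -
  have less: "pos u < pos v" if "u < n" "v < n" "K u < K v" for u v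
    unfolding pos_def by (rule psubset_card_mono) (use that in auto)
  show iff: "pos u < pos v \<longleftrightarrow> K u < K v" if "u < n" "v < n" for u v
  proof
    assume l: "pos u < pos v"
    show "K u < K v"
    proof (rule ccontr)
      assume "\<not> K u < K v"
      then have "K v < K u \<or> K u = K v" by auto
      then have "pos v \<le> pos u" using less[OF that(2,1)] by (auto simp: pos_def)
      then show False using l by simp
    qed
  qed (rule less[OF that])
  have inj: "inj_on pos {..<n}"
  proof (rule inj_onI)
    fix u v assume uv: "u \<in> {..<n}" "v \<in> {..<n}" "pos u = pos v"
    then have "\<not> K u < K v" "\<not> K v < K u" using iff[of u v] iff[of v u] by auto
    then show "u = v" using assms(1) uv by (auto simp: inj_on_def)
  qed
  have "pos ` {..<n} \<subseteq> {..<n}"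
  proof
    fix y assume "y \<in> pos ` {..<n}"
    then obtain v where v: "v < n" "y = pos v" by auto
    have "pos v < card {..<n}" unfolding pos_def by (rule psubset_card_mono) (use v in auto)
    then show "y \<in> {..<n}" using v by simp
  qed
  then show "bij_betw pos {..<n} {..<n}"
    unfolding bij_betw_def using inj endo_inj_surj[OF _ _ inj] by simp
qed

text \<open>The i-th clique vertex gets the key 2 * i + 1 and a vertex of colour e the key 2 * e, so
  exactly the first e clique vertices precede it. Ties are broken by vertex numbers.\<close>

lemma realize_colours:
  assumes \<rho>: "\<And>i. i < q \<Longrightarrow> \<rho> i < n" "inj_on \<rho> {..<q}" and e: "\<And>v. e v \<le> q"
  shows "\<exists>pos. inj pos \<and> bij_betw pos {..<n} {..<n} \<and>
    (\<forall>v<n. v \<notin> \<rho> ` {..<q} \<longrightarrow> colour q (\<lambda>a b. pos a < pos b) \<rho> v = e v)"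
proof -
  define key where "key = (\<lambda>v. if v \<in> \<rho> ` {..<q} then 2 * inv_into {..<q} \<rho> v + 1 else 2 * e v)"
  define K where "K = (\<lambda>v. key v * n + v)"
  have Kinj: "inj_on K {..<n}"
  proof (rule inj_onI)
    fix u v assume "u \<in> {..<n}" "v \<in> {..<n}" "K u = K v"
    then have "K u mod n = K v mod n" "u < n" "v < n" by auto
    then show "u = v" by (simp add: K_def)
  qed
  define pos where "pos = (\<lambda>v. if v < n then card {u. u < n \<and> K u < K v} else v)"
  note rb = rank_bij[OF Kinj]
  have b: "bij_betw pos {..<n} {..<n}"
    using rb(1) by (subst bij_betw_cong[of _ _ "\<lambda>v. card {u. u < n \<and> K u < K v}"]) (auto simp: pos_def)
  have lt: "pos u < pos v \<longleftrightarrow> K u < K v" if "u < n" "v < n" for u v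
    using rb(2)[OF that] that by (simp add: pos_def)
  have pn: "pos v < n" if "v < n" for v using b that by (auto simp: bij_betw_def)
  have "inj pos"
  proof (rule injI)
    fix u v assume uv: "pos u = pos v"
    consider "u < n" "v < n" | "u < n" "\<not> v < n" | "\<not> u < n" "v < n" | "\<not> u < n" "\<not> v < n" by blast
    then show "u = v"
    proof cases
      case 1
      then show ?thesis using b uv by (auto simp: bij_betw_def inj_on_def)
    next
      case 2
      then show ?thesis using pn[of u] uv by (simp add: pos_def)
    next
      case 3
      then show ?thesis using pn[of v] uv by (simp add: pos_def)
    qed (use uv in \<open>simp add: pos_def\<close>)
  qed
  moreover have "colour q (\<lambda>a b. pos a < pos b) \<rho> v = e v" if v: "v < n" "v \<notin> \<rho> ` {..<q}" for v
  proof -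
    have "pos (\<rho> i) < pos v \<longleftrightarrow> i < e v" if i: "i < q" for i
    proof -
      have ki: "key (\<rho> i) = 2 * i + 1" using i \<rho>(2) by (simp add: key_def)
      have kv: "key v = 2 * e v" using v by (simp add: key_def)
      have "K (\<rho> i) < K v \<longleftrightarrow> i < e v"
      proof (cases "i < e v")
        case True
        then have "(2 * i + 2) * n \<le> 2 * e v * n" by (intro mult_le_mono1) simp
        then show ?thesis using True \<rho>(1)[OF i] by (simp add: K_def ki kv algebra_simps)
      next
        case False
        then have "e v * n \<le> i * n" by (intro mult_le_mono1) simp
        moreover have "K (\<rho> i) = 2 * (i * n) + n + \<rho> i" "K v = 2 * (e v * n) + v"
          by (simp_all add: K_def ki kv algebra_simps)
        ultimately show ?thesis using False v(1) by linarith
      qed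
      then show ?thesis using lt[OF \<rho>(1)[OF i] v(1)] by simp
    qed
    then have "{i. i < q \<and> pos (\<rho> i) < pos v} = {i. i < e v}" using e[of v] by auto
    then show ?thesis by (simp add: colour_def)
  qed
  ultimately show ?thesis using b by blast
qed

lemma lt_neq: "inj pos \<Longrightarrow> (\<lambda>x y. pos x < (pos y :: nat) \<or> pos y < pos x) = (\<noteq>)"
  by (intro ext) (metis injD less_irrefl linorder_neqE_nat)

section \<open>Orderings of a graph that contains a reference\<close>

definition isref :: "nat \<Rightarrow> nat \<Rightarrow> (nat \<Rightarrow> nat \<Rightarrow> bool) \<Rightarrow> (nat \<Rightarrow> nat) \<Rightarrow> bool" where
  "isref n q E \<rho> = (emb q E (\<noteq>) \<rho> \<and> (\<forall>i<q+45. \<rho> i < n))"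

lemma emb_inj: "emb q E (\<noteq>) \<rho> \<Longrightarrow> inj_on \<rho> {..<q+45}"
  unfolding emb_def inj_on_def by (metis lessThan_iff)

text \<open>Without a visible difference the labels agree and the second clique lies inside the
  first one; being of equal size, they coincide as sets.\<close>

lemma emb_equiv:
  assumes "emb q E (\<noteq>) \<rho>" "emb q E (\<noteq>) \<sigma>" "\<not> diff_emb q E (\<noteq>) \<rho> \<sigma>"
  shows "\<And>i. i < 45 \<Longrightarrow> \<sigma> (q + i) = \<rho> (q + i)" "\<sigma> ` {..<q} = \<rho> ` {..<q}" "cl q E (\<noteq>) \<sigma> = cl q E (\<noteq>) \<rho>"
proof -
  show b: "\<And>i. i < 45 \<Longrightarrow> \<sigma> (q + i) = \<rho> (q + i)"
    using assms(2,3) unfolding diff_emb_def by metis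
  have "\<sigma> ` {..<q} \<subseteq> \<rho> ` {..<q}"
  proof
    fix y assume "y \<in> \<sigma> ` {..<q}"
    then obtain i where i: "i < q" "y = \<sigma> i" by auto
    then have "\<exists>j<q. \<sigma> i = \<rho> j" using assms(2,3) unfolding diff_emb_def by blast
    then show "y \<in> \<rho> ` {..<q}" using i by auto
  qed
  moreover have "card (\<sigma> ` {..<q}) = card (\<rho> ` {..<q})"
    using card_image[OF inj_on_subset[OF emb_inj[OF assms(1)], of "{..<q}"]]
      card_image[OF inj_on_subset[OF emb_inj[OF assms(2)], of "{..<q}"]] by simp
  ultimately show a: "\<sigma> ` {..<q} = \<rho> ` {..<q}" by (intro card_subset_eq) auto
  have im: "(\<forall>i<q+45. v \<noteq> \<tau> i) \<longleftrightarrow> v \<notin> \<tau> ` {..<q} \<and> (\<forall>i<45. v \<noteq> \<tau> (q + i))" for v and \<tau> :: "nat \<Rightarrow> nat"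
  proof
    assume R: "v \<notin> \<tau> ` {..<q} \<and> (\<forall>i<45. v \<noteq> \<tau> (q + i))"
    show "\<forall>i<q+45. v \<noteq> \<tau> i"
    proof (intro allI impI)
      fix i assume "i < q + 45"
      then show "v \<noteq> \<tau> i" using R by (cases "i < q") (auto dest: spec[of _ "i - q"])
    qed
  next
    assume R: "\<forall>i<q+45. v \<noteq> \<tau> i"
    have "v \<noteq> \<tau> i" if "i < q" for i using R that by simp
    then have "v \<notin> \<tau> ` {..<q}" by auto
    then show "v \<notin> \<tau> ` {..<q} \<and> (\<forall>i<45. v \<noteq> \<tau> (q + i))" using R by simp
  qed
  have "(\<forall>i<q+45. v \<noteq> \<sigma> i) \<longleftrightarrow> (\<forall>i<q+45. v \<noteq> \<rho> i)" for v
    unfolding im a using b by auto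
  moreover have "\<sigma> (q + (5 * k + s)) = \<rho> (q + (5 * k + s))" if "k < 9" "s < 5" for k s
    using b that by simp
  ultimately show "cl q E (\<noteq>) \<sigma> = cl q E (\<noteq>) \<rho>" by (auto simp: cl_def fun_eq_iff)
qed

text \<open>The colour counts members of the clique before v, so only the clique as a set
  matters.\<close>

lemma colour_image:
  assumes "inj_on \<rho> {..<q}" "inj_on \<sigma> {..<q}" "\<sigma> ` {..<q} = \<rho> ` {..<q}"
  shows "colour q lt \<sigma> v = colour q lt \<rho> v"
proof -
  have "colour q lt \<tau> v = card {w \<in> \<tau> ` {..<q}. lt w v}" if "inj_on \<tau> {..<q}" for \<tau>
  proof -
    have "{w \<in> \<tau> ` {..<q}. lt w v} = \<tau> ` {i. i < q \<and> lt (\<tau> i) v}" by auto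
    moreover have "inj_on \<tau> {i. i < q \<and> lt (\<tau> i) v}" by (rule inj_on_subset[OF that]) auto
    ultimately show ?thesis by (simp add: colour_def card_image)
  qed
  then show ?thesis using assms by simp
qed

lemma cvc_col_cong:
  assumes "\<And>v k s. cl q E N \<rho> v k s \<Longrightarrow> col v = col' v"
  shows "cvc MA MC q E N \<rho> col u a b = cvc MA MC q E N \<rho> col' u a b"
proof -
  have "col u = col' u \<and> col a = col' a \<and> col b = col' b" if "par q E N \<rho> 1 u a" "par q E N \<rho> 2 u b"
    using that assms unfolding par_def by blast
  moreover have "col u = col' u" if "cl q E N \<rho> u k s" for k s using that by (rule assms)
  ultimately show ?thesis unfolding cvc_def by (intro arg_cong2[of _ _ _ _ "(\<or>)"] ex_cong1 conj_cong refl) auto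
qed

locale fgraph = verifier +
  fixes q :: nat and dec :: "nat \<Rightarrow> val" and enc :: "val \<Rightarrow> nat"
  assumes wf: "wf_tm MA" "wf_tm MC" "4 \<le> fst (snd MC)"
    and dec: "\<And>v. v \<in> vals MA MC \<Longrightarrow> dec (enc v) = v \<and> enc v \<le> q"
begin

abbreviation "LF \<equiv> F_free_ordering_lang (Fset MA MC dec q)"

definition solv :: "nat \<Rightarrow> (nat \<Rightarrow> nat \<Rightarrow> bool) \<Rightarrow> (nat \<Rightarrow> nat) \<Rightarrow> bool" where
  "solv n E \<rho> = (\<forall>\<kappa> s T. cel q E \<rho> \<kappa> 1 s \<longrightarrow> hgt q E \<rho> T \<kappa> \<longrightarrow> solvable MA MC (rowk n q E \<rho> \<kappa> T) T)"

definition nostat :: "nat \<Rightarrow> (nat \<Rightarrow> nat \<Rightarrow> bool) \<Rightarrow> (nat \<Rightarrow> nat) \<Rightarrow> bool" where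
  "nostat n E \<rho> = ((\<forall>\<rho>'. (\<forall>i<q+45. \<rho>' i < n) \<longrightarrow> \<not> diff_emb q E (\<noteq>) \<rho> \<rho>') \<and>
     (\<forall>u<n. \<forall>a<n. \<forall>b<n. \<forall>c<n. \<forall>d<n. \<not> svc q E (\<noteq>) \<rho> u a b c d))"

lemma LF_noref:
  assumes "\<And>\<rho>. \<not> isref (enc_nverts x) q (enc_edge x) \<rho>"
  shows "x \<in> LF"
  unfolding F_free_iff
proof (intro exI[of _ "\<lambda>v. v"] conjI allI impI)
  fix \<rho> \<rho>' u a b c d assume "\<forall>i<q+45. \<rho> i < enc_nverts x \<and> \<rho>' i < enc_nverts x"
  then have "\<not> emb q (enc_edge x) (\<noteq>) \<rho>" using assms unfolding isref_def by blast
  then show "\<not> viol MA MC dec q (enc_edge x) (\<lambda>a b. a < b) \<rho> \<rho>' u a b c d"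
    unfolding viol_def Let_def using lt_neq[of "\<lambda>v. v"] by simp
qed (auto simp: bij_betw_def)

text \<open>Static defects do not depend on the order, so a graph with one has no good ordering at
  all. Otherwise orderings and valid colourings correspond, and \<open>colour_iff\<close>
  applies.\<close>

lemma LF_ref:
  assumes "isref (enc_nverts x) q (enc_edge x) \<rho>"
  shows "x \<in> LF \<longleftrightarrow> nostat (enc_nverts x) (enc_edge x) \<rho> \<and> solv (enc_nverts x) (enc_edge x) \<rho>"
proof -
  let ?n = "enc_nverts x" and ?E = "enc_edge x"
  have e: "emb q ?E (\<noteq>) \<rho>" and rn: "\<forall>i<q+45. \<rho> i < ?n" using assms by (auto simp: isref_def)
  have En: "?E i j \<Longrightarrow> i < ?n \<and> j < ?n" for i j by (simp add: enc_edge_def Let_def)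
  have G: "gref MA MC V L tA pW TC ?n q ?E \<rho>" if ns: "nostat ?n ?E \<rho>"
  proof
    show "\<not> svc q ?E (\<noteq>) \<rho> u a b c d" if "u < ?n" "a < ?n" "b < ?n" "c < ?n" "d < ?n" for u a b c d
      using ns that unfolding nostat_def by blast
  qed (use wf En in auto)
  show ?thesis
  proof
    assume "x \<in> LF"
    then obtain pos :: "nat \<Rightarrow> nat" where pos: "inj pos" and nv0: "\<forall>\<rho> \<rho>' u a b c d. (\<forall>i<q+45. \<rho> i < ?n \<and> \<rho>' i < ?n) \<longrightarrow> u < ?n \<longrightarrow> a < ?n \<longrightarrow>
       b < ?n \<longrightarrow> c < ?n \<longrightarrow> d < ?n \<longrightarrow> \<not> viol MA MC dec q ?E (\<lambda>a b. pos a < pos b) \<rho> \<rho>' u a b c d"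
      unfolding F_free_iff by (elim exE conjE) (rule that)
    note nv = nv0[rule_format]
    have n0: "0 < ?n" using rn by (metis add_pos_pos gr0I less_nat_zero_code zero_less_numeral add_is_0 numeral_eq_iff)
    let ?col = "\<lambda>v. dec (colour q (\<lambda>a b. pos a < pos b) \<rho> v)"
    have A: "\<not> diff_emb q ?E (\<noteq>) \<rho> \<rho>' \<and> \<not> svc q ?E (\<noteq>) \<rho> u a b c d \<and> \<not> cvc MA MC q ?E (\<noteq>) \<rho> ?col u a b"
      if "\<forall>i<q+45. \<rho>' i < ?n" "u < ?n" "a < ?n" "b < ?n" "c < ?n" "d < ?n" for \<rho>' u a b c d
      using nv[of \<rho> \<rho>' u a b c d] that rn e unfolding viol_def Let_def lt_neq[OF pos] by blast
    have ns: "nostat ?n ?E \<rho>"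
      unfolding nostat_def using A[OF _ n0 n0 n0 n0 n0] A[OF rn] by blast
    interpret gref MA MC V L tA pW TC ?n q ?E \<rho> by (rule G[OF ns])
    have "valid ?col" unfolding valid_def using A[OF rn _ _ _ n0 n0] by blast
    then have "solv ?n ?E \<rho>" unfolding solv_def using valid_imp_solvable by blast
    then show "nostat ?n ?E \<rho> \<and> solv ?n ?E \<rho>" using ns by blast
  next
    assume R: "nostat ?n ?E \<rho> \<and> solv ?n ?E \<rho>"
    then have ns: "nostat ?n ?E \<rho>" by blast
    interpret gref MA MC V L tA pW TC ?n q ?E \<rho> by (rule G[OF ns])
    obtain c where c: "valid c" "\<And>v. c v \<in> vals MA MC"
      using colour_iff R unfolding solv_def by blast
    have injq: "inj_on \<rho> {..<q}" by (rule inj_on_subset[OF emb_inj[OF e]]) auto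
    have "\<And>i. i < q \<Longrightarrow> \<rho> i < ?n" "\<And>v. enc (c v) \<le> q" using rn dec c(2) by auto
    from realize_colours[OF this(1) injq, of "\<lambda>v. enc (c v)", OF _ this(2)]
    obtain pos where pos: "inj pos" "bij_betw pos {..<?n} {..<?n}"
      and col: "\<And>v. v < ?n \<Longrightarrow> v \<notin> \<rho> ` {..<q} \<Longrightarrow> colour q (\<lambda>a b. pos a < pos b) \<rho> v = enc (c v)"
      by blast
    have "\<not> viol MA MC dec q ?E (\<lambda>a b. pos a < pos b) \<sigma> \<sigma>' u a b c' d"
      if h: "\<forall>i<q+45. \<sigma> i < ?n \<and> \<sigma>' i < ?n" "u < ?n" "a < ?n" "b < ?n" "c' < ?n" "d < ?n" for \<sigma> \<sigma>' u a b c' d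
    proof
      assume v: "viol MA MC dec q ?E (\<lambda>a b. pos a < pos b) \<sigma> \<sigma>' u a b c' d"
      let ?col = "\<lambda>v. dec (colour q (\<lambda>a b. pos a < pos b) \<sigma> v)"
      have es: "emb q ?E (\<noteq>) \<sigma>" and v': "diff_emb q ?E (\<noteq>) \<sigma> \<sigma>' \<or> svc q ?E (\<noteq>) \<sigma> u a b c' d \<or> cvc MA MC q ?E (\<noteq>) \<sigma> ?col u a b"
        using v unfolding viol_def Let_def lt_neq[OF pos(1)] by blast+
      have nd: "\<not> diff_emb q ?E (\<noteq>) \<rho> \<sigma>" using ns h(1) unfolding nostat_def by blast
      \<comment> \<open>Violations may be built on any reference, but all of them see the same
        cells, parents and colours as \<open>\<rho>\<close>.\<close>
      note eq = emb_equiv[OF e es nd]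
      have injs: "inj_on \<sigma> {..<q}" by (rule inj_on_subset[OF emb_inj[OF es]]) auto
      have pr: "par q ?E (\<noteq>) \<sigma> = par q ?E (\<noteq>) \<rho>" by (simp add: par_def fun_eq_iff eq(3))
      from v' show False
      proof (elim disjE)
        assume d: "diff_emb q ?E (\<noteq>) \<sigma> \<sigma>'"
        then have es': "emb q ?E (\<noteq>) \<sigma>'" by (simp add: diff_emb_def)
        have nd': "\<not> diff_emb q ?E (\<noteq>) \<rho> \<sigma>'" using ns h(1) unfolding nostat_def by blast
        note eq' = emb_equiv[OF e es' nd']
        have "\<exists>j<q. \<sigma>' i = \<sigma> j" if "i < q" for i
        proof -
          have "\<sigma>' i \<in> \<sigma> ` {..<q}" using that eq(2) eq'(2) by auto
          then show ?thesis by auto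
        qed
        then show False using d eq(1) eq'(1) unfolding diff_emb_def by metis
      next
        assume "svc q ?E (\<noteq>) \<sigma> u a b c' d"
        then have "svc q ?E (\<noteq>) \<rho> u a b c' d" by (simp add: svc_def eq(3) pr)
        then show False using nosv h by blast
      next
        assume "cvc MA MC q ?E (\<noteq>) \<sigma> ?col u a b"
        then have cv: "cvc MA MC q ?E (\<noteq>) \<rho> ?col u a b" by (simp add: cvc_def eq(3) pr)
        have "?col v = c v" if "cl q ?E (\<noteq>) \<rho> v k s" for v k s
        proof -
          have "v \<noteq> \<rho> i" if "i < q" for i using \<open>cl q ?E (\<noteq>) \<rho> v k s\<close> that by (simp add: cl_def)
          then have "v \<notin> \<rho> ` {..<q}" by auto
          moreover have "v < ?n" using C_bd[OF that] by blast
          ultimately have "colour q (\<lambda>a b. pos a < pos b) \<rho> v = enc (c v)" using col by blast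
          then show ?thesis using colour_image[OF injq injs eq(2)] dec[OF c(2)] by simp
        qed
        then have "cvc MA MC q ?E (\<noteq>) \<rho> ?col u a b = cvc MA MC q ?E (\<noteq>) \<rho> c u a b"
          by (rule cvc_col_cong)
        then have "cvc MA MC q ?E (\<noteq>) \<rho> c u a b" using cv by simp
        then show False using c(1) h unfolding valid_def by blast
      qed
    qed
    then show "x \<in> LF" unfolding F_free_iff
      by (intro exI[of _ pos] conjI pos allI impI)
  qed
qed

end

section \<open>From inputs to graphs\<close>

definition ca :: "nat \<Rightarrow> nat \<Rightarrow> nat \<Rightarrow> nat" where
  "ca q T v = (v - (q + 45)) div (T + 1)"

definition cb :: "nat \<Rightarrow> nat \<Rightarrow> nat \<Rightarrow> nat" where
  "cb q T v = (v - (q + 45)) mod (T + 1)"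

text \<open>The cells number a full square, so that division recovers both coordinates. Those with a
  + b > T remain isolated vertices.\<close>

definition cell :: "nat \<Rightarrow> nat \<Rightarrow> nat \<Rightarrow> nat \<Rightarrow> nat" where
  "cell q T a b = q + 45 + (a * (T + 1) + b)"

definition knd :: "nat \<Rightarrow> (nat \<Rightarrow> nat) \<Rightarrow> nat \<Rightarrow> nat \<Rightarrow> nat" where
  "knd T \<kappa> a b = (if a + b = T then \<kappa> a else if a = 0 \<and> b = 0 then 1 else 0)"

definition lab :: "nat \<Rightarrow> (nat \<Rightarrow> nat) \<Rightarrow> nat \<Rightarrow> nat \<Rightarrow> nat" where
  "lab T \<kappa> a b = 5 * knd T \<kappa> a b + (a + 2 * b) mod 5"

definition gE :: "nat \<Rightarrow> nat \<Rightarrow> (nat \<Rightarrow> nat) \<Rightarrow> nat \<Rightarrow> nat \<Rightarrow> bool" where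
  "gE q T \<kappa> i j = (i < j \<and> (i < q \<and> (j < q \<or> j < q + 45 \<and> i \<le> j - q) \<or>
     q \<le> i \<and> i < q + 45 \<and> q + 45 \<le> j \<and> ca q T j + cb q T j \<le> T \<and> i = q + lab T \<kappa> (ca q T j) (cb q T j) \<or>
     q + 45 \<le> i \<and> ca q T i + cb q T i \<le> T \<and> ca q T j + cb q T j \<le> T \<and>
       (ca q T j = ca q T i + 1 \<and> cb q T j = cb q T i \<or> ca q T j = ca q T i \<and> cb q T j = cb q T i + 1)))"

lemma parI: "E u a \<Longrightarrow> cl q E N \<rho> u k s \<Longrightarrow> cl q E N \<rho> a k' ((s + e) mod 5) \<Longrightarrow> par q E N \<rho> e u a"
  unfolding par_def using cl_bd by blast

lemma parE:
  assumes "par q E N \<rho> e u a"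
  obtains k s k' where "E u a" "cl q E N \<rho> u k s" "cl q E N \<rho> a k' ((s + e) mod 5)"
  using assms unfolding par_def by blast

lemma mod5_neq: "(m + 1) mod 5 \<noteq> m mod (5::nat)" "(m + 2) mod 5 \<noteq> m mod (5::nat)"
  "(m + 3) mod 5 \<noteq> m mod (5::nat)" "(m + 4) mod 5 \<noteq> m mod (5::nat)"
  by presburger+

text \<open>The bound 48 serves rigidity: the q - 1 neighbours of a clique vertex inside the clique
  outnumber the at most 45 clique neighbours of a label vertex and the few neighbours of a
  cell.\<close>

locale grid =
  fixes q T :: nat and \<kappa> :: "nat \<Rightarrow> nat"
  assumes q: "48 \<le> q" and T: "0 < T" and row: "rowok \<kappa> T"
begin

definition n :: nat where "n = q + 45 + (T + 1) * (T + 1)"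

definition E :: "nat \<Rightarrow> nat \<Rightarrow> bool" where
  "E i j = (i < n \<and> j < n \<and> i \<noteq> j \<and> (gE q T \<kappa> i j \<or> gE q T \<kappa> j i))"

abbreviation "c \<equiv> cell q T"

lemma E_sym: "E i j \<longleftrightarrow> E j i"
  unfolding E_def by blast

lemma E_n: "E i j \<Longrightarrow> i < n \<and> j < n"
  unfolding E_def by blast

lemma cab: assumes "b \<le> T" shows "ca q T (c a b) = a" "cb q T (c a b) = b"
  using assms by (simp_all add: ca_def cb_def cell_def div_mult_self3[where b = "T + 1"] del: add_Suc_right)

lemma c_ge: "\<not> c a b < q" "\<not> c a b < q + 45" "q + 45 \<le> c a b" "q \<le> c a b"
  by (auto simp: cell_def)

lemma c_less: assumes "a \<le> T" "b \<le> T" shows "c a b < n"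
proof -
  have "a * (T + 1) \<le> T * (T + 1)" using assms(1) by (rule mult_le_mono1)
  then show ?thesis using assms(2) by (simp add: cell_def n_def algebra_simps)
qed

lemma c_inj: assumes "b \<le> T" "b' \<le> T" "c a b = c a' b'" shows "a = a' \<and> b = b'"
  using cab[OF assms(1), of a] cab[OF assms(2), of a'] assms(3) by simp

lemma c_lt1: "c a b < c (a + 1) b" "c a b < c a (b + 1)"
  by (auto simp: cell_def)

lemma vertex_cases:
  assumes "v < n"
  obtains (A) "v < q" | (B) l where "l < 45" "v = q + l" | (C) a b where "a \<le> T" "b \<le> T" "v = c a b"
proof -
  have "v < q \<or> (\<exists>l<45. v = q + l) \<or> (\<exists>a b. a \<le> T \<and> b \<le> T \<and> v = c a b)"
  proof (cases "v < q + 45")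
    case True
    then have "v < q \<or> (v - q < 45 \<and> v = q + (v - q))" by auto
    then show ?thesis by blast
  next
    case False
    let ?w = "v - (q + 45)"
    have w: "?w < (T + 1) * (T + 1)" using assms False by (simp add: n_def)
    have "?w div (T + 1) < T + 1" using w by (simp only: less_mult_imp_div_less)
    moreover have "?w mod (T + 1) < T + 1" by (rule mod_less_divisor) simp
    moreover have "v = c (?w div (T + 1)) (?w mod (T + 1))"
      using False by (simp only: cell_def div_mult_mod_eq)
    ultimately show ?thesis by (metis Suc_eq_plus1 less_Suc_eq_le)
  qed
  then show ?thesis using that by blast
qed

lemma row_bd: "j \<le> T \<Longrightarrow> 2 \<le> \<kappa> j \<and> \<kappa> j \<le> 8"
  using row by (simp add: rowok_def)

lemma knd_bd: "a + b \<le> T \<Longrightarrow> knd T \<kappa> a b \<le> 8"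
  using row_bd[of a] by (auto simp: knd_def)

lemma knd_cases:
  assumes "a + b \<le> T"
  shows "2 \<le> knd T \<kappa> a b \<longleftrightarrow> a + b = T" "knd T \<kappa> a b = 1 \<longleftrightarrow> a = 0 \<and> b = 0"
proof -
  have a: "2 \<le> \<kappa> a" using row_bd[of a] assms by simp
  then show "2 \<le> knd T \<kappa> a b \<longleftrightarrow> a + b = T" by (simp add: knd_def)
  have "\<kappa> a \<noteq> 1" using a by linarith
  then show "knd T \<kappa> a b = 1 \<longleftrightarrow> a = 0 \<and> b = 0" using T by (auto simp: knd_def)
qed

lemma lab_less: assumes "a + b \<le> T" shows "lab T \<kappa> a b < 45"
proof -
  have "(a + 2 * b) mod 5 < 5" by simp
  then show ?thesis using knd_bd[OF assms] unfolding lab_def by linarith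
qed

lemma E_AB: "u < q \<Longrightarrow> l < 45 \<Longrightarrow> E u (q + l) \<longleftrightarrow> u \<le> l"
  unfolding E_def gE_def n_def by auto

lemma E_BB: "l < 45 \<Longrightarrow> l' < 45 \<Longrightarrow> \<not> E (q + l) (q + l')"
  unfolding E_def gE_def by auto

lemma E_AC: "u < q \<Longrightarrow> \<not> E u (c a b)"
  unfolding E_def gE_def using c_ge[of a b] by auto

lemma E_BC: assumes "l < 45" "a \<le> T" "b \<le> T"
  shows "E (q + l) (c a b) \<longleftrightarrow> a + b \<le> T \<and> l = lab T \<kappa> a b"
proof -
  have "q + l < n" using assms(1) by (simp add: n_def)
  moreover have "q + l < c a b" using c_ge(3)[of a b] assms(1) by linarith
  ultimately show ?thesis
    unfolding E_def gE_def cab[OF assms(3)] using c_less[OF assms(2,3)] c_ge[of a b] assms(1) by auto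
qed

lemma E_CC: assumes "a \<le> T" "b \<le> T" "a' \<le> T" "b' \<le> T"
  shows "E (c a b) (c a' b') \<longleftrightarrow> a + b \<le> T \<and> a' + b' \<le> T \<and>
    (a' = a + 1 \<and> b' = b \<or> a' = a \<and> b' = b + 1 \<or> a = a' + 1 \<and> b = b' \<or> a = a' \<and> b = b' + 1)"
  unfolding E_def gE_def cab[OF assms(2)] cab[OF assms(4)]
  using c_less[OF assms(1,2)] c_less[OF assms(3,4)] c_ge[of a b] c_ge[of a' b'] c_lt1[of a b] c_lt1[of a' b'] by auto

abbreviation "Ce \<equiv> cel q E (\<lambda>i. i)"
abbreviation "Pr \<equiv> Pa q E (\<lambda>i. i)"

lemma Ce_iff: "Ce v k s \<longleftrightarrow> (\<exists>a b. a + b \<le> T \<and> v = c a b \<and> k = knd T \<kappa> a b \<and> s = (a + 2 * b) mod 5)"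
proof
  assume h: "Ce v k s"
  then have ks: "k < 9" "s < 5" and nv: "\<forall>i<q+45. v \<noteq> i" and e: "E v (q + (5 * k + s))" by (simp_all add: cl_def)
  have l: "5 * k + s < 45" using ks by linarith
  have "v < n" using E_n[OF e] by simp
  then show "\<exists>a b. a + b \<le> T \<and> v = c a b \<and> k = knd T \<kappa> a b \<and> s = (a + 2 * b) mod 5"
  proof (cases v rule: vertex_cases)
    case (C a b)
    then have ab: "a + b \<le> T" "5 * k + s = lab T \<kappa> a b" using e E_BC[OF l C(1,2)] E_sym by simp_all
    have m5: "(a + 2 * b) mod 5 < 5" by simp
    have "k = knd T \<kappa> a b" using ab(2) m5 ks(2) unfolding lab_def by linarith
    moreover from this have "s = (a + 2 * b) mod 5" using ab(2) unfolding lab_def by linarith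
    ultimately show ?thesis using C(3) ab(1) by blast
  qed (use nv[rule_format, of v] in auto)
next
  assume "\<exists>a b. a + b \<le> T \<and> v = c a b \<and> k = knd T \<kappa> a b \<and> s = (a + 2 * b) mod 5"
  then obtain a b where ab: "a + b \<le> T" "v = c a b" "k = knd T \<kappa> a b" "s = (a + 2 * b) mod 5" by blast
  have "E v (q + (5 * k + s))"
    using E_BC[of "5 * k + s" a b] lab_less[OF ab(1)] ab E_sym by (simp add: lab_def)
  moreover have "k < 9" using knd_bd[OF ab(1)] ab(3) by simp
  moreover have "\<forall>i<q+45. v \<noteq> i" using c_ge(2)[of a b] ab(2) by auto
  ultimately show "Ce v k s" using ab(4) by (simp add: cl_def)
qed

lemma CeE:
  assumes "Ce v k s"
  obtains a b where "a + b \<le> T" "v = c a b" "k = knd T \<kappa> a b" "s = (a + 2 * b) mod 5"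
  using assms unfolding Ce_iff by (elim exE conjE) (rule that)

lemma Ce_c: assumes "a + b \<le> T" shows "Ce (c a b) k s \<longleftrightarrow> k = knd T \<kappa> a b \<and> s = (a + 2 * b) mod 5"
proof -
  have "a' = a \<and> b' = b" if "a' + b' \<le> T" "c a b = c a' b'" for a' b'
    using c_inj[of b b' a a'] that assms by auto
  then show ?thesis unfolding Ce_iff using assms by metis
qed

lemma Pr_iff: "Pr e u v \<longleftrightarrow> (\<exists>a b a' b'. u = c a b \<and> v = c a' b' \<and> a + b \<le> T \<and> a' + b' \<le> T \<and>
    (a' = a + 1 \<and> b' = b \<or> a' = a \<and> b' = b + 1 \<or> a = a' + 1 \<and> b = b' \<or> a = a' \<and> b = b' + 1) \<and>
    (a' + 2 * b') mod 5 = (a + 2 * b + e) mod 5)" (is "_ = ?R")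
proof
  assume "Pr e u v"
  then obtain k s k' where h: "E u v" "Ce u k s" "Ce v k' ((s + e) mod 5)" by (rule parE)
  obtain a b where ab: "a + b \<le> T" "u = c a b" "k = knd T \<kappa> a b" "s = (a + 2 * b) mod 5" by (rule CeE[OF h(2)])
  obtain a' b' where ab': "a' + b' \<le> T" "v = c a' b'" "k' = knd T \<kappa> a' b'" "(s + e) mod 5 = (a' + 2 * b') mod 5"
    by (rule CeE[OF h(3)])
  have le: "a \<le> T" "b \<le> T" "a' \<le> T" "b' \<le> T" using ab(1) ab'(1) by auto
  have "a' = a + 1 \<and> b' = b \<or> a' = a \<and> b' = b + 1 \<or> a = a' + 1 \<and> b = b' \<or> a = a' \<and> b = b' + 1"
    using h(1) unfolding ab(2) ab'(2) E_CC[OF le] by (elim conjE)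
  moreover have "(a' + 2 * b') mod 5 = (a + 2 * b + e) mod 5"
    unfolding ab'(4)[symmetric] ab(4) by (rule mod_add_left_eq)
  ultimately show ?R using ab(1,2) ab'(1,2) by (intro exI conjI)
next
  assume ?R
  then obtain a b a' b' where h: "u = c a b" "v = c a' b'" "a + b \<le> T" "a' + b' \<le> T"
    "a' = a + 1 \<and> b' = b \<or> a' = a \<and> b' = b + 1 \<or> a = a' + 1 \<and> b = b' \<or> a = a' \<and> b = b' + 1"
    "(a' + 2 * b') mod 5 = (a + 2 * b + e) mod 5" by (elim exE conjE) (rule that)
  have le: "a \<le> T" "b \<le> T" "a' \<le> T" "b' \<le> T" using h(3,4) by auto
  have "E u v" unfolding h(1,2) E_CC[OF le] by (intro conjI h)
  moreover have "Ce u (knd T \<kappa> a b) ((a + 2 * b) mod 5)" unfolding h(1) Ce_c[OF h(3)] by simp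
  moreover have "Ce v (knd T \<kappa> a' b') (((a + 2 * b) mod 5 + e) mod 5)"
    unfolding h(2) Ce_c[OF h(4)] h(6) mod_add_left_eq by simp
  ultimately show "Pr e u v" by (rule parI)
qed

text \<open>The other three steps between neighbouring cells change the shift by 2, 4 and 3, never
  by 1 modulo 5.\<close>

lemma Pr1_iff: "Pr 1 u v \<longleftrightarrow> (\<exists>a b. u = c a b \<and> v = c (Suc a) b \<and> a + b < T)"
proof
  assume "Pr 1 u v"
  then obtain a b a' b' where h: "u = c a b" "v = c a' b'" "a + b \<le> T" "a' + b' \<le> T"
    "a' = a + 1 \<and> b' = b \<or> a' = a \<and> b' = b + 1 \<or> a = a' + 1 \<and> b = b' \<or> a = a' \<and> b = b' + 1"
    "(a' + 2 * b') mod 5 = (a + 2 * b + 1) mod 5" unfolding Pr_iff by (elim exE conjE) (rule that)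
  have "a' = a + 1 \<and> b' = b" using h(5)
  proof (elim disjE)
    assume "a' = a \<and> b' = b + 1"
    then show ?thesis using h(6) mod5_neq(1)[of "a + 2 * b + 1"] by (simp add: algebra_simps)
  next
    assume "a = a' + 1 \<and> b = b'"
    then show ?thesis using h(6) mod5_neq(2)[of "a' + 2 * b'"] by (simp add: algebra_simps)
  next
    assume "a = a' \<and> b = b' + 1"
    then show ?thesis using h(6) mod5_neq(3)[of "a' + 2 * b'"] by (simp add: algebra_simps)
  qed
  then show "\<exists>a b. u = c a b \<and> v = c (Suc a) b \<and> a + b < T"
    using h(1,2,4) by (intro exI[of _ a] exI[of _ b]) (simp add: Suc_eq_plus1)
next
  assume "\<exists>a b. u = c a b \<and> v = c (Suc a) b \<and> a + b < T"
  then obtain a b where "u = c a b" "v = c (Suc a) b" "a + b < T" by blast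
  moreover have "(Suc a + 2 * b) mod 5 = (a + 2 * b + 1) mod 5" by (simp add: Suc_eq_plus1 algebra_simps)
  ultimately have "u = c a b \<and> v = c (Suc a) b \<and> a + b \<le> T \<and> Suc a + b \<le> T \<and>
      (Suc a = a + 1 \<and> b = b \<or> Suc a = a \<and> b = b + 1 \<or> a = Suc a + 1 \<and> b = b \<or> a = Suc a \<and> b = b + 1) \<and>
      (Suc a + 2 * b) mod 5 = (a + 2 * b + 1) mod 5" by simp
  then show "Pr 1 u v" unfolding Pr_iff by (intro exI)
qed

lemma Pr2_iff: "Pr 2 u v \<longleftrightarrow> (\<exists>a b. u = c a b \<and> v = c a (Suc b) \<and> a + b < T)"
proof
  assume "Pr 2 u v"
  then obtain a b a' b' where h: "u = c a b" "v = c a' b'" "a + b \<le> T" "a' + b' \<le> T"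
    "a' = a + 1 \<and> b' = b \<or> a' = a \<and> b' = b + 1 \<or> a = a' + 1 \<and> b = b' \<or> a = a' \<and> b = b' + 1"
    "(a' + 2 * b') mod 5 = (a + 2 * b + 2) mod 5" unfolding Pr_iff by (elim exE conjE) (rule that)
  have "a' = a \<and> b' = b + 1" using h(5)
  proof (elim disjE)
    assume "a' = a + 1 \<and> b' = b"
    then show ?thesis using h(6) mod5_neq(1)[of "a + 2 * b + 1"] by (simp add: algebra_simps)
  next
    assume "a = a' + 1 \<and> b = b'"
    then show ?thesis using h(6) mod5_neq(3)[of "a' + 2 * b'"] by (simp add: algebra_simps)
  next
    assume "a = a' \<and> b = b' + 1"
    then show ?thesis using h(6) mod5_neq(4)[of "a' + 2 * b'"] by (simp add: algebra_simps)
  qed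
  then show "\<exists>a b. u = c a b \<and> v = c a (Suc b) \<and> a + b < T"
    using h(1,2,4) by (intro exI[of _ a] exI[of _ b]) (simp add: Suc_eq_plus1)
next
  assume "\<exists>a b. u = c a b \<and> v = c a (Suc b) \<and> a + b < T"
  then obtain a b where "u = c a b" "v = c a (Suc b)" "a + b < T" by blast
  moreover have "(a + 2 * Suc b) mod 5 = (a + 2 * b + 2) mod 5" by simp
  ultimately have "u = c a b \<and> v = c a (Suc b) \<and> a + b \<le> T \<and> a + Suc b \<le> T \<and>
      (a = a + 1 \<and> Suc b = b \<or> a = a \<and> Suc b = b + 1 \<or> a = a + 1 \<and> b = Suc b \<or> a = a \<and> b = Suc b + 1) \<and>
      (a + 2 * Suc b) mod 5 = (a + 2 * b + 2) mod 5" by simp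
  then show "Pr 2 u v" unfolding Pr_iff by (intro exI)
qed

lemma Pr1_c: assumes "b \<le> T" shows "Pr 1 (c a b) v \<longleftrightarrow> v = c (Suc a) b \<and> a + b < T"
proof
  assume "Pr 1 (c a b) v"
  then obtain a' b' where "c a b = c a' b'" "v = c (Suc a') b'" "a' + b' < T" unfolding Pr1_iff by blast
  then show "v = c (Suc a) b \<and> a + b < T" using c_inj[of b b' a a'] assms by auto
qed (auto simp: Pr1_iff)

lemma Pr2_c: assumes "b \<le> T" shows "Pr 2 (c a b) v \<longleftrightarrow> v = c a (Suc b) \<and> a + b < T"
proof
  assume "Pr 2 (c a b) v"
  then obtain a' b' where "c a b = c a' b'" "v = c a' (Suc b')" "a' + b' < T" unfolding Pr2_iff by blast
  then show "v = c a (Suc b) \<and> a + b < T" using c_inj[of b b' a a'] assms by auto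
qed (auto simp: Pr2_iff)

lemma nosvc: "\<not> svc q E (\<noteq>) (\<lambda>i. i) u v w y z"
proof -
  have c1: "k = k' \<and> s = s'" if h: "Ce u k s" "Ce u k' s'" for k s k' s'
  proof -
    obtain a b where u: "a + b \<le> T" "u = c a b" by (rule CeE[OF h(1)])
    show ?thesis using h Ce_c[OF u(1)] unfolding u(2) by simp
  qed
  have c2: False if h: "u \<noteq> v" "Ce u 1 s" "Ce v 1 s'" for s s'
  proof -
    obtain a b where u: "a + b \<le> T" "u = c a b" by (rule CeE[OF h(2)])
    obtain a' b' where v: "a' + b' \<le> T" "v = c a' b'" by (rule CeE[OF h(3)])
    have "knd T \<kappa> a b = 1" "knd T \<kappa> a' b' = 1" using h(2,3) Ce_c[OF u(1)] Ce_c[OF v(1)] u(2) v(2) by auto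
    then show False using knd_cases(2)[OF u(1)] knd_cases(2)[OF v(1)] u(2) v(2) h(1) by simp
  qed
  have c3: False if h: "Pr 1 u v" "Pr 1 u w" "v \<noteq> w"
  proof -
    obtain a b where u: "u = c a b" "a + b < T" using h(1) unfolding Pr1_iff by (elim exE conjE) (rule that)
    then show False using h Pr1_c[of b a] by simp
  qed
  have c4: False if h: "Pr 2 u v" "Pr 2 u w" "v \<noteq> w"
  proof -
    obtain a b where u: "u = c a b" "a + b < T" using h(1) unfolding Pr2_iff by (elim exE conjE) (rule that)
    then show False using h Pr2_c[of b a] by simp
  qed
  have c5: False if h: "Pr 1 u v \<or> Pr 2 u v" "Ce u k s" "2 \<le> k" for k s
  proof -
    obtain a b where u: "u = c a b" "a + b < T" using h(1) unfolding Pr1_iff Pr2_iff by (elim disjE exE conjE) (rule that, assumption+)+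
    then have "k = knd T \<kappa> a b" using h(2) Ce_c[of a b] by simp
    then show False using h(3) knd_cases(1)[of a b] u(2) by simp
  qed
  have c6: False if h: "Pr 1 u v" "Pr 2 u w" "Pr 2 v y" "Pr 1 w z" "y \<noteq> z"
  proof -
    obtain a b where u: "u = c a b" "a + b < T" using h(1) unfolding Pr1_iff by (elim exE conjE) (rule that)
    have v: "v = c (Suc a) b" and w: "w = c a (Suc b)"
      using h(1,2) u Pr1_c[of b a] Pr2_c[of b a] by simp_all
    have "y = c (Suc a) (Suc b)" using h(3) Pr2_c[of b "Suc a"] u(2) unfolding v by simp
    moreover have "z = c (Suc a) (Suc b)" using h(4) Pr1_c[of "Suc b" a] u(2) unfolding w by simp
    ultimately show False using h(5) by simp
  qed
  have c7: False if h: "Pr 1 u v" "Pr 2 u w" "Ce v ka sa" "Ce w kb sb" "\<not> okp kb ka" for ka sa kb sb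
  proof -
    obtain a b where u: "u = c a b" "a + b < T" using h(1) unfolding Pr1_iff by (elim exE conjE) (rule that)
    have v: "v = c (Suc a) b" and w: "w = c a (Suc b)"
      using h(1,2) u Pr1_c[of b a] Pr2_c[of b a] by simp_all
    have k: "ka = knd T \<kappa> (Suc a) b" "kb = knd T \<kappa> a (Suc b)"
      using h(3,4) Ce_c[of "Suc a" b] Ce_c[of a "Suc b"] u(2) unfolding v w by simp_all
    have "okp kb ka"
    proof (cases "Suc (a + b) = T")
      case True
      then have "ka = \<kappa> (Suc a)" "kb = \<kappa> a" using k by (simp_all add: knd_def)
      moreover have "2 \<le> \<kappa> a" "2 \<le> \<kappa> (Suc a)" using row_bd True by simp_all
      moreover have "adj (\<kappa> a) (\<kappa> (Suc a))" using row True by (simp add: rowok_def)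
      ultimately show ?thesis by (simp add: okp_def)
    next
      case False
      then show ?thesis unfolding k by (simp add: knd_def okp_def)
    qed
    then show False using h(5) by simp
  qed
  have c8: False if h: "Pr 1 v u" "Pr 1 w u" "v \<noteq> w"
  proof -
    obtain a b where v: "v = c a b" "u = c (Suc a) b" "a + b < T" using h(1) unfolding Pr1_iff by (elim exE conjE) (rule that)
    obtain a' b' where w: "w = c a' b'" "u = c (Suc a') b'" "a' + b' < T" using h(2) unfolding Pr1_iff by (elim exE conjE) (rule that)
    have "Suc a = Suc a' \<and> b = b'" by (rule c_inj) (use v w in auto)
    then show False using h(3) v(1) w(1) by simp
  qed
  have c5': "Pr 1 u v \<Longrightarrow> Ce u k s \<Longrightarrow> 2 \<le> k \<Longrightarrow> False" "Pr 2 u v \<Longrightarrow> Ce u k s \<Longrightarrow> 2 \<le> k \<Longrightarrow> False" for k s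
    using c5 by auto
  show ?thesis
  proof
    assume "svc q E (\<noteq>) (\<lambda>i. i) u v w y z"
    then show False unfolding svc_def
    proof (elim disjE exE conjE, goal_cases)
      case (1 k s k' s')
      then show ?case using c1[of k s k' s'] by simp
    next
      case (2 k s k' s')
      then show ?case using c1[of k s k' s'] by simp
    next
      case (3 s s')
      then show ?case by (intro c2[of s s'])
    next
      case 4
      then show ?case by (intro c3)
    next
      case 5
      then show ?case by (intro c4)
    next
      case (6 k s)
      then show ?case by (intro c5'(1)[of k s])
    next
      case (7 k s)
      then show ?case by (intro c5'(2)[of k s])
    next
      case 8
      then show ?case by (intro c6)
    next
      case (9 ka sa kb sb)
      then show ?case by (intro c7[of ka sa kb sb])
    next
      case (10 k s)
      then show ?case by (intro c8)
    qed
  qed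
qed

lemma emb_id: "emb q E (\<noteq>) (\<lambda>i. i)"
  unfolding emb_def
proof (intro allI impI conjI)
  fix i j assume "i < q + 45" "j < q + 45" "Rg q i j"
  then show "E i j" unfolding Rg_def E_def gE_def n_def by auto
qed

text \<open>Degrees force a copied clique onto the clique. The copy of label l then has at least l +
  1 neighbours there, so it is a label with index at least l; by injectivity all labels stay
  fixed.\<close>

lemma nodiff: assumes \<rho>: "\<forall>i<q+45. \<rho> i < n" shows "\<not> diff_emb q E (\<noteq>) (\<lambda>i. i) \<rho>"
proof
  assume d: "diff_emb q E (\<noteq>) (\<lambda>i. i) \<rho>"
  then have e: "emb q E (\<noteq>) \<rho>" by (simp add: diff_emb_def)
  note inj = emb_inj[OF e]
  have ad: "E (\<rho> i) (\<rho> j)" if "Rg q i j" for i j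
  proof -
    have "i < q + 45" "j < q + 45" using that by (auto simp: Rg_def)
    then show ?thesis using e that unfolding emb_def by blast
  qed
  have clq: "E (\<rho> i) w" if "i < q" "w \<in> \<rho> ` ({..<q} - {i})" for i w
    using that ad by (auto simp: Rg_def)
  have cS: "card (\<rho> ` ({..<q} - {i})) = q - 1" if "i < q" for i
    using that by (subst card_image[OF inj_on_subset[OF inj]]) auto
  have notC: "\<rho> i \<noteq> c a b" if i: "i < q" and ab: "a \<le> T" "b \<le> T" for i a b
  proof
    assume ri: "\<rho> i = c a b"
    \<comment> \<open>All candidates for neighbours of a cell: its label and the four cells around
      it, far fewer than q - 1.\<close>
    let ?N = "[q + lab T \<kappa> a b, c (a + 1) b, c a (b + 1), c (a - 1) b, c a (b - 1)]"
    have "\<rho> ` ({..<q} - {i}) \<subseteq> set ?N"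
    proof
      fix w assume "w \<in> \<rho> ` ({..<q} - {i})"
      then have w: "E (c a b) w" using clq[OF i] ri by simp
      then have "w < n" using E_n by blast
      then show "w \<in> set ?N"
      proof (cases w rule: vertex_cases)
        case A
        then show ?thesis using w E_AC E_sym by blast
      next
        case (B l)
        then show ?thesis using w E_BC[OF B(1) ab] E_sym by simp
      next
        case (C a' b')
        then show ?thesis using w E_CC[OF ab C(1,2)] by auto
      qed
    qed
    then have "card (\<rho> ` ({..<q} - {i})) \<le> card (set ?N)" by (intro card_mono) auto
    also have "\<dots> \<le> length ?N" by (rule card_length)
    finally show False using cS[OF i] q by simp
  qed
  have inA: "\<rho> i < q" if i: "i < q" for i
  proof -
    have "\<rho> i < n" using \<rho> i by simp
    then show ?thesis
    proof (cases "\<rho> i" rule: vertex_cases)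
      case (B l)
      have "\<rho> ` ({..<q} - {i}) \<subseteq> {..l}"
      proof
        fix w assume wi: "w \<in> \<rho> ` ({..<q} - {i})"
        then have w: "E (q + l) w" using clq[OF i] B by simp
        then have "w < n" using E_n by blast
        then show "w \<in> {..l}"
        proof (cases w rule: vertex_cases)
          case A
          then show ?thesis using w E_AB[OF A B(1)] E_sym by simp
        next
          case (B l')
          then show ?thesis using w E_BB[OF \<open>l < 45\<close> B(1)] by simp
        next
          case (C a b)
          obtain k where "k < q" "w = \<rho> k" using wi by auto
          then show ?thesis using notC[OF _ C(1,2), of k] C(3) by simp
        qed
      qed
      then have "card (\<rho> ` ({..<q} - {i})) \<le> card {..l}" by (intro card_mono) auto
      then show ?thesis using cS[OF i] q B(1) by simp
    next
      case (C a b)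
      then show ?thesis using notC[OF i C(1,2)] by simp
    qed
  qed
  have "\<rho> ` {..<q} \<subseteq> {..<q}" using inA by auto
  moreover have "card (\<rho> ` {..<q}) = q" using card_image[OF inj_on_subset[OF inj, of "{..<q}"]] by simp
  ultimately have onA: "\<rho> ` {..<q} = {..<q}" by (intro card_subset_eq) auto
  \<comment> \<open>By the staircase a label can only move upwards.\<close>
  have lb: "\<exists>m<45. \<rho> (q + l) = q + m \<and> l \<le> m" if l: "l < 45" for l
  proof -
    have nq: "\<not> \<rho> (q + l) < q"
    proof
      assume "\<rho> (q + l) < q"
      then have "\<rho> (q + l) \<in> \<rho> ` {..<q}" using onA by simp
      then obtain j where j: "j < q" "\<rho> (q + l) = \<rho> j" by auto
      then have "q + l = j" using inj_onD[OF inj j(2)] l by simp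
      then show False using j(1) by simp
    qed
    have adj: "E (\<rho> j) (\<rho> (q + l))" if "j \<le> l" for j using that l q by (intro ad) (auto simp: Rg_def)
    have "\<rho> (q + l) < n" using \<rho> l by simp
    then show ?thesis
    proof (cases "\<rho> (q + l)" rule: vertex_cases)
      case (B m)
      have "\<rho> ` {..l} \<subseteq> {..m}"
      proof
        fix w assume "w \<in> \<rho> ` {..l}"
        then obtain j where j: "j \<le> l" "w = \<rho> j" by auto
        then have "w < q" using inA l q by simp
        then show "w \<in> {..m}" using adj[OF j(1)] j(2) E_AB[OF _ B(1)] B(2) by simp
      qed
      then have "card (\<rho> ` {..l}) \<le> card {..m}" by (intro card_mono) auto
      moreover have "card (\<rho> ` {..l}) = card {..l}"
        by (rule card_image[OF inj_on_subset[OF inj]]) (use l q in auto)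
      ultimately show ?thesis using B by auto
    next
      case (C a b)
      then show ?thesis using adj[of 0] E_AC[OF inA, of 0] q by auto
    qed (use nq in simp)
  qed
  \<comment> \<open>Induction from the largest label downwards: every higher place is already
    taken.\<close>
  have fixB: "\<rho> (q + l) = q + l" if "l < 45" for l
    using that
  proof (induction "45 - l" arbitrary: l rule: less_induct)
    case less
    obtain m where m: "m < 45" "\<rho> (q + l) = q + m" "l \<le> m" using lb[OF less.prems] by blast
    show ?case
    proof (cases "l = m")
      case False
      then have "\<rho> (q + m) = q + m" using less m by simp
      then have "\<rho> (q + m) = \<rho> (q + l)" using m(2) by simp
      then have "q + m = q + l" using inj_onD[OF inj, of "q + m" "q + l"] m less.prems by simp
      then show ?thesis using False by simp
    qed (use m in simp)
  qed
  show False using d fixB inA unfolding diff_emb_def by auto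
qed

lemma isref_id: "isref n q E (\<lambda>i. i)"
  using emb_id by (simp add: isref_def n_def)

lemma hgt_c: "a + b + d = T \<Longrightarrow> hgt q E (\<lambda>i. i) d (c a b)"
proof (induction d arbitrary: a b)
  case 0
  then have "Ce (c a b) (knd T \<kappa> a b) ((a + 2 * b) mod 5) \<and> 2 \<le> knd T \<kappa> a b"
    using Ce_c[of a b] knd_cases(1)[of a b] by simp
  then show ?case by auto
next
  case (Suc d)
  have "Pr 1 (c a b) (c (Suc a) b)" "Pr 2 (c a b) (c a (Suc b))"
    using Suc.prems Pr1_c[of b a] Pr2_c[of b a] by auto
  then show ?case using Suc.IH[of "Suc a" b] Suc.IH[of a "Suc b"] Suc.prems by auto
qed

end

section \<open>Equivalence of the grid graph with its base row\<close>

context fgraph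
begin

lemma grid_solv:
  assumes "48 \<le> q" "0 < T" "rowok \<kappa> T"
  shows "nostat (grid.n q T) (grid.E q T \<kappa>) (\<lambda>i. i)"
    and "solv (grid.n q T) (grid.E q T \<kappa>) (\<lambda>i. i) \<longleftrightarrow> solvable MA MC \<kappa> T"
proof -
  interpret g: grid q T \<kappa> by unfold_locales (use assms in auto)
  show "nostat g.n g.E (\<lambda>i. i)" unfolding nostat_def using g.nosvc g.nodiff by blast
  interpret r: gref MA MC V L tA pW TC g.n q g.E "\<lambda>i. i"
    by unfold_locales (use wf g.E_n g.nosvc in auto)
  have h: "r.H T (g.c 0 0)" using g.hgt_c[of 0 0 T] by simp
  have c: "r.C (g.c 0 0) 1 0" using g.Ce_c[of 0 0 1 0] g.T by (simp add: knd_def)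
  have p1: "(r.p 1 ^^ a) (g.c 0 0) = g.c a 0" if "a \<le> T" for a
    using that
  proof (induction a)
    case (Suc a)
    then show ?case using r.p1_eq[of "g.c a 0" "g.c (Suc a) 0"] g.Pr1_c[of 0 a] by simp
  qed simp
  have pp: "r.pp (g.c 0 0) a b = g.c a b" if "a + b \<le> T" for a b
    using that
  proof (induction b)
    case 0
    then show ?case using p1[of a] by (simp add: pt_def)
  next
    case (Suc b)
    then show ?case using r.p2_eq[of "g.c a b" "g.c a (Suc b)"] g.Pr2_c[of b a] r.p2_pt[of "g.c 0 0" a b] by simp
  qed
  have rk: "rowk g.n q g.E (\<lambda>i. i) (g.c 0 0) T j = \<kappa> j" if "j \<le> T" for j
    using that pp[of j "T - j"] r.K_eq[of "g.c j (T - j)" "\<kappa> j" "(j + 2 * (T - j)) mod 5"] g.Ce_c[of j "T - j"]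
    by (simp add: rowk_def knd_def)
  have sv: "solvable MA MC (rowk g.n q g.E (\<lambda>i. i) (g.c 0 0) T) T \<longleftrightarrow> solvable MA MC \<kappa> T"
  proof -
    have "tri (comb MA MC) (\<lambda>j. Ini (rowk g.n q g.E (\<lambda>i. i) (g.c 0 0) T j) (ch j)) T 0 =
        tri (comb MA MC) (\<lambda>j. Ini (\<kappa> j) (ch j)) T 0" for ch by (rule tri_cong) (simp add: rk)
    moreover have "choice (rowk g.n q g.E (\<lambda>i. i) (g.c 0 0) T) ch T = choice \<kappa> ch T" for ch
      by (simp add: choice_def rk)
    ultimately show ?thesis by (simp add: solvable_def)
  qed
  show "solv g.n g.E (\<lambda>i. i) \<longleftrightarrow> solvable MA MC \<kappa> T"
  proof
    assume "solv g.n g.E (\<lambda>i. i)"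
    then show "solvable MA MC \<kappa> T" using h c sv unfolding solv_def by blast
  next
    assume s: "solvable MA MC \<kappa> T"
    show "solv g.n g.E (\<lambda>i. i)" unfolding solv_def
    proof (intro allI impI)
      fix k s T' assume k: "r.C k 1 s" "r.H T' k"
      have "k = g.c 0 0" by (rule r.corner_unique[OF k(1) c])
      moreover have "T' = T" using r.H_unique[OF k(2), of T] h calculation by simp
      ultimately show "solvable MA MC (rowk g.n q g.E (\<lambda>i. i) k T') T'" using s sv by simp
    qed
  qed
qed

end

lemma enc_nverts_square: assumes "length y = n * n" shows "enc_nverts y = n"
  unfolding enc_nverts_def
proof (rule Greatest_equality)
  fix m assume "m * m \<le> length y"
  then have "m * m \<le> n * n" using assms by simp
  then show "m \<le> n" by (metis leI linorder_not_le mult_strict_mono' zero_le)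
qed (simp add: assms)

definition gcode :: "nat \<Rightarrow> nat \<Rightarrow> (nat \<Rightarrow> nat) \<Rightarrow> bool list" where
  "gcode q T \<kappa> = (let n = q + 45 + (T + 1) * (T + 1) in map (\<lambda>i. gE q T \<kappa> (i div n) (i mod n)) [0..<n * n])"

lemma (in grid) gcode: "enc_nverts (gcode q T \<kappa>) = n" "enc_edge (gcode q T \<kappa>) = E"
proof -
  have f: "gcode q T \<kappa> = map (\<lambda>i. gE q T \<kappa> (i div n) (i mod n)) [0..<n * n]"
    by (simp add: gcode_def n_def Let_def)
  show n: "enc_nverts (gcode q T \<kappa>) = n" unfolding f by (rule enc_nverts_square) simp
  have "gcode q T \<kappa> ! (i * n + j) = gE q T \<kappa> i j" if "i < n" "j < n" for i j
  proof -
    have "Suc i * n \<le> n * n" using that(1) by (intro mult_le_mono1) simp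
    then have "i * n + j < n * n" using that(2) by simp
    moreover have "(i * n + j) div n = i" "(i * n + j) mod n = j" using that by simp_all
    ultimately show ?thesis unfolding f by simp
  qed
  then show "enc_edge (gcode q T \<kappa>) = E"
    by (intro ext) (auto simp: enc_edge_def E_def n Let_def)
qed

lemma (in fgraph) gcode_LF:
  assumes "48 \<le> q" "0 < T" "rowok \<kappa> T"
  shows "gcode q T \<kappa> \<in> LF \<longleftrightarrow> solvable MA MC \<kappa> T"
proof -
  interpret g: grid q T \<kappa> by unfold_locales (use assms in auto)
  have "isref (enc_nverts (gcode q T \<kappa>)) q (enc_edge (gcode q T \<kappa>)) (\<lambda>i. i)"
    unfolding g.gcode by (rule g.isref_id)
  from LF_ref[OF this] show ?thesis unfolding g.gcode using grid_solv[OF assms] by simp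
qed

text \<open>The base row for input \<open>x\<close>, coded by its list of symbols, with the head at position \<open>t\<close>.\<close>

definition xbit :: "nat list \<Rightarrow> nat \<Rightarrow> nat" where
  "xbit x k = (if k < 2 * length x then nthd x (k div 2) else if k = 2 * length x then 1 else 2)"

definition xrow :: "nat \<Rightarrow> nat \<Rightarrow> nat list \<Rightarrow> nat \<Rightarrow> nat" where
  "xrow t w x j = (if j < t then 2
     else if j - t < 2 * length x + 2 then (if j = t then 2 else 4) + xbit x (j - t)
     else if j - t < 2 * length x + 2 + w then 7 else 8)"

lemma nthd_sym: "l < length x \<Longrightarrow> nthd (map sym x) l = sym (x ! l)"
  by (simp add: nthd_def)

lemma xbit_range: "xbit (map sym x) k = 1 \<or> xbit (map sym x) k = 2"
proof (cases "k < 2 * length x")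
  case True
  then show ?thesis using nthd_sym[of "k div 2" x] by (simp add: xbit_def sym_def)
qed (simp add: xbit_def)

lemma pair_enc_xbit:
  assumes "k < 2 * length x + 2"
  shows "sym (pair_enc x [] ! k) = xbit (map sym x) k"
proof (cases "k < 2 * length x")
  case True
  have "k = 2 * (k div 2) \<or> k = Suc (2 * (k div 2))" by presburger
  then have "pair_enc x [] ! k = x ! (k div 2)" using nth_pair_enc[of "k div 2" x "[]"] True by fastforce
  then show ?thesis using True nthd_sym[of "k div 2" x] by (simp add: xbit_def)
next
  case False
  have l: "length (concat (map (\<lambda>b. [b, b]) x)) = 2 * length x" by (induction x) auto
  have "k - 2 * length x = 0 \<or> k - 2 * length x = 1" using assms False by linarith
  then show ?thesis using False assms by (auto simp: pair_enc_def nth_append l xbit_def sym_def)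
qed

lemma cls_xrow: "cls (xrow t w (map sym x) j) = (if j < t then 0 else if j = t then 1
    else if j - t < 2 * length x + 2 then 2 else if j - t < 2 * length x + 2 + w then 3 else 4)"
proof (cases "j = t")
  case True
  then show ?thesis using xbit_range[of x 0] by (elim disjE) (simp_all add: xrow_def cls_def)
next
  case False
  then show ?thesis using xbit_range[of x "j - t"] by (elim disjE) (simp_all add: xrow_def cls_def)
qed

lemma xrow_rowok: assumes "0 < t" shows "rowok (xrow t w (map sym x)) T"
  unfolding rowok_def
proof (intro conjI allI impI)
  fix j
  have x: "1 \<le> xbit (map sym x) i" "xbit (map sym x) i \<le> 2" for i using xbit_range[of x i] by auto
  show "2 \<le> xrow t w (map sym x) j" unfolding xrow_def using x[of "j - t"] by simp
  show "xrow t w (map sym x) j \<le> 8" unfolding xrow_def using x[of "j - t"] x[of 0] by simp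
  consider "Suc j < t" | "Suc j = t" | "j = t" | "t < j" by linarith
  then show "adj (xrow t w (map sym x) j) (xrow t w (map sym x) (Suc j))"
    unfolding adj_def cls_xrow by cases (auto simp: Suc_diff_le)
qed

context verifier
begin

text \<open>With the head at position t of a base of length 2 t + 1, the apex is the cell straight
  above it after t steps. The flag is raised there one step after halting, whence the summand
  1.\<close>

lemma xrow_flag:
  assumes t: "TC (2 * length x + 2 + pW (length x)) + 1 \<le> t"
  shows "cflag (tri (comb MA MC) (\<lambda>j. Ini (xrow t (pW (length x)) (map sym x) j) 0) (2 * t) 0) = 1"
proof -
  let ?w = "pW (length x)"
  let ?k = "xrow t ?w (map sym x)"
  define v where "v = map sym (pair_enc x []) @ replicate ?w 3"
  have lv: "length v = 2 * length x + 2 + ?w" by (simp add: v_def length_pair_enc)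
  have gv: "goodv pW v" unfolding goodv_def v_def by blast
  have sv: "set v \<subseteq> {1, 2, 3}" by (auto simp: v_def sym_def)
  obtain \<theta> where \<theta>: "\<theta> \<le> TC (length v)" and \<theta>f: "\<And>t z. snd (snd (tcell MC (tape_of v) t z)) =
      (if int \<theta> + 1 + \<bar>z\<bar> \<le> int t then (if goodv pW v then 1 else 2) else 0)"
    using MC_halt[OF sv] by metis
  obtain t' where t': "t = Suc t'" using t by (cases t) auto
  have "icell (?k a) 3 = tcell MC (tape_of v) 0 (int a - int t)" for a
  proof (cases "a < t")
    case True
    then show ?thesis by (simp add: xrow_def icell_def tape_of_def)
  next
    case False
    define l where "l = a - t"
    have a: "a = t + l" using False by (simp add: l_def)
    have "fst (icell (?k a) 3) = nthd v l"
    proof (cases "l < 2 * length x + 2")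
      case True
      then have "nthd v l = xbit (map sym x) l"
        using pair_enc_xbit[OF True] by (simp add: nthd_def v_def nth_append length_pair_enc)
      then show ?thesis using True xbit_range[of x l] xbit_range[of x 0] by (auto simp: xrow_def a icell_def)
    next
      case F: False
      then show ?thesis by (auto simp: nthd_def v_def nth_append length_pair_enc xrow_def a icell_def)
    qed
    moreover have "fst (snd (icell (?k a) 3)) = (if a = t then 1 else 0)"
      using xbit_range[of x l] by (auto simp: xrow_def a icell_def)
    moreover have "snd (snd (icell (?k a) 3)) = 0" by (simp add: icell_def)
    moreover have "tape_of v (int a - int t) = nthd v l" by (simp add: tape_of_def a)
    ultimately show ?thesis by (intro prod_eqI) (auto simp: a)
  qed
  then have "grow MC (\<lambda>j. icell (?k j) 3) (Suc t') 0 = tcell MC (tape_of v) (Suc t') (int 0 + int (Suc t') - int t)"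
    by (rule grow_tcell)
  then have "snd (snd (grow MC (\<lambda>j. icell (?k j) 3) (Suc t') 0)) = 1"
    using \<theta>f[of "Suc t'" 0] \<theta> t lv gv by (simp add: t' del: grow.simps tcell.simps)
  then show ?thesis unfolding t' using tri_grow(2)[of "xrow (Suc t') ?w (map sym x)" "\<lambda>_. 0" MA MC t' 0]
    by (simp add: t' del: tri.simps mult_Suc_right grow.simps)
qed

text \<open>The row determines some input by \<open>row_main\<close>; counting input cells and
  comparing their bits identifies it as x. The second assumption keeps all input cells inside the
  base.\<close>

lemma xrow_solvable:
  assumes t: "TC (2 * length x + 2 + pW (length x)) + 1 \<le> t" "2 * length x + 2 \<le> t"
  shows "solvable MA MC (xrow t (pW (length x)) (map sym x)) (2 * t) \<longleftrightarrow> x \<in> L"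
proof -
  let ?k = "xrow t (pW (length x)) (map sym x)"
  have "0 < t" using t by simp
  obtain i x' where i: "i \<le> 2 * t" "?k i = 3 \<or> ?k i = 4"
    and cnt: "\<forall>j\<le>2 * t. (3 \<le> ?k j \<and> ?k j \<le> 6) \<longleftrightarrow> i \<le> j \<and> j < i + (2 * length x' + 2)"
    and iT: "i + (2 * length x' + 2) \<le> Suc (2 * t)"
    and bits: "\<forall>l<length x'. x' ! l \<longleftrightarrow> ?k (i + 2 * l) = 4 \<or> ?k (i + 2 * l) = 6"
    and sol: "solvable MA MC ?k (2 * t) \<longleftrightarrow> x' \<in> L"
    using row_main[OF xrow_rowok[OF \<open>0 < t\<close>] xrow_flag[OF t(1)]] by blast
  have it: "i = t" using i(2) xbit_range[of x "i - t"] by (auto simp: xrow_def split: if_splits)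
  have ran: "3 \<le> ?k j \<and> ?k j \<le> 6 \<longleftrightarrow> t \<le> j \<and> j < t + (2 * length x + 2)" for j
    using xbit_range[of x "j - t"] by (auto simp: xrow_def)
  have len: "length x' = length x"
  proof (rule ccontr)
    assume "length x' \<noteq> length x"
    then consider "length x' < length x" | "length x < length x'" by linarith
    then show False
    proof cases
      case 1
      then show False using cnt[rule_format, of "t + 2 * length x' + 2"] ran[of "t + 2 * length x' + 2"] t(2) it by simp
    next
      case 2
      then show False using cnt[rule_format, of "t + 2 * length x + 2"] ran[of "t + 2 * length x + 2"] iT it by simp
    qed
  qed
  have "x' = x"
  proof (rule nth_equalityI[OF len])
    fix l assume "l < length x'"
    then have l: "l < length x" and b: "x' ! l \<longleftrightarrow> ?k (t + 2 * l) = 4 \<or> ?k (t + 2 * l) = 6" using len bits it by auto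
    have "xbit (map sym x) (2 * l) = sym (x ! l)" using l nthd_sym[OF l] by (simp add: xbit_def)
    then show "x' ! l = x ! l" unfolding b using l by (auto simp: xrow_def sym_def)
  qed
  then show ?thesis using sol by simp
qed

end

section \<open>The map from inputs to graphs in polynomial time\<close>

lemma PTb_gE:
  assumes "PT l m T" "PT l m I" "PT l m J" "\<And>A. PT l m A \<Longrightarrow> PT l m (\<lambda>x env. K x env (A x env))"
  shows "PTb l m (\<lambda>x env. gE q (T x env) (K x env) (I x env) (J x env))"
  unfolding gE_def ca_def cb_def lab_def knd_def by (intro PT_intros assms)

lemma PT_xrow:
  assumes "PT l m t" "PT l m w" "PT l m A"
  shows "PT l m (\<lambda>x env. xrow (t x env) (w x env) x (A x env))"
  unfolding xrow_def xbit_def by (intro PT_intros assms)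

theorem gcode_computable:
  assumes t: "\<And>m. PT 0 m (\<lambda>x env. t (length x))" and w: "\<And>m. PT 0 m (\<lambda>x env. w (length x))"
  shows "poly_computable (\<lambda>x. gcode q (2 * t (length x)) (xrow (t (length x)) (w (length x)) (map sym x)))"
proof -
  let ?n = "\<lambda>x. q + 45 + (2 * t (length x) + 1) * (2 * t (length x) + 1)"
  let ?B = "\<lambda>x env. gE q (2 * t (length x)) (xrow (t (length x)) (w (length x)) x) (env ! 0 div ?n x) (env ! 0 mod ?n x)"
  have v: "PT 0 1 (\<lambda>x env. env ! 0)" by (rule PT_var) simp
  have "PT 0 0 (\<lambda>x env. ?n x * ?n x)" by (intro PT_intros t)
  moreover have "PTb 0 1 ?B" by (intro PTb_gE PT_intros PT_xrow t w v)
  ultimately have "poly_computable (\<lambda>x. map (\<lambda>i. ?B (map sym x) [i]) [0..<?n (map sym x) * ?n (map sym x)])"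
    by (rule PT_poly_computable)
  then show ?thesis by (simp add: gcode_def Let_def)
qed

section \<open>From graphs to inputs\<close>

lemma PTb_op0: "PTb l 0 (\<lambda>x env. h x) \<Longrightarrow> PTb l m (\<lambda>x env. h x)"
  unfolding PTb_def by (rule PT_op0)

lemma PT_take_var: "j < k \<Longrightarrow> k \<le> m \<Longrightarrow> PT l m (\<lambda>x env. take k env ! j)"
  by (rule PT_take[OF _ PT_var])

text \<open>The bound is a constant, so the quantifier is unrolled into the program and the index
  may select a different predicate each time instead of being held in a register.\<close>

lemma PTb_allK: "(\<And>i. i < (K::nat) \<Longrightarrow> PTb l m (B i)) \<Longrightarrow> PTb l m (\<lambda>x env. \<forall>i<K. B i x env)"
proof (induction K)
  case (Suc K)
  then have "PTb l m (\<lambda>x env. (\<forall>i<K. B i x env) \<and> B K x env)" by (intro PTb_conj) auto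
  then show ?case by (rule PTb_eqI) (auto simp: less_Suc_eq)
qed (simp add: PTb_const)

lemma PTb_exK: "(\<And>i. i < (K::nat) \<Longrightarrow> PTb l m (B i)) \<Longrightarrow> PTb l m (\<lambda>x env. \<exists>i<K. B i x env)"
proof (induction K)
  case (Suc K)
  then have "PTb l m (\<lambda>x env. (\<exists>i<K. B i x env) \<or> B K x env)" by (intro PTb_disj) auto
  then show ?case by (rule PTb_eqI) (auto simp: less_Suc_eq)
qed (simp add: PTb_const)

lemma bleast_Suc: "bleast (Suc K) B = (if \<exists>i<K. B i then bleast K B else if B K then K else Suc K)"
proof (cases "\<exists>i<K. B i")
  case True
  then have b: "bleast K B < K" "B (bleast K B)" using bleast_less_iff[of K B] bleast_less[of K B] by auto
  have "bleast (Suc K) B \<le> bleast K B"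
  proof (rule ccontr)
    assume "\<not> ?thesis"
    then show False using bleast_least[of "bleast K B" "Suc K" B] b by simp
  qed
  moreover from this have "B (bleast (Suc K) B)" using b bleast_less[of "Suc K" B] by simp
  ultimately have "bleast (Suc K) B = bleast K B" using bleast_least[of "bleast (Suc K) B" K B] by fastforce
  then show ?thesis using True by simp
next
  case False
  show ?thesis
  proof (cases "B K")
    case True
    have "bleast (Suc K) B = K" by (rule bleast_unique) (use True False in \<open>auto simp: less_Suc_eq\<close>)
    then show ?thesis using True False by auto
  next
    case F: False
    then have "\<not> bleast (Suc K) B < Suc K" using False bleast_less[of "Suc K" B] by (auto simp: less_Suc_eq)
    then show ?thesis using bleast_le[of "Suc K" B] False F by auto
  qed
qed

lemma PT_bleastK: "(\<And>i. i < K \<Longrightarrow> PTb l m (B i)) \<Longrightarrow> PT l m (\<lambda>x env. bleast K (\<lambda>i. B i x env))"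
proof (induction K)
  case 0
  then show ?case by (simp add: bleast_def PT_const)
next
  case (Suc K)
  then show ?case unfolding bleast_Suc by (intro PT_If PTb_exK PT_const) auto
qed

section \<open>Reading reference, apex and diagram off a graph\<close>

definition nn :: "nat list \<Rightarrow> nat" where
  "nn x = bleast (length x + 1) (\<lambda>n. length x < (n + 1) * (n + 1))"

definition Ed :: "nat list \<Rightarrow> nat \<Rightarrow> nat \<Rightarrow> bool" where
  "Ed x i j = (i < nn x \<and> j < nn x \<and> i \<noteq> j \<and> (nthd x (i * nn x + j) = 2 \<or> nthd x (j * nn x + i) = 2))"

text \<open>A map of the reference into the graph is given by the base-n digits of a number below n
  ^ (q + 45). As q is fixed, all these maps can be tried in polynomial time.\<close>

definition rh :: "nat list \<Rightarrow> nat \<Rightarrow> nat \<Rightarrow> nat" where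
  "rh x t i = (t div nn x ^ i) mod nn x"

definition rr :: "nat \<Rightarrow> nat list \<Rightarrow> nat" where
  "rr q x = bleast (nn x ^ (q + 45)) (\<lambda>t. emb q (Ed x) (\<noteq>) (rh x t))"

definition stat :: "nat \<Rightarrow> nat list \<Rightarrow> bool" where
  "stat q x = ((\<exists>t<nn x ^ (q + 45). diff_emb q (Ed x) (\<noteq>) (rh x (rr q x)) (rh x t)) \<or>
     (\<exists>u<nn x. \<exists>a<nn x. \<exists>b<nn x. \<exists>c<nn x. \<exists>d<nn x. svc q (Ed x) (\<noteq>) (rh x (rr q x)) u a b c d))"

definition kap :: "nat \<Rightarrow> nat list \<Rightarrow> nat" where
  "kap q x = bleast (nn x) (\<lambda>v. \<exists>s<5. cel q (Ed x) (rh x (rr q x)) v 1 s)"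

definition px :: "nat \<Rightarrow> nat list \<Rightarrow> nat \<Rightarrow> nat \<Rightarrow> nat" where
  "px q x = prt (nn x) q (Ed x) (rh x (rr q x))"

definition kx :: "nat \<Rightarrow> nat list \<Rightarrow> nat \<Rightarrow> nat" where
  "kx q x = kd q (Ed x) (rh x (rr q x))"

definition ptx :: "nat \<Rightarrow> nat list \<Rightarrow> nat \<Rightarrow> nat \<Rightarrow> nat" where
  "ptx q x a b = (px q x 2 ^^ b) ((px q x 1 ^^ a) (kap q x))"

text \<open>In a complete diagram the descent along first parents meets distinct vertices, so it
  reaches the base in fewer than n steps and the search finds the height.\<close>

definition Tx :: "nat \<Rightarrow> nat list \<Rightarrow> nat" where
  "Tx q x = bleast (nn x + 1) (\<lambda>a. 2 \<le> kx q x (ptx q x a 0) \<and> kx q x (ptx q x a 0) < 9)"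

definition full :: "nat \<Rightarrow> nat list \<Rightarrow> bool" where
  "full q x = (\<forall>a<Tx q x + 1. \<forall>b<Tx q x + 1.
     (a + b < Tx q x \<longrightarrow> px q x 1 (ptx q x a b) < nn x \<and> px q x 2 (ptx q x a b) < nn x) \<and>
     (a + b = Tx q x \<longrightarrow> 2 \<le> kx q x (ptx q x a b) \<and> kx q x (ptx q x a b) < 9))"

definition rx :: "nat \<Rightarrow> nat list \<Rightarrow> nat \<Rightarrow> nat" where
  "rx q x j = kx q x (ptx q x j (Tx q x - j))"

lemma PT_nn: "PT l m (\<lambda>x env. nn x)"
proof (rule PT_op0, unfold nn_def, rule PT_bleast)
  show "PTb l (Suc 0) (\<lambda>x env. length x < (env ! 0 + 1) * (env ! 0 + 1))"
    by (intro PT_intros PT_var) simp_all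
qed (intro PT_intros)

lemma PTb_Ed: "PT l m A \<Longrightarrow> PT l m B \<Longrightarrow> PTb l m (\<lambda>x env. Ed x (A x env) (B x env))"
  unfolding Ed_def by (intro PT_intros PT_nn)

lemma PT_rh: "PT l m A \<Longrightarrow> PT l m (\<lambda>x env. rh x (A x env) i)"
  unfolding rh_def by (intro PT_intros PT_nn)

lemma PTb_emb: "PT l m A \<Longrightarrow> PTb l m (\<lambda>x env. emb q (Ed x) (\<noteq>) (rh x (A x env)))"
  unfolding emb_def by (intro PTb_allK PT_intros PTb_Ed PT_rh)

lemma PTb_cl: "PT l m A \<Longrightarrow> PT l m V \<Longrightarrow> PTb l m (\<lambda>x env. cl q (Ed x) (\<noteq>) (rh x (A x env)) (V x env) k s)"
  unfolding cl_def by (intro PTb_allK PT_intros PTb_Ed PT_rh)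

lemma PTb_par: "PT l m A \<Longrightarrow> PT l m U \<Longrightarrow> PT l m V \<Longrightarrow>
    PTb l m (\<lambda>x env. par q (Ed x) (\<noteq>) (rh x (A x env)) e (U x env) (V x env))"
  unfolding par_def by (intro PTb_exK PTb_conj PTb_Ed PTb_cl)

lemma PTb_diff_emb: "PT l m A \<Longrightarrow> PT l m B \<Longrightarrow>
    PTb l m (\<lambda>x env. diff_emb q (Ed x) (\<noteq>) (rh x (A x env)) (rh x (B x env)))"
  unfolding diff_emb_def by (intro PTb_conj PTb_disj PTb_not PTb_eq PTb_emb PTb_exK PTb_allK PT_rh)

lemma PTb_svc: "PT l m A \<Longrightarrow> PT l m U \<Longrightarrow> PT l m V \<Longrightarrow> PT l m W \<Longrightarrow> PT l m Y \<Longrightarrow> PT l m Z \<Longrightarrow>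
    PTb l m (\<lambda>x env. svc q (Ed x) (\<noteq>) (rh x (A x env)) (U x env) (V x env) (W x env) (Y x env) (Z x env))"
  unfolding svc_def
  by (intro PTb_const PTb_exK PTb_disj PTb_conj PTb_cl PTb_par PTb_not PTb_eq)

lemma PT_rr: "PT l m (\<lambda>x env. rr q x)"
proof (rule PT_op0, unfold rr_def, rule PT_bleast)
  show "PTb l (Suc 0) (\<lambda>x env. emb q (Ed x) (\<noteq>) (rh x (env ! 0)))"
    by (intro PTb_emb PT_var) simp
qed (intro PT_intros PT_nn)

lemma PTb_stat: "PTb l m (\<lambda>x env. stat q x)"
proof -
  have d: "PTb l 0 (\<lambda>x env. \<exists>t<nn x ^ (q + 45). diff_emb q (Ed x) (\<noteq>) (rh x (rr q x)) (rh x t))"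
    by (rule PTb_ex) (intro PT_power PT_nn, intro PTb_diff_emb PT_rr PT_var, simp)
  define S4 where "S4 = (\<lambda>x u a b c. \<exists>d<nn x. svc q (Ed x) (\<noteq>) (rh x (rr q x)) u a b c d)"
  define S3 where "S3 = (\<lambda>x u a b. \<exists>c<nn x. S4 x u a b c)"
  define S2 where "S2 = (\<lambda>x u a. \<exists>b<nn x. S3 x u a b)"
  define S1 where "S1 = (\<lambda>x u. \<exists>a<nn x. S2 x u a)"
  have s4: "PTb l 4 (\<lambda>x env. S4 x (env ! 0) (env ! 1) (env ! 2) (env ! 3))"
    unfolding S4_def
  proof (rule PTb_ex[OF PT_nn])
    show "PTb l (Suc 4) (\<lambda>x env. svc q (Ed x) (\<noteq>) (rh x (rr q x)) (take 4 env ! 0) (take 4 env ! 1) (take 4 env ! 2)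
        (take 4 env ! 3) (env ! 4))"
      by (intro PTb_svc PT_rr PT_take_var PT_var) simp_all
  qed
  have s3: "PTb l 3 (\<lambda>x env. S3 x (env ! 0) (env ! 1) (env ! 2))"
    unfolding S3_def
  proof (rule PTb_ex[OF PT_nn])
    show "PTb l (Suc 3) (\<lambda>x env. S4 x (take 3 env ! 0) (take 3 env ! 1) (take 3 env ! 2) (env ! 3))"
      using s4 by simp
  qed
  have s2: "PTb l 2 (\<lambda>x env. S2 x (env ! 0) (env ! 1))"
    unfolding S2_def
  proof (rule PTb_ex[OF PT_nn])
    show "PTb l (Suc 2) (\<lambda>x env. S3 x (take 2 env ! 0) (take 2 env ! 1) (env ! 2))"
      using s3 by simp
  qed
  have s1: "PTb l 1 (\<lambda>x env. S1 x (env ! 0))"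
    unfolding S1_def
  proof (rule PTb_ex[OF PT_nn])
    show "PTb l (Suc 1) (\<lambda>x env. S2 x (take 1 env ! 0) (env ! 1))"
      using s2 by (simp add: Suc_1)
  qed
  have "PTb l 0 (\<lambda>x env. \<exists>u<nn x. S1 x u)"
  proof (rule PTb_ex[OF PT_nn])
    show "PTb l (Suc 0) (\<lambda>x env. S1 x (env ! 0))" using s1 by (simp add: One_nat_def)
  qed
  then have "PTb l 0 (\<lambda>x env. \<exists>u<nn x. \<exists>a<nn x. \<exists>b<nn x. \<exists>c<nn x. \<exists>d<nn x. svc q (Ed x) (\<noteq>) (rh x (rr q x)) u a b c d)"
    unfolding S1_def S2_def S3_def S4_def .
  from PTb_disj[OF d this] show ?thesis unfolding stat_def by (rule PTb_op0)
qed

lemma PT_kap: "PT l m (\<lambda>x env. kap q x)"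
proof (rule PT_op0, unfold kap_def, rule PT_bleast)
  show "PTb l (Suc 0) (\<lambda>x env. \<exists>s<5. cel q (Ed x) (rh x (rr q x)) (env ! 0) 1 s)"
    by (intro PTb_exK PTb_cl PT_rr PT_var) simp
qed (rule PT_nn)

lemma PT_px: assumes "PT l m A" shows "PT l m (\<lambda>x env. px q x e (A x env))"
proof (rule PT_op1[OF _ assms], unfold px_def prt_def, rule PT_bleast)
  show "PTb l (Suc 1) (\<lambda>x env. Pa q (Ed x) (rh x (rr q x)) e (take 1 env ! 0) (env ! 1))"
    by (intro PTb_par PT_rr PT_take_var PT_var) simp_all
qed (rule PT_nn)

lemma PT_kx: "PT l m A \<Longrightarrow> PT l m (\<lambda>x env. kx q x (A x env))"
  unfolding kx_def kd_def by (intro PT_bleastK PTb_exK PTb_cl PT_rr)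

lemma px_le: "px q x e u \<le> nn x"
  unfolding px_def prt_def by (rule bleast_le)

lemma PT_ptx: assumes "PT l m A" "PT l m B" shows "PT l m (\<lambda>x env. ptx q x (A x env) (B x env))"
proof -
  have b1: "(px q x e ^^ i) a \<le> nn x" if "a \<le> nn x" for x e i a
    using that px_le by (cases i) auto
  have kap: "kap q x \<le> nn x" for x unfolding kap_def by (rule bleast_le)
  have 1: "PT l 1 (\<lambda>x env. (px q x 1 ^^ (env ! 0)) (kap q x))"
    by (rule PT_funpow[where S = "\<lambda>x env. px q x 1" and H = "\<lambda>x env. nn x"])
      (auto intro!: PT_var PT_kap PT_px PT_nn b1 kap)
  have "PT l 2 (\<lambda>x env. (px q x 2 ^^ (env ! 1)) ((px q x 1 ^^ (env ! 0)) (kap q x)))"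
    by (rule PT_funpow[where S = "\<lambda>x env. px q x 2" and H = "\<lambda>x env. nn x"])
      (auto intro!: PT_var PT_op1[OF 1] PT_px PT_nn b1 kap)
  from PT_op2[OF this assms] show ?thesis unfolding ptx_def .
qed

lemma PT_Tx: "PT l m (\<lambda>x env. Tx q x)"
proof (rule PT_op0, unfold Tx_def, rule PT_bleast)
  show "PTb l (Suc 0) (\<lambda>x env. 2 \<le> kx q x (ptx q x (env ! 0) 0) \<and> kx q x (ptx q x (env ! 0) 0) < 9)"
    by (intro PT_intros PT_kx PT_ptx PT_var) simp_all
qed (intro PT_intros PT_nn)

lemma PTb_full: "PTb l m (\<lambda>x env. full q x)"
proof (rule PTb_op0, unfold full_def, rule PTb_all)
  show "PT l 0 (\<lambda>x env. Tx q x + 1)" by (intro PT_intros PT_Tx)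
  let ?Q = "\<lambda>x a b. (a + b < Tx q x \<longrightarrow> px q x 1 (ptx q x a b) < nn x \<and> px q x 2 (ptx q x a b) < nn x) \<and>
     (a + b = Tx q x \<longrightarrow> 2 \<le> kx q x (ptx q x a b) \<and> kx q x (ptx q x a b) < 9)"
  have "PTb l 1 (\<lambda>x env. \<forall>b<Tx q x + 1. ?Q x (env ! 0) b)"
  proof (rule PTb_all)
    show "PT l 1 (\<lambda>x env. Tx q x + 1)" by (intro PT_intros PT_Tx)
    show "PTb l (Suc 1) (\<lambda>x env. ?Q x (take 1 env ! 0) (env ! 1))"
      by (intro PT_intros PT_Tx PT_nn PT_px PT_kx PT_ptx PT_take_var PT_var) simp_all
  qed
  then show "PTb l (Suc 0) (\<lambda>x env. \<forall>b<Tx q x + 1. ?Q x (env ! 0) b)" by (simp add: One_nat_def)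
qed

lemma PT_rx: "PT l m A \<Longrightarrow> PT l m (\<lambda>x env. rx q x (A x env))"
  unfolding rx_def by (intro PT_kx PT_ptx PT_diff PT_Tx)

lemma nn_enc_nverts: "nn (map sym y) = enc_nverts y"
proof -
  let ?l = "length y" and ?n = "nn (map sym y)"
  have "?n < ?l + 1" unfolding nn_def length_map bleast_less_iff by (intro exI[of _ ?l]) (simp add: algebra_simps)
  then have u: "?l < (?n + 1) * (?n + 1)"
    using bleast_less[of "?l + 1" "\<lambda>n. ?l < (n + 1) * (n + 1)"] by (simp add: nn_def)
  have "?n * ?n \<le> ?l"
  proof (cases ?n)
    case (Suc k)
    then have "\<not> ?l < (k + 1) * (k + 1)"
      using bleast_least[of k "?l + 1" "\<lambda>n. ?l < (n + 1) * (n + 1)"] by (simp add: nn_def)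
    then show ?thesis using Suc by (simp add: algebra_simps)
  qed simp
  moreover have "m \<le> ?n" if "m * m \<le> ?l" for m
  proof (rule ccontr)
    assume "\<not> m \<le> ?n"
    then have "(?n + 1) * (?n + 1) \<le> m * m" by (intro mult_le_mono) auto
    then show False using u that by simp
  qed
  ultimately show ?thesis unfolding enc_nverts_def by (intro Greatest_equality[symmetric])
qed

lemma Ed_enc_edge: "Ed (map sym y) = enc_edge y"
proof (intro ext)
  fix i j
  let ?n = "enc_nverts y"
  have sq: "?n * ?n \<le> length y"
    unfolding enc_nverts_def by (rule GreatestI_nat[of _ 0 "length y"]) (auto intro: order_trans[OF le_square])
  have "nthd (map sym y) (a * ?n + b) = 2 \<longleftrightarrow> y ! (a * ?n + b)" if "a < ?n" "b < ?n" for a b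
  proof -
    have "Suc a * ?n \<le> ?n * ?n" using that(1) by (intro mult_le_mono1) simp
    then have "a * ?n + b < length y" using that(2) sq by simp
    then show ?thesis using nthd_sym by (simp add: sym_def)
  qed
  then show "Ed (map sym y) i j = enc_edge y i j"
    unfolding Ed_def enc_edge_def Let_def nn_enc_nverts by blast
qed

lemma digits_surj:
  assumes "\<And>i. i < r \<Longrightarrow> \<rho> i < (n::nat)"
  shows "\<exists>t<n ^ r. \<forall>i<r. (t div n ^ i) mod n = \<rho> i"
  using assms
proof (induction r arbitrary: \<rho>)
  case (Suc r)
  obtain t where t: "t < n ^ r" "\<forall>i<r. (t div n ^ i) mod n = \<rho> (Suc i)"
    using Suc.IH[of "\<lambda>i. \<rho> (Suc i)"] Suc.prems by auto
  have r0: "\<rho> 0 < n" using Suc.prems by simp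
  let ?t = "t * n + \<rho> 0"
  have "Suc t * n \<le> n ^ r * n" using t(1) by (intro mult_le_mono1) simp
  then have "?t < n ^ Suc r" using r0 by (simp add: mult.commute)
  moreover have "(?t div n ^ i) mod n = \<rho> i" if "i < Suc r" for i
  proof (cases i)
    case 0
    then show ?thesis using r0 by simp
  next
    case (Suc j)
    have "?t div n ^ i = ?t div n div n ^ j" unfolding Suc by (simp add: div_mult2_eq)
    also have "?t div n = t" using r0 by simp
    finally show ?thesis using t(2) that Suc by simp
  qed
  ultimately show ?case by blast
qed simp

lemma diff_emb_cong: "(\<And>i. i < q + 45 \<Longrightarrow> \<rho>' i = \<sigma> i) \<Longrightarrow> diff_emb q E N \<rho> \<rho>' = diff_emb q E N \<rho> \<sigma>"
  by (simp add: diff_emb_def emb_cong[of q \<rho>' \<sigma>] cong: conj_cong)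

text \<open>The triangle for choice 0 in all witness slots, computed on the codes of the colours; the flag of
  the second machine does not depend on the choices.\<close>

definition cf :: "tm \<Rightarrow> tm \<Rightarrow> (nat \<Rightarrow> val) \<Rightarrow> (val \<Rightarrow> nat) \<Rightarrow> nat \<Rightarrow> nat \<Rightarrow> nat" where
  "cf MA MC dec enc a b = (let v = comb MA MC (dec a) (dec b) in if v \<in> vals MA MC then enc v else 0)"

definition apex :: "tm \<Rightarrow> tm \<Rightarrow> (nat \<Rightarrow> val) \<Rightarrow> (val \<Rightarrow> nat) \<Rightarrow> nat \<Rightarrow> nat list \<Rightarrow> nat" where
  "apex MA MC dec enc q x =
     tri (cf MA MC dec enc) (\<lambda>j. nthd (map (\<lambda>k. enc (Ini k 0)) [0..<9]) (rx q x j)) (Tx q x) 0"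

definition flg :: "tm \<Rightarrow> tm \<Rightarrow> (nat \<Rightarrow> val) \<Rightarrow> (val \<Rightarrow> nat) \<Rightarrow> nat \<Rightarrow> nat list \<Rightarrow> nat" where
  "flg MA MC dec enc q x = nthd (map (\<lambda>k. cflag (dec k)) [0..<q + 1]) (apex MA MC dec enc q x)"

text \<open>0 means that a good ordering certainly exists, 1 that none exists, and 2 that the
  diagram encodes an input that has to be read off.\<close>

definition md :: "tm \<Rightarrow> tm \<Rightarrow> (nat \<Rightarrow> val) \<Rightarrow> (val \<Rightarrow> nat) \<Rightarrow> nat \<Rightarrow> nat list \<Rightarrow> nat" where
  "md MA MC dec enc q x = (if \<not> rr q x < nn x ^ (q + 45) then 0 else if stat q x then 1
     else if \<not> kap q x < nn x then 0 else if \<not> full q x then 0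
     else if flg MA MC dec enc q x \<noteq> 1 then 0 else 2)"

definition i0 :: "nat \<Rightarrow> nat list \<Rightarrow> nat" where
  "i0 q x = bleast (Tx q x + 1) (\<lambda>j. rx q x j = 3 \<or> rx q x j = 4)"

text \<open>Input cells hold each bit twice and a separator of two cells.\<close>

definition xlen :: "nat \<Rightarrow> nat list \<Rightarrow> nat" where
  "xlen q x = ((\<Sum>j<Tx q x + 1. of_bool (3 \<le> rx q x j \<and> rx q x j \<le> 6)) - 2) div 2"

text \<open>The decided cases are mapped to the fixed words \<open>y1\<close> and \<open>y0\<close>,
  which will be a member and a non-member.\<close>

definition decode :: "tm \<Rightarrow> tm \<Rightarrow> (nat \<Rightarrow> val) \<Rightarrow> (val \<Rightarrow> nat) \<Rightarrow> nat \<Rightarrow> bool list \<Rightarrow> bool list \<Rightarrow> bool list \<Rightarrow> bool list" where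
  "decode MA MC dec enc q y0 y1 y = (let x = map sym y; d = md MA MC dec enc q x in
     map (\<lambda>i. if d = 0 then nthd (map sym y1) i = 2 else if d = 1 then nthd (map sym y0) i = 2
         else rx q x (i0 q x + 2 * i) = 4 \<or> rx q x (i0 q x + 2 * i) = 6)
       [0..<if d = 0 then length y1 else if d = 1 then length y0 else xlen q x])"

lemma map_nthd_sym: "map (\<lambda>i. nthd (map sym y) i = 2) [0..<length y] = y"
  by (rule nth_equalityI) (auto simp: nthd_sym sym_def)

context fgraph
begin

lemma PT_md: "PT 1 m (\<lambda>x env. md MA MC dec enc q x)"
proof -
  have e: "enc v \<le> q" if "v \<in> vals MA MC" for v using dec[OF that] by simp
  have "PT 1 0 (\<lambda>x env. apex MA MC dec enc q x)"
    unfolding apex_def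
  proof (rule PT_tri[where K = "q + 1"])
    show "PT 0 (Suc 0) (\<lambda>x env. nthd (map (\<lambda>k. enc (Ini k 0)) [0..<9]) (rx q x (env ! 0)))"
      by (intro PT_list PT_rx PT_var) simp
    show "nthd (map (\<lambda>k. enc (Ini k 0)) [0..<9]) (rx q x j) < q + 1" for x j
    proof (cases "rx q x j < 9")
      case True
      have "enc (Ini (rx q x j) 0) \<le> q" by (rule e) (use True in \<open>simp add: vals_simps\<close>)
      then show ?thesis using True by (simp add: nthd_def)
    qed (simp add: nthd_def)
    show "cf MA MC dec enc a b < q + 1" for a b 
      using e[of "comb MA MC (dec a) (dec b)"] by (auto simp: cf_def Let_def)
  qed (rule PT_Tx)
  then have "PT 1 m (\<lambda>x env. apex MA MC dec enc q x)" by (rule PT_op0)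
  then have "PT 1 m (\<lambda>x env. flg MA MC dec enc q x)" unfolding flg_def by (rule PT_list)
  then show ?thesis unfolding md_def by (intro PT_intros PTb_stat PTb_full PT_kap PT_rr PT_nn)
qed

theorem decode_computable: "poly_computable (decode MA MC dec enc q y0 y1)"
proof -
  have "PT 1 0 (\<lambda>x env. i0 q x)" unfolding i0_def
  proof (rule PT_bleast)
    show "PTb 1 (Suc 0) (\<lambda>x env. rx q x (env ! 0) = 3 \<or> rx q x (env ! 0) = 4)"
      by (intro PT_intros PT_rx PT_var) simp_all
  qed (intro PT_intros PT_Tx)
  then have i: "PT 1 1 (\<lambda>x env. i0 q x)" by (rule PT_op0)
  have s: "PT 1 0 (\<lambda>x env. \<Sum>j<Tx q x + 1. of_bool (3 \<le> rx q x j \<and> rx q x j \<le> 6))"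
  proof (rule PT_sum)
    show "PT 1 (Suc 0) (\<lambda>x env. of_bool (3 \<le> rx q x (env ! 0) \<and> rx q x (env ! 0) \<le> 6))"
      by (intro PT_intros PT_rx PT_var) simp_all
  qed (intro PT_intros PT_Tx)
  have l: "PT 1 0 (\<lambda>x env. xlen q x)" unfolding xlen_def by (intro PT_div PT_diff PT_const s)
  let ?d = "md MA MC dec enc q"
  let ?N = "\<lambda>x (env::nat list). if ?d x = 0 then length y1 else if ?d x = 1 then length y0 else xlen q x"
  let ?B = "\<lambda>x env. if ?d x = 0 then nthd (map sym y1) (env ! 0) = 2 else if ?d x = 1 then nthd (map sym y0) (env ! 0) = 2
         else rx q x (i0 q x + 2 * env ! 0) = 4 \<or> rx q x (i0 q x + 2 * env ! 0) = 6"
  have "PT 1 0 ?N" by (intro PT_If PTb_eq PT_md PT_const l)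
  moreover have v: "PT 1 1 (\<lambda>x env. env ! 0)" by (rule PT_var) simp
  have "PTb 1 1 ?B"
    by (intro PTb_If PTb_disj PTb_eq PT_md PT_const PT_list PT_rx PT_add PT_mult i v)
  ultimately have "poly_computable (\<lambda>y. map (\<lambda>i. ?B (map sym y) [i]) [0..<?N (map sym y) []])"
    by (rule PT_poly_computable)
  moreover have "(\<lambda>y. map (\<lambda>i. ?B (map sym y) [i]) [0..<?N (map sym y) []]) = decode MA MC dec enc q y0 y1"
    by (simp add: fun_eq_iff decode_def Let_def)
  ultimately show ?thesis by simp
qed

text \<open>Whatever is missing (reference, apex, completeness, acceptance by the second machine)
  leaves the graph without effective demands, so the answer is yes. A static defect makes it no. In
  the only other case \<open>row_main\<close> equates the existence of a good ordering with
  membership of the input read off.\<close>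

theorem decode_correct:
  assumes y: "y1 \<in> L" "y0 \<notin> L"
  shows "y \<in> LF \<longleftrightarrow> decode MA MC dec enc q y0 y1 y \<in> L"
proof -
  let ?x = "map sym y"
  define n where "n = enc_nverts y"
  define E where "E = enc_edge y"
  define \<rho> where "\<rho> = rh ?x (rr q ?x)"
  let ?d = "md MA MC dec enc q ?x"
  have n: "nn ?x = n" by (simp add: n_def nn_enc_nverts)
  have E: "Ed ?x = E" by (simp add: E_def Ed_enc_edge)
  have En: "E i j \<Longrightarrow> i < n \<and> j < n" for i j by (simp add: E_def n_def enc_edge_def Let_def)
  have dig: "\<exists>t<n ^ (q + 45). \<forall>i<q+45. rh ?x t i = \<sigma> i" if "\<forall>i<q+45. \<sigma> i < n" for \<sigma>
    using digits_surj[of "q + 45" \<sigma> n] that by (simp add: rh_def n)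
  have d0: "decode MA MC dec enc q y0 y1 y = y1" if "?d = 0" using that by (simp add: decode_def Let_def map_nthd_sym)
  have d1: "decode MA MC dec enc q y0 y1 y = y0" if "?d = 1" using that by (simp add: decode_def Let_def map_nthd_sym)
  show ?thesis
  proof (cases "rr q ?x < n ^ (q + 45)")
    case False
    have "\<not> isref n q E \<sigma>" for \<sigma>
    proof
      assume r: "isref n q E \<sigma>"
      then obtain t where t: "t < n ^ (q + 45)" "\<forall>i<q+45. rh ?x t i = \<sigma> i" using dig[of \<sigma>] by (auto simp: isref_def)
      have "emb q E (\<noteq>) (rh ?x t) = emb q E (\<noteq>) \<sigma>" by (rule emb_cong) (use t in auto)
      then have "\<exists>t<n ^ (q + 45). emb q E (\<noteq>) (rh ?x t)" using t(1) r by (auto simp: isref_def)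
      then show False using False by (simp add: rr_def n E bleast_less_iff)
    qed
    then have "y \<in> LF" unfolding n_def E_def by (rule LF_noref)
    moreover have "?d = 0" using False by (simp add: md_def n)
    ultimately show ?thesis using d0 y by simp
  next
    case True
    have n0: "0 < n" using True by (cases "n = 0") (simp_all add: zero_power)
    have "emb q E (\<noteq>) \<rho>"
      using True bleast_less[of "n ^ (q + 45)" "\<lambda>t. emb q E (\<noteq>) (rh ?x t)"] by (simp add: rr_def \<rho>_def n E)
    moreover have "\<rho> i < n" for i using n0 by (simp add: \<rho>_def rh_def n)
    ultimately have ref: "isref n q E \<rho>" by (simp add: isref_def)
    have LF: "y \<in> LF \<longleftrightarrow> nostat n E \<rho> \<and> solv n E \<rho>" unfolding n_def E_def by (rule LF_ref) (use ref in \<open>simp add: n_def E_def\<close>)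
    have st: "stat q ?x \<longleftrightarrow> \<not> nostat n E \<rho>"
    proof -
      have AB: "(\<exists>t<n ^ (q + 45). diff_emb q E (\<noteq>) \<rho> (rh ?x t)) \<longleftrightarrow> (\<exists>\<sigma>. (\<forall>i<q+45. \<sigma> i < n) \<and> diff_emb q E (\<noteq>) \<rho> \<sigma>)" (is "?A = ?B")
      proof
        assume ?A
        then obtain t where t: "diff_emb q E (\<noteq>) \<rho> (rh ?x t)" by (elim exE conjE) (rule that)
        have "\<forall>i<q+45. rh ?x t i < n" using n0 by (simp add: rh_def n)
        then show ?B using t by (intro exI[of _ "rh ?x t"] conjI)
      next
        assume ?B
        then obtain \<sigma> where \<sigma>: "\<forall>i<q+45. \<sigma> i < n" "diff_emb q E (\<noteq>) \<rho> \<sigma>" by (elim exE conjE) (rule that)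
        obtain t where t: "t < n ^ (q + 45)" "\<forall>i<q+45. rh ?x t i = \<sigma> i" 
          using dig[OF \<sigma>(1)] by (elim exE conjE) (rule that)
        have "diff_emb q E (\<noteq>) \<rho> (rh ?x t) = diff_emb q E (\<noteq>) \<rho> \<sigma>" by (rule diff_emb_cong) (use t in auto)
        then show ?A using \<sigma>(2) t(1) by (intro exI[of _ t]) simp
      qed
      show ?thesis unfolding stat_def nostat_def n E \<rho>_def[symmetric] AB by simp
    qed
    show ?thesis
    proof (cases "nostat n E \<rho>")
      case False
      then have "?d = 1" using True st by (simp add: md_def n)
      then show ?thesis using LF False d1 y by simp
    next
      case ns: True
      interpret g: gref MA MC V L tA pW TC n q E \<rho>
      proof
        show "\<not> svc q E (\<noteq>) \<rho> u a b c d" if "u < n" "a < n" "b < n" "c < n" "d < n" for u a b c d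
          using ns that unfolding nostat_def by blast
      qed (use wf En in auto)
      have LF': "y \<in> LF \<longleftrightarrow> solv n E \<rho>" using LF ns by simp
      define \<kappa> where "\<kappa> = kap q ?x"
      define T where "T = Tx q ?x"
      have px: "px q ?x = g.p" by (simp add: px_def n E \<rho>_def)
      have kx: "kx q ?x = g.K" by (simp add: kx_def E \<rho>_def)
      have ptx: "ptx q ?x = g.pp \<kappa>" by (simp add: fun_eq_iff ptx_def pt_def px \<kappa>_def)
      have kap: "\<kappa> < n \<longleftrightarrow> (\<exists>v s. g.C v 1 s)"
      proof -
        have "\<kappa> < n \<longleftrightarrow> (\<exists>v<n. \<exists>s<5. g.C v 1 s)" by (simp add: \<kappa>_def kap_def n E \<rho>_def bleast_less_iff)
        then show ?thesis using g.C_bd by blast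
      qed
      show ?thesis
      proof (cases "\<kappa> < n")
        case False
        then have "solv n E \<rho>" unfolding solv_def using kap by blast
        moreover have "?d = 0" using True st ns False by (simp add: md_def n \<kappa>_def)
        ultimately show ?thesis using LF' d0 y by simp
      next
        case kn: True
        have "\<exists>s<5. g.C \<kappa> 1 s"
          using kn bleast_less[of n "\<lambda>v. \<exists>s<5. g.C v 1 s"] by (simp add: \<kappa>_def kap_def n E \<rho>_def)
        then obtain s where s: "g.C \<kappa> 1 s" by blast
        have Kb: "2 \<le> g.K v \<and> g.K v < 9 \<longleftrightarrow> g.H 0 v" for v
        proof
          assume h: "2 \<le> g.K v \<and> g.K v < 9"
          then have "\<exists>s<5. g.C v (g.K v) s" unfolding kd_def using bleast_less[of 9 "\<lambda>k. \<exists>s<5. g.C v k s"] by blast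
          then show "g.H 0 v" using h by auto
        next
          assume "g.H 0 v"
          then obtain k s where k: "g.C v k s" "2 \<le> k" by auto
          then show "2 \<le> g.K v \<and> g.K v < 9" using g.K_eq[OF k(1)] g.C_bd[OF k(1)] by simp
        qed
        have Pp: "g.p e u < n \<Longrightarrow> g.P e u (g.p e u)" for e u unfolding prt_def by (rule bleast_less)
        have T_def': "T = bleast (n + 1) (\<lambda>a. g.H 0 (g.pp \<kappa> a 0))"
          by (simp add: T_def Tx_def kx ptx Kb n del: hgt.simps)
        have full: "full q ?x \<longleftrightarrow> (\<forall>a<T+1. \<forall>b<T+1. (a + b < T \<longrightarrow> g.p 1 (g.pp \<kappa> a b) < n \<and> g.p 2 (g.pp \<kappa> a b) < n) \<and>
            (a + b = T \<longrightarrow> g.H 0 (g.pp \<kappa> a b)))"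
          unfolding full_def T_def[symmetric] kx ptx px Kb n ..
        \<comment> \<open>The test follows addresses with all first-parent steps in front. Commuting
          squares show that the first parent of a tested cell is the cell at the next address, so
          the tests add up to a complete diagram.\<close>
        have full_H: "g.H T \<kappa>" if fl: "full q ?x"
        proof -
          have par: "g.P 1 (g.pp \<kappa> a b) (g.p 1 (g.pp \<kappa> a b))" "g.P 2 (g.pp \<kappa> a b) (g.p 2 (g.pp \<kappa> a b))" if "a + b < T" for a b
            using fl that unfolding full by (simp_all add: Pp)
          have sw: "g.p 1 (g.pp \<kappa> a b) = g.pp \<kappa> (Suc a) b" if "a + b < T" for a b
            using that
          proof (induction b)
            case 0
            then show ?case by (simp add: pt_def)
          next
            case (Suc b)
            have IH: "g.p 1 (g.pp \<kappa> a b) = g.pp \<kappa> (Suc a) b" using Suc by simp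
            have a: "g.P 1 (g.pp \<kappa> a b) (g.pp \<kappa> (Suc a) b)" using par(1)[of a b] Suc.prems IH by simp
            have b: "g.P 2 (g.pp \<kappa> a b) (g.pp \<kappa> a (Suc b))" using par(2)[of a b] Suc.prems by (simp add: g.p2_pt)
            have c: "g.P 2 (g.pp \<kappa> (Suc a) b) (g.pp \<kappa> (Suc a) (Suc b))" using par(2)[of "Suc a" b] Suc.prems by (simp add: g.p2_pt)
            have d: "g.P 1 (g.pp \<kappa> a (Suc b)) (g.p 1 (g.pp \<kappa> a (Suc b)))" using par(1)[of a "Suc b"] Suc.prems by simp
            show ?case using g.P_commute[OF a b c d] by simp
          qed
          have "g.H d (g.pp \<kappa> a b)" if "a + b + d = T" for d a b
            using that
          proof (induction d arbitrary: a b)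
            case 0
            then show ?case using fl unfolding full by (simp del: hgt.simps)
          next
            case (Suc d)
            have "g.P 1 (g.pp \<kappa> a b) (g.pp \<kappa> (Suc a) b)" "g.P 2 (g.pp \<kappa> a b) (g.pp \<kappa> a (Suc b))"
              using par[of a b] sw[of a b] Suc.prems by (simp_all add: g.p2_pt)
            then show ?case using Suc.IH[of "Suc a" b] Suc.IH[of a "Suc b"] Suc.prems by auto
          qed
          from this[of 0 0 T] show ?thesis by (simp add: pt_def)
        qed
        have H_full: "T' = T \<and> full q ?x" if h: "g.H T' \<kappa>" for T'
        proof -
          have Hp: "g.H (T' - a) (g.pp \<kappa> a 0)" if "a \<le> T'" for a using g.H_pt[OF h, of a 0] that by simp
          \<comment> \<open>Cells on the path of first parents have different heights and so are
            distinct, which puts the height within the range of the search.\<close>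
          have inj: "inj_on (\<lambda>a. g.pp \<kappa> a 0) {..T'}"
          proof (rule inj_onI)
            fix a b assume ab: "a \<in> {..T'}" "b \<in> {..T'}" "g.pp \<kappa> a 0 = g.pp \<kappa> b 0"
            then have "T' - a = T' - b" using g.H_unique[OF Hp[of a], of "T' - b"] Hp[of b] by simp
            then show "a = b" using ab by simp
          qed
          have Hn: "v < n" if "g.H t v" for t v
            using that g.C_bd g.P_n by (cases t) auto
          have "(\<lambda>a. g.pp \<kappa> a 0) ` {..T'} \<subseteq> {..<n}" using Hp Hn by auto
          from card_mono[OF _ this] have "Suc T' \<le> n" by (simp add: card_image[OF inj])
          have Tb: "g.H 0 (g.pp \<kappa> T' 0)" using Hp[of T'] by (simp del: hgt.simps)
          have nb: "\<not> g.H 0 (g.pp \<kappa> a 0)" if "a < T'" for a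
            using g.H_unique[OF Hp[of a], of 0] that by auto
          have lt: "T < n + 1" unfolding T_def' bleast_less_iff using Tb \<open>Suc T' \<le> n\<close> by (intro exI[of _ T']) simp
          then have "g.H 0 (g.pp \<kappa> T 0)" unfolding T_def' by (rule bleast_less)
          then have "\<not> T < T'" using nb by blast
          moreover have "\<not> T' < T"
          proof
            assume "T' < T"
            then have "\<not> g.H 0 (g.pp \<kappa> T' 0)" unfolding T_def' by (rule bleast_least)
            then show False using Tb by blast
          qed
          ultimately have T: "T' = T" by simp
          have "g.p 1 (g.pp \<kappa> a b) < n \<and> g.p 2 (g.pp \<kappa> a b) < n" if "a + b < T" for a b
            using g.H_parents[OF h, of a b] that T g.p1_eq g.p2_eq g.P_n by metis
          moreover have "g.H 0 (g.pp \<kappa> a b)" if "a + b = T" for a b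
          proof -
            have "T' - a - b = 0" using that T by simp
            then show ?thesis using g.H_pt[OF h, of a b] that T by (simp del: hgt.simps)
          qed
          ultimately show ?thesis unfolding full using T by blast
        qed
        show ?thesis
        proof (cases "full q ?x")
          case False
          have "\<not> g.H T' v" if "g.C v 1 s'" for T' v s'
            using g.corner_unique[OF that s] H_full False by blast
          then have "solv n E \<rho>" unfolding solv_def by blast
          moreover have "?d = 0" using True st ns kn False by (simp add: md_def n \<kappa>_def)
          ultimately show ?thesis using LF' d0 y by simp
        next
          case fl: True
          have H: "g.H T \<kappa>" by (rule full_H[OF fl])
          let ?r = "rowk n q E \<rho> \<kappa> T"
          have rx: "rx q ?x = ?r" by (simp add: fun_eq_iff rx_def rowk_def kx ptx T_def)
          have T0: "0 < T"
          proof (rule ccontr)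
            assume "\<not> 0 < T"
            then have "g.H 0 \<kappa>" using H by simp
            then obtain k s' where "g.C \<kappa> k s'" "2 \<le> k" by auto
            then show False using g.C_unique[OF s, of k s'] by simp
          qed
          have sv: "solv n E \<rho> \<longleftrightarrow> solvable MA MC ?r T"
          proof
            assume "solv n E \<rho>"
            then show "solvable MA MC ?r T" unfolding solv_def using s H by blast
          next
            assume sol: "solvable MA MC ?r T"
            show "solv n E \<rho>" unfolding solv_def
            proof (intro allI impI)
              fix k s' T' assume k: "g.C k 1 s'" "g.H T' k"
              have "k = \<kappa>" by (rule g.corner_unique[OF k(1) s])
              moreover have "T' = T" using H_full k(2) calculation by blast
              ultimately show "solvable MA MC (rowk n q E \<rho> k T') T'" using sol by simp
            qed
          qed
          let ?t = "tri (comb MA MC) (\<lambda>j. Ini (?r j) 0) T 0"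
          have iv: "Ini (?r j) 0 \<in> vals MA MC" if "j \<le> T" for j
            using g.H_base(3)[OF H that] by (simp add: vals_simps)
          have tr: "tri (cf MA MC dec enc) (\<lambda>j. nthd (map (\<lambda>k. enc (Ini k 0)) [0..<9]) (?r j)) d a =
              enc (tri (comb MA MC) (\<lambda>j. Ini (?r j) 0) d a) \<and> tri (comb MA MC) (\<lambda>j. Ini (?r j) 0) d a \<in> vals MA MC"
            if "a + d \<le> T" for d a
            using that
          proof (induction d arbitrary: a)
            case 0
            then show ?case using iv[of a] g.H_base(3)[OF H, of a] by (simp add: nthd_def)
          next
            case (Suc d)
            let ?u = "tri (comb MA MC) (\<lambda>j. Ini (?r j) 0) d a" and ?v = "tri (comb MA MC) (\<lambda>j. Ini (?r j) 0) d (Suc a)"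
            have u: "?u \<in> vals MA MC" "?v \<in> vals MA MC" using Suc.IH[of a] Suc.IH[of "Suc a"] Suc.prems by auto
            then show ?case using Suc.IH[of a] Suc.IH[of "Suc a"] Suc.prems dec[OF u(1)] dec[OF u(2)] g.comb_vals[OF u]
              by (simp add: cf_def)
          qed
          have tv: "?t \<in> vals MA MC" and te: "apex MA MC dec enc q ?x = enc ?t"
            using tr[of 0 T] by (simp_all add: apex_def rx T_def)
          have fg: "flg MA MC dec enc q ?x = cflag ?t"
            using dec[OF tv] by (simp add: flg_def te nthd_def less_Suc_eq_le del: upt_Suc)
          show ?thesis
          proof (cases "cflag ?t = 1")
            case False
            then have "solv n E \<rho>" using sv solvable_no_flag[OF T0 False] by simp
            moreover have "?d = 0" using True st ns kn fl False by (simp add: md_def n \<kappa>_def fg)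
            ultimately show ?thesis using LF' d0 y by simp
          next
            case f1: True
            have rok: "rowok ?r T" by (rule g.H_rowok[OF H])
            obtain i z where i: "i \<le> T" "?r i = 3 \<or> ?r i = 4"
              and cnt: "\<forall>j\<le>T. (3 \<le> ?r j \<and> ?r j \<le> 6) \<longleftrightarrow> i \<le> j \<and> j < i + (2 * length z + 2)"
              and iT: "i + (2 * length z + 2) \<le> Suc T"
              and bits: "\<forall>l<length z. z ! l \<longleftrightarrow> ?r (i + 2 * l) = 4 \<or> ?r (i + 2 * l) = 6"
              and sol: "solvable MA MC ?r T \<longleftrightarrow> z \<in> L"
              using row_main[OF rok f1] by (elim exE conjE) (rule that)
            note fmt = row_format[OF rok i]
            have uniq: "j = i" if "j \<le> T" "?r j = 3 \<or> ?r j = 4" for j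
            proof (rule ccontr)
              assume "j \<noteq> i"
              then consider "j < i" | "i < j" by linarith
              then show False
              proof cases
                case 1
                then show False using fmt(2)[OF 1] that(2) by simp
              next
                case 2
                then show False using fmt(3)[OF 2 that(1)] that(2) by simp
              qed
            qed
            have "bleast (T + 1) (\<lambda>j. ?r j = 3 \<or> ?r j = 4) = i"
            proof (rule bleast_unique)
              show "i < T + 1" using i(1) by simp
              show "j = i" if "j < T + 1" "?r j = 3 \<or> ?r j = 4" for j
                by (rule uniq[OF _ that(2)]) (use that(1) in simp)
            qed (rule i(2))
            then have i0: "i0 q ?x = i" unfolding i0_def rx T_def[symmetric] .
            have "(\<Sum>j<T + 1. of_bool (3 \<le> ?r j \<and> ?r j \<le> 6)) = (\<Sum>j<T + 1. of_bool (j \<in> {i..<i + (2 * length z + 2)}) :: nat)"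
            proof (rule sum.cong[OF refl])
              fix j assume "j \<in> {..<T + 1}"
              then have "j \<le> T" by simp
              then have "(3 \<le> ?r j \<and> ?r j \<le> 6) = (j \<in> {i..<i + (2 * length z + 2)})"
                using cnt[rule_format, of j] unfolding atLeastLessThan_iff by blast
              then show "of_bool (3 \<le> ?r j \<and> ?r j \<le> 6) = (of_bool (j \<in> {i..<i + (2 * length z + 2)}) :: nat)"
                by (simp only:)
            qed
            also have "\<dots> = card ({..<T + 1} \<inter> {i..<i + (2 * length z + 2)})"
              by (simp add: of_bool_def sum.If_cases Int_def)
            also have "{..<T + 1} \<inter> {i..<i + (2 * length z + 2)} = {i..<i + (2 * length z + 2)}" using iT by auto
            finally have xl: "xlen q ?x = length z" by (simp add: xlen_def rx T_def[symmetric])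
            have d2: "?d = 2" using True st ns kn fl f1 by (simp add: md_def n \<kappa>_def fg)
            have "decode MA MC dec enc q y0 y1 y = map (\<lambda>l. ?r (i + 2 * l) = 4 \<or> ?r (i + 2 * l) = 6) [0..<length z]"
              by (simp add: decode_def Let_def d2 i0 xl rx)
            also have "\<dots> = z" by (rule nth_equalityI) (use bits in auto)
            finally show ?thesis using LF' sv sol by simp
          qed
        qed
      qed
    qed
  qed
qed

end

section \<open>Equivalence\<close>

definition fmt1 :: "nat list \<Rightarrow> nat \<Rightarrow> bool" where
  "fmt1 v l = (\<forall>j<l. nthd v (2 * j) = nthd v (2 * j + 1) \<and> (nthd v (2 * j) = 1 \<or> nthd v (2 * j) = 2))"

definition fmt2 :: "(nat \<Rightarrow> nat) \<Rightarrow> nat list \<Rightarrow> nat \<Rightarrow> bool" where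
  "fmt2 pW v l = (\<forall>j<pW l. nthd v (2 * l + 2 + j) = 3)"

text \<open>The unknown input is replaced by its length, which is found by bounded search; the bits
  are then read off at the even positions.\<close>

lemma goodv_iff:
  "goodv pW v \<longleftrightarrow> (\<exists>l<length v + 1. length v = 2 * l + 2 + pW l \<and> fmt1 v l \<and> nthd v (2 * l) = 1 \<and> nthd v (2 * l + 1) = 2 \<and> fmt2 pW v l)"
proof
  assume "goodv pW v"
  then obtain x where v: "v = map sym (pair_enc x []) @ replicate (pW (length x)) 3" by (auto simp: goodv_def)
  let ?l = "length x"
  have len: "length v = 2 * ?l + 2 + pW ?l" by (simp add: v length_pair_enc)
  have nv: "nthd v k = xbit (map sym x) k" if "k < 2 * ?l + 2" for k
    using that pair_enc_xbit[OF that] by (simp add: nthd_def v nth_append length_pair_enc)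
  have "fmt1 v ?l" unfolding fmt1_def
  proof (intro allI impI)
    fix j assume j: "j < ?l"
    have "(2 * j + 1) div 2 = j" by simp
    then have "xbit (map sym x) (2 * j) = sym (x ! j)" "xbit (map sym x) (2 * j + 1) = sym (x ! j)"
      using j nthd_sym[OF j] by (simp_all add: xbit_def)
    then show "nthd v (2 * j) = nthd v (2 * j + 1) \<and> (nthd v (2 * j) = 1 \<or> nthd v (2 * j) = 2)"
      using nv[of "2 * j"] nv[of "2 * j + 1"] j by (simp add: sym_def)
  qed
  moreover have "fmt2 pW v ?l" by (simp add: fmt2_def nthd_def len) (simp add: v nth_append length_pair_enc)
  moreover have "nthd v (2 * ?l) = 1" "nthd v (2 * ?l + 1) = 2"
    using nv[of "2 * ?l"] nv[of "2 * ?l + 1"] by (simp_all add: xbit_def)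
  ultimately show "\<exists>l<length v + 1. length v = 2 * l + 2 + pW l \<and> fmt1 v l \<and> nthd v (2 * l) = 1 \<and> nthd v (2 * l + 1) = 2 \<and> fmt2 pW v l"
    using len by (intro exI[of _ ?l]) simp
next
  assume "\<exists>l<length v + 1. length v = 2 * l + 2 + pW l \<and> fmt1 v l \<and> nthd v (2 * l) = 1 \<and> nthd v (2 * l + 1) = 2 \<and> fmt2 pW v l"
  then obtain l where len: "length v = 2 * l + 2 + pW l" and f1: "fmt1 v l" and s: "nthd v (2 * l) = 1" "nthd v (2 * l + 1) = 2"
    and f2: "fmt2 pW v l" by (elim exE conjE) (rule that)
  define x where "x = map (\<lambda>j. nthd v (2 * j) = 2) [0..<l]"
  have lx: "length x = l" by (simp add: x_def)
  have "v = map sym (pair_enc x []) @ replicate (pW (length x)) 3"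
  proof (rule nth_equalityI)
    show "length v = length (map sym (pair_enc x []) @ replicate (pW (length x)) 3)"
      by (simp add: len length_pair_enc lx)
    fix k assume k: "k < length v"
    have vk: "v ! k = nthd v k" using k by (simp add: nthd_def)
    show "v ! k = (map sym (pair_enc x []) @ replicate (pW (length x)) 3) ! k"
    proof (cases "k < 2 * l + 2")
      case True
      have "nthd v k = xbit (map sym x) k"
      proof (cases "k < 2 * l")
        case k2: True
        let ?j = "k div 2"
        have j: "?j < l" using k2 by simp
        have "k = 2 * ?j \<or> k = 2 * ?j + 1" by presburger
        then have "nthd v k = nthd v (2 * ?j)" using f1 j unfolding fmt1_def by metis
        moreover have "nthd v (2 * ?j) = 1 \<or> nthd v (2 * ?j) = 2" using f1 j unfolding fmt1_def by blast
        moreover have "xbit (map sym x) k = sym (nthd v (2 * ?j) = 2)"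
          using k2 j nthd_sym[of ?j x] by (simp add: xbit_def lx) (simp add: x_def)
        ultimately show ?thesis by (auto simp: sym_def)
      next
        case False
        then have "k = 2 * l \<or> k = 2 * l + 1" using True by linarith
        then show ?thesis using s by (auto simp: xbit_def lx)
      qed
      then show ?thesis using True pair_enc_xbit[of k x] by (simp add: vk nth_append length_pair_enc lx)
    next
      case False
      define j where "j = k - (2 * l + 2)"
      have j: "k = 2 * l + 2 + j" "j < pW l" using False k len by (auto simp: j_def)
      then have "nthd v k = 3" using f2 unfolding fmt2_def by blast
      then show ?thesis unfolding vk using j by (simp add: nth_append length_pair_enc lx)
    qed
  qed
  then show "goodv pW v" unfolding goodv_def by blast
qed

lemma PTb_goodv: "PTb 0 m (\<lambda>x env. goodv (\<lambda>n. c * n ^ k + c) x)"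
proof (rule PTb_op0, unfold goodv_iff, rule PTb_ex)
  have f1: "PTb 0 1 (\<lambda>x env. fmt1 x (env ! 0))" unfolding fmt1_def
  proof (rule PTb_all)
    show "PTb 0 (Suc 1) (\<lambda>x env. nthd x (2 * env ! 1) = nthd x (2 * env ! 1 + 1) \<and> (nthd x (2 * env ! 1) = 1 \<or> nthd x (2 * env ! 1) = 2))"
      by (intro PT_intros PT_var) simp_all
  qed (rule PT_var, simp)
  have f2: "PTb 0 1 (\<lambda>x env. fmt2 (\<lambda>n. c * n ^ k + c) x (env ! 0))" unfolding fmt2_def
  proof (rule PTb_all)
    show "PT 0 1 (\<lambda>x env. c * env ! 0 ^ k + c)" by (intro PT_intros PT_var) simp
    show "PTb 0 (Suc 1) (\<lambda>x env. nthd x (2 * take 1 env ! 0 + 2 + env ! 1) = 3)"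
      by (intro PT_intros PT_take_var PT_var) simp_all
  qed
  have "PTb 0 1 (\<lambda>x env. length x = 2 * env ! 0 + 2 + (c * env ! 0 ^ k + c) \<and> fmt1 x (env ! 0) \<and>
      nthd x (2 * env ! 0) = 1 \<and> nthd x (2 * env ! 0 + 1) = 2 \<and> fmt2 (\<lambda>n. c * n ^ k + c) x (env ! 0))"
    by (intro PT_intros f1 f2 PT_var) simp_all
  then show "PTb 0 (Suc 0) (\<lambda>x env. length x = 2 * env ! 0 + 2 + (c * env ! 0 ^ k + c) \<and> fmt1 x (env ! 0) \<and>
      nthd x (2 * env ! 0) = 1 \<and> nthd x (2 * env ! 0 + 1) = 2 \<and> fmt2 (\<lambda>n. c * n ^ k + c) x (env ! 0))"
    by (simp add: One_nat_def)
qed (intro PT_intros)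

lemma polynomial_mono: "mono (\<lambda>n::nat. c * n ^ k + c :: nat)"
  by (auto intro!: monoI power_mono mult_le_mono2)

lemma in_P_astep:
  assumes "in_P V"
  obtains M c k where "wf_tm M" "\<forall>y. \<exists>t p tp. t \<le> c * length y ^ k + c \<and>
    (astep M ^^ t) (0, 0, tape_of (map sym y)) = (1, p, tp) \<and> tp p = (if y \<in> V then 2 else 1)"
proof -
  obtain M c k where M: "wf_tm M" and r: "computes_in M (\<lambda>x. [x \<in> V]) (\<lambda>n. c * n ^ k + c)"
    using assms unfolding in_P_def poly_computable_def by blast
  have "\<exists>t p tp. t \<le> c * length y ^ k + c \<and>
    (astep M ^^ t) (0, 0, tape_of (map sym y)) = (1, p, tp) \<and> tp p = (if y \<in> V then 2 else 1)" for y
  proof -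
    obtain t where t: "t \<le> c * length y ^ k + c" "fst ((tm_step M ^^ t) (init_config y)) = 1"
      "tm_output ((tm_step M ^^ t) (init_config y)) = map sym [y \<in> V]"
      using r unfolding computes_in_def by blast
    have rel: "cfg_rel ((tm_step M ^^ t) (init_config y)) ((astep M ^^ t) (0, 0, tape_of (map sym y)))"
      by (rule cfg_rel_funpow[OF cfg_rel_init])
    obtain q p tp where A: "(astep M ^^ t) (0, 0, tape_of (map sym y)) = (q, p, tp)" by (metis prod_cases3)
    have "q = 1" using cfg_rel_fst[OF rel] t(2) A by simp
    moreover have "tp p = sym (y \<in> V)"
      using cfg_rel_head[of "(tm_step M ^^ t) (init_config y)" q p tp "sym (y \<in> V)" "[]"] rel A t(3) by simp
    ultimately show ?thesis using t(1) A by (intro exI[of _ t]) (simp add: sym_def)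
  qed
  then show ?thesis using that M by blast
qed

lemma const_computable: "poly_computable (\<lambda>x. [])"
  using PT_poly_computable[OF PT_const[of 0 0 0] PTb_const[of 0 1 True]] by simp

lemma poly_equivalent_const: "poly_equivalent A A" if "A = {} \<or> A = UNIV"
  unfolding poly_equivalent_def poly_reduces_def using const_computable that by auto

lemma F_free_empty: "F_free_ordering_lang {} = UNIV"
proof -
  have "\<exists>pos. bij_betw pos {..<n} {..<n}" for n :: nat by (rule exI[of _ "\<lambda>i. i"]) (simp add: bij_betw_def)
  then show ?thesis by (simp add: F_free_ordering_lang_def)
qed

text \<open>The graph without vertices is contained in every graph.\<close>

lemma F_free_null: "F_free_ordering_lang {(0, \<lambda>_ _. False)} = {}"
  by (simp add: F_free_ordering_lang_def contains_ordered_def)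

theorem theorem1p1:
  fixes L :: "bool list set"
  assumes "in_NP L"
  shows "\<exists>\<F>. finite \<F> \<and> (\<forall>F\<in>\<F>. wf_ograph F) \<and> poly_equivalent (F_free_ordering_lang \<F>) L"
proof (cases "L = {} \<or> L = UNIV")
  \<comment> \<open>A many-one reduction into a trivial language cannot give both answers, so these
    two languages get their own sets of patterns.\<close>
  case True
  then show ?thesis
  proof
    assume "L = {}"
    then show ?thesis using F_free_null poly_equivalent_const[of "{}"]
      by (intro exI[of _ "{(0, \<lambda>_ _. False)}"]) (simp add: wf_ograph_def)
  next
    assume "L = UNIV"
    then show ?thesis using F_free_empty poly_equivalent_const[of UNIV] by (intro exI[of _ "{}"]) simp
  qed
next
  case False
  then obtain y0 y1 where y: "y1 \<in> L" "y0 \<notin> L" by blast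
  obtain V c k where V: "in_P V" and L: "\<And>x. x \<in> L \<longleftrightarrow> (\<exists>w. length w \<le> c * length x ^ k + c \<and> pair_enc x w \<in> V)"
    using assms unfolding in_NP_def by blast
  define pW where "pW = (\<lambda>n. c * n ^ k + c)"
  obtain MA c1 k1 where ma: "wf_tm MA" "\<forall>y. \<exists>t p tp. t \<le> c1 * length y ^ k1 + c1 \<and>
    (astep MA ^^ t) (0, 0, tape_of (map sym y)) = (1, p, tp) \<and> tp p = (if y \<in> V then 2 else 1)"
    by (rule in_P_astep[OF V])
  define tA where "tA = (\<lambda>n. c1 * n ^ k1 + c1)"
  \<comment> \<open>The verdict is written this many times, so that the cell at distance 2 *
    \<open>tA\<close> + length is nonblank, as the clock condition demands.\<close>
  let ?N = "\<lambda>x (env::nat list). 2 * (c1 * length x ^ k1 + c1) + length x + 1"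
  have "PT 0 0 ?N" by (intro PT_intros)
  from PT_output[OF this PTb_goodv[of 1 c k]] obtain MC TC where
    mc: "wf_tm MC" "4 \<le> fst (snd MC)" "polyb TC" and MCr: "\<forall>xs. set xs \<subseteq> {1, 2, 3} \<longrightarrow>
    (\<exists>t tp. t \<le> TC (length xs) \<and> (astep MC ^^ t) (0, 0, tape_of xs) = (1, 0, tp) \<and>
      (\<forall>i<?N xs []. tp (int i) = sym (goodv (\<lambda>n. c * n ^ k + c) xs)) \<and> tp (int (?N xs [])) = 0)"
    by (elim exE conjE) (rule that)
  obtain h where h: "bij_betw h (vals MA MC) {0..<card (vals MA MC)}"
    using ex_bij_betw_finite_nat[OF finite_vals] by blast
  \<comment> \<open>Large enough to give every value its own colour and to make the reference
    rigid.\<close>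
  define q where "q = max 48 (card (vals MA MC))"
  define dec where "dec = inv_into (vals MA MC) h"
  interpret fgraph MA MC V L tA pW TC q dec h
  proof
    show "mono tA" unfolding tA_def by (rule polynomial_mono)
    show "\<exists>t p tp. t \<le> tA (length y) \<and> (astep MA ^^ t) (0, 0, tape_of (map sym y)) = (1, p, tp) \<and>
      tp p = (if y \<in> V then 2 else 1)" for y unfolding tA_def using ma(2) by blast
    show "x \<in> L \<longleftrightarrow> (\<exists>w. length w \<le> pW (length x) \<and> pair_enc x w \<in> V)" for x unfolding pW_def by (rule L)
    show "\<exists>t tp. t \<le> TC (length v) \<and> (astep MC ^^ t) (0, 0, tape_of v) = (1, 0, tp) \<and>
      tp 0 = (if goodv pW v then 2 else 1) \<and> tp (int (2 * tA (length v) + length v)) \<noteq> 0"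
      if v: "set v \<subseteq> {1, 2, 3}" for v
    proof -
      obtain t tp where t: "t \<le> TC (length v)" "(astep MC ^^ t) (0, 0, tape_of v) = (1, 0, tp)"
        and tp: "\<forall>i<?N v []. tp (int i) = sym (goodv pW v)"
        using MCr[rule_format, OF v] unfolding pW_def[symmetric] by (elim exE conjE) (rule that)
      have "tp 0 = sym (goodv pW v)" using tp[rule_format, of 0] by simp
      moreover have "tp (int (2 * tA (length v) + length v)) = sym (goodv pW v)"
        using tp[rule_format, of "2 * tA (length v) + length v"] by (simp add: tA_def)
      ultimately show ?thesis using t by (intro exI[of _ t] exI[of _ tp]) (simp add: sym_def)
    qed
    show "dec (h v) = v \<and> h v \<le> q" if "v \<in> vals MA MC" for v
    proof -
      have "h v < card (vals MA MC)" using bij_betwE[OF h] that by auto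
      then show ?thesis using that bij_betw_inv_into_left[OF h that] by (simp add: dec_def q_def)
    qed
  qed (use ma(1) mc in auto)
  obtain C e where C: "\<And>n. TC n \<le> C * (n + 1) ^ e" using mc(3) unfolding polyb_def by blast
  \<comment> \<open>Half the height of the diagram: an explicit polynomial above the running time of
    the second machine plus one, which also leaves room for the input cells.\<close>
  define ts where "ts = (\<lambda>n. C * ((2 * n + 2 + (c * n ^ k + c)) + 1) ^ e + (2 * n + 2) + 1)"
  define f where "f = (\<lambda>x. gcode q (2 * ts (length x)) (xrow (ts (length x)) (pW (length x)) (map sym x)))"
  have "poly_computable f" unfolding f_def
  proof (rule gcode_computable)
    show "PT 0 m (\<lambda>x env. ts (length x))" for m unfolding ts_def by (intro PT_intros)
    show "PT 0 m (\<lambda>x env. pW (length x))" for m unfolding pW_def by (intro PT_intros)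
  qed
  moreover have "x \<in> L \<longleftrightarrow> f x \<in> LF" for x
  proof -
    have t: "TC (2 * length x + 2 + pW (length x)) + 1 \<le> ts (length x)" "2 * length x + 2 \<le> ts (length x)"
      using C[of "2 * length x + 2 + pW (length x)"] by (simp_all add: ts_def pW_def)
    have "0 < ts (length x)" using t(2) by simp
    then show ?thesis unfolding f_def
      using gcode_LF[of "2 * ts (length x)" "xrow (ts (length x)) (pW (length x)) (map sym x)"]
        xrow_rowok[of "ts (length x)" "pW (length x)" x "2 * ts (length x)"] xrow_solvable[OF t] by (simp add: q_def)
  qed
  ultimately have "poly_reduces L LF" unfolding poly_reduces_def by blast
  moreover have "poly_reduces LF L"
    unfolding poly_reduces_def using decode_computable[of y0 y1] decode_correct[OF y] by blast
  moreover have "\<forall>F\<in>Fset MA MC dec q. wf_ograph F" by (auto simp: Fset_def)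
  ultimately show ?thesis using finite_Fset[of MA MC dec q] unfolding poly_equivalent_def by blast
qed

end
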